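(* Let $q$ be an odd prime power. Let $NS_0=1$ and, for $n\ge 1$, let $NS_n$ be the number of ordered pairs $(A,B)$ of commuting nilpotent elements of the Lie algebra of $\mathrm{Sp}(2n,q)$ (both $A$ and $B$ nilpotent, $AB=BA$). Then \[ \sum_{n \geq 0} \frac{NS_n u^n}{|\mathrm{Sp}(2n,q)|} = \frac{\prod_{i \geq 1} (1+u^i)}{\prod_{i \geq 1} \prod_{l \geq 0} (1-u^i/q^{2l+1})} .\]
   Context: Let $J$ be an invertible skew-symmetric $2n\times 2n$ matrix over $\mathbb{F}_q$ ($q$ odd). $\mathrm{Sp}(2n,q)$ is the group of $2n\times 2n$ matrices $g$ over $\mathbb{F}_q$ with $gJg^{\top}=J$, and its Lie algebra is $\{A\in \mathrm{Mat}(2n,q): AJ=(AJ)^{\top}\}$, where $\mathrm{Mat}(2n,q)$ is the set of all $2n\times 2n$ matrices over $\mathbb{F}_q$. By convention $|\mathrm{Sp}(0,q)|=1$. The identity is one of power series in $u$ with real coefficients (the infinite product converging coefficientwise). *)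

theory Defs
  imports
    "HOL-Analysis.Analysis"
    "HOL-Computational_Algebra.Formal_Power_Series"
    "HOL-Library.Cardinality"
    "Jordan_Normal_Form.Matrix"
begin

definition skew_symmetric_mat :: "'a::ring_1 mat \<Rightarrow> bool" where
  "skew_symmetric_mat J \<longleftrightarrow> square_mat J \<and> transpose_mat J = - J"

definition Sp_group :: "nat \<Rightarrow> 'a::field mat \<Rightarrow> 'a mat set" where
  "Sp_group n J = {g \<in> carrier_mat (2 * n) (2 * n). g * J * transpose_mat g = J}"

definition sp_lie :: "nat \<Rightarrow> 'a::field mat \<Rightarrow> 'a mat set" where
  "sp_lie n J = {A \<in> carrier_mat (2 * n) (2 * n). A * J = transpose_mat (A * J)}"

definition nilpotent_mat :: "'a::semiring_1 mat \<Rightarrow> bool" where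
  "nilpotent_mat A \<longleftrightarrow> square_mat A \<and> (\<exists>k. A ^\<^sub>m k = 0\<^sub>m (dim_row A) (dim_row A))"

definition commuting_nilpotent_pairs :: "nat \<Rightarrow> 'a::field mat \<Rightarrow> ('a mat \<times> 'a mat) set" where
  "commuting_nilpotent_pairs n J =
     {(A, B). A \<in> sp_lie n J \<and> B \<in> sp_lie n J \<and>
        nilpotent_mat A \<and> nilpotent_mat B \<and> A * B = B * A}"

definition NS :: "nat \<Rightarrow> 'a::field mat \<Rightarrow> nat" where
  "NS n J = card (commuting_nilpotent_pairs n J)"

lemma finite_carrier_mat:
  "finite (carrier_mat m n :: 'a::finite mat set)"
proof -
  let ?F = "PiE ({0..<m} \<times> {0..<n}) (\<lambda>_. UNIV :: 'a set)"
  have "A \<in> mat m n ` ?F" if A: "A \<in> carrier_mat m n" for A :: "'a mat"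
  proof (rule image_eqI)
    show "A = mat m n (restrict (\<lambda>ij. A $$ ij) ({0..<m} \<times> {0..<n}))"
      using A by (intro eq_matI) auto
  qed auto
  then have "carrier_mat m n \<subseteq> mat m n ` ?F" by blast
  moreover have "finite ?F" by (intro finite_PiE) auto
  ultimately show ?thesis by (meson finite_imageI finite_subset)
qed

lemma finite_Sp_group: "finite (Sp_group n (J :: 'a::{field,finite} mat))"
  by (rule finite_subset[OF _ finite_carrier_mat]) (auto simp: Sp_group_def)

lemma finite_commuting_nilpotent_pairs:
  "finite (commuting_nilpotent_pairs n (J :: 'a::{field,finite} mat))"
  by (rule finite_subset[OF _ finite_cartesian_product[OF finite_carrier_mat finite_carrier_mat]])
     (auto simp: commuting_nilpotent_pairs_def sp_lie_def)

text \<open>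
  The conventions for \<open>n = 0\<close> need no case distinction: they are the values of the general
  definitions at the unique \<open>0 \<times> 0\<close> matrix, which is both nilpotent and invertible.
\<close>

lemma Sp_group_0:
  assumes "J \<in> carrier_mat 0 0"
  shows "card (Sp_group 0 J) = 1"
proof -
  have "Sp_group 0 J = {0\<^sub>m 0 0}"
    using assms by (auto simp: Sp_group_def intro!: eq_matI)
  then show ?thesis by simp
qed

lemma NS_0:
  assumes "J \<in> carrier_mat 0 0"
  shows "NS 0 J = 1"
proof -
  have "nilpotent_mat (0\<^sub>m 0 0 :: 'a mat)"
    unfolding nilpotent_mat_def by (auto intro!: exI[of _ 0] eq_matI)
  then have "commuting_nilpotent_pairs 0 J = {(0\<^sub>m 0 0, 0\<^sub>m 0 0)}"
    using assms by (auto simp: commuting_nilpotent_pairs_def sp_lie_def intro!: eq_matI)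
  then show ?thesis by (simp add: NS_def)
qed

text \<open>
  Infinite products of real power series are taken coefficientwise, with the usual topology
  of the reals on each coefficient. The library's metric on \<^typ>\<open>real fps\<close> is the \<open>X\<close>-adic one
  (discrete on coefficients), for which the products \<open>\<Prod>l. 1 - X ^ i / q ^ (2 * l + 1)\<close>
  do not converge, so \<^const>\<open>prodinf\<close> is not applicable.
\<close>

definition fps_convergent_prod :: "(nat \<Rightarrow> real fps) \<Rightarrow> bool" where
  "fps_convergent_prod f \<longleftrightarrow> (\<forall>k. convergent (\<lambda>N. fps_nth (\<Prod>i<N. f i) k))"

definition fps_prodinf :: "(nat \<Rightarrow> real fps) \<Rightarrow> real fps" where
  "fps_prodinf f = Abs_fps (\<lambda>k. lim (\<lambda>N. fps_nth (\<Prod>i<N. f i) k))"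

text \<open>The index \<open>i \<ge> 1\<close> of the identity is represented by \<open>Suc i\<close> with \<open>i \<ge> 0\<close>.\<close>

definition num_factor :: "nat \<Rightarrow> real fps" where
  "num_factor i = 1 + fps_X ^ Suc i"

definition den_factor :: "nat \<Rightarrow> nat \<Rightarrow> nat \<Rightarrow> real fps" where
  "den_factor q i l = 1 - fps_const (1 / real q ^ (2 * l + 1)) * fps_X ^ Suc i"

end

theory Submission
  imports
    Defs
    "Jordan_Normal_Form.Determinant"
    "HOL-Number_Theory.Residues"
begin

text \<open>
  Write an element of the Lie algebra as \<open>A = \<Omega> \<beta>\<close> with \<open>\<Omega> = J\<close>. The forms \<open>J\<close> constitute a single
  congruence class with stabiliser \<open>Sp\<close>, so the coefficient of \<open>u\<^sup>n\<close> is the number of triples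
  \<open>(\<Omega>, \<beta>, B)\<close> divided by \<open>|GL(2n)|\<close> (the mass of these triples). More generally let \<open>e = 1\<close> or
  \<open>e = -1\<close>, let \<open>\<Omega>\<close> be nonsingular of sign \<open>e\<close> (symmetric or skew), \<open>\<beta>\<close> and \<open>B \<Omega>\<close> of sign \<open>-e\<close> and
  \<open>\<beta> B\<close> of sign \<open>e\<close>, with \<open>\<Omega> \<beta>\<close> and \<open>B\<close> nilpotent.

  In a basis that begins with the radical of \<open>\<beta>\<close>, say of dimension \<open>s\<close>, one has \<open>\<beta> = [0, 0; 0, b]\<close>,
  \<open>\<Omega> = [d, c; e c\<^sup>T, a]\<close>, \<open>B = [D, C; 0, B']\<close>, and \<open>(b, a, B'\<^sup>T)\<close> is again such a triple, for the sign
  \<open>-e\<close>. The number of ways to complete it depends only on \<open>s\<close>, on \<open>r = dim b\<close> and on the nullity \<open>t\<close> of \<open>a\<close>,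
  and all powers of \<open>q\<close> cancel from the masses: if \<open>p(e, s, r)\<close> is the mass of the triples with \<open>\<beta>\<close> of
  nullity \<open>s\<close> and rank \<open>r\<close>, then \<open>p(e, s, r) = (\<Sum>t. M(e, s - t) * p(-e, t, r - t))\<close>, where \<open>M(e, m)\<close> is
  the mass of the pairs of a nonsingular form \<open>d\<close> of sign \<open>e\<close> and a form \<open>h\<close> of sign \<open>-e\<close> with \<open>h d\<^sup>-\<^sup>1\<close>
  nilpotent. So the series \<open>H(e, i)\<close>, the sum of \<open>p(e, s, r) u^(i s + r)\<close>, satisfies
  \<open>H(e, i) = M(e)(u^i) * H(-e, i + 1)\<close>, and \<open>H(-1, 1) = M(-1)(u) * M(1)(u^2) * M(-1)(u^3) * \<dots>\<close>.

  The same recursion without \<open>B\<close>, applied to all pairs \<open>(\<Omega>, \<beta>)\<close> and to those with \<open>\<Omega> \<beta>\<close> nilpotent,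
  gives \<open>M(e)\<close> as a quotient of two series that are determined by the numbers of nonsingular forms. These
  satisfy first-order \<open>q\<close>-difference equations, as does \<open>D(z) = (\<Prod>l. 1 - z / q^(2 l + 1))\<close>, namely
  \<open>D(z) = (1 - z / q) * D(z / q^2)\<close>; comparison yields \<open>M(-1) = 1 / D(u^2)\<close> and
  \<open>M(1) = (1 + u) / D(u^2)\<close>. Substitution into the product and \<open>u^2 \<mapsto> u\<close> give the identity.
\<close>

hide_const (open) Determinants.det Finite_Cartesian_Product.row Finite_Cartesian_Product.vec

section \<open>Forms over a field\<close>

text \<open>The obstacle is that nilpotent elements of the Lie algebra have unwieldy centralisers.
  The count therefore never fixes a class of \<open>A\<close>; it uses only the radical of
  \<open>\<beta>\<close>. The conditions give \<open>\<beta> * B = - B\<^sup>T * \<beta>\<close>, so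
  \<open>B\<close> preserves the kernel of \<open>\<beta>\<close>, whence its triangular shape. On
  the quotient \<open>b\<close> is nonsingular while \<open>a\<close> may degenerate, so the two
  exchange roles, and with them the signs; as they are forms on dual spaces, \<open>B'\<close> has
  to be transposed. Nonsingularity of \<open>\<Omega>\<close> forces \<open>c\<close> to be
  injective on the radical of \<open>a\<close>, hence \<open>t \<le> s\<close>. On the
  \<open>t\<close> dimensions paired off in this way \<open>D\<close> is minus the transpose of a
  block of \<open>B'\<close>, hence nilpotent automatically. On the other \<open>s - t\<close>
  dimensions there remains a pair \<open>(d, h)\<close> with \<open>h d\<^sup>-\<^sup>1\<close>
  nilpotent: this is the origin of \<open>M(e, s - t)\<close>. Nonsingular symmetric forms fall into
  more than one congruence class. All sums therefore run over all forms of a given nullity, and only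
  the radical is brought to a normal position.\<close>

definition GL :: "nat \<Rightarrow> 'a::field mat set" where
  "GL n = {g \<in> carrier_mat n n. det g \<noteq> 0}"

text \<open>The scalar \<open>e\<close> is a sign: \<open>e = 1\<close> gives the symmetric matrices and \<open>e = -1\<close> the skew-symmetric ones.\<close>

definition Sym :: "'a::field \<Rightarrow> nat \<Rightarrow> 'a mat set" where
  "Sym e n = {M \<in> carrier_mat n n. M\<^sup>T = e \<cdot>\<^sub>m M}"

definition NSym :: "'a::field \<Rightarrow> nat \<Rightarrow> 'a mat set" where
  "NSym e n = {M \<in> Sym e n. det M \<noteq> 0}"

text \<open>The inverse on \<open>GL\<close>; for singular \<open>g\<close> the choice is
  arbitrary.\<close>

definition ginv :: "'a::field mat \<Rightarrow> 'a mat" where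
  "ginv g = (SOME h. h \<in> carrier_mat (dim_row g) (dim_row g) \<and> g * h = 1\<^sub>m (dim_row g) \<and> h * g
    = 1\<^sub>m (dim_row g))"

lemma GL_carrier: "g \<in> GL n \<Longrightarrow> g \<in> carrier_mat n n"
  by (simp add: GL_def)

lemma ginv:
  assumes "g \<in> GL n"
  shows "ginv g \<in> carrier_mat n n" "g * ginv g = 1\<^sub>m n" "ginv g * g = 1\<^sub>m n"
proof -
  have g: "g \<in> carrier_mat n n" "det g \<noteq> 0" using assms by (auto simp: GL_def)
  from det_non_zero_imp_unit[OF g(1,2)]
  have "\<exists>h. h \<in> carrier_mat n n \<and> g * h = 1\<^sub>m n \<and> h * g = 1\<^sub>m n"
    by (auto simp: Units_def ring_mat_def)
  from someI_ex[OF this] g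
  have "ginv g \<in> carrier_mat n n \<and> g * ginv g = 1\<^sub>m n \<and> ginv g * g = 1\<^sub>m n"
    unfolding ginv_def by simp
  then show "ginv g \<in> carrier_mat n n" "g * ginv g = 1\<^sub>m n" "ginv g * g = 1\<^sub>m n" by auto
qed

lemma GL_I:
  assumes "g \<in> carrier_mat n n" "h \<in> carrier_mat n n" "g * h = 1\<^sub>m n"
  shows "g \<in> GL n"
proof -
  have "det g * det h = 1" using det_mult[OF assms(1,2)] assms(3) by simp
  then show ?thesis using assms(1) by (auto simp: GL_def)
qed

lemma GL_mult: "g \<in> GL n \<Longrightarrow> h \<in> GL n \<Longrightarrow> g * h \<in> GL n"
  by (auto simp: GL_def det_mult)

lemma GL_one [simp]: "1\<^sub>m n \<in> GL n"
  by (simp add: GL_def)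

lemma GL_transpose: "g \<in> GL n \<Longrightarrow> g\<^sup>T \<in> GL n"
  by (auto simp: GL_def det_transpose)

lemma GL_ginv: "g \<in> GL n \<Longrightarrow> ginv g \<in> GL n"
  using GL_I[of "ginv g" n g] ginv[of g n] GL_carrier[of g n] by auto

lemma carrier_0: "carrier_mat 0 n = {0\<^sub>m 0 n}" "carrier_mat n 0 = {0\<^sub>m n 0}"
  by (auto intro!: eq_matI)

lemma GL_0: "GL 0 = {1\<^sub>m 0}"
  by (auto simp: GL_def intro!: eq_matI)

lemma GL_cancel_left:
  assumes "g \<in> GL n" "A \<in> carrier_mat n k" "B \<in> carrier_mat n k" "g * A = g * B"
  shows "A = B"
proof -
  note g = ginv[OF assms(1)] GL_carrier[OF assms(1)]
  have "ginv g * (g * A) = ginv g * (g * B)" using assms(4) by simp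
  then show ?thesis using g assms(2,3)
    by (simp flip: assoc_mult_mat[of _ n n _ n])
qed

lemma GL_cancel_right:
  assumes "g \<in> GL n" "A \<in> carrier_mat k n" "B \<in> carrier_mat k n" "A * g = B * g"
  shows "A = B"
proof -
  note g = ginv[OF assms(1)] GL_carrier[OF assms(1)]
  have "(A * g) * ginv g = (B * g) * ginv g" using assms(4) by simp
  then show ?thesis using g assms(2,3)
    by (simp add: assoc_mult_mat[of _ k n _ n])
qed

lemma GL_kernel:
  assumes "g \<in> carrier_mat n n"
  shows "g \<in> GL n \<longleftrightarrow> (\<forall>v \<in> carrier_vec n. g *\<^sub>v v = 0\<^sub>v n \<longrightarrow> v = 0\<^sub>v n)"
  using det_0_iff_vec_prod_zero_field[OF assms] assms by (auto simp: GL_def)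

section \<open>Block matrices, forms of a given sign and congruence\<close>

lemma four_block_cong_iff:
  assumes "A \<in> carrier_mat nr1 nc1" "B \<in> carrier_mat nr1 nc2" "C \<in> carrier_mat nr2 nc1"
    "D \<in> carrier_mat nr2 nc2"
    and "A' \<in> carrier_mat nr1 nc1" "B' \<in> carrier_mat nr1 nc2" "C' \<in> carrier_mat nr2 nc1"
      "D' \<in> carrier_mat nr2 nc2"
  shows "four_block_mat A B C D = four_block_mat A' B' C' D' \<longleftrightarrow> A = A' \<and> B = B' \<and> C = C' \<and> D = D'"
proof
  assume eq: "four_block_mat A B C D = four_block_mat A' B' C' D'"
  have "A = A'"
  proof (rule eq_matI)
    fix i j assume "i < dim_row A'" "j < dim_col A'"
    then show "A $$ (i,j) = A' $$ (i,j)" using arg_cong[OF eq, of "\<lambda>M. M $$ (i,j)"] assms by auto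
  qed (use assms in auto)
  moreover have "B = B'"
  proof (rule eq_matI)
    fix i j assume "i < dim_row B'" "j < dim_col B'"
    then show "B $$ (i,j) = B' $$ (i,j)" using arg_cong[OF eq, of "\<lambda>M. M $$ (i,nc1 + j)"] assms by auto
  qed (use assms in auto)
  moreover have "C = C'"
  proof (rule eq_matI)
    fix i j assume "i < dim_row C'" "j < dim_col C'"
    then show "C $$ (i,j) = C' $$ (i,j)" using arg_cong[OF eq, of "\<lambda>M. M $$ (nr1 + i,j)"] assms by auto
  qed (use assms in auto)
  moreover have "D = D'"
  proof (rule eq_matI)
    fix i j assume "i < dim_row D'" "j < dim_col D'"
    then show "D $$ (i,j) = D' $$ (i,j)" using arg_cong[OF eq, of "\<lambda>M. M $$ (nr1 + i,nc1 + j)"] assms by auto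
  qed (use assms in auto)
  ultimately show "A = A' \<and> B = B' \<and> C = C' \<and> D = D'" by simp
qed auto

lemma four_block_cases:
  assumes "M \<in> carrier_mat (r1 + r2) (c1 + c2)"
  obtains A B C D where "A \<in> carrier_mat r1 c1" "B \<in> carrier_mat r1 c2"
    "C \<in> carrier_mat r2 c1" "D \<in> carrier_mat r2 c2" "M = four_block_mat A B C D"
proof -
  obtain A B C D where "split_block M r1 c1 = (A, B, C, D)" by (metis prod_cases4)
  from split_block[OF this, of r2 c2] assms that show thesis by auto
qed

lemma Sym_carrier: "M \<in> Sym e n \<Longrightarrow> M \<in> carrier_mat n n"
  by (simp add: Sym_def)

lemma NSym_Sym: "M \<in> NSym e n \<Longrightarrow> M \<in> Sym e n"
  by (simp add: NSym_def)

lemma NSym_GL: "M \<in> NSym e n \<Longrightarrow> M \<in> GL n"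
  by (simp add: NSym_def Sym_def GL_def)

lemma NSym_iff: "M \<in> NSym e n \<longleftrightarrow> M \<in> Sym e n \<and> M \<in> GL n"
  by (auto simp: NSym_def Sym_def GL_def)

lemma smult_1 [simp]: "(1::'a::monoid_mult) \<cdot>\<^sub>m M = M"
  by (rule eq_matI) auto

lemma smult_smult: "a \<cdot>\<^sub>m (b \<cdot>\<^sub>m M) = (a * b :: 'a::semigroup_mult) \<cdot>\<^sub>m M"
  by (rule eq_matI) (auto simp: mult.assoc)

lemma transpose_smult: "(a \<cdot>\<^sub>m M)\<^sup>T = a \<cdot>\<^sub>m M\<^sup>T"
  by (rule eq_matI) auto

text \<open>The two off-diagonal conditions coincide because \<open>e\<close> is its own inverse. A
  form of sign \<open>e\<close> thus amounts to two smaller forms and one arbitrary rectangular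
  block.\<close>

lemma Sym_block:
  assumes "e * e = 1"
    and c: "A \<in> carrier_mat s s" "B \<in> carrier_mat s r" "C \<in> carrier_mat r s" "D \<in> carrier_mat r r"
  shows "four_block_mat A B C D \<in> Sym e (s + r) \<longleftrightarrow> A \<in> Sym e s \<and> C = e \<cdot>\<^sub>m B\<^sup>T \<and> D \<in> Sym e r"
proof -
  have "four_block_mat A B C D \<in> Sym e (s + r) \<longleftrightarrow>
      four_block_mat A\<^sup>T C\<^sup>T B\<^sup>T D\<^sup>T = four_block_mat (e \<cdot>\<^sub>m A) (e \<cdot>\<^sub>m B) (e \<cdot>\<^sub>m C) (e \<cdot>\<^sub>m D)"
    using c by (simp add: Sym_def smult_four_block_mat[OF c] transpose_four_block_mat[OF c])
  also have "\<dots> \<longleftrightarrow> A\<^sup>T = e \<cdot>\<^sub>m A \<and> C\<^sup>T = e \<cdot>\<^sub>m B \<and> B\<^sup>T = e \<cdot>\<^sub>m C \<and> D\<^sup>T = e \<cdot>\<^sub>m D"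
    by (rule four_block_cong_iff) (use c in auto)
  also have "\<dots> \<longleftrightarrow> A \<in> Sym e s \<and> C = e \<cdot>\<^sub>m B\<^sup>T \<and> D \<in> Sym e r"
  proof -
    have "C\<^sup>T = e \<cdot>\<^sub>m B \<longleftrightarrow> C = e \<cdot>\<^sub>m B\<^sup>T"
      by (metis transpose_smult transpose_transpose)
    moreover have "B\<^sup>T = e \<cdot>\<^sub>m C" if "C = e \<cdot>\<^sub>m B\<^sup>T"
      using that assms(1) by (simp add: smult_smult)
    ultimately show ?thesis using c by (auto simp: Sym_def)
  qed
  finally show ?thesis .
qed

lemma Sym_block_I:
  assumes "e * e = 1" "A \<in> Sym e s" "B \<in> carrier_mat s r" "D \<in> Sym e r"
  shows "four_block_mat A B (e \<cdot>\<^sub>m B\<^sup>T) D \<in> Sym e (s + r)"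
  using assms by (subst Sym_block) (auto dest: Sym_carrier)

lemma Sym_congruence:
  assumes "M \<in> Sym e n" "g \<in> carrier_mat k n"
  shows "g * M * g\<^sup>T \<in> Sym e k"
proof -
  have M: "M \<in> carrier_mat n n" "M\<^sup>T = e \<cdot>\<^sub>m M" using assms(1) by (auto simp: Sym_def)
  have "(g * M * g\<^sup>T)\<^sup>T = (g\<^sup>T)\<^sup>T * (g * M)\<^sup>T"
    by (rule transpose_mult[of _ k n _ k]) (use M(1) assms(2) in auto)
  also have "(g * M)\<^sup>T = M\<^sup>T * g\<^sup>T"
    by (rule transpose_mult[of _ k n _ n]) (use M(1) assms(2) in auto)
  finally have "(g * M * g\<^sup>T)\<^sup>T = g * (M\<^sup>T * g\<^sup>T)" by simp
  also have "g * (M\<^sup>T * g\<^sup>T) = e \<cdot>\<^sub>m (g * M * g\<^sup>T)"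
    unfolding M(2) using M(1) assms(2)
    by (simp add: mult_smult_assoc_mat[of _ n n _ k] mult_smult_distrib[of _ k n _ k]
      assoc_mult_mat[of _ k n _ n])
  finally show ?thesis using M(1) assms(2) by (simp add: Sym_def)
qed

lemma NSym_congruence:
  assumes "M \<in> NSym e n" "g \<in> GL n"
  shows "g * M * g\<^sup>T \<in> NSym e n"
  using assms Sym_congruence[of M e n g n] GL_mult[of "g * M" n "g\<^sup>T"] GL_mult[of g n M] GL_transpose[of g n]
  by (auto simp: NSym_iff GL_carrier)

lemma congruence_comp:
  fixes M :: "'a::field mat"
  assumes "M \<in> carrier_mat n n" "g \<in> carrier_mat k n" "h \<in> carrier_mat l k"
  shows "h * (g * M * g\<^sup>T) * h\<^sup>T = (h * g) * M * (h * g)\<^sup>T"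
proof -
  have "(h * g)\<^sup>T = g\<^sup>T * h\<^sup>T"
    by (rule transpose_mult[of _ l k _ n]) (use assms in auto)
  moreover have "h * (g * M * g\<^sup>T) * h\<^sup>T = h * (g * M * g\<^sup>T * h\<^sup>T)"
    by (rule assoc_mult_mat[of _ l k _ k]) (use assms in auto)
  moreover have "g * M * g\<^sup>T * h\<^sup>T = g * M * (g\<^sup>T * h\<^sup>T)"
    by (rule assoc_mult_mat[of _ k n _ k]) (use assms in auto)
  moreover have "h * (g * M * (g\<^sup>T * h\<^sup>T)) = h * (g * M) * (g\<^sup>T * h\<^sup>T)"
    by (rule assoc_mult_mat[of _ l k _ n, symmetric]) (use assms in auto)
  moreover have "h * (g * M) = h * g * M"
    by (rule assoc_mult_mat[of _ l k _ n, symmetric]) (use assms in auto)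
  ultimately show ?thesis by simp
qed

lemma congruence_inverse:
  assumes "M \<in> carrier_mat n n" "g \<in> GL n"
  shows "ginv g * (g * M * g\<^sup>T) * (ginv g)\<^sup>T = M" "g * (ginv g * M * (ginv g)\<^sup>T) * g\<^sup>T = M"
proof -
  note g = ginv[OF assms(2)] GL_carrier[OF assms(2)]
  show "ginv g * (g * M * g\<^sup>T) * (ginv g)\<^sup>T = M"
    by (subst congruence_comp[of _ n _ n _ n]) (use g assms in auto)
  show "g * (ginv g * M * (ginv g)\<^sup>T) * g\<^sup>T = M"
    by (subst congruence_comp[of _ n _ n _ n]) (use g assms in auto)
qed

lemma GL_congruence_iff:
  assumes "M \<in> carrier_mat n n" "g \<in> GL n"
  shows "g * M * g\<^sup>T \<in> GL n \<longleftrightarrow> M \<in> GL n"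
proof -
  have g: "g \<in> carrier_mat n n" "det g \<noteq> 0" using assms(2) by (auto simp: GL_def)
  have "det (g * M * g\<^sup>T) = det g * det M * det g"
    using assms(1) g(1) by (simp add: det_mult[of _ n] det_transpose)
  then show ?thesis using g assms(1) by (auto simp: GL_def)
qed

lemma GL_upper_block:
  assumes "A \<in> carrier_mat s s" "B \<in> carrier_mat s r" "D \<in> carrier_mat r r"
  shows "four_block_mat A B (0\<^sub>m r s) D \<in> GL (s + r) \<longleftrightarrow> A \<in> GL s \<and> D \<in> GL r"
  using assms by (auto simp: GL_def det_four_block_mat_lower_left_zero[OF assms(1,2) refl assms(3)])

lemma GL_lower_block:
  assumes "A \<in> carrier_mat s s" "C \<in> carrier_mat r s" "D \<in> carrier_mat r r"
  shows "four_block_mat A (0\<^sub>m s r) C D \<in> GL (s + r) \<longleftrightarrow> A \<in> GL s \<and> D \<in> GL r"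
  using assms by (auto simp: GL_def det_four_block_mat_upper_right_zero[OF assms(1) refl assms(2,3)])

section \<open>Cardinalities over a finite field\<close>

lemma finite_Sym [simp]: "finite (Sym e n :: 'a::{field,finite} mat set)"
  by (rule finite_subset[OF _ finite_carrier_mat]) (auto simp: Sym_def)

lemma finite_NSym [simp]: "finite (NSym e n :: 'a::{field,finite} mat set)"
  by (rule finite_subset[OF _ finite_Sym]) (auto simp: NSym_def)

lemma finite_GL [simp]: "finite (GL n :: 'a::{field,finite} mat set)"
  by (rule finite_subset[OF _ finite_carrier_mat]) (auto simp: GL_def)

declare finite_carrier_mat [simp]

lemma card_carrier_mat:
  "card (carrier_mat m n :: 'a::{finite} mat set) = CARD('a) ^ (m * n)"
proof -
  let ?I = "{..<m} \<times> {..<n}"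
  have "bij_betw (mat m n) (PiE ?I (\<lambda>_. UNIV :: 'a set)) (carrier_mat m n)"
  proof (rule bij_betwI[where g = "\<lambda>A. restrict (\<lambda>ij. A $$ ij) ?I"])
    fix f assume "f \<in> PiE ?I (\<lambda>_. UNIV :: 'a set)"
    then have "f ij = undefined" if "ij \<notin> ?I" for ij
      using that by (rule PiE_arb)
    then show "restrict (\<lambda>ij. mat m n f $$ ij) ?I = f"
      by (auto simp: fun_eq_iff restrict_def)
  qed (auto intro!: eq_matI)
  from bij_betw_same_card[OF this] show ?thesis
    by (simp add: card_PiE card_cartesian_product)
qed

lemma card_carrier_vec: "card (carrier_vec n :: 'a::finite vec set) = CARD('a) ^ n"
proof -
  have "bij_betw (vec n) (PiE {..<n} (\<lambda>_. UNIV :: 'a set)) (carrier_vec n)"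
  proof (rule bij_betwI[where g = "\<lambda>A. restrict (\<lambda>i. A $ i) {..<n}"])
    fix f assume "f \<in> PiE {..<n} (\<lambda>_. UNIV :: 'a set)"
    then have "f i = undefined" if "i \<notin> {..<n}" for i
      using that by (rule PiE_arb)
    then show "restrict (\<lambda>i. vec n f $ i) {..<n} = f"
      by (auto simp: fun_eq_iff restrict_def)
  qed (auto intro!: eq_vecI)
  from bij_betw_same_card[OF this] show ?thesis
    by (simp add: card_PiE)
qed

lemma finite_carrier_vec [simp]: "finite (carrier_vec n :: 'a::finite vec set)"
  by (rule card_ge_0_finite) (simp add: card_carrier_vec)

lemma bij_betw_Sym_block:
  assumes "e * e = 1"
  shows "bij_betw (\<lambda>(A, B, D). four_block_mat A B (e \<cdot>\<^sub>m B\<^sup>T) D)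
    (Sym e s \<times> carrier_mat s r \<times> Sym e r) (Sym e (s + r))"
proof (rule bij_betw_imageI)
  show "inj_on (\<lambda>(A, B, D). four_block_mat A B (e \<cdot>\<^sub>m B\<^sup>T) D) (Sym e s \<times> carrier_mat s r \<times> Sym e r)"
  proof (rule inj_onI)
    fix x y
    assume *: "x \<in> Sym e s \<times> carrier_mat s r \<times> Sym e r" "y \<in> Sym e s \<times> carrier_mat s r \<times> Sym e r"
      "(\<lambda>(A, B, D). four_block_mat A B (e \<cdot>\<^sub>m B\<^sup>T) D) x = (\<lambda>(A, B, D). four_block_mat A B (e \<cdot>\<^sub>m B\<^sup>T) D) y"
    obtain A B D A' B' D' where xy: "x = (A, B, D)" "y = (A', B', D')" by (metis prod_cases3)
    have "A = A' \<and> B = B' \<and> e \<cdot>\<^sub>m B\<^sup>T = e \<cdot>\<^sub>m B'\<^sup>T \<and> D = D'"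
      by (rule four_block_cong_iff[of _ s s _ r _ r, THEN iffD1]) (use * xy in \<open>auto dest: Sym_carrier\<close>)
    then show "x = y" using xy by simp
  qed
next
  show "(\<lambda>(A, B, D). four_block_mat A B (e \<cdot>\<^sub>m B\<^sup>T) D) ` (Sym e s \<times> carrier_mat s r \<times> Sym e r)
    = Sym e (s + r)"
  proof (intro equalityI subsetI)
    fix M assume M: "M \<in> Sym e (s + r)"
    obtain A B C D where *: "A \<in> carrier_mat s s" "B \<in> carrier_mat s r"
      "C \<in> carrier_mat r s" "D \<in> carrier_mat r r" "M = four_block_mat A B C D"
      using four_block_cases[OF Sym_carrier[OF M]] by metis
    show "M \<in> (\<lambda>(A, B, D). four_block_mat A B (e \<cdot>\<^sub>m B\<^sup>T) D) ` (Sym e s \<times> carrier_mat s r \<times> Sym e r)"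
      using M * Sym_block[OF assms *(1-4)] by (auto intro!: image_eqI[where x = "(A, B, D)"])
  qed (auto intro: Sym_block_I[OF assms])
qed

text \<open>The characteristic divides the order of the field, so characteristic 2 would make that
  order even.\<close>

lemma odd_card_two_neq_0:
  assumes "odd CARD('a::{field,finite})"
  shows "(2 :: 'a) \<noteq> 0"
proof
  assume "(2 :: 'a) = 0"
  then have "of_nat 2 = (0 :: 'a)" by simp
  then have "CHAR('a) dvd 2" by (simp only: of_nat_eq_0_iff_char_dvd)
  moreover have "CHAR('a) \<noteq> 1"
  proof
    assume "CHAR('a) = 1"
    then have "of_nat 1 = (0 :: 'a)" by (metis of_nat_CHAR)
    then show False by simp
  qed
  ultimately have "CHAR('a) = 2" using two_is_prime_nat by (metis prime_nat_iff)
  then show False using CHAR_dvd_CARD[where 'a = 'a] assms by auto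
qed

text \<open>The dimension of \<open>Sym e n\<close> when 2 is invertible: the entries above the
  diagonal, together with the diagonal in the symmetric case.\<close>

definition symdim :: "'a::field \<Rightarrow> nat \<Rightarrow> nat" where
  "symdim e n = (\<Sum>i<n. i) + (if e = 1 then n else 0)"

lemma symdim_0 [simp]: "symdim e 0 = 0" by (simp add: symdim_def)

lemma symdim_Suc: "symdim e (Suc n) = symdim e 1 + n + symdim e n"
  by (simp add: symdim_def)

lemma card_Sym:
  fixes e :: "'a::{field,finite}"
  assumes e: "e = 1 \<or> e = -1" and odd: "odd CARD('a)"
  shows "card (Sym e n) = CARD('a) ^ symdim e n"
proof (induction n)
  case 0
  have "Sym e 0 = {0\<^sub>m 0 0}" by (auto simp: Sym_def carrier_0 intro!: eq_matI)
  then show ?case by (simp add: symdim_def)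
next
  case (Suc n)
  have 2: "(2::'a) \<noteq> 0" by (rule odd_card_two_neq_0[OF odd])
  have ee: "e * e = 1" using e by auto
  have *: "Sym e 1 = {M \<in> carrier_mat 1 1. M $$ (0,0) = e * M $$ (0,0)}"
    by (auto simp: Sym_def mat_eq_iff)
  have 1: "card (Sym e 1) = CARD('a) ^ symdim e 1"
  proof (cases "e = 1")
    case True
    then have "Sym e 1 = carrier_mat 1 1" using * by simp
    then show ?thesis using True by (simp add: card_carrier_mat symdim_def)
  next
    case False
    then have e1: "e = -1" using e by simp
    have neg: "x = e * x \<longleftrightarrow> x = 0" for x :: 'a
    proof -
      have "x = e * x \<longleftrightarrow> 2 * x = 0" using e1 by (auto simp: add_eq_0_iff2)
      then show ?thesis using 2 by simp
    qed
    have "Sym e 1 = {M \<in> carrier_mat 1 1. M $$ (0,0) = 0}" by (simp only: * neg)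
    also have "\<dots> = {0\<^sub>m 1 1}" by (auto simp: mat_eq_iff)
    finally have "Sym e 1 = {0\<^sub>m 1 1}" .
    then show ?thesis using False by (simp add: symdim_def)
  qed
  have "card (Sym e (1 + n)) = card (Sym e 1 \<times> (carrier_mat 1 n :: 'a mat set) \<times> Sym e n)"
    using bij_betw_same_card[OF bij_betw_Sym_block[OF ee, of 1 n]] by simp
  also have "\<dots> = CARD('a) ^ symdim e (Suc n)"
    by (simp add: card_cartesian_product 1 Suc card_carrier_mat symdim_Suc[of e n] power_add del: One_nat_def)
  finally show ?case by simp
qed

text \<open>On the level of dimensions this is the splitting of a square matrix into its symmetric
  and its skew part. The cancellation of all powers of \<open>q\<close> in the recursion for triples
  rests on it.\<close>

lemma symdim_plus_minus:
  assumes "(2::'a::field) \<noteq> 0" "e = 1 \<or> e = (-1::'a)"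
  shows "symdim e n + symdim (- e) n = n * n"
proof -
  have "(-1::'a) \<noteq> 1" using assms(1) by (metis add.right_inverse one_add_one)
  moreover have "(\<Sum>i<n. i) + (\<Sum>i<n. i) + n = n * n"
    by (induction n) auto
  ultimately show ?thesis using assms(2) by (auto simp: symdim_def)
qed

section \<open>Matrices of full column rank and the order of the general linear group\<close>

definition idblock :: "nat \<Rightarrow> nat \<Rightarrow> 'a::field mat" where
  "idblock s t = mat s t (\<lambda>(i, j). if i = j then 1 else 0)"

definition full_col_rank :: "nat \<Rightarrow> nat \<Rightarrow> 'a::field mat set" where
  "full_col_rank s t = {c \<in> carrier_mat s t. \<forall>v \<in> carrier_vec t. c *\<^sub>v v = 0\<^sub>v s \<longrightarrow> v = 0\<^sub>v t}"

lemma idblock_carrier [simp]: "idblock s t \<in> carrier_mat s t"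
  by (simp add: idblock_def)

lemma idblock_dims [simp]: "dim_row (idblock s t) = s" "dim_col (idblock s t) = t"
  by (simp_all add: idblock_def)

text \<open>Completion of a nonzero vector to a basis: in the standard basis the unit vector at a
  pivot position of \<open>w\<close> is replaced by \<open>w\<close>, which is then listed in place
  0.\<close>

lemma GL_first_column:
  fixes w :: "'a::field vec"
  assumes w: "w \<in> carrier_vec s" "w \<noteq> 0\<^sub>v s"
  shows "\<exists>Y \<in> GL s. col Y 0 = w"
proof -
  obtain j where j: "j < s" "w $ j \<noteq> 0" using w by (metis carrier_vecD eq_vecI index_zero_vec)
  \<comment> \<open>The transposition of \<open>0\<close> and \<open>j\<close>. Column
    \<open>k > 0\<close> of \<open>Y\<close> is the unit vector at \<open>p k\<close>, so precisely
    the pivot position \<open>j\<close> is left to \<open>w\<close>.\<close>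
  define p where "p k = (if k = 0 then j else if k = j then 0 else k)" for k
  have pp: "i = p k \<longleftrightarrow> k = p i" for i k by (auto simp: p_def)
  have p_less: "p i < s" if "i < s" for i using that j by (auto simp: p_def)
  define Y where "Y = mat s s (\<lambda>(i, k). if k = 0 then w $ i else if i = p k then 1 else (0::'a))"
  have Y: "Y \<in> carrier_mat s s" by (simp add: Y_def)
  have Yv: "(Y *\<^sub>v v) $ i = w $ i * v $ 0 + (if p i \<noteq> 0 then v $ p i else 0)"
    if v: "v \<in> carrier_vec s" and i: "i < s" for v i
  proof -
    have "(Y *\<^sub>v v) $ i = (\<Sum>k\<in>{0..<s}. (if k = 0 then w $ i else if i = p k then 1 else 0) * v $ k)"
      using v i Y by (simp add: Y_def scalar_prod_def)
    also have "{0..<s} = insert 0 {1..<s}" using j(1) by auto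
    also have "(\<Sum>k\<in>insert 0 {1..<s}. (if k = 0 then w $ i else if i = p k then 1 else 0) * v $ k)
       = w $ i * v $ 0 + (\<Sum>k\<in>{1..<s}. (if k = 0 then w $ i else if i = p k then 1 else 0) * v $ k)"
      by (subst sum.insert) auto
    also have "(\<Sum>k\<in>{1..<s}. (if k = 0 then w $ i else if i = p k then 1 else 0) * v $ k)
       = (\<Sum>k\<in>{1..<s}. if k = p i then v $ k else 0)"
    proof (rule sum.cong[OF refl])
      fix k assume "k \<in> {1..<s}"
      then show "(if k = 0 then w $ i else if i = p k then 1 else 0) * v $ k = (if k = p i then v $ k else 0)"
        using pp[of i k] by auto
    qed
    also have "\<dots> = (if p i \<in> {1..<s} then v $ p i else 0)" by (rule sum.delta) simp
    also have "\<dots> = (if p i \<noteq> 0 then v $ p i else 0)" using p_less[OF i] by auto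
    finally show ?thesis .
  qed
  have "Y \<in> GL s"
  proof (subst GL_kernel[OF Y], intro ballI impI)
    fix v assume v: "v \<in> carrier_vec s" and Y0: "Y *\<^sub>v v = 0\<^sub>v s"
    have z: "w $ i * v $ 0 + (if p i \<noteq> 0 then v $ p i else 0) = 0" if "i < s" for i
      using Yv[OF v that] Y0 that by simp
    have v0: "v $ 0 = 0" using z[OF j(1)] j(2) by (auto simp: p_def split: if_splits)
    show "v = 0\<^sub>v s"
    proof (rule eq_vecI)
      fix k assume "k < dim_vec (0\<^sub>v s :: 'a vec)"
      then have k: "k < s" by simp
      have "p (p k) = k" by (auto simp: p_def)
      then show "v $ k = 0\<^sub>v s $ k" using z[OF p_less[OF k]] v0 k by (cases "k = 0") auto
    qed (use v in auto)
  qed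
  moreover have "col Y 0 = w" using w j by (intro eq_vecI) (auto simp: Y_def)
  ultimately show ?thesis by blast
qed

lemma mult_idblock_col:
  assumes "Y \<in> carrier_mat n (t + m)" "i < n" "j < t"
  shows "(Y * idblock (t + m) t) $$ (i, j) = Y $$ (i, j)"
proof -
  have "(Y * idblock (t + m) t) $$ (i, j) = (\<Sum>k\<in>{0..<t + m}. Y $$ (i, k) * (if k = j then 1 else 0))"
    using assms by (simp add: scalar_prod_def idblock_def)
  also have "\<dots> = (\<Sum>k\<in>{0..<t + m}. if k = j then Y $$ (i, k) else 0)"
    by (rule sum.cong) auto
  also have "\<dots> = Y $$ (i, j)" using assms by (simp add: sum.delta)
  finally show ?thesis .
qed

lemma full_col_rank_mult:
  assumes "Y \<in> GL s" "c \<in> full_col_rank s t"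
  shows "Y * c \<in> full_col_rank s t"
proof -
  have Y: "Y \<in> carrier_mat s s" and c: "c \<in> carrier_mat s t" using assms
    by (auto simp: GL_def full_col_rank_def)
  show ?thesis unfolding full_col_rank_def
  proof (intro CollectI conjI ballI impI)
    fix v assume v: "v \<in> carrier_vec t" "(Y * c) *\<^sub>v v = 0\<^sub>v s"
    then have "Y *\<^sub>v (c *\<^sub>v v) = 0\<^sub>v s" using Y c by simp
    then have "c *\<^sub>v v = 0\<^sub>v s" using GL_kernel[OF Y] assms(1) c v by auto
    then show "v = 0\<^sub>v t" using assms(2) v by (auto simp: full_col_rank_def)
  qed (use Y c in auto)
qed

lemma idblock_full_col_rank: "idblock (t + m) t \<in> full_col_rank (t + m) t"
  unfolding full_col_rank_def
proof (intro CollectI conjI ballI impI)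
  fix v :: "'a vec" assume v: "v \<in> carrier_vec t" and z: "idblock (t + m) t *\<^sub>v v = 0\<^sub>v (t + m)"
  show "v = 0\<^sub>v t"
  proof (rule eq_vecI)
    fix i assume "i < dim_vec (0\<^sub>v t :: 'a vec)"
    then have i: "i < t" by simp
    have "(idblock (t + m) t *\<^sub>v v) $ i = (\<Sum>k\<in>{0..<t}. (if i = k then 1 else 0) * v $ k)"
      using i v by (simp add: idblock_def scalar_prod_def)
    also have "\<dots> = (\<Sum>k\<in>{0..<t}. if i = k then v $ k else 0)" by (rule sum.cong) auto
    also have "\<dots> = v $ i" using i by (simp add: sum.delta)
    finally show "v $ i = 0\<^sub>v t $ i" using z i by simp
  qed (use v in auto)
qed simp

text \<open>Once the first column has been moved to the first unit vector, the lower right block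
  again has independent columns, so induction on the number of columns applies. The bound
  \<open>t \<le> s\<close> comes out as the existence of \<open>m\<close>.\<close>

lemma full_col_rank_normal_form:
  "c \<in> full_col_rank s t \<Longrightarrow> \<exists>m. s = t + m \<and> (\<exists>Y \<in> GL s. c = Y * idblock s t)"
proof (induction t arbitrary: s c)
  case 0
  then have "c = 0\<^sub>m s 0" using carrier_0(2)[of s] by (auto simp: full_col_rank_def)
  moreover have "idblock s 0 = (0\<^sub>m s 0 :: 'a mat)" using carrier_0(2)[of s] idblock_carrier[of s 0] by blast
  ultimately have "c = 1\<^sub>m s * idblock s 0" by simp
  then show ?case by (intro exI[of _ s]) (auto intro!: bexI[of _ "1\<^sub>m s"])
next
  case (Suc t)
  have c: "c \<in> carrier_mat s (1 + t)" and ker: "\<And>v. v \<in> carrier_vec (1 + t) \<Longrightarrow> c *\<^sub>v v = 0\<^sub>v s \<Longrightarrow> v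
    = 0\<^sub>v (1 + t)"
    using Suc.prems by (auto simp: full_col_rank_def)
  have "col c 0 \<noteq> 0\<^sub>v s"
  proof
    assume "col c 0 = 0\<^sub>v s"
    then have "c *\<^sub>v unit_vec (1 + t) 0 = 0\<^sub>v s"
      using c by (intro eq_vecI) (auto simp: vec_eq_iff)
    from ker[OF _ this] have "unit_vec (1 + t) 0 = (0\<^sub>v (1 + t) :: 'a vec)" by simp
    then show False by (metis unit_vec_nonzero zero_less_Suc plus_1_eq_Suc)
  qed
  then obtain Y1 where Y1: "Y1 \<in> GL s" "col Y1 0 = col c 0"
    using GL_first_column[of "col c 0" s] c carrier_vecI[of "col c 0" s] by auto
  note Y1c = GL_carrier[OF Y1(1)] and Y1i = ginv[OF Y1(1)]
  have "s \<noteq> 0"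
  proof
    assume "s = 0" then have "col c 0 = 0\<^sub>v s" using c by (intro eq_vecI) auto
    with \<open>col c 0 \<noteq> 0\<^sub>v s\<close> show False by simp
  qed
  then obtain s' where s: "s = 1 + s'" by (metis not0_implies_Suc plus_1_eq_Suc)
  define c' where "c' = ginv Y1 * c"
  have c': "c' \<in> carrier_mat (1 + s') (1 + t)" using c Y1i s by (auto simp: c'_def)
  have c'full_col_rank: "c' \<in> full_col_rank s (1 + t)" unfolding c'_def
    by (rule full_col_rank_mult) (use Suc.prems GL_ginv[OF Y1(1)] in auto)
  have col0: "c' $$ (i, 0) = (if i = 0 then 1 else 0)" if "i < s" for i
  proof -
    have "c' $$ (i, 0) = row (ginv Y1) i \<bullet> col c 0"
      using that c Y1i s by (simp add: c'_def)
    also have "\<dots> = (ginv Y1 * Y1) $$ (i, 0)" using that Y1c Y1i(1) s by (simp add: Y1(2)[symmetric])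
    also have "\<dots> = (if i = 0 then 1 else 0)" using Y1i that s by simp
    finally show ?thesis .
  qed
  obtain A x C c'' where bl: "A \<in> carrier_mat 1 1" "x \<in> carrier_mat 1 t" "C \<in> carrier_mat s' 1"
    "c'' \<in> carrier_mat s' t"
    "c' = four_block_mat A x C c''" using four_block_cases[OF c'] by metis
  have A: "A = 1\<^sub>m 1" using col0[of 0] bl s by (intro eq_matI) auto
  have C: "C = 0\<^sub>m s' 1"
  proof (rule eq_matI)
    fix i j assume "i < dim_row (0\<^sub>m s' 1 :: 'a mat)" "j < dim_col (0\<^sub>m s' 1 :: 'a mat)"
    then show "C $$ (i, j) = 0\<^sub>m s' 1 $$ (i, j)" using col0[of "Suc i"] bl s by auto
  qed (use bl in auto)
  have "c'' \<in> full_col_rank s' t" unfolding full_col_rank_def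
  proof (intro CollectI conjI ballI impI)
    fix v assume v: "v \<in> carrier_vec t" "c'' *\<^sub>v v = 0\<^sub>v s'"
    \<comment> \<open>The first entry is chosen so that the top row of \<open>c'\<close> kills
      \<open>?w\<close>; a kernel vector of \<open>c''\<close> thus becomes one of
      \<open>c'\<close>.\<close>
    let ?w = "(- (x *\<^sub>v v)) @\<^sub>v v"
    have "c' *\<^sub>v ?w = (A *\<^sub>v (- (x *\<^sub>v v)) + x *\<^sub>v v) @\<^sub>v (C *\<^sub>v (- (x *\<^sub>v v)) + c'' *\<^sub>v v)"
      unfolding bl(5) by (rule four_block_mat_mult_vec[OF bl(1-4)]) (use bl v in auto)
    also have "\<dots> = 0\<^sub>v s" unfolding A C v(2) s
      using bl v by (intro eq_vecI) (auto simp: append_vec_def)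
    finally have "c' *\<^sub>v ?w = 0\<^sub>v s" .
    moreover have "?w \<in> carrier_vec (1 + t)" using bl v by (intro append_carrier_vec) auto
    ultimately have "?w = 0\<^sub>v (1 + t)" using c'full_col_rank by (auto simp: full_col_rank_def)
    then have "?w $ (1 + i) = 0" if "i < t" for i using that by simp
    then have "v $ i = 0" if "i < t" for i
      using that bl v by (auto simp: append_vec_def)
    then show "v = 0\<^sub>v t" using v by (intro eq_vecI) auto
  qed (use bl in auto)
  from Suc.IH[OF this] obtain m Y2 where m: "s' = t + m" and Y2: "Y2 \<in> GL s'" "c'' = Y2 * idblock s' t"
    by auto
  note Y2c = GL_carrier[OF Y2(1)]
  let ?x = "mat 1 s' (\<lambda>(i, j). if j < t then x $$ (i, j) else 0)"
  have x: "?x * idblock s' t = x" unfolding m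
  proof (rule eq_matI)
    fix i j assume "i < dim_row x" "j < dim_col x"
    then have ij: "i < 1" "j < t" using bl by auto
    show "(mat 1 (t + m) (\<lambda>(i, j). if j < t then x $$ (i, j) else 0) * idblock (t + m) t) $$ (i, j)
      = x $$ (i, j)"
      by (subst mult_idblock_col[of _ 1]) (use ij in auto)
  qed (use bl in auto)
  let ?Z = "four_block_mat (1\<^sub>m 1) ?x (0\<^sub>m s' 1) Y2"
  have Z: "?Z \<in> GL (1 + s')" using Y2 Y2c by (subst GL_upper_block) auto
  have id: "idblock (1 + s') (1 + t) = four_block_mat (1\<^sub>m 1) (0\<^sub>m 1 t) (0\<^sub>m s' 1) (idblock s' t)"
    by (rule eq_matI) (auto simp: idblock_def)
  have "?Z * idblock (1 + s') (1 + t) = four_block_mat (1\<^sub>m 1) x (0\<^sub>m s' 1) c''"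
    unfolding id using Y2c bl(2) x Y2(2)[symmetric]
    by (subst mult_four_block_mat[of _ 1 1 _ s' _ s' _ _ 1 _ t]) auto
  then have "c' = ?Z * idblock s (Suc t)" using bl A C s by simp
  then have "Y1 * c' = Y1 * (?Z * idblock s (Suc t))" by (rule arg_cong)
  also have "\<dots> = Y1 * ?Z * idblock s (Suc t)"
    by (rule assoc_mult_mat[symmetric, of _ s s _ s _ "Suc t"]) (use Y1c GL_carrier[OF Z] s in simp_all)
  finally have "Y1 * c' = Y1 * ?Z * idblock s (Suc t)" .
  moreover have "Y1 * c' = c" unfolding c'_def using Y1c Y1i c by (simp flip: assoc_mult_mat[of _ s s _ s])
  ultimately have "c = Y1 * ?Z * idblock s (Suc t)" by simp
  moreover have "Y1 * ?Z \<in> GL s" using GL_mult[OF Y1(1), of ?Z] Z s by simp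
  moreover have "s = Suc t + m" using m s by simp
  ultimately show ?case by blast
qed

lemma card_fibres:
  assumes "finite A" "finite B" "f ` A \<subseteq> B" "\<And>b. b \<in> B \<Longrightarrow> card {a \<in> A. f a = b} = k"
  shows "card A = card B * k"
proof -
  have "card A = (\<Sum>b\<in>B. \<Sum>a\<in>{a \<in> A. f a = b}. 1)"
    using sum.group[OF assms(1-3), of "\<lambda>_. 1::nat"] by simp
  then show ?thesis using assms(4) by simp
qed

lemma finite_full_col_rank [simp]: "finite (full_col_rank s t :: 'a::{field,finite} mat set)"
  by (rule finite_subset[OF _ finite_carrier_mat]) (auto simp: full_col_rank_def)

text \<open>Orbit counting for the transitive left action of \<open>GL (t + m)\<close>. The
  stabiliser of \<open>idblock (t + m) t\<close> consists of the block matrices with first block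
  column \<open>1, 0\<close>: an arbitrary upper right block over an invertible lower right
  one.\<close>

lemma card_full_col_rank:
  "card (full_col_rank (t + m) t :: 'a::{field,finite} mat set) *
    (CARD('a) ^ (t * m) * card (GL m :: 'a mat set)) = card (GL (t + m) :: 'a mat set)"
proof (rule card_fibres[symmetric])
  let ?E = "idblock (t + m) t :: 'a mat"
  show "(\<lambda>Y. Y * ?E) ` GL (t + m) \<subseteq> full_col_rank (t + m) t"
    using full_col_rank_mult idblock_full_col_rank by blast
  have E: "?E = four_block_mat (1\<^sub>m t) (0\<^sub>m t 0) (0\<^sub>m m t) (0\<^sub>m m 0)"
    by (rule eq_matI) (auto simp: idblock_def)
  fix c :: "'a mat" assume c: "c \<in> full_col_rank (t + m) t"
  then obtain Y0 where Y0: "Y0 \<in> GL (t + m)" "c = Y0 * ?E" using full_col_rank_normal_form[OF c] by auto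
  note Y0c = GL_carrier[OF Y0(1)] and Y0i = ginv[OF Y0(1)]
  have "bij_betw (\<lambda>(X, h). Y0 * four_block_mat (1\<^sub>m t) X (0\<^sub>m m t) h) (carrier_mat t m \<times> GL m)
     {Y \<in> GL (t + m). Y * ?E = c}"
  proof (rule bij_betw_imageI)
    show "inj_on (\<lambda>(X, h). Y0 * four_block_mat (1\<^sub>m t) X (0\<^sub>m m t) h) (carrier_mat t m \<times> GL m)"
    proof (rule inj_onI)
      fix p p' assume p: "p \<in> carrier_mat t m \<times> GL m" "p' \<in> carrier_mat t m \<times> GL m"
        and eq: "(case p of (X, h) \<Rightarrow> Y0 * four_block_mat (1\<^sub>m t) X (0\<^sub>m m t) h) =
                 (case p' of (X, h) \<Rightarrow> Y0 * four_block_mat (1\<^sub>m t) X (0\<^sub>m m t) h)"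
      obtain X h X' h' where pp: "p = (X, h)" "p' = (X', h')" by (metis prod.exhaust)
      have "four_block_mat (1\<^sub>m t) X (0\<^sub>m m t) h = four_block_mat (1\<^sub>m t) X' (0\<^sub>m m t) h'"
        by (rule GL_cancel_left[OF Y0(1), of _ "t + m"])
          (use p eq pp GL_carrier[of h m] GL_carrier[of h' m] in \<open>auto intro!: four_block_carrier_mat\<close>)
      then show "p = p'" using p pp
        by (subst (asm) four_block_cong_iff[of _ t t _ m _ m]) (auto dest: GL_carrier)
    qed
    have "Y \<in> (\<lambda>(X, h). Y0 * four_block_mat (1\<^sub>m t) X (0\<^sub>m m t) h) ` (carrier_mat t m \<times> GL m)"
      if Y: "Y \<in> GL (t + m)" "Y * ?E = c" for Y
    proof -
      let ?Z = "ginv Y0 * Y"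
      have Z: "?Z \<in> GL (t + m)" by (rule GL_mult[OF GL_ginv[OF Y0(1)] Y(1)])
      have YZ: "Y = Y0 * ?Z" using Y0c Y0i GL_carrier[OF Y(1)]
        by (simp flip: assoc_mult_mat[of _ "t+m" "t+m" _ "t+m"])
      have "?Z * ?E = ginv Y0 * (Y * ?E)" using Y0i GL_carrier[OF Y(1)]
        by (intro assoc_mult_mat[of _ "t + m" "t + m" _ "t + m" _ t]) auto
      also have "\<dots> = ginv Y0 * Y0 * ?E" unfolding Y(2) Y0(2) using Y0i Y0c
        by (intro assoc_mult_mat[of _ "t + m" "t + m" _ "t + m" _ t, symmetric]) auto
      finally have ZE: "?Z * ?E = ?E" using Y0i left_mult_one_mat[OF idblock_carrier, of "t + m" t] by simp
      obtain A X C h where bl: "A \<in> carrier_mat t t" "X \<in> carrier_mat t m" "C \<in> carrier_mat m t"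
        "h \<in> carrier_mat m m"
        "?Z = four_block_mat A X C h" using four_block_cases[OF GL_carrier[OF Z]] by metis
      have "four_block_mat A X C h * ?E = four_block_mat A (0\<^sub>m t 0) C (0\<^sub>m m 0)"
        unfolding E by (subst mult_four_block_mat[OF bl(1-4), of _ t _ 0]) (use bl in auto)
      then have "four_block_mat A (0\<^sub>m t 0) C (0\<^sub>m m 0)
        = four_block_mat (1\<^sub>m t) (0\<^sub>m t 0) (0\<^sub>m m t) (0\<^sub>m m 0)"
        using ZE bl(5) E by simp
      then have AC: "A = 1\<^sub>m t" "C = 0\<^sub>m m t"
        using bl by (subst (asm) four_block_cong_iff[of _ t t _ 0 _ m]; auto)+
      have "h \<in> GL m" using Z bl unfolding bl(5) AC by (subst (asm) GL_upper_block) auto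
      then show ?thesis using YZ bl AC by (intro image_eqI[where x = "(X, h)"]) auto
    qed
    moreover have "Y0 * four_block_mat (1\<^sub>m t) X (0\<^sub>m m t) h \<in> {Y \<in> GL (t + m). Y * ?E = c}"
      if "X \<in> carrier_mat t m" "h \<in> GL m" for X h
    proof -
      let ?Z = "four_block_mat (1\<^sub>m t) X (0\<^sub>m m t) h"
      have h: "h \<in> carrier_mat m m" using that by (simp add: GL_carrier)
      have Z: "?Z \<in> GL (t + m)" by (subst GL_upper_block) (use that h in auto)
      have "?Z * ?E = ?E" unfolding E
        by (subst mult_four_block_mat[of _ t t _ m _ m _ _ t _ 0]) (use that h in auto)
      then have "Y0 * ?Z * ?E = c" unfolding Y0(2) using Y0c GL_carrier[OF Z]
        by (subst assoc_mult_mat[of _ "t + m" "t + m" _ "t + m" _ t]) auto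
      then show ?thesis using GL_mult[OF Y0(1) Z] by simp
    qed
    ultimately show "(\<lambda>(X, h). Y0 * four_block_mat (1\<^sub>m t) X (0\<^sub>m m t) h) ` (carrier_mat t m \<times> GL m) =
      {Y \<in> GL (t + m). Y * ?E = c}" by auto
  qed
  from bij_betw_same_card[OF this]
  show "card {Y \<in> GL (t + m). Y * ?E = c} = CARD('a) ^ (t * m) * card (GL m :: 'a mat set)"
    by (simp add: card_cartesian_product card_carrier_mat)
qed auto

lemma card_full_col_rank_1: "card (full_col_rank s 1 :: 'a::{field,finite} mat set) = CARD('a) ^ s - 1"
proof -
  have "full_col_rank s 1 = carrier_mat s 1 - {0\<^sub>m s 1 :: 'a mat}"
  proof (intro equalityI subsetI)
    fix c :: "'a mat" assume c: "c \<in> full_col_rank s 1"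
    have "c \<noteq> 0\<^sub>m s 1"
    proof
      assume "c = 0\<^sub>m s 1"
      then have "c *\<^sub>v unit_vec 1 0 = 0\<^sub>v s" by (intro eq_vecI) auto
      then have "unit_vec 1 0 = (0\<^sub>v 1 :: 'a vec)" using c by (auto simp: full_col_rank_def)
      then show False by simp
    qed
    then show "c \<in> carrier_mat s 1 - {0\<^sub>m s 1}" using c by (auto simp: full_col_rank_def)
  next
    fix c :: "'a mat" assume c: "c \<in> carrier_mat s 1 - {0\<^sub>m s 1}"
    then obtain i where i: "i < s" "c $$ (i, 0) \<noteq> 0" by (auto simp: mat_eq_iff)
    show "c \<in> full_col_rank s 1" unfolding full_col_rank_def
    proof (intro CollectI conjI ballI impI)
      fix v :: "'a vec" assume v: "v \<in> carrier_vec 1" "c *\<^sub>v v = 0\<^sub>v s"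
      have "(c *\<^sub>v v) $ i = c $$ (i, 0) * v $ 0" using v(1) i c by (auto simp: scalar_prod_def)
      then have "c $$ (i, 0) * v $ 0 = 0" using v(2) i(1) by (metis index_zero_vec(1))
      then have "v $ 0 = 0" using i by simp
      then show "v = 0\<^sub>v 1" using v by (intro eq_vecI) auto
    qed (use c in auto)
  qed
  then show ?thesis by (simp add: card_Diff_subset card_carrier_mat)
qed

lemma card_GL_Suc:
  "card (GL (Suc n) :: 'a::{field,finite} mat set)
    = (CARD('a) ^ Suc n - 1) * (CARD('a) ^ n * card (GL n :: 'a mat set))"
  using card_full_col_rank[of 1 n, where 'a = 'a] card_full_col_rank_1[of "1 + n", where 'a = 'a] by simp

lemma card_GL_pos: "card (GL n :: 'a::{field,finite} mat set) > 0"
  by (subst card_gt_0_iff) (metis GL_one empty_iff finite_GL)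

section \<open>Nilpotent matrices\<close>

lemma nil_iff:
  "M \<in> carrier_mat n n \<Longrightarrow> nilpotent_mat M \<longleftrightarrow> (\<exists>k. M ^\<^sub>m k = 0\<^sub>m n n)"
  by (auto simp: nilpotent_mat_def)

lemma pow_mat_add:
  assumes "A \<in> carrier_mat n n"
  shows "A ^\<^sub>m (k + l) = A ^\<^sub>m k * A ^\<^sub>m l"
proof (induction l)
  case (Suc l)
  have "A ^\<^sub>m (k + Suc l) = A ^\<^sub>m k * A ^\<^sub>m l * A" using Suc by simp
  also have "\<dots> = A ^\<^sub>m k * (A ^\<^sub>m l * A)"
    by (rule assoc_mult_mat[of _ n n _ n _ n]) (use assms in auto)
  finally show ?case by simp
qed (use assms in auto)

lemma pow_mat_comm:
  assumes "A \<in> carrier_mat n n"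
  shows "A ^\<^sub>m k * A = A * A ^\<^sub>m k"
  using pow_mat_add[OF assms, of 1 k] assms by simp

lemma pow_mat_zero_mono:
  assumes "A \<in> carrier_mat n n" "A ^\<^sub>m k = 0\<^sub>m n n"
  shows "A ^\<^sub>m (k + l) = 0\<^sub>m n n"
  using assms by (simp add: pow_mat_add)

text \<open>Stated with an intertwining relation, so that \<open>P\<close> can be a transpose or a
  nonsingular form without its inverse being written down.\<close>

lemma nil_intertwine:
  assumes P: "P \<in> GL n" and M: "M \<in> carrier_mat n n" "M' \<in> carrier_mat n n" and eq: "P * M = M' * P"
  shows "nilpotent_mat M \<longleftrightarrow> nilpotent_mat M'"
proof -
  note Pc = GL_carrier[OF P]
  have pow: "P * M ^\<^sub>m k = M' ^\<^sub>m k * P" for k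
  proof (induction k)
    case (Suc k)
    have "P * M ^\<^sub>m Suc k = P * M ^\<^sub>m k * M"
      using assoc_mult_mat[of P n n "M ^\<^sub>m k" n M n] Pc M by simp
    also have "\<dots> = M' ^\<^sub>m k * (P * M)" unfolding Suc
      by (rule assoc_mult_mat[of _ n n _ n _ n]) (use Pc M in auto)
    also have "\<dots> = M' ^\<^sub>m k * M' * P" unfolding eq
      by (rule assoc_mult_mat[of _ n n _ n _ n, symmetric]) (use Pc M in auto)
    finally show ?case by simp
  qed (use Pc M in auto)
  have "M ^\<^sub>m k = 0\<^sub>m n n \<longleftrightarrow> M' ^\<^sub>m k = 0\<^sub>m n n" for k
  proof
    assume "M ^\<^sub>m k = 0\<^sub>m n n"
    then have "M' ^\<^sub>m k * P = 0\<^sub>m n n * P" using Pc unfolding pow[of k, symmetric] by simp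
    then show "M' ^\<^sub>m k = 0\<^sub>m n n" by (rule GL_cancel_right[OF P, rotated 2]) (use M in auto)
  next
    assume "M' ^\<^sub>m k = 0\<^sub>m n n"
    then have "P * M ^\<^sub>m k = P * 0\<^sub>m n n" using Pc unfolding pow[of k] by simp
    then show "M ^\<^sub>m k = 0\<^sub>m n n" by (rule GL_cancel_left[OF P, rotated 2]) (use M in auto)
  qed
  then show ?thesis using M by (simp add: nil_iff)
qed

lemma nil_similar:
  assumes P: "P \<in> GL n" and M: "M \<in> carrier_mat n n"
  shows "nilpotent_mat (P * M * ginv P) \<longleftrightarrow> nilpotent_mat M"
proof -
  note Pc = GL_carrier[OF P] ginv[OF P]
  have "P * M * ginv P * P = P * M * (ginv P * P)"
    by (rule assoc_mult_mat[of _ n n _ n _ n]) (use Pc M in auto)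
  then have "P * M = P * M * ginv P * P" using Pc M by simp
  from nil_intertwine[OF P M _ this] show ?thesis using Pc M by auto
qed

lemma pow_mat_transpose:
  fixes M :: "'a::field mat"
  assumes M: "M \<in> carrier_mat n n"
  shows "(M\<^sup>T) ^\<^sub>m k = (M ^\<^sub>m k)\<^sup>T"
proof (induction k)
  case (Suc k)
  have "(M ^\<^sub>m Suc k)\<^sup>T = (M * M ^\<^sub>m k)\<^sup>T" using pow_mat_comm[OF M, of k] by simp
  also have "\<dots> = (M ^\<^sub>m k)\<^sup>T * M\<^sup>T" by (rule transpose_mult[of _ n n _ n]) (use M in auto)
  finally show ?case using Suc by simp
qed (use M in auto)

lemma nil_transpose:
  fixes M :: "'a::field mat"
  assumes M: "M \<in> carrier_mat n n"
  shows "nilpotent_mat (M\<^sup>T) \<longleftrightarrow> nilpotent_mat M"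
proof -
  have "(M ^\<^sub>m k)\<^sup>T = 0\<^sub>m n n \<longleftrightarrow> M ^\<^sub>m k = 0\<^sub>m n n" for k
    by (metis transpose_transpose zero_transpose_mat)
  then show ?thesis using M by (simp add: nil_iff[of _ n] pow_mat_transpose[OF M])
qed

lemma nil_uminus_imp:
  fixes M :: "'a::field mat"
  assumes M: "M \<in> carrier_mat n n" "nilpotent_mat M"
  shows "nilpotent_mat (- M)"
proof -
  have "(- M) ^\<^sub>m k = M ^\<^sub>m k \<or> (- M) ^\<^sub>m k = - (M ^\<^sub>m k)" for k
    by (induction k) (use M in auto)
  moreover obtain k where "M ^\<^sub>m k = 0\<^sub>m n n" using M by (auto simp: nil_iff)
  moreover have "- (0\<^sub>m n n :: 'a mat) = 0\<^sub>m n n" by (rule eq_matI) auto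
  ultimately have "(- M) ^\<^sub>m k = 0\<^sub>m n n" by metis
  then show ?thesis using M by (auto simp: nil_iff)
qed

lemma nil_uminus:
  fixes M :: "'a::field mat"
  assumes M: "M \<in> carrier_mat n n"
  shows "nilpotent_mat (- M) \<longleftrightarrow> nilpotent_mat M"
  using nil_uminus_imp[of M n] nil_uminus_imp[of "- M" n] M by auto

lemma nil_upper_block:
  assumes c: "A \<in> carrier_mat s s" "B \<in> carrier_mat s r" "D \<in> carrier_mat r r"
  shows "nilpotent_mat (four_block_mat A B (0\<^sub>m r s) D) \<longleftrightarrow> nilpotent_mat A \<and> nilpotent_mat D"
proof -
  let ?M = "four_block_mat A B (0\<^sub>m r s) D"
  have Mc: "?M \<in> carrier_mat (s + r) (s + r)" using c by auto
  have pow: "\<exists>X \<in> carrier_mat s r. ?M ^\<^sub>m k = four_block_mat (A ^\<^sub>m k) X (0\<^sub>m r s) (D ^\<^sub>m k)" for k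
  proof (induction k)
    case 0
    have "?M ^\<^sub>m 0 = four_block_mat (1\<^sub>m s) (0\<^sub>m s r) (0\<^sub>m r s) (1\<^sub>m r)"
      using c by simp
    then show ?case using c by (intro bexI[of _ "0\<^sub>m s r"]) auto
  next
    case (Suc k)
    then obtain X where X: "X \<in> carrier_mat s r" "?M ^\<^sub>m k = four_block_mat (A ^\<^sub>m k) X (0\<^sub>m r s) (D ^\<^sub>m k)"
      by auto
    have "?M ^\<^sub>m Suc k = four_block_mat (A ^\<^sub>m k) X (0\<^sub>m r s) (D ^\<^sub>m k) * ?M" using X by simp
    also have "\<dots> = four_block_mat (A ^\<^sub>m k * A + X * 0\<^sub>m r s) (A ^\<^sub>m k * B + X * D) (0\<^sub>m r s * A
      + D ^\<^sub>m k * 0\<^sub>m r s)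
       (0\<^sub>m r s * B + D ^\<^sub>m k * D)"
      by (rule mult_four_block_mat) (use c X in auto)
    also have "\<dots> = four_block_mat (A ^\<^sub>m Suc k) (A ^\<^sub>m k * B + X * D) (0\<^sub>m r s) (D ^\<^sub>m Suc k)"
    proof (rule cong_four_block_mat)
      show "A ^\<^sub>m k * A + X * 0\<^sub>m r s = A ^\<^sub>m Suc k"
        using c X right_add_zero_mat[OF mult_carrier_mat[OF pow_carrier_mat[OF c(1), of k] c(1)]] by simp
      show "0\<^sub>m r s * A + D ^\<^sub>m k * 0\<^sub>m r s = 0\<^sub>m r s" using c by simp
      show "0\<^sub>m r s * B + D ^\<^sub>m k * D = D ^\<^sub>m Suc k"
        using c left_add_zero_mat[OF mult_carrier_mat[OF pow_carrier_mat[OF c(3), of k] c(3)]] by simp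
    qed simp
    finally show ?case using c X by (intro bexI[of _ "A ^\<^sub>m k * B + X * D"]) auto
  qed
  have zero: "four_block_mat (0\<^sub>m s s) (0\<^sub>m s r) (0\<^sub>m r s) (0\<^sub>m r r) = (0\<^sub>m (s + r) (s + r) :: 'a mat)"
    by simp
  show ?thesis
  proof
    assume "nilpotent_mat ?M"
    then obtain k where k: "?M ^\<^sub>m k = 0\<^sub>m (s + r) (s + r)" using Mc by (auto simp: nil_iff)
    obtain X where X: "X \<in> carrier_mat s r" "?M ^\<^sub>m k = four_block_mat (A ^\<^sub>m k) X (0\<^sub>m r s) (D ^\<^sub>m k)"
      using pow by auto
    then have "four_block_mat (A ^\<^sub>m k) X (0\<^sub>m r s) (D ^\<^sub>m k)
      = four_block_mat (0\<^sub>m s s) (0\<^sub>m s r) (0\<^sub>m r s) (0\<^sub>m r r)"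
      using k zero by simp
    then have "A ^\<^sub>m k = 0\<^sub>m s s \<and> X = 0\<^sub>m s r \<and> 0\<^sub>m r s = (0\<^sub>m r s :: 'a mat) \<and> D ^\<^sub>m k = 0\<^sub>m r r"
      by (subst (asm) four_block_cong_iff[of _ s s _ r _ r]) (use c X in auto)
    then show "nilpotent_mat A \<and> nilpotent_mat D" using c by (auto simp: nil_iff)
  next
    assume "nilpotent_mat A \<and> nilpotent_mat D"
    then obtain k l where kl: "A ^\<^sub>m k = 0\<^sub>m s s" "D ^\<^sub>m l = 0\<^sub>m r r" using c by (auto simp: nil_iff)
    let ?n = "k + l"
    have n: "A ^\<^sub>m ?n = 0\<^sub>m s s" "D ^\<^sub>m ?n = 0\<^sub>m r r"
      using pow_mat_zero_mono[OF c(1) kl(1), of l] pow_mat_zero_mono[OF c(3) kl(2), of k]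
        by (simp_all add: add.commute)
    obtain X where X: "X \<in> carrier_mat s r" "?M ^\<^sub>m ?n = four_block_mat (0\<^sub>m s s) X (0\<^sub>m r s) (0\<^sub>m r r)"
      using pow[of ?n] n by auto
    \<comment> \<open>With both diagonal blocks zero, the matrix has square zero.\<close>
    have "?M ^\<^sub>m (?n + ?n) = ?M ^\<^sub>m ?n * ?M ^\<^sub>m ?n" by (rule pow_mat_add[OF Mc])
    also have "\<dots> = four_block_mat (0\<^sub>m s s) (0\<^sub>m s r) (0\<^sub>m r s) (0\<^sub>m r r)"
      unfolding X(2) by (subst mult_four_block_mat[of _ s s _ r _ r _ _ s _ r]) (use X in auto)
    finally have "?M ^\<^sub>m (?n + ?n) = 0\<^sub>m (s + r) (s + r)" using zero by simp
    then show "nilpotent_mat ?M" using Mc by (auto simp: nil_iff)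
  qed
qed

lemma nil_lower_block:
  fixes A :: "'a::field mat"
  assumes c: "A \<in> carrier_mat s s" "C \<in> carrier_mat r s" "D \<in> carrier_mat r r"
  shows "nilpotent_mat (four_block_mat A (0\<^sub>m s r) C D) \<longleftrightarrow> nilpotent_mat A \<and> nilpotent_mat D"
proof -
  have "(four_block_mat A (0\<^sub>m s r) C D)\<^sup>T = four_block_mat A\<^sup>T C\<^sup>T (0\<^sub>m r s) D\<^sup>T"
    by (subst transpose_four_block_mat[of _ s s _ r _ r]) (use c in auto)
  moreover have "nilpotent_mat (four_block_mat A (0\<^sub>m s r) C D)
    \<longleftrightarrow> nilpotent_mat ((four_block_mat A (0\<^sub>m s r) C D)\<^sup>T)"
    by (rule nil_transpose[of _ "s + r", symmetric]) (use c in auto)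
  ultimately show ?thesis using nil_upper_block[of "A\<^sup>T" s "C\<^sup>T" r
    "D\<^sup>T"] nil_transpose[of A s] nil_transpose[of D r] c by simp
qed

lemma nil_GL:
  assumes "M \<in> GL r" "nilpotent_mat M"
  shows "r = 0"
proof (rule ccontr)
  assume r: "r \<noteq> 0"
  have "M ^\<^sub>m k \<in> GL r" for k
    by (induction k) (use assms GL_carrier[OF assms(1)] in \<open>auto intro: GL_mult\<close>)
  moreover obtain k where "M ^\<^sub>m k = 0\<^sub>m r r" using assms GL_carrier[OF assms(1)] by (auto simp: nil_iff)
  ultimately have "0\<^sub>m r r \<in> (GL r :: 'a mat set)" by metis
  then have "\<forall>v \<in> carrier_vec r. 0\<^sub>m r r *\<^sub>v v = (0\<^sub>v r :: 'a vec) \<longrightarrow> v = 0\<^sub>v r"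
    using GL_kernel[OF zero_carrier_mat, of r] by blast
  moreover have "0\<^sub>m r r *\<^sub>v unit_vec r 0 = (0\<^sub>v r :: 'a vec)" by (intro eq_vecI) auto
  ultimately have "unit_vec r 0 = (0\<^sub>v r :: 'a vec)" by auto
  then show False using r by (metis not_gr_zero unit_vec_nonzero)
qed

lemma GL_mult_vec_eq_0:
  assumes "g \<in> GL n" "w \<in> carrier_vec n"
  shows "g *\<^sub>v w = 0\<^sub>v n \<longleftrightarrow> w = 0\<^sub>v n"
proof
  assume "g *\<^sub>v w = 0\<^sub>v n"
  then show "w = 0\<^sub>v n" using GL_kernel[OF GL_carrier[OF assms(1)]] assms by blast
next
  assume "w = 0\<^sub>v n"
  then show "g *\<^sub>v w = 0\<^sub>v n" using GL_carrier[OF assms(1)] by (intro eq_vecI) auto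
qed

section \<open>The radical of a form\<close>

text \<open>The nullity is read off as the exponent of this cardinality, which is visibly invariant
  under congruence.\<close>

definition kernel_card :: "nat \<Rightarrow> 'a::field mat \<Rightarrow> nat" where
  "kernel_card n M = card {v \<in> carrier_vec n. M *\<^sub>v v = 0\<^sub>v n}"

lemma kernel_card_congruence:
  assumes M: "M \<in> carrier_mat n n" and g: "g \<in> GL n"
  shows "kernel_card n (g * M * g\<^sup>T) = kernel_card n M"
proof -
  note gc = GL_carrier[OF g] and t = ginv[OF GL_transpose[OF g]] GL_carrier[OF GL_transpose[OF g]]
  have mv: "(g * M * g\<^sup>T) *\<^sub>v v = g *\<^sub>v (M *\<^sub>v (g\<^sup>T *\<^sub>v v))" if "v \<in> carrier_vec n" for v
  proof -
    have "(g * M * g\<^sup>T) *\<^sub>v v = (g * M) *\<^sub>v (g\<^sup>T *\<^sub>v v)"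
      by (rule assoc_mult_mat_vec[of _ n n _ n]) (use gc M that in auto)
    also have "\<dots> = g *\<^sub>v (M *\<^sub>v (g\<^sup>T *\<^sub>v v))"
      by (rule assoc_mult_mat_vec[of _ n n _ n]) (use gc M that in auto)
    finally show ?thesis .
  qed
  have z: "g *\<^sub>v w = 0\<^sub>v n \<longleftrightarrow> w = 0\<^sub>v n" if "w \<in> carrier_vec n" for w
    by (rule GL_mult_vec_eq_0[OF g that])
  have inv1: "ginv (g\<^sup>T) *\<^sub>v (g\<^sup>T *\<^sub>v v) = v" and inv2: "g\<^sup>T *\<^sub>v (ginv (g\<^sup>T) *\<^sub>v v) = v"
    if "v \<in> carrier_vec n" for v
    using t that by (simp_all flip: assoc_mult_mat_vec[of _ n n _ n])
  have "bij_betw (\<lambda>v. g\<^sup>T *\<^sub>v v) {v \<in> carrier_vec n. (g * M * g\<^sup>T) *\<^sub>v v = 0\<^sub>v n} {v \<in> carrier_vec n. M *\<^sub>v v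
    = 0\<^sub>v n}"
  proof (rule bij_betwI[where g = "\<lambda>v. ginv (g\<^sup>T) *\<^sub>v v"])
    show "(\<lambda>v. g\<^sup>T *\<^sub>v v) \<in> {v \<in> carrier_vec n. (g * M * g\<^sup>T) *\<^sub>v v = 0\<^sub>v n} \<rightarrow> {v \<in> carrier_vec n. M *\<^sub>v v
      = 0\<^sub>v n}"
    proof
      fix v assume v: "v \<in> {v \<in> carrier_vec n. (g * M * g\<^sup>T) *\<^sub>v v = 0\<^sub>v n}"
      then have c: "v \<in> carrier_vec n" and "(g * M * g\<^sup>T) *\<^sub>v v = 0\<^sub>v n" by blast+
      then have "g *\<^sub>v (M *\<^sub>v (g\<^sup>T *\<^sub>v v)) = 0\<^sub>v n" by (simp only: mv[OF c])
      then show "g\<^sup>T *\<^sub>v v \<in> {v \<in> carrier_vec n. M *\<^sub>v v = 0\<^sub>v n}"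
        using z[of "M *\<^sub>v (g\<^sup>T *\<^sub>v v)"] gc M c by simp
    qed
    show "(\<lambda>v. ginv (g\<^sup>T) *\<^sub>v v) \<in> {v \<in> carrier_vec n. M *\<^sub>v v
      = 0\<^sub>v n} \<rightarrow> {v \<in> carrier_vec n. (g * M * g\<^sup>T) *\<^sub>v v = 0\<^sub>v n}"
    proof
      fix v assume v: "v \<in> {v \<in> carrier_vec n. M *\<^sub>v v = 0\<^sub>v n}"
      then have c: "v \<in> carrier_vec n" and m: "M *\<^sub>v v = 0\<^sub>v n" by blast+
      have c': "ginv (g\<^sup>T) *\<^sub>v v \<in> carrier_vec n" using t(1) c by simp
      have "(g * M * g\<^sup>T) *\<^sub>v (ginv (g\<^sup>T) *\<^sub>v v) = 0\<^sub>v n"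
        unfolding mv[OF c'] inv2[OF c] m using z[of "0\<^sub>v n"] by simp
      then show "ginv (g\<^sup>T) *\<^sub>v v \<in> {v \<in> carrier_vec n. (g * M * g\<^sup>T) *\<^sub>v v = 0\<^sub>v n}" using c' by blast
    qed
  qed (use inv1 inv2 in blast)+
  then show ?thesis unfolding kernel_card_def by (rule bij_betw_same_card)
qed

lemma kernel_card_diag:
  fixes a :: "'a::{field,finite} mat"
  assumes a: "a \<in> GL r"
  shows "kernel_card (t + r) (four_block_mat (0\<^sub>m t t) (0\<^sub>m t r) (0\<^sub>m r t) a) = CARD('a) ^ t"
proof -
  let ?M = "four_block_mat (0\<^sub>m t t) (0\<^sub>m t r) (0\<^sub>m r t) a"
  note ac = GL_carrier[OF a]
  have mv: "?M *\<^sub>v (u @\<^sub>v w) = 0\<^sub>v t @\<^sub>v (a *\<^sub>v w)" if "u \<in> carrier_vec t" "w \<in> carrier_vec r" for u w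
  proof -
    have "?M *\<^sub>v (u @\<^sub>v w) = (0\<^sub>m t t *\<^sub>v u + 0\<^sub>m t r *\<^sub>v w) @\<^sub>v (0\<^sub>m r t *\<^sub>v u + a *\<^sub>v w)"
      by (rule four_block_mat_mult_vec) (use that ac in auto)
    also have "0\<^sub>m t t *\<^sub>v u + 0\<^sub>m t r *\<^sub>v w = 0\<^sub>v t" using that by (intro eq_vecI) auto
    also have "0\<^sub>m r t *\<^sub>v u + a *\<^sub>v w = a *\<^sub>v w" using that ac by (intro eq_vecI) auto
    finally show ?thesis .
  qed
  have z: "a *\<^sub>v w = 0\<^sub>v r \<longleftrightarrow> w = 0\<^sub>v r" if "w \<in> carrier_vec r" for w
    by (rule GL_mult_vec_eq_0[OF a that])
  have zz: "0\<^sub>v t @\<^sub>v 0\<^sub>v r = (0\<^sub>v (t + r) :: 'a vec)" by (intro eq_vecI) auto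
  have "bij_betw (\<lambda>u. u @\<^sub>v 0\<^sub>v r) (carrier_vec t) {v \<in> carrier_vec (t + r). ?M *\<^sub>v v = 0\<^sub>v (t + r)}"
  proof (rule bij_betw_imageI)
    show "inj_on (\<lambda>u. u @\<^sub>v 0\<^sub>v r) (carrier_vec t :: 'a vec set)"
      by (rule inj_onI) (metis append_vec_eq)
    show "(\<lambda>u. u @\<^sub>v 0\<^sub>v r) ` carrier_vec t = {v \<in> carrier_vec (t + r). ?M *\<^sub>v v = 0\<^sub>v (t + r)}"
    proof (intro equalityI subsetI)
      fix v assume "v \<in> (\<lambda>u. u @\<^sub>v 0\<^sub>v r) ` (carrier_vec t :: 'a vec set)"
      then obtain u where u: "u \<in> carrier_vec t" "v = u @\<^sub>v 0\<^sub>v r" by auto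
      have "?M *\<^sub>v v = 0\<^sub>v (t + r)" unfolding u(2) using mv[OF u(1), of "0\<^sub>v r"] z[of "0\<^sub>v r"] zz by simp
      then show "v \<in> {v \<in> carrier_vec (t + r). ?M *\<^sub>v v = 0\<^sub>v (t + r)}" using u by simp
    next
      fix v assume "v \<in> {v \<in> carrier_vec (t + r). ?M *\<^sub>v v = 0\<^sub>v (t + r)}"
      then have v: "v \<in> carrier_vec (t + r)" "?M *\<^sub>v v = 0\<^sub>v (t + r)" by blast+
      define u w where "u = vec_first v t" and "w = vec_last v r"
      have uw: "v = u @\<^sub>v w" "u \<in> carrier_vec t" "w \<in> carrier_vec r"
        using v(1) by (auto simp: u_def w_def)
      have "0\<^sub>v t @\<^sub>v (a *\<^sub>v w) = 0\<^sub>v t @\<^sub>v 0\<^sub>v r" using v(2) mv[OF uw(2,3)] uw(1) zz by metis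
      then have "a *\<^sub>v w = 0\<^sub>v r" by (metis append_vec_eq zero_carrier_vec)
      then have "w = 0\<^sub>v r" using z uw(3) by blast
      then show "v \<in> (\<lambda>u. u @\<^sub>v 0\<^sub>v r) ` carrier_vec t" using uw by blast
    qed
  qed
  from bij_betw_same_card[OF this] show ?thesis by (simp add: kernel_card_def card_carrier_vec)
qed

text \<open>Taking a kernel vector as first basis vector makes the first column vanish, and by the
  sign condition the first row too. Induction on the size repeats this until the remaining form is
  nonsingular; that form is left as it is.\<close>

lemma Sym_diag:
  assumes e: "e * e = 1"
  shows "a \<in> Sym e n \<Longrightarrow> \<exists>t r. n = t + r \<and> (\<exists>h \<in> GL n. \<exists>a1 \<in> NSym e r.
     h * a * h\<^sup>T = four_block_mat (0\<^sub>m t t) (0\<^sub>m t r) (0\<^sub>m r t) a1)"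
proof (induction n arbitrary: a rule: less_induct)
  case (less n)
  note ac = Sym_carrier[OF less.prems]
  show ?case
  proof (cases "a \<in> GL n")
    case True
    have "1\<^sub>m n * a * (1\<^sub>m n)\<^sup>T = four_block_mat (0\<^sub>m 0 0) (0\<^sub>m 0 n) (0\<^sub>m n 0) a"
      using ac by (intro eq_matI) auto
    moreover have "a \<in> NSym e n" "n = 0 + n" using True less.prems by (auto simp: NSym_iff)
    ultimately show ?thesis using GL_one[of n] by blast
  next
    case False
    then obtain v where v: "v \<in> carrier_vec n" "a *\<^sub>v v = 0\<^sub>v n" "v \<noteq> 0\<^sub>v n" using GL_kernel[OF ac] by auto
    then obtain Y where Y: "Y \<in> GL n" "col Y 0 = v" using GL_first_column by blast
    note Yc = GL_carrier[OF Y(1)]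
    have "n \<noteq> 0" using v by (metis carrier_vecD eq_vecI index_zero_vec(2) less_nat_zero_code)
    then obtain n' where n: "n = 1 + n'" by (metis not0_implies_Suc plus_1_eq_Suc)
    let ?M = "Y\<^sup>T * a * Y"
    have MS: "?M \<in> Sym e (1 + n')" using Sym_congruence[OF less.prems, of "Y\<^sup>T" n] Yc n by simp
    have aY0: "(a * Y) $$ (i, 0) = 0" if "i < n" for i
    proof -
      have "(a * Y) $$ (i, 0) = (a *\<^sub>v col Y 0) $ i" using that ac Yc by simp
      then show ?thesis using Y(2) v(2) that by simp
    qed
    have M0: "?M $$ (i, 0) = 0" if "i < n" for i
    proof -
      have "?M = Y\<^sup>T * (a * Y)" using ac Yc by (intro assoc_mult_mat[of _ n n _ n _ n]) auto
      then have "?M $$ (i, 0) = (\<Sum>k\<in>{0..<n}. (Y\<^sup>T) $$ (i, k) * (a * Y) $$ (k, 0))"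
        using that ac Yc n by (simp add: scalar_prod_def del: index_mult_mat(1) assoc_mult_mat
          index_transpose_mat(1))
          (subst index_mult_mat(1), auto simp: scalar_prod_def simp del: assoc_mult_mat)
      then show ?thesis using aY0 by simp
    qed
    obtain A B C D where bl: "A \<in> carrier_mat 1 1" "B \<in> carrier_mat 1 n'" "C \<in> carrier_mat n' 1"
      "D \<in> carrier_mat n' n'"
      "?M = four_block_mat A B C D" using four_block_cases[OF Sym_carrier[OF MS]] by metis
    have A: "A = 0\<^sub>m 1 1" using M0[of 0] bl n by (intro eq_matI) auto
    have C: "C = 0\<^sub>m n' 1"
    proof (rule eq_matI)
      fix i j assume "i < dim_row (0\<^sub>m n' 1 :: 'a mat)" "j < dim_col (0\<^sub>m n' 1 :: 'a mat)"
      then show "C $$ (i, j) = 0\<^sub>m n' 1 $$ (i, j)" using M0[of "Suc i"] n unfolding bl(5) using bl(1-4)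
        by auto
    qed (use bl in auto)
    have S: "C = e \<cdot>\<^sub>m B\<^sup>T" "D \<in> Sym e n'" using MS bl(5) Sym_block[OF e bl(1-4)] by auto
    have "B = (e \<cdot>\<^sub>m C)\<^sup>T" unfolding S(1) using e by (simp add: smult_smult transpose_smult)
    then have B: "B = 0\<^sub>m 1 n'" unfolding C by simp
    from less.IH[OF _ S(2)] n obtain t r h a1 where ih: "n' = t + r" "h \<in> GL n'" "a1 \<in> NSym e r"
      "h * D * h\<^sup>T = four_block_mat (0\<^sub>m t t) (0\<^sub>m t r) (0\<^sub>m r t) a1" by auto
    note hc = GL_carrier[OF ih(2)] and a1c = Sym_carrier[OF NSym_Sym[OF ih(3)]]
    let ?H = "four_block_mat (1\<^sub>m 1) (0\<^sub>m 1 n') (0\<^sub>m n' 1) h"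
    have H: "?H \<in> GL n" unfolding n by (subst GL_upper_block) (use ih hc in auto)
    note Hc = GL_carrier[OF H]
    have HT: "?H\<^sup>T = four_block_mat (1\<^sub>m 1) (0\<^sub>m 1 n') (0\<^sub>m n' 1) (h\<^sup>T)"
      by (subst transpose_four_block_mat[of _ 1 1 _ n' _ n']) (use hc in auto)
    have "?H * ?M = four_block_mat (0\<^sub>m 1 1) (0\<^sub>m 1 n') (0\<^sub>m n' 1) (h * D)"
      unfolding bl(5) A B C by (subst mult_four_block_mat[of _ 1 1 _ n' _ n' _ _ 1 _ n']) (use hc bl in auto)
    then have "?H * ?M * ?H\<^sup>T = four_block_mat (0\<^sub>m 1 1) (0\<^sub>m 1 n') (0\<^sub>m n' 1) (h * D * h\<^sup>T)"
      unfolding HT using hc bl(4) by (simp only:)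
        (subst mult_four_block_mat[of _ 1 1 _ n' _ n' _ _ 1 _ n'], auto)
    also have "\<dots> = four_block_mat (0\<^sub>m (1 + t) (1 + t)) (0\<^sub>m (1 + t) r) (0\<^sub>m r (1 + t)) a1"
      unfolding ih(4) using a1c ih(1) by (intro eq_matI) auto
    finally have "?H * (Y\<^sup>T * a * (Y\<^sup>T)\<^sup>T) * ?H\<^sup>T
      = four_block_mat (0\<^sub>m (1 + t) (1 + t)) (0\<^sub>m (1 + t) r) (0\<^sub>m r (1 + t)) a1"
      by simp
    also have "?H * (Y\<^sup>T * a * (Y\<^sup>T)\<^sup>T) * ?H\<^sup>T = (?H * Y\<^sup>T) * a * (?H * Y\<^sup>T)\<^sup>T"
      by (rule congruence_comp[of _ n _ n _ n]) (use ac Yc Hc in auto)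
    finally show ?thesis using ih n GL_mult[OF H GL_transpose[OF Y(1)]]
      by (intro exI[of _ "1 + t"] exI[of _ r]) auto
  qed
qed

lemma card_field_gt_1: "1 < CARD('a::{field,finite})"
proof -
  have "card {0, 1 :: 'a} \<le> CARD('a)" by (rule card_mono) auto
  then show ?thesis by simp
qed

section \<open>Forms of given nullity and their normal position\<close>

lemma add_zero_mat_dims [simp]:
  fixes A :: "'a::monoid_add mat"
  assumes "dim_row A = n" "dim_col A = m"
  shows "0\<^sub>m n m + A = A" "A + 0\<^sub>m n m = A"
  using assms by (auto intro!: eq_matI)

definition zdiag :: "nat \<Rightarrow> 'a::zero mat \<Rightarrow> 'a mat" where
  "zdiag t a = four_block_mat (0\<^sub>m t t) (0\<^sub>m t (dim_col a)) (0\<^sub>m (dim_row a) t) a"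

lemma zdiag_eq: "a \<in> carrier_mat r r \<Longrightarrow> zdiag t a = four_block_mat (0\<^sub>m t t) (0\<^sub>m t r) (0\<^sub>m r t) a"
  by (simp add: zdiag_def)

lemma zdiag_carrier [simp]: "a \<in> carrier_mat r r \<Longrightarrow> zdiag t a \<in> carrier_mat (t + r) (t + r)"
  by (simp add: zdiag_def)

lemma zdiag_Sym:
  assumes "e * e = 1" "a \<in> Sym e r"
  shows "zdiag t a \<in> Sym e (t + r)"
proof -
  have "e \<cdot>\<^sub>m (0\<^sub>m t r)\<^sup>T = 0\<^sub>m r t" by simp
  moreover have "0\<^sub>m t t \<in> Sym e t" by (simp add: Sym_def)
  ultimately show ?thesis using Sym_block_I[OF assms(1), of "0\<^sub>m t t" t "0\<^sub>m t r" r a] assms(2)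
    by (simp add: zdiag_eq[OF Sym_carrier[OF assms(2)]])
qed

text \<open>The parameters are the nullity \<open>t\<close> and the rank \<open>r\<close>, not the size \<open>t + r\<close>.\<close>

definition SymN :: "'a::{field,finite} \<Rightarrow> nat \<Rightarrow> nat \<Rightarrow> 'a mat set" where
  "SymN e t r = {M \<in> Sym e (t + r). kernel_card (t + r) M = CARD('a) ^ t}"

lemma SymN_Sym: "M \<in> SymN e t r \<Longrightarrow> M \<in> Sym e (t + r)"
  by (simp add: SymN_def)

lemma finite_SymN [simp]: "finite (SymN e t r)"
  by (rule finite_subset[OF _ finite_Sym]) (auto simp: SymN_def)

lemma SymN_congruence:
  assumes "M \<in> SymN e t r" "g \<in> GL (t + r)"
  shows "g * M * g\<^sup>T \<in> SymN e t r"
  using assms Sym_congruence[of M e "t + r" g "t + r"] kernel_card_congruence[of M "t + r" g]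
  by (auto simp: SymN_def dest: Sym_carrier GL_carrier)

lemma zdiag_SymN:
  assumes "e * e = 1" "a \<in> NSym e r"
  shows "zdiag t a \<in> SymN e t r"
  using assms zdiag_Sym[OF assms(1) NSym_Sym[OF assms(2)]] kernel_card_diag[OF NSym_GL[OF assms(2)], of t]
  by (simp add: SymN_def zdiag_eq[OF GL_carrier[OF NSym_GL[OF assms(2)]]])

lemma Sym_cases_SymN:
  assumes e: "e * e = 1" and a: "a \<in> Sym e n"
  obtains t r where "n = t + r" "a \<in> SymN e t r"
proof -
  obtain t r h a1 where *: "n = t + r" "h \<in> GL n" "a1 \<in> NSym e r" "h * a * h\<^sup>T = zdiag t a1"
    using Sym_diag[OF e a] by (metis NSym_GL GL_carrier zdiag_eq)
  have "kernel_card n a = kernel_card n (h * a * h\<^sup>T)" using kernel_card_congruence[OF Sym_carrier[OF a] *(2)]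
    by simp
  also have "\<dots> = CARD('a) ^ t" using zdiag_SymN[OF e *(3), of t] *(1,4) by (simp add: SymN_def)
  finally have "a \<in> SymN e t r" using a *(1) by (simp add: SymN_def)
  with *(1) that show thesis by blast
qed

lemma SymN_unique:
  assumes "a \<in> SymN e t r" "a \<in> SymN e t' r'" "t + r = t' + r'"
  shows "t = t' \<and> r = r'"
proof -
  have "CARD('a) ^ t = CARD('a) ^ t'" using assms by (auto simp: SymN_def)
  then have "t = t'" using card_field_gt_1[where 'a = 'a] by (metis power_inject_exp)
  then show ?thesis using assms(3) by simp
qed

lemma SymN_normal_form:
  assumes e: "e * e = 1" and a: "a \<in> SymN e t r"
  obtains h a1 where "h \<in> GL (t + r)" "a1 \<in> NSym e r" "h * a * h\<^sup>T = zdiag t a1"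
proof -
  obtain t' r' h a1 where *: "t + r = t' + r'" "h \<in> GL (t + r)" "a1 \<in> NSym e r'" "h * a * h\<^sup>T = zdiag t' a1"
    using Sym_diag[OF e SymN_Sym[OF a]] by (metis NSym_GL GL_carrier zdiag_eq)
  have "t = t' \<and> r = r'"
    by (rule SymN_unique[OF SymN_congruence[OF a *(2)] _ *(1)]) (use *(4) zdiag_SymN[OF e *(3)] in simp)
  then show thesis using * that by simp
qed

lemma SymN_0: "e * e = 1 \<Longrightarrow> SymN e 0 r = NSym e r"
proof (intro equalityI subsetI)
  fix a assume e: "e * e = 1" and a: "a \<in> SymN e 0 r"
  obtain h a1 where h: "h \<in> GL (0 + r)" "a1 \<in> NSym e r" "h * a * h\<^sup>T = zdiag 0 a1"
    using SymN_normal_form[OF e a] .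
  have "zdiag 0 a1 = a1" by (rule eq_matI) (auto simp: zdiag_def)
  then have "h * a * h\<^sup>T \<in> GL r" using h NSym_GL by auto
  then have "a \<in> GL r" using GL_congruence_iff[of a r h] h Sym_carrier[OF SymN_Sym[OF a]] by simp
  then show "a \<in> NSym e r" using SymN_Sym[OF a] by (simp add: NSym_iff)
next
  fix a assume e: "e * e = 1" and a: "a \<in> NSym e r"
  have "zdiag 0 a = a" by (rule eq_matI) (auto simp: zdiag_def)
  then show "a \<in> SymN e 0 r" using zdiag_SymN[OF e a, of 0] by simp
qed

text \<open>The lower right block of the transformed form is \<open>D * b * D\<^sup>T\<close>. If it
  is nonsingular then \<open>D\<close> is invertible, and then \<open>B * b * D\<^sup>T = 0\<close>
  forces \<open>B = 0\<close>. The nonsingular part may change under \<open>k\<close>; only the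
  position of the radical is kept.\<close>

lemma stabilizer_zdiag:
  assumes e: "e * e = 1" and b: "b \<in> NSym e r" and k: "k \<in> GL (s + r)"
  shows "k * zdiag s b * k\<^sup>T \<in> zdiag s ` NSym e r \<longleftrightarrow>
    (\<exists>A \<in> GL s. \<exists>C \<in> carrier_mat r s. \<exists>D \<in> GL r. k = four_block_mat A (0\<^sub>m s r) C D)"
proof -
  note bc = GL_carrier[OF NSym_GL[OF b]]
  obtain A B C D where bl: "A \<in> carrier_mat s s" "B \<in> carrier_mat s r" "C \<in> carrier_mat r s"
    "D \<in> carrier_mat r r"
    "k = four_block_mat A B C D" using four_block_cases[OF GL_carrier[OF k]] by metis
  have kT: "k\<^sup>T = four_block_mat A\<^sup>T C\<^sup>T B\<^sup>T D\<^sup>T" unfolding bl(5)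
    by (rule transpose_four_block_mat[OF bl(1-4)])
  have "k * zdiag s b = four_block_mat (A * 0\<^sub>m s s + B * 0\<^sub>m r s) (A * 0\<^sub>m s r + B * b) (C * 0\<^sub>m s s
    + D * 0\<^sub>m r s) (C * 0\<^sub>m s r + D * b)"
    unfolding bl(5) zdiag_eq[OF bc] by (rule mult_four_block_mat[OF bl(1-4)]) (use bc in auto)
  also have "\<dots> = four_block_mat (0\<^sub>m s s) (B * b) (0\<^sub>m r s) (D * b)"
    by (rule cong_four_block_mat) (use bl bc in auto)
  finally have "k * zdiag s b * k\<^sup>T = four_block_mat (0\<^sub>m s s * A\<^sup>T + B * b * B\<^sup>T) (0\<^sub>m s s * C\<^sup>T
    + B * b * D\<^sup>T)
       (0\<^sub>m r s * A\<^sup>T + D * b * B\<^sup>T) (0\<^sub>m r s * C\<^sup>T + D * b * D\<^sup>T)"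
    unfolding kT by (simp only:) (rule mult_four_block_mat[of _ s s _ r _ r _ _ s _ r], use bl(1-4) bc in
      simp_all)
  also have "\<dots> = four_block_mat (B * b * B\<^sup>T) (B * b * D\<^sup>T) (D * b * B\<^sup>T) (D * b * D\<^sup>T)"
    by (rule cong_four_block_mat) (use bl(1-4) bc in \<open>simp_all del: assoc_mult_mat\<close>)
  finally have kz: "k * zdiag s b * k\<^sup>T = \<dots>" .
  show ?thesis
  proof
    assume "k * zdiag s b * k\<^sup>T \<in> zdiag s ` NSym e r"
    then obtain b' where b': "b' \<in> NSym e r" "k * zdiag s b * k\<^sup>T = zdiag s b'" by auto
    note b'c = GL_carrier[OF NSym_GL[OF b'(1)]]
    have "B * b * B\<^sup>T = 0\<^sub>m s s \<and> B * b * D\<^sup>T = 0\<^sub>m s r \<and> D * b * B\<^sup>T = 0\<^sub>m r s \<and> D * b * D\<^sup>T = b'"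
      using b'(2) unfolding kz zdiag_eq[OF b'c]
      by (rule four_block_cong_iff[of _ s s _ r _ r, THEN iffD1, rotated 8]) (use bl(1-4) bc b'c in simp_all)
    then have eqs: "B * b * D\<^sup>T = 0\<^sub>m s r" "D * b * D\<^sup>T = b'" by auto
    have "det b' = det D * det b * det D"
      unfolding eqs(2)[symmetric] using bl bc
        by (simp add: det_mult[of _ r] det_transpose del: assoc_mult_mat)
    then have D: "D \<in> GL r" using NSym_GL[OF b'(1)] bl by (auto simp: GL_def)
    have "B * b = 0\<^sub>m s r"
      by (rule GL_cancel_right[OF GL_transpose[OF D], of _ s]) (use eqs(1) bl bc in auto)
    then have "B = 0\<^sub>m s r"
      by (intro GL_cancel_right[OF NSym_GL[OF b], of B s]) (use bl bc in auto)
    moreover from this have "A \<in> GL s" using k bl GL_lower_block[OF bl(1,3,4)] by simp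
    ultimately show "\<exists>A \<in> GL s. \<exists>C \<in> carrier_mat r s. \<exists>D \<in> GL r. k = four_block_mat A (0\<^sub>m s r) C D"
      using bl D by blast
  next
    assume "\<exists>A \<in> GL s. \<exists>C \<in> carrier_mat r s. \<exists>D \<in> GL r. k = four_block_mat A (0\<^sub>m s r) C D"
    then obtain A' C' D' where *: "A' \<in> GL s" "C' \<in> carrier_mat r s" "D' \<in> GL r" "k
      = four_block_mat A' (0\<^sub>m s r) C' D'" by blast
    have "A = A' \<and> B = 0\<^sub>m s r \<and> C = C' \<and> D = D'"
      using *(4) unfolding bl(5) by (subst (asm) four_block_cong_iff[of _ s s _ r _ r])
        (use bl * GL_carrier in auto)
    then have BD: "B = 0\<^sub>m s r" "D \<in> GL r" using *(3) by auto
    have "D * b * D\<^sup>T \<in> NSym e r" by (rule NSym_congruence[OF b BD(2)])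
    moreover have "k * zdiag s b * k\<^sup>T = zdiag s (D * b * D\<^sup>T)"
      unfolding kz BD(1) using bl(4) bc by (subst zdiag_eq[of _ r]) auto
    ultimately show "k * zdiag s b * k\<^sup>T \<in> zdiag s ` NSym e r" by blast
  qed
qed

lemma card_stabilizer_zdiag:
  fixes e :: "'a::{field,finite}"
  assumes e: "e * e = 1" and M: "M \<in> SymN e s r"
  shows "card {g \<in> GL (s + r). g * M * g\<^sup>T \<in> zdiag s ` NSym e r} =
    CARD('a) ^ (r * s) * card (GL s :: 'a mat set) * card (GL r :: 'a mat set)"
proof -
  obtain h b where h: "h \<in> GL (s + r)" "b \<in> NSym e r" "h * M * h\<^sup>T = zdiag s b"
    using SymN_normal_form[OF e M] .
  note hc = GL_carrier[OF h(1)] ginv[OF h(1)] and Mc = Sym_carrier[OF SymN_Sym[OF M]]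
  let ?K = "{k \<in> GL (s + r). k * zdiag s b * k\<^sup>T \<in> zdiag s ` NSym e r}"
  let ?G = "{g \<in> GL (s + r). g * M * g\<^sup>T \<in> zdiag s ` NSym e r}"
  have conj: "(k * h) * M * (k * h)\<^sup>T = k * zdiag s b * k\<^sup>T" if "k \<in> GL (s + r)" for k
    unfolding h(3)[symmetric] by (rule congruence_comp[symmetric, of _ "s + r" _ "s + r" _ "s + r"])
      (use that hc Mc GL_carrier in auto)
  have "bij_betw (\<lambda>k. k * h) ?K ?G"
  proof (rule bij_betwI[where g = "\<lambda>g. g * ginv h"])
    have kh: "k * h * ginv h = k" if "k \<in> GL (s + r)" for k
      using hc GL_carrier[OF that] by (simp add: assoc_mult_mat[of _ "s+r" "s+r" _ "s+r" _ "s+r"])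
    have kh': "k * ginv h * h = k" if "k \<in> GL (s + r)" for k
      using hc GL_carrier[OF that] by (simp add: assoc_mult_mat[of _ "s+r" "s+r" _ "s+r" _ "s+r"])
    show "(\<lambda>k. k * h) \<in> ?K \<rightarrow> ?G"
    proof
      fix k assume "k \<in> ?K"
      then have k: "k \<in> GL (s + r)" "k * zdiag s b * k\<^sup>T \<in> zdiag s ` NSym e r" by blast+
      then show "k * h \<in> ?G" using conj[OF k(1)] GL_mult[OF k(1) h(1)] by (simp only: mem_Collect_eq)
    qed
    show "(\<lambda>g. g * ginv h) \<in> ?G \<rightarrow> ?K"
    proof
      fix g assume "g \<in> ?G"
      then have g: "g \<in> GL (s + r)" "g * M * g\<^sup>T \<in> zdiag s ` NSym e r" by blast+
      have k: "g * ginv h \<in> GL (s + r)" by (rule GL_mult[OF g(1) GL_ginv[OF h(1)]])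
      show "g * ginv h \<in> ?K" using conj[OF k] k g kh'[OF g(1)] by (simp only: mem_Collect_eq) 
    qed
    show "k * h * ginv h = k" if "k \<in> ?K" for k using that kh by blast
    show "k * ginv h * h = k" if "k \<in> ?G" for k using that kh' by blast
  qed
  then have "card ?G = card ?K" by (rule bij_betw_same_card[symmetric])
  also have "bij_betw (\<lambda>(C, A, D). four_block_mat A (0\<^sub>m s r) C D) (carrier_mat r s \<times> GL s \<times> GL r) ?K"
  proof (rule bij_betw_imageI)
    show "inj_on (\<lambda>(C, A, D). four_block_mat A (0\<^sub>m s r) C D) (carrier_mat r s \<times> GL s \<times> (GL r :: 'a mat set))"
    proof (rule inj_onI)
      fix x y :: "'a mat \<times> 'a mat \<times> 'a mat"
      assume *: "x \<in> carrier_mat r s \<times> GL s \<times> GL r" "y \<in> carrier_mat r s \<times> GL s \<times> GL r"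
        "(\<lambda>(C, A, D). four_block_mat A (0\<^sub>m s r) C D) x = (\<lambda>(C, A, D). four_block_mat A (0\<^sub>m s r) C D) y"
      obtain C A D C' A' D' where xy: "x = (C, A, D)" "y = (C', A', D')" by (metis prod_cases3)
      have "A = A' \<and> 0\<^sub>m s r = (0\<^sub>m s r :: 'a mat) \<and> C = C' \<and> D = D'"
        by (rule four_block_cong_iff[of _ s s _ r _ r, THEN iffD1]) (use * xy in \<open>auto dest: GL_carrier\<close>)
      then show "x = y" using xy by simp
    qed
    show "(\<lambda>(C, A, D). four_block_mat A (0\<^sub>m s r) C D) ` (carrier_mat r s \<times> GL s \<times> GL r) = ?K"
    proof (intro equalityI subsetI)
      fix k assume "k \<in> (\<lambda>(C, A, D). four_block_mat A (0\<^sub>m s r) C D) `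
        (carrier_mat r s \<times> GL s \<times> (GL r :: 'a mat set))"
      then obtain C A D where *: "C \<in> carrier_mat r s" "A \<in> GL s" "D \<in> GL r" "k
        = four_block_mat A (0\<^sub>m s r) C D" by auto
      have k: "k \<in> GL (s + r)" unfolding *(4)
        using GL_lower_block[OF GL_carrier[OF *(2)] *(1) GL_carrier[OF *(3)]] * by blast
      then show "k \<in> ?K" using stabilizer_zdiag[OF e h(2) k] * by blast
    next
      fix k assume "k \<in> ?K"
      then have k: "k \<in> GL (s + r)" "k * zdiag s b * k\<^sup>T \<in> zdiag s ` NSym e r" by blast+
      then obtain A C D where "A \<in> GL s" "C \<in> carrier_mat r s" "D \<in> GL r" "k = four_block_mat A (0\<^sub>m s r) C D"
        using stabilizer_zdiag[OF e h(2) k(1)] by blast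
      then show "k \<in> (\<lambda>(C, A, D). four_block_mat A (0\<^sub>m s r) C D) ` (carrier_mat r s \<times> GL s \<times> GL r)" by force
    qed
  qed
  then have "card ?K = card (carrier_mat r s \<times> GL s \<times> GL r :: ('a mat \<times> 'a mat \<times> 'a mat) set)"
    by (rule bij_betw_same_card[symmetric])
  finally show ?thesis by (simp add: card_cartesian_product card_carrier_mat)
qed

text \<open>Double counting of the pairs \<open>(M, g)\<close> for which
  \<open>g * M * g\<^sup>T\<close> is in normal position. Each \<open>M\<close> has the same number
  of partners \<open>g\<close>, by \<open>card_stabilizer_zdiag\<close>, and each \<open>g\<close>
  gives a bijection onto the normal positions. Summing over all \<open>b\<close>, and not over one
  representative, covers the several congruence classes at once.\<close>

lemma orbit_sum:
  fixes W :: "'a::{field,finite} mat \<Rightarrow> nat"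
  assumes e: "e * e = 1"
    and inv: "\<And>M g. M \<in> Sym e (s + r) \<Longrightarrow> g \<in> GL (s + r) \<Longrightarrow> W (g * M * g\<^sup>T) = W M"
  shows "(\<Sum>M\<in>SymN e s r. W M) * (CARD('a) ^ (r * s) * card (GL s :: 'a mat set) * card (GL r :: 'a mat set))
    = card (GL (s + r) :: 'a mat set) * (\<Sum>b\<in>NSym e r. W (zdiag s b))"
proof -
  let ?Z = "zdiag s ` NSym e r"
  let ?K = "CARD('a) ^ (r * s) * card (GL s :: 'a mat set) * card (GL r :: 'a mat set)"
  have zs: "?Z \<subseteq> SymN e s r" using zdiag_SymN[OF e] by blast
  have "(\<Sum>M\<in>SymN e s r. W M) * ?K = (\<Sum>M\<in>SymN e s r. \<Sum>g | g \<in> GL (s + r) \<and> g * M * g\<^sup>T \<in> ?Z. W (g * M * g\<^sup>T))"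
    unfolding sum_distrib_right
  proof (rule sum.cong[OF refl])
    fix M assume M: "M \<in> SymN e s r"
    have "(\<Sum>g | g \<in> GL (s + r) \<and> g * M * g\<^sup>T \<in> ?Z. W (g * M * g\<^sup>T))
      = (\<Sum>g | g \<in> GL (s + r) \<and> g * M * g\<^sup>T \<in> ?Z. W M)"
      by (rule sum.cong) (use inv[OF SymN_Sym[OF M]] in auto)
    then show "W M * ?K = (\<Sum>g | g \<in> GL (s + r) \<and> g * M * g\<^sup>T \<in> ?Z. W (g * M * g\<^sup>T))"
      using card_stabilizer_zdiag[OF e M] by simp
  qed
  also have "\<dots> = (\<Sum>g\<in>GL (s + r). \<Sum>M | M \<in> SymN e s r \<and> g * M * g\<^sup>T \<in> ?Z. W (g * M * g\<^sup>T))"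
    by (rule sum.swap_restrict) auto
  also have "\<dots> = (\<Sum>g\<in>(GL (s + r) :: 'a mat set). \<Sum>X\<in>?Z. W X)"
  proof (rule sum.cong[OF refl])
    fix g :: "'a mat" assume g: "g \<in> GL (s + r)"
    have "bij_betw (\<lambda>M. g * M * g\<^sup>T) {M. M \<in> SymN e s r \<and> g * M * g\<^sup>T \<in> ?Z} ?Z"
    proof (rule bij_betwI[where g = "\<lambda>M. ginv g * M * (ginv g)\<^sup>T"])
      show "(\<lambda>M. ginv g * M * (ginv g)\<^sup>T) \<in> ?Z \<rightarrow> {M. M \<in> SymN e s r \<and> g * M * g\<^sup>T \<in> ?Z}"
      proof
        fix X assume X: "X \<in> ?Z"
        then have XS: "X \<in> SymN e s r" using zs by blast
        have "g * (ginv g * X * (ginv g)\<^sup>T) * g\<^sup>T = X"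
          by (rule congruence_inverse[OF Sym_carrier[OF SymN_Sym[OF XS]] g])
        then show "ginv g * X * (ginv g)\<^sup>T \<in> {M. M \<in> SymN e s r \<and> g * M * g\<^sup>T \<in> ?Z}"
          using SymN_congruence[OF XS GL_ginv[OF g]] X by (simp only: mem_Collect_eq)
      qed
      show "ginv g * (g * M * g\<^sup>T) * (ginv g)\<^sup>T = M" if "M \<in> {M. M \<in> SymN e s r \<and> g * M * g\<^sup>T \<in> ?Z}" for M
        by (rule congruence_inverse[OF _ g]) (use that SymN_Sym Sym_carrier in blast)
      show "g * (ginv g * X * (ginv g)\<^sup>T) * g\<^sup>T = X" if "X \<in> ?Z" for X
        by (rule congruence_inverse[OF _ g]) (use that zs SymN_Sym Sym_carrier in blast)
    qed blast
    then show "(\<Sum>M | M \<in> SymN e s r \<and> g * M * g\<^sup>T \<in> ?Z. W (g * M * g\<^sup>T)) = (\<Sum>X\<in>?Z. W X)"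
      by (rule sum.reindex_bij_betw)
  qed
  also have "\<dots> = card (GL (s + r) :: 'a mat set) * (\<Sum>X\<in>?Z. W X)" by simp
  also have "(\<Sum>X\<in>?Z. W X) = (\<Sum>b\<in>NSym e r. W (zdiag s b))"
  proof (rule sum.reindex[unfolded comp_def])
    show "inj_on (zdiag s) (NSym e r)"
    proof (rule inj_onI)
      fix a b assume *: "a \<in> NSym e r" "b \<in> NSym e r" "zdiag s a = zdiag s b"
      note c = GL_carrier[OF NSym_GL[OF *(1)]] GL_carrier[OF NSym_GL[OF *(2)]]
      show "a = b" using *(3) unfolding c[THEN zdiag_eq]
        by (subst (asm) four_block_cong_iff[of _ s s _ r _ r]) (use c in auto)
    qed
  qed
  finally show ?thesis .
qed

section \<open>Bordering a form\<close>

text \<open>Two matrices side by side, written as four blocks with empty lower blocks so that the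
  product rules for block matrices apply.\<close>

definition hcat :: "'a::zero mat \<Rightarrow> 'a mat \<Rightarrow> 'a mat" where
  "hcat A B = four_block_mat A B (0\<^sub>m 0 (dim_col A)) (0\<^sub>m 0 (dim_col B))"

lemma hcat_eq:
  "A \<in> carrier_mat n t \<Longrightarrow> B \<in> carrier_mat n r \<Longrightarrow> hcat A B = four_block_mat A B (0\<^sub>m 0 t) (0\<^sub>m 0 r)"
  by (simp add: hcat_def)

lemma hcat_carrier [simp]:
  "A \<in> carrier_mat n t \<Longrightarrow> B \<in> carrier_mat n r \<Longrightarrow> hcat A B \<in> carrier_mat n (t + r)"
  unfolding hcat_def by (rule carrier_matI) auto

lemma mult_hcat:
  fixes K :: "'a::semiring_0 mat"
  assumes "K \<in> carrier_mat k n" "A \<in> carrier_mat n t" "B \<in> carrier_mat n r"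
  shows "K * hcat A B = hcat (K * A) (K * B)"
proof -
  have K: "K = four_block_mat K (0\<^sub>m k 0) (0\<^sub>m 0 n) (0\<^sub>m 0 0)"
    by (rule eq_matI) (use assms in auto)
  have "four_block_mat K (0\<^sub>m k 0) (0\<^sub>m 0 n) (0\<^sub>m 0 0) * hcat A B = hcat (K * A) (K * B)"
    unfolding hcat_eq[OF assms(2,3)] hcat_eq[OF mult_carrier_mat[OF assms(1,2)]
      mult_carrier_mat[OF assms(1,3)]]
    by (subst mult_four_block_mat[of _ k n _ 0 _ 0 _ _ t _ r]) (use assms in simp_all)
  then show ?thesis using K by simp
qed

lemma hcat_mult_four_block:
  fixes A :: "'a::semiring_0 mat"
  assumes "A \<in> carrier_mat n t" "B \<in> carrier_mat n r"
    "P \<in> carrier_mat t t'" "Q \<in> carrier_mat t r'" "R \<in> carrier_mat r t'" "S \<in> carrier_mat r r'"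
  shows "hcat A B * four_block_mat P Q R S = hcat (A * P + B * R) (A * Q + B * S)"
proof -
  have "hcat (A * P + B * R) (A * Q + B * S)
    = four_block_mat (A * P + B * R) (A * Q + B * S) (0\<^sub>m 0 t') (0\<^sub>m 0 r')"
    using assms by (intro hcat_eq[of _ n]) auto
  then show ?thesis
    unfolding hcat_eq[OF assms(1,2)]
    by (subst mult_four_block_mat[of _ n t _ r _ 0 _ _ t' _ r']) (use assms in simp_all)
qed

lemma hcat_add:
  fixes A :: "'a::monoid_add mat"
  assumes "A \<in> carrier_mat n t" "B \<in> carrier_mat n r" "A' \<in> carrier_mat n t" "B' \<in> carrier_mat n r"
  shows "hcat A B + hcat A' B' = hcat (A + A') (B + B')"
  by (rule eq_matI) (use assms in \<open>auto simp: hcat_def\<close>)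

lemma hcat_inj:
  assumes "A \<in> carrier_mat n t" "B \<in> carrier_mat n r" "A' \<in> carrier_mat n t" "B' \<in> carrier_mat n r"
    "hcat A B = hcat A' B'"
  shows "A = A' \<and> B = B'"
proof -
  have "four_block_mat A B (0\<^sub>m 0 t) (0\<^sub>m 0 r) = four_block_mat A' B' (0\<^sub>m 0 t) (0\<^sub>m 0 r)"
    using assms(5) unfolding hcat_eq[OF assms(1,2)] hcat_eq[OF assms(3,4)] .
  then have "A = A' \<and> B = B' \<and> 0\<^sub>m 0 t = (0\<^sub>m 0 t :: 'a mat) \<and> 0\<^sub>m 0 r = (0\<^sub>m 0 r :: 'a mat)"
    by (rule four_block_cong_iff[of _ n t _ r _ 0, THEN iffD1, rotated 8]) (use assms in simp_all)
  then show ?thesis by simp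
qed

lemma bij_betw_hcat:
  "bij_betw (\<lambda>(A, B). hcat A B) (carrier_mat n t \<times> carrier_mat n r)
    (carrier_mat n (t + r) :: 'a::zero mat set)"
proof (rule bij_betw_imageI)
  show "inj_on (\<lambda>(A, B). hcat A B) (carrier_mat n t \<times> carrier_mat n r :: ('a mat \<times> 'a mat) set)"
  proof (rule inj_onI)
    fix x y :: "'a mat \<times> 'a mat"
    assume *: "x \<in> carrier_mat n t \<times> carrier_mat n r" "y \<in> carrier_mat n t \<times> carrier_mat n r"
      "(\<lambda>(A, B). hcat A B) x = (\<lambda>(A, B). hcat A B) y"
    then show "x = y" using hcat_inj[of "fst x" n t "snd x" r "fst y" "snd y"] by (cases x, cases y) simp
  qed
  show "(\<lambda>(A, B). hcat A B) ` (carrier_mat n t \<times> carrier_mat n r) = (carrier_mat n (t + r) :: 'a mat set)"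
  proof (intro equalityI subsetI)
    fix M :: "'a mat" assume "M \<in> carrier_mat n (t + r)"
    then have "M \<in> carrier_mat (n + 0) (t + r)" by simp
    then obtain A B C D where bl: "A \<in> carrier_mat n t" "B \<in> carrier_mat n r"
      "C \<in> carrier_mat 0 t" "D \<in> carrier_mat 0 r" "M = four_block_mat A B C D"
      using four_block_cases by metis
    have "C = 0\<^sub>m 0 t" "D = 0\<^sub>m 0 r" using bl(3,4) carrier_0(1) by blast+
    then have "M = hcat A B" using bl hcat_eq[OF bl(1,2)] by simp
    then show "M \<in> (\<lambda>(A, B). hcat A B) ` (carrier_mat n t \<times> carrier_mat n r)"
      using bl by (intro image_eqI[where x = "(A, B)"]) simp_all
  qed auto
qed

lemma hcat_mult_vec:
  assumes "A \<in> carrier_mat n t" "B \<in> carrier_mat n r" "u \<in> carrier_vec t" "w \<in> carrier_vec r"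
  shows "hcat A B *\<^sub>v (u @\<^sub>v w) = A *\<^sub>v u + B *\<^sub>v w"
proof -
  have "hcat A B *\<^sub>v (u @\<^sub>v w) = (A *\<^sub>v u + B *\<^sub>v w) @\<^sub>v (0\<^sub>m 0 t *\<^sub>v u + 0\<^sub>m 0 r *\<^sub>v w)"
    unfolding hcat_eq[OF assms(1,2)] by (rule four_block_mat_mult_vec) (use assms in auto)
  also have "\<dots> = A *\<^sub>v u + B *\<^sub>v w" by (rule eq_vecI) (use assms in auto)
  finally show ?thesis .
qed

definition bordered :: "'a::field \<Rightarrow> 'a mat \<Rightarrow> 'a mat \<Rightarrow> 'a mat \<Rightarrow> 'a mat" where
  "bordered e d c a = four_block_mat d c (e \<cdot>\<^sub>m c\<^sup>T) a"

lemma bordered_Sym: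
  assumes "e * e = 1" "d \<in> Sym e s" "c \<in> carrier_mat s r" "a \<in> Sym e r"
  shows "bordered e d c a \<in> Sym e (s + r)"
  unfolding bordered_def by (rule Sym_block_I[OF assms])

lemma bordered_inj:
  assumes "d \<in> carrier_mat s s" "c \<in> carrier_mat s r" "a \<in> carrier_mat r r"
    "d' \<in> carrier_mat s s" "c' \<in> carrier_mat s r" "a' \<in> carrier_mat r r" "bordered e d c a
      = bordered e d' c' a'"
  shows "d = d' \<and> c = c' \<and> a = a'"
proof -
  have "d = d' \<and> c = c' \<and> e \<cdot>\<^sub>m c\<^sup>T = e \<cdot>\<^sub>m c'\<^sup>T \<and> a = a'"
    using assms(7) unfolding bordered_def
    by (rule four_block_cong_iff[of _ s s _ r _ r, THEN iffD1, rotated 8]) (use assms in simp_all)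
  then show ?thesis by simp
qed

text \<open>Of the new corner \<open>d'\<close> only the existence is recorded: in the sums to come
  \<open>d\<close> runs through all of \<open>Sym e s\<close>, so it matters just that the corners
  are permuted. The effect on \<open>c\<close> and \<open>a\<close> is what is used to normalise
  them.\<close>

lemma bordered_transform:
  assumes e: "e * e = 1" and d: "d \<in> Sym e s" and c: "c \<in> carrier_mat s r" and a: "a \<in> Sym e r"
    and k: "k \<in> carrier_mat s s" and X: "X \<in> carrier_mat s r" and h: "h \<in> carrier_mat r r"
    and g: "g = four_block_mat k X (0\<^sub>m r s) h"
  shows "\<exists>d' \<in> Sym e s. g * bordered e d c a * g\<^sup>T = bordered e d' ((k * c + X * a) * h\<^sup>T) (h * a * h\<^sup>T)"
proof -
  note dc = Sym_carrier[OF d] and ac = Sym_carrier[OF a]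
  have ct: "e \<cdot>\<^sub>m c\<^sup>T \<in> carrier_mat r s" using c by simp
  have gT: "g\<^sup>T = four_block_mat k\<^sup>T (0\<^sub>m s r) X\<^sup>T h\<^sup>T" unfolding g
    by (subst transpose_four_block_mat[of _ s s _ r _ r]) (use k X h in simp_all)
  let ?P = "k * d + X * (e \<cdot>\<^sub>m c\<^sup>T)" and ?Q = "k * c + X * a" and ?R = "0\<^sub>m r s * d + h * (e \<cdot>\<^sub>m c\<^sup>T)"
    and ?S = "0\<^sub>m r s * c + h * a"
  have c4: "?P \<in> carrier_mat s s" "?Q \<in> carrier_mat s r" "?R \<in> carrier_mat r s" "?S \<in> carrier_mat r r"
    using k X h c ct dc ac by auto
  have "g * bordered e d c a = four_block_mat ?P ?Q ?R ?S"
    unfolding g bordered_def by (rule mult_four_block_mat[OF k X _ h dc c ct ac]) simp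
  then have "g * bordered e d c a * g\<^sup>T = four_block_mat (?P * k\<^sup>T + ?Q * X\<^sup>T) (?P * 0\<^sub>m s r
    + ?Q * h\<^sup>T) (?R * k\<^sup>T + ?S * X\<^sup>T) (?R * 0\<^sub>m s r + ?S * h\<^sup>T)"
    unfolding gT by (simp only:) (rule mult_four_block_mat[OF c4], use k X h in simp_all)
  also have "?P * 0\<^sub>m s r + ?Q * h\<^sup>T = ?Q * h\<^sup>T" using c4 h c X dc ac k by (simp del: assoc_mult_mat)
  also have "?R * 0\<^sub>m s r + ?S * h\<^sup>T = h * a * h\<^sup>T" using c4 h c X dc ac k by (simp del: assoc_mult_mat)
  finally have eq: "g * bordered e d c a * g\<^sup>T
    = four_block_mat (?P * k\<^sup>T + ?Q * X\<^sup>T) (?Q * h\<^sup>T) (?R * k\<^sup>T + ?S * X\<^sup>T) (h * a * h\<^sup>T)" .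
  have t1: "?P * k\<^sup>T + ?Q * X\<^sup>T \<in> carrier_mat s s"
    by (rule add_carrier_mat, rule mult_carrier_mat[OF c4(2)]) (simp add: X)
  have t2: "?Q * h\<^sup>T \<in> carrier_mat s r" by (rule mult_carrier_mat[OF c4(2)]) (simp add: h)
  have t3: "?R * k\<^sup>T + ?S * X\<^sup>T \<in> carrier_mat r s"
    by (rule add_carrier_mat, rule mult_carrier_mat[OF c4(4)]) (simp add: X)
  have t4: "h * a * h\<^sup>T \<in> carrier_mat r r"
    by (rule mult_carrier_mat[OF mult_carrier_mat[OF h ac]]) (simp add: h)
  have "g \<in> carrier_mat (s + r) (s + r)" unfolding g using k h by simp
  then have "g * bordered e d c a * g\<^sup>T \<in> Sym e (s + r)" by (rule Sym_congruence[OF bordered_Sym[OF e d c a]])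
  then have "?P * k\<^sup>T + ?Q * X\<^sup>T \<in> Sym e s \<and> ?R * k\<^sup>T + ?S * X\<^sup>T = e \<cdot>\<^sub>m (?Q * h\<^sup>T)\<^sup>T \<and> h * a * h\<^sup>T \<in> Sym e r"
    unfolding eq by (rule iffD1[OF Sym_block[OF e t1 t2 t3 t4]])
  then obtain d' where d': "d' \<in> Sym e s" "?R * k\<^sup>T + ?S * X\<^sup>T = e \<cdot>\<^sub>m (?Q * h\<^sup>T)\<^sup>T" "?P * k\<^sup>T + ?Q * X\<^sup>T
    = d'" by blast
  have "g * bordered e d c a * g\<^sup>T = bordered e d' (?Q * h\<^sup>T) (h * a * h\<^sup>T)"
    unfolding eq d'(2,3) by (simp only: bordered_def)
  then show ?thesis using d'(1) by blast
qed

text \<open>For fixed \<open>c\<close> and \<open>a\<close>, congruence by \<open>g\<close> induces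
  a map on the corners \<open>d\<close>. It is injective because \<open>g\<close> is invertible,
  hence a permutation of the finite set \<open>Sym e s\<close>.\<close>

lemma bordered_fibre_sum:
  fixes \<psi> :: "'a::{field,finite} mat \<Rightarrow> nat"
  assumes e: "e * e = 1" and c: "c \<in> carrier_mat s r" and a: "a \<in> Sym e r"
    and k: "k \<in> GL s" and X: "X \<in> carrier_mat s r" and h: "h \<in> GL r"
    and g: "g = four_block_mat k X (0\<^sub>m r s) h"
  shows "(\<Sum>d\<in>Sym e s. \<psi> (g * bordered e d c a * g\<^sup>T))
    = (\<Sum>d\<in>Sym e s. \<psi> (bordered e d ((k * c + X * a) * h\<^sup>T) (h * a * h\<^sup>T)))"
proof -
  note kc = GL_carrier[OF k] and hc = GL_carrier[OF h] and ac = Sym_carrier[OF a]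
  have gG: "g \<in> GL (s + r)" unfolding g using GL_upper_block[OF kc X hc] k h by blast
  have "\<forall>d \<in> Sym e s. \<exists>d'. d' \<in> Sym e s \<and> g * bordered e d c a * g\<^sup>T
    = bordered e d' ((k * c + X * a) * h\<^sup>T) (h * a * h\<^sup>T)"
    using bordered_transform[OF e _ c a kc X hc g] by blast
  then obtain f where f: "\<And>d. d \<in> Sym e s \<Longrightarrow> f d \<in> Sym e s"
    "\<And>d. d \<in> Sym e s \<Longrightarrow> g * bordered e d c a * g\<^sup>T = bordered e (f d) ((k * c + X * a) * h\<^sup>T) (h * a * h\<^sup>T)"
    by metis
  have "inj_on f (Sym e s)"
  proof (rule inj_onI)
    fix d d' assume *: "d \<in> Sym e s" "d' \<in> Sym e s" "f d = f d'"
    have "g * bordered e d c a * g\<^sup>T = g * bordered e d' c a * g\<^sup>T" using f(2)[OF *(1)] f(2)[OF *(2)] *(3)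
      by simp
    then have "ginv g * (g * bordered e d c a * g\<^sup>T) * (ginv g)\<^sup>T
      = ginv g * (g * bordered e d' c a * g\<^sup>T) * (ginv g)\<^sup>T" by simp
    then have "bordered e d c a = bordered e d' c a"
      using congruence_inverse(1)[OF Sym_carrier[OF bordered_Sym[OF e *(1) c a]] gG]
        congruence_inverse(1)[OF Sym_carrier[OF bordered_Sym[OF e *(2) c a]] gG] by simp
    then show "d = d'" using bordered_inj[OF Sym_carrier[OF *(1)] c ac Sym_carrier[OF *(2)] c ac] by blast
  qed
  then have "bij_betw f (Sym e s) (Sym e s)"
    using f(1) by (intro bij_betw_imageI endo_inj_surj) auto
  then have "(\<Sum>d\<in>Sym e s. \<psi> (bordered e d ((k * c + X * a) * h\<^sup>T) (h * a * h\<^sup>T))) =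
      (\<Sum>d\<in>Sym e s. \<psi> (bordered e (f d) ((k * c + X * a) * h\<^sup>T) (h * a * h\<^sup>T)))"
    by (rule sum.reindex_bij_betw[symmetric])
  also have "\<dots> = (\<Sum>d\<in>Sym e s. \<psi> (g * bordered e d c a * g\<^sup>T))" by (rule sum.cong) (use f(2) in auto)
  finally show ?thesis by simp
qed

lemma bordered_sum_transport:
  fixes \<psi> :: "'a::{field,finite} mat \<Rightarrow> nat"
  assumes e: "e * e = 1" and a: "a \<in> Sym e r" and h: "h \<in> GL r"
    and g: "g = four_block_mat (1\<^sub>m s) (0\<^sub>m s r) (0\<^sub>m r s) h"
  shows "(\<Sum>c\<in>carrier_mat s r. \<Sum>d\<in>Sym e s. \<psi> (g * bordered e d c a * g\<^sup>T)) =
    (\<Sum>c\<in>carrier_mat s r. \<Sum>d\<in>Sym e s. \<psi> (bordered e d c (h * a * h\<^sup>T)))"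
proof -
  note hc = GL_carrier[OF h] and ht = ginv[OF GL_transpose[OF h]]
  have "(\<Sum>c\<in>carrier_mat s r. \<Sum>d\<in>Sym e s. \<psi> (g * bordered e d c a * g\<^sup>T)) =
     (\<Sum>c\<in>carrier_mat s r. \<Sum>d\<in>Sym e s. \<psi> (bordered e d (c * h\<^sup>T) (h * a * h\<^sup>T)))"
  proof (rule sum.cong[OF refl])
    fix c :: "'a mat" assume c: "c \<in> carrier_mat s r"
    have "1\<^sub>m s * c + 0\<^sub>m s r * a = c" using c Sym_carrier[OF a] by simp
    then show "(\<Sum>d\<in>Sym e s. \<psi> (g * bordered e d c a * g\<^sup>T))
      = (\<Sum>d\<in>Sym e s. \<psi> (bordered e d (c * h\<^sup>T) (h * a * h\<^sup>T)))"
      using bordered_fibre_sum[OF e c a GL_one _ h g, of \<psi>] by simp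
  qed
  also have "\<dots> = (\<Sum>c\<in>carrier_mat s r. \<Sum>d\<in>Sym e s. \<psi> (bordered e d c (h * a * h\<^sup>T)))"
  proof (rule sum.reindex_bij_betw[of "\<lambda>c. c * h\<^sup>T"])
    show "bij_betw (\<lambda>c. c * h\<^sup>T) (carrier_mat s r) (carrier_mat s r)"
    proof (rule bij_betwI[where g = "\<lambda>c. c * ginv (h\<^sup>T)"])
      fix c :: "'a mat" assume c: "c \<in> carrier_mat s r"
      have "c * h\<^sup>T * ginv h\<^sup>T = c * (h\<^sup>T * ginv h\<^sup>T)"
        by (rule assoc_mult_mat[of _ s r _ r _ r]) (use c hc ht in simp_all)
      then show "c * h\<^sup>T * ginv h\<^sup>T = c" using ht c by simp
      have "c * ginv h\<^sup>T * h\<^sup>T = c * (ginv h\<^sup>T * h\<^sup>T)"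
        by (rule assoc_mult_mat[of _ s r _ r _ r]) (use c hc ht in simp_all)
      then show "c * ginv h\<^sup>T * h\<^sup>T = c" using ht c by simp
    qed (use hc ht in auto)
  qed
  finally show ?thesis .
qed

lemma zdiag_mult_vec:
  fixes a :: "'a::field mat"
  assumes "a \<in> carrier_mat r r" "u \<in> carrier_vec t" "w \<in> carrier_vec r"
  shows "zdiag t a *\<^sub>v (u @\<^sub>v w) = 0\<^sub>v t @\<^sub>v (a *\<^sub>v w)"
proof -
  have "zdiag t a *\<^sub>v (u @\<^sub>v w) = (0\<^sub>m t t *\<^sub>v u + 0\<^sub>m t r *\<^sub>v w) @\<^sub>v (0\<^sub>m r t *\<^sub>v u + a *\<^sub>v w)"
    unfolding zdiag_eq[OF assms(1)] by (rule four_block_mat_mult_vec) (use assms in auto)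
  also have "0\<^sub>m t t *\<^sub>v u + 0\<^sub>m t r *\<^sub>v w = 0\<^sub>v t" using assms by (intro eq_vecI) auto
  also have "0\<^sub>m r t *\<^sub>v u + a *\<^sub>v w = a *\<^sub>v w" using assms by (intro eq_vecI) auto
  finally show ?thesis .
qed

lemma bordered_mult_vec:
  assumes "d \<in> carrier_mat s s" "c \<in> carrier_mat s r" "a \<in> carrier_mat r r" "u \<in> carrier_vec s"
    "w \<in> carrier_vec r"
  shows "bordered e d c a *\<^sub>v (u @\<^sub>v w) = (d *\<^sub>v u + c *\<^sub>v w) @\<^sub>v ((e \<cdot>\<^sub>m c\<^sup>T) *\<^sub>v u + a *\<^sub>v w)"
  unfolding bordered_def by (rule four_block_mat_mult_vec) (use assms in auto)

lemma zero_append: "0\<^sub>v t @\<^sub>v 0\<^sub>v r = 0\<^sub>v (t + r)"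
  by (rule eq_vecI) auto

lemma mult_mat_zero_vec [simp]: "A \<in> carrier_mat m n \<Longrightarrow> A *\<^sub>v (0\<^sub>v n) = (0\<^sub>v m :: 'a::semiring_0 vec)"
  by (rule eq_vecI) auto

text \<open>A vector in the radical of the lower right form that is also killed by \<open>c2\<close>
  is killed by the whole matrix.\<close>

lemma bordered_singular:
  assumes d: "d \<in> carrier_mat s s" and c: "c2 \<in> carrier_mat s t" "c1 \<in> carrier_mat s r"
    and a: "a1 \<in> carrier_mat r r"
    and nFC: "c2 \<notin> full_col_rank s t"
  shows "bordered e d (hcat c2 c1) (zdiag t a1) \<notin> GL (s + (t + r))"
proof
  let ?M = "bordered e d (hcat c2 c1) (zdiag t a1)"
  assume GL: "?M \<in> GL (s + (t + r))"
  obtain v where v: "v \<in> carrier_vec t" "c2 *\<^sub>v v = 0\<^sub>v s" "v \<noteq> 0\<^sub>v t" using nFC c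
    by (auto simp: full_col_rank_def)
  let ?w = "v @\<^sub>v 0\<^sub>v r" and ?u = "0\<^sub>v s @\<^sub>v (v @\<^sub>v 0\<^sub>v r)"
  have h: "hcat c2 c1 \<in> carrier_mat s (t + r)" using c by simp
  have cw: "hcat c2 c1 *\<^sub>v ?w = 0\<^sub>v s" using hcat_mult_vec[OF c v(1) zero_carrier_vec] v c by simp
  have aw: "zdiag t a1 *\<^sub>v ?w = 0\<^sub>v (t + r)" using zdiag_mult_vec[OF a v(1) zero_carrier_vec] a
    by (simp add: zero_append)
  have w: "?w \<in> carrier_vec (t + r)" using v by simp
  have "?M *\<^sub>v ?u = (d *\<^sub>v 0\<^sub>v s + hcat c2 c1 *\<^sub>v ?w) @\<^sub>v ((e \<cdot>\<^sub>m (hcat c2 c1)\<^sup>T) *\<^sub>v 0\<^sub>v s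
    + zdiag t a1 *\<^sub>v ?w)"
    by (rule bordered_mult_vec[OF d h]) (use a w in auto)
  also have "(e \<cdot>\<^sub>m (hcat c2 c1)\<^sup>T) *\<^sub>v 0\<^sub>v s = 0\<^sub>v (t + r)"
    by (rule mult_mat_zero_vec) (use h in auto)
  finally have "?M *\<^sub>v ?u = 0\<^sub>v (s + (t + r))" unfolding cw aw using d by (simp add: zero_append)
  then have "?u = 0\<^sub>v (s + (t + r))" using GL_mult_vec_eq_0[OF GL, of ?u] w by simp
  then have "?u = 0\<^sub>v s @\<^sub>v (0\<^sub>v t @\<^sub>v 0\<^sub>v r)" by (simp add: zero_append)
  then have "?w = 0\<^sub>v t @\<^sub>v 0\<^sub>v r" by (metis append_vec_eq zero_carrier_vec)
  then have "v = 0\<^sub>v t" using append_vec_eq[OF v(1), of "0\<^sub>v t"] by simp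
  with v(3) show False by simp
qed

text \<open>Only those \<open>c\<close> contribute that are injective on the radical of
  \<open>a\<close>, that is, whose first \<open>t\<close> columns are independent. A congruence
  fixing \<open>a\<close> moves every such \<open>c\<close> to the identity followed by zeros, so
  all of them give the same sum over \<open>d\<close>; the factor in front counts them.\<close>

lemma bordered_sum_normal:
  fixes \<psi> :: "'a::{field,finite} mat \<Rightarrow> nat"
  assumes e: "e * e = 1" and a1: "a1 \<in> NSym e r" and a: "a = zdiag t a1"
    and zero: "\<And>M. M \<notin> GL (s + (t + r)) \<Longrightarrow> \<psi> M = 0"
    and inv: "\<And>d c k X. d \<in> Sym e s \<Longrightarrow> c \<in> carrier_mat s (t + r) \<Longrightarrow> k \<in> GL s \<Longrightarrow> X \<in> carrier_mat s (t + r) \<Longrightarrow>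
      \<psi> (four_block_mat k X (0\<^sub>m (t + r) s) (1\<^sub>m (t + r)) * bordered e d c a *
        (four_block_mat k X (0\<^sub>m (t + r) s) (1\<^sub>m (t + r)))\<^sup>T)
      = \<psi> (bordered e d c a)"
  shows "(\<Sum>c\<in>carrier_mat s (t + r). \<Sum>d\<in>Sym e s. \<psi> (bordered e d c a)) =
    card (full_col_rank s t :: 'a mat set) * CARD('a) ^ (s * r) *
      (\<Sum>d\<in>Sym e s. \<psi> (bordered e d (hcat (idblock s t) (0\<^sub>m s r)) a))"
proof -
  let ?S = "\<Sum>d\<in>Sym e s. \<psi> (bordered e d (hcat (idblock s t) (0\<^sub>m s r)) a)"
  note a1c = GL_carrier[OF NSym_GL[OF a1]] and a1i = ginv[OF NSym_GL[OF a1]]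
  have aS: "a \<in> Sym e (t + r)" unfolding a by (rule zdiag_Sym[OF e NSym_Sym[OF a1]])
  note ac = Sym_carrier[OF aS]
  have inner: "(\<Sum>d\<in>Sym e s. \<psi> (bordered e d (hcat c2 c1) a)) = (if c2 \<in> full_col_rank s t then ?S else 0)"
    if c: "c2 \<in> carrier_mat s t" "c1 \<in> carrier_mat s r" for c2 c1
  proof (cases "c2 \<in> full_col_rank s t")
    case False
    then show ?thesis using bordered_singular[OF _ c a1c False] zero by (auto simp: a Sym_carrier)
  next
    case True
    obtain Y where Y: "Y \<in> GL s" "c2 = Y * idblock s t" using full_col_rank_normal_form[OF True] by blast
    note Yc = GL_carrier[OF Y(1)] and Yi = ginv[OF Y(1)]
    let ?k = "ginv Y"
    have "?k * (Y * idblock s t) = ?k * Y * idblock s t"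
      by (rule assoc_mult_mat[of _ s s _ s _ t, symmetric]) (use Yc Yi in simp_all)
    then have k2: "?k * c2 = idblock s t" using Yi left_mult_one_mat[OF idblock_carrier, of s t]
      by (simp add: Y(2))
    \<comment> \<open>Solves \<open>?k * c1 + X1 * a1 = 0\<close>, which is possible because
      \<open>a1\<close> is invertible: the columns of \<open>c\<close> outside the radical are
      cleared.\<close>
    define X1 where "X1 = - (?k * c1 * ginv a1)"
    have X1: "X1 \<in> carrier_mat s r" unfolding X1_def using Yi a1i c by simp
    have "?k * c1 * ginv a1 * a1 = ?k * c1 * (ginv a1 * a1)"
      by (rule assoc_mult_mat[of _ s r _ r _ r]) (use Yi a1i a1c c in simp_all)
    then have "X1 * a1 = - (?k * c1)" unfolding X1_def using Yi a1i c a1c by (simp del: assoc_mult_mat)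
    then have k1: "?k * c1 + X1 * a1 = 0\<^sub>m s r" using Yi(1) c a1c by (intro eq_matI) auto
    let ?X = "hcat (0\<^sub>m s t) X1"
    have X: "?X \<in> carrier_mat s (t + r)" using X1 by simp
    have "?X * a = hcat (0\<^sub>m s t * 0\<^sub>m t t + X1 * 0\<^sub>m r t) (0\<^sub>m s t * 0\<^sub>m t r + X1 * a1)"
      unfolding a zdiag_eq[OF a1c] by (rule hcat_mult_four_block) (use X1 a1c in auto)
    then have Xa: "?X * a = hcat (0\<^sub>m s t) (X1 * a1)" using X1 a1c by simp
    have "?k * hcat c2 c1 = hcat (idblock s t) (?k * c1)"
      using mult_hcat[OF Yi(1) c] k2 by simp
    then have "?k * hcat c2 c1 + ?X * a = hcat (idblock s t + 0\<^sub>m s t) (?k * c1 + X1 * a1)"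
      unfolding Xa by (simp only:) (rule hcat_add, use Yi(1) c X1 a1c in auto)
    then have kc: "?k * hcat c2 c1 + ?X * a = hcat (idblock s t) (0\<^sub>m s r)" using k1 by simp
    let ?g = "four_block_mat ?k ?X (0\<^sub>m (t + r) s) (1\<^sub>m (t + r))"
    have hc: "hcat c2 c1 \<in> carrier_mat s (t + r)" using c by simp
    have "(\<Sum>d\<in>Sym e s. \<psi> (bordered e d (hcat c2 c1) a))
      = (\<Sum>d\<in>Sym e s. \<psi> (?g * bordered e d (hcat c2 c1) a * ?g\<^sup>T))"
      by (rule sum.cong[OF refl], rule inv[symmetric]) (use hc X GL_ginv[OF Y(1)] in auto)
    also have "\<dots> = (\<Sum>d\<in>Sym e s. \<psi> (bordered e d ((?k * hcat c2 c1 + ?X * a) * (1\<^sub>m (t + r))\<^sup>T)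
      (1\<^sub>m (t + r) * a * (1\<^sub>m (t + r))\<^sup>T)))"
      by (rule bordered_fibre_sum[OF e hc aS GL_ginv[OF Y(1)] X GL_one refl])
    also have "\<dots> = ?S" unfolding kc using ac right_mult_one_mat[of "hcat (idblock s t) (0\<^sub>m s r :: 'a mat)" s
      "t + r"] by simp
    finally show ?thesis using True by simp
  qed
  have "(\<Sum>c\<in>carrier_mat s (t + r). \<Sum>d\<in>Sym e s. \<psi> (bordered e d c a)) =
    (\<Sum>x\<in>carrier_mat s t \<times> carrier_mat s r. \<Sum>d\<in>Sym e s. \<psi> (bordered e d (case x of (c2, c1) \<Rightarrow> hcat c2 c1) a))"
    by (rule sum.reindex_bij_betw[OF bij_betw_hcat, symmetric])
  also have "\<dots> = (\<Sum>x\<in>(carrier_mat s t \<times> carrier_mat s r :: ('a mat \<times> 'a mat) set). if fst x \<in> full_col_rank s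
    t then ?S else 0)"
  proof (rule sum.cong[OF refl])
    fix x :: "'a mat \<times> 'a mat" assume x: "x \<in> carrier_mat s t \<times> carrier_mat s r"
    show "(\<Sum>d\<in>Sym e s. \<psi> (bordered e d (case x of (c2, c1) \<Rightarrow> hcat c2 c1) a))
      = (if fst x \<in> full_col_rank s t then ?S else 0)"
      unfolding case_prod_beta by (rule inner) (use x in \<open>simp_all add: mem_Times_iff\<close>)
  qed
  also have "\<dots> = (\<Sum>x\<in>(full_col_rank s t \<times> carrier_mat s r :: ('a mat \<times> 'a mat) set). ?S)"
  proof -
    have "{x \<in> (carrier_mat s t \<times> carrier_mat s r :: ('a mat \<times> 'a mat) set). fst x \<in> full_col_rank s t}
      = full_col_rank s t \<times> carrier_mat s r"
      by (auto simp: full_col_rank_def)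
    then show ?thesis by (simp only: sum.inter_filter[symmetric] finite_cartesian_product finite_carrier_mat)
  qed
  also have "\<dots> = card (full_col_rank s t :: 'a mat set) * CARD('a) ^ (s * r) * ?S"
    by (simp add: card_cartesian_product card_carrier_mat)
  finally show ?thesis .
qed

lemma hcat_idblock:
  "hcat (idblock (t + m) t) (0\<^sub>m (t + m) r) = four_block_mat (1\<^sub>m t) (0\<^sub>m t r) (0\<^sub>m m t) (0\<^sub>m m r)"
  by (rule eq_matI) (auto simp: hcat_def idblock_def)

lemma smult_transpose_hcat_idblock:
  "e \<cdot>\<^sub>m (hcat (idblock (t + m) t) (0\<^sub>m (t + m) r))\<^sup>T
    = four_block_mat (e \<cdot>\<^sub>m 1\<^sub>m t) (0\<^sub>m t m) (0\<^sub>m r t) (0\<^sub>m r m)"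
  unfolding hcat_idblock by (rule eq_matI) auto

lemma zero_mat_mult_vec [simp]: "v \<in> carrier_vec n \<Longrightarrow> 0\<^sub>m m n *\<^sub>v v = (0\<^sub>v m :: 'a::semiring_0 vec)"
  by (rule eq_vecI) auto

lemma append_eq_zero:
  "u \<in> carrier_vec n \<Longrightarrow> w \<in> carrier_vec m \<Longrightarrow> u @\<^sub>v w = 0\<^sub>v (n + m) \<longleftrightarrow> u = 0\<^sub>v n \<and> w = 0\<^sub>v m"
  by (metis append_vec_eq zero_append zero_carrier_vec)

lemma vec_split:
  assumes "v \<in> carrier_vec (n + m)"
  obtains u w where "u \<in> carrier_vec n" "w \<in> carrier_vec m" "v = u @\<^sub>v w"
  using assms that[of "vec_first v n" "vec_last v m"] by simp

text \<open>In the four components of a kernel vector, the third block row gives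
  \<open>x = 0\<close>, the fourth gives \<open>w = 0\<close>, the second then reads
  \<open>d22 *\<^sub>v y = 0\<close>, and the first determines \<open>z\<close> from the rest. So
  \<open>d22\<close> alone decides.\<close>

lemma bordered_normal_GL:
  fixes e :: "'a::field"
  assumes e: "e * e = 1" and d: "d11 \<in> carrier_mat t t" "d12 \<in> carrier_mat t m" "d22 \<in> carrier_mat m m"
    and a1: "a1 \<in> GL r"
  shows "bordered e (four_block_mat d11 d12 (e \<cdot>\<^sub>m d12\<^sup>T) d22) (hcat (idblock (t + m) t) (0\<^sub>m (t + m) r))
    (zdiag t a1)
    \<in> GL (t + m + (t + r)) \<longleftrightarrow> d22 \<in> GL m"
proof -
  let ?d = "four_block_mat d11 d12 (e \<cdot>\<^sub>m d12\<^sup>T) d22"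
    and ?c = "hcat (idblock (t + m) t) (0\<^sub>m (t + m) r) :: 'a mat"
  let ?M = "bordered e ?d ?c (zdiag t a1)"
  note a1c = GL_carrier[OF a1]
  have dc: "?d \<in> carrier_mat (t + m) (t + m)" using d by simp
  have cc: "?c \<in> carrier_mat (t + m) (t + r)" by simp
  have Mc: "?M \<in> carrier_mat (t + m + (t + r)) (t + m + (t + r))"
    unfolding bordered_def by (rule four_block_carrier_mat[OF dc]) (use a1c in simp)
  have Mv: "?M *\<^sub>v ((x @\<^sub>v y) @\<^sub>v (z @\<^sub>v w)) =
     ((d11 *\<^sub>v x + d12 *\<^sub>v y + z) @\<^sub>v ((e \<cdot>\<^sub>m d12\<^sup>T) *\<^sub>v x + d22 *\<^sub>v y)) @\<^sub>v ((e \<cdot>\<^sub>v x) @\<^sub>v (a1 *\<^sub>v w))"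
    if v: "x \<in> carrier_vec t" "y \<in> carrier_vec m" "z \<in> carrier_vec t" "w \<in> carrier_vec r" for x y z w
  proof -
    have 1: "?d *\<^sub>v (x @\<^sub>v y) = (d11 *\<^sub>v x + d12 *\<^sub>v y) @\<^sub>v ((e \<cdot>\<^sub>m d12\<^sup>T) *\<^sub>v x + d22 *\<^sub>v y)"
      by (rule four_block_mat_mult_vec) (use d v in auto)
    have "?c *\<^sub>v (z @\<^sub>v w) = (1\<^sub>m t *\<^sub>v z + 0\<^sub>m t r *\<^sub>v w) @\<^sub>v (0\<^sub>m m t *\<^sub>v z + 0\<^sub>m m r *\<^sub>v w)"
      unfolding hcat_idblock by (rule four_block_mat_mult_vec) (use v in auto)
    then have 2: "?c *\<^sub>v (z @\<^sub>v w) = z @\<^sub>v 0\<^sub>v m" using v by simp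
    have "(e \<cdot>\<^sub>m ?c\<^sup>T) *\<^sub>v (x @\<^sub>v y) = ((e \<cdot>\<^sub>m 1\<^sub>m t) *\<^sub>v x + 0\<^sub>m t m *\<^sub>v y) @\<^sub>v (0\<^sub>m r t *\<^sub>v x
      + 0\<^sub>m r m *\<^sub>v y)"
      unfolding smult_transpose_hcat_idblock by (rule four_block_mat_mult_vec) (use v in auto)
    moreover have "(e \<cdot>\<^sub>m 1\<^sub>m t) *\<^sub>v x = e \<cdot>\<^sub>v x" using v by (intro eq_vecI) auto
    ultimately have 3: "(e \<cdot>\<^sub>m ?c\<^sup>T) *\<^sub>v (x @\<^sub>v y) = (e \<cdot>\<^sub>v x) @\<^sub>v 0\<^sub>v r" using v by simp
    have 4: "zdiag t a1 *\<^sub>v (z @\<^sub>v w) = 0\<^sub>v t @\<^sub>v (a1 *\<^sub>v w)" by (rule zdiag_mult_vec) (use a1c v in auto)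
    have "?M *\<^sub>v ((x @\<^sub>v y) @\<^sub>v (z @\<^sub>v w)) =
       (?d *\<^sub>v (x @\<^sub>v y) + ?c *\<^sub>v (z @\<^sub>v w)) @\<^sub>v ((e \<cdot>\<^sub>m ?c\<^sup>T) *\<^sub>v (x @\<^sub>v y) + zdiag t a1 *\<^sub>v (z @\<^sub>v w))"
      by (rule bordered_mult_vec[OF dc cc]) (use a1c v in auto)
    also have "?d *\<^sub>v (x @\<^sub>v y) + ?c *\<^sub>v (z @\<^sub>v w) =
       (d11 *\<^sub>v x + d12 *\<^sub>v y + z) @\<^sub>v ((e \<cdot>\<^sub>m d12\<^sup>T) *\<^sub>v x + d22 *\<^sub>v y)"
      unfolding 1 2 by (rule eq_vecI) (use d v in auto)
    also have "(e \<cdot>\<^sub>m ?c\<^sup>T) *\<^sub>v (x @\<^sub>v y) + zdiag t a1 *\<^sub>v (z @\<^sub>v w) = (e \<cdot>\<^sub>v x) @\<^sub>v (a1 *\<^sub>v w)"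
      unfolding 3 4 by (rule eq_vecI) (use a1c v in auto)
    finally show ?thesis .
  qed
  have Mv0: "?M *\<^sub>v ((x @\<^sub>v y) @\<^sub>v (z @\<^sub>v w)) = 0\<^sub>v (t + m + (t + r)) \<longleftrightarrow>
     (d11 *\<^sub>v x + d12 *\<^sub>v y + z = 0\<^sub>v t \<and> (e \<cdot>\<^sub>m d12\<^sup>T) *\<^sub>v x + d22 *\<^sub>v y = 0\<^sub>v m)
       \<and> (e \<cdot>\<^sub>v x = 0\<^sub>v t \<and> a1 *\<^sub>v w = 0\<^sub>v r)"
    if v: "x \<in> carrier_vec t" "y \<in> carrier_vec m" "z \<in> carrier_vec t" "w \<in> carrier_vec r" for x y z w
  proof -
    have c: "d11 *\<^sub>v x + d12 *\<^sub>v y + z \<in> carrier_vec t" "(e \<cdot>\<^sub>m d12\<^sup>T) *\<^sub>v x + d22 *\<^sub>v y \<in> carrier_vec m"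
      "e \<cdot>\<^sub>v x \<in> carrier_vec t" "a1 *\<^sub>v w \<in> carrier_vec r"
      using v d a1c by (auto intro!: carrier_vecI)
    show ?thesis unfolding Mv[OF v]
      using append_eq_zero[OF append_carrier_vec[OF c(1,2)] append_carrier_vec[OF c(3,4)]]
        append_eq_zero[OF c(1,2)] append_eq_zero[OF c(3,4)] by simp
  qed
  show ?thesis
  proof
    assume M: "?M \<in> GL (t + m + (t + r))"
    show "d22 \<in> GL m" unfolding GL_kernel[OF d(3)]
    proof (intro ballI impI)
      fix y assume y: "y \<in> carrier_vec m" "d22 *\<^sub>v y = 0\<^sub>v m"
      \<comment> \<open>Balances the first block row, where \<open>z\<close> enters with coefficient
        one.\<close>
      let ?z = "- (d12 *\<^sub>v y)"
      have c: "0\<^sub>v t \<in> carrier_vec t" "?z \<in> carrier_vec t" "0\<^sub>v r \<in> carrier_vec r" using d y by auto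
      have e1: "d11 *\<^sub>v 0\<^sub>v t + d12 *\<^sub>v y + ?z = 0\<^sub>v t" using d y by (intro eq_vecI) auto
      have e2: "(e \<cdot>\<^sub>m d12\<^sup>T) *\<^sub>v 0\<^sub>v t + d22 *\<^sub>v y = 0\<^sub>v m" unfolding y(2) using d by (intro eq_vecI) auto
      have e3: "e \<cdot>\<^sub>v 0\<^sub>v t = (0\<^sub>v t :: 'a vec)" by (intro eq_vecI) auto
      have e4: "a1 *\<^sub>v 0\<^sub>v r = 0\<^sub>v r" using a1c by simp
      have "?M *\<^sub>v ((0\<^sub>v t @\<^sub>v y) @\<^sub>v (?z @\<^sub>v 0\<^sub>v r)) = 0\<^sub>v (t + m + (t + r))"
        unfolding Mv0[OF c(1) y(1) c(2,3)] using e1 e2 e3 e4 by blast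
      then have "(0\<^sub>v t @\<^sub>v y) @\<^sub>v (?z @\<^sub>v 0\<^sub>v r) = 0\<^sub>v (t + m + (t + r))"
        using GL_mult_vec_eq_0[OF M append_carrier_vec[OF append_carrier_vec[OF c(1) y(1)]
          append_carrier_vec[OF c(2,3)]]] by blast
      then have "0\<^sub>v t @\<^sub>v y = 0\<^sub>v (t + m)"
        using append_eq_zero[OF append_carrier_vec[OF c(1) y(1)] append_carrier_vec[OF c(2,3)]] by blast
      then show "y = 0\<^sub>v m" using append_eq_zero[OF c(1) y(1)] by blast
    qed
  next
    assume D: "d22 \<in> GL m"
    show "?M \<in> GL (t + m + (t + r))" unfolding GL_kernel[OF Mc]
    proof (intro ballI impI)
      fix v assume v: "v \<in> carrier_vec (t + m + (t + r))" "?M *\<^sub>v v = 0\<^sub>v (t + m + (t + r))"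
      obtain u u' where u: "u \<in> carrier_vec (t + m)" "u' \<in> carrier_vec (t + r)" "v = u @\<^sub>v u'"
        using vec_split[OF v(1)] .
      obtain x y where xy: "x \<in> carrier_vec t" "y \<in> carrier_vec m" "u = x @\<^sub>v y" using vec_split[OF u(1)] .
      obtain z w where zw: "z \<in> carrier_vec t" "w \<in> carrier_vec r" "u' = z @\<^sub>v w" using vec_split[OF u(2)] .
      have eqs: "d11 *\<^sub>v x + d12 *\<^sub>v y + z = 0\<^sub>v t" "(e \<cdot>\<^sub>m d12\<^sup>T) *\<^sub>v x + d22 *\<^sub>v y = 0\<^sub>v m" "e \<cdot>\<^sub>v x
        = 0\<^sub>v t" "a1 *\<^sub>v w = 0\<^sub>v r"
        using v(2) Mv0[OF xy(1,2) zw(1,2)] unfolding u(3) xy(3) zw(3) by blast+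
      have "x = e \<cdot>\<^sub>v (e \<cdot>\<^sub>v x)" using e by (simp add: smult_smult_assoc)
      then have x: "x = 0\<^sub>v t" unfolding eqs(3)
        by (metis eq_vecI index_smult_vec index_zero_vec mult_zero_right)
      have w: "w = 0\<^sub>v r" using eqs(4) GL_mult_vec_eq_0[OF a1 zw(2)] by blast
      have "d22 *\<^sub>v y = 0\<^sub>v m" using eqs(2) d xy unfolding x by (simp add: mult_mat_zero_vec[of _ m t])
      then have y: "y = 0\<^sub>v m" using GL_mult_vec_eq_0[OF D xy(2)] by blast
      have z: "z = 0\<^sub>v t" using eqs(1) d zw unfolding x y
        by (simp add: mult_mat_zero_vec[of _ t m] mult_mat_zero_vec[of _ t t])
      show "v = 0\<^sub>v (t + m + (t + r))" unfolding u(3) xy(3) zw(3) x y z w by (simp only: zero_append)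
    qed
  qed
qed

lemma sum_triple:
  fixes f :: "'c \<Rightarrow> nat"
  shows "(\<Sum>(x, y, z)\<in>A \<times> B \<times> C. f z) = card A * card B * (\<Sum>z\<in>C. f z)"
  by (simp add: sum.cartesian_product')

lemma bordered_normal_sum:
  fixes e :: "'a::{field,finite}" and f :: "'a mat \<Rightarrow> nat"
  assumes e: "e * e = 1" and a1: "a1 \<in> NSym e r"
    and \<psi>: "\<And>M. M \<notin> GL (t + m + (t + r)) \<Longrightarrow> \<psi> M = 0"
    and f: "\<And>d11 d12 d22. d11 \<in> Sym e t \<Longrightarrow> d12 \<in> carrier_mat t m \<Longrightarrow> d22 \<in> NSym e m \<Longrightarrow>
       \<psi> (bordered e (four_block_mat d11 d12 (e \<cdot>\<^sub>m d12\<^sup>T) d22) (hcat (idblock (t + m) t) (0\<^sub>m (t + m) r))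
         (zdiag t a1)) = f d22"
  shows "(\<Sum>d\<in>Sym e (t + m). \<psi> (bordered e d (hcat (idblock (t + m) t) (0\<^sub>m (t + m) r)) (zdiag t a1))) =
    card (Sym e t) * card (carrier_mat t m :: 'a mat set) * (\<Sum>d\<in>NSym e m. f d)"
proof -
  let ?E = "\<lambda>d. bordered e d (hcat (idblock (t + m) t) (0\<^sub>m (t + m) r)) (zdiag t a1)"
  have "(\<Sum>d\<in>Sym e (t + m). \<psi> (?E d)) = (\<Sum>x\<in>Sym e t \<times> carrier_mat t m \<times> Sym e m.
      \<psi> (?E (case x of (A, B, D) \<Rightarrow> four_block_mat A B (e \<cdot>\<^sub>m B\<^sup>T) D)))"
    by (rule sum.reindex_bij_betw[OF bij_betw_Sym_block[OF e], symmetric])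
  also have "\<dots> = (\<Sum>(x, y, z)\<in>Sym e t \<times> (carrier_mat t m :: 'a mat set) \<times> Sym e m. if z \<in> GL m then f z else
    0)"
  proof (rule sum.cong[OF refl])
    fix x :: "'a mat \<times> 'a mat \<times> 'a mat" assume x: "x \<in> Sym e t \<times> carrier_mat t m \<times> Sym e m"
    obtain A B D where ABD: "x = (A, B, D)" by (metis prod_cases3)
    have c: "A \<in> Sym e t" "B \<in> carrier_mat t m" "D \<in> Sym e m" using x ABD by auto
    note iff = bordered_normal_GL[OF e Sym_carrier[OF c(1)] c(2) Sym_carrier[OF c(3)] NSym_GL[OF a1]]
    have "\<psi> (?E (four_block_mat A B (e \<cdot>\<^sub>m B\<^sup>T) D)) = (if D \<in> GL m then f D else 0)"
    proof (cases "D \<in> GL m")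
      case True
      then show ?thesis using f[OF c(1,2), of D] c(3) by (simp add: NSym_iff)
    next
      case False
      then show ?thesis using \<psi>[of "?E (four_block_mat A B (e \<cdot>\<^sub>m B\<^sup>T) D)"] iff by simp
    qed
    then show "\<psi> (?E (case x of (A, B, D) \<Rightarrow> four_block_mat A B (e \<cdot>\<^sub>m B\<^sup>T) D))
      = (case x of (x, y, z) \<Rightarrow> if z \<in> GL m then f z else 0)"
      unfolding ABD by simp
  qed
  also have "\<dots> = card (Sym e t) * card (carrier_mat t m :: 'a mat set) *
    (\<Sum>z\<in>Sym e m. if z \<in> GL m then f z else 0)"
    by (rule sum_triple)
  also have "(\<Sum>z\<in>Sym e m. if z \<in> GL m then f z else 0) = (\<Sum>d\<in>NSym e m. f d)"
  proof -
    have "NSym e m = {z \<in> Sym e m. z \<in> GL m}" by (auto simp: NSym_iff)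
    then show ?thesis by (simp only: sum.inter_filter[OF finite_Sym])
  qed
  finally show ?thesis .
qed

lemma full_col_rank_empty: "s < t \<Longrightarrow> full_col_rank s t = {}"
  using full_col_rank_normal_form by fastforce

text \<open>The common scheme of two counts: with weight 1 on the nonsingular forms, and with the
  number of extensions of \<open>B0\<close> as weight. The operator \<open>B\<close> is carried
  along because the second weight is invariant only if \<open>B\<close> is conjugated together with
  the congruence of the form; \<open>Q\<close> collects the relations between \<open>B\<close> and
  \<open>a\<close> that survive this. If \<open>s < t\<close>, the truncated difference
  \<open>s - t\<close> is harmless since no injective \<open>c\<close> exists and the first factor
  is zero.\<close>

lemma bordered_sum_general:
  fixes e :: "'a::{field,finite}" and f :: "'a mat \<Rightarrow> nat" and \<psi> :: "'a mat \<Rightarrow> 'a mat \<Rightarrow> nat"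
  assumes e: "e * e = 1" and a: "a \<in> SymN e t r" and B0: "B0 \<in> carrier_mat (t + r) (t + r)" "Q B0 a"
    and Q: "\<And>B a h. B \<in> carrier_mat (t + r) (t + r) \<Longrightarrow> a \<in> Sym e (t + r) \<Longrightarrow> h \<in> GL (t + r) \<Longrightarrow> Q B a
      \<Longrightarrow> Q (h * B * ginv h) (h * a * h\<^sup>T)"
    and zero: "\<And>B M. M \<notin> GL (s + (t + r)) \<Longrightarrow> \<psi> B M = 0"
    and inv: "\<And>B M k X h. B \<in> carrier_mat (t + r) (t + r) \<Longrightarrow> M \<in> Sym e (s + (t + r)) \<Longrightarrow> k \<in> GL s
      \<Longrightarrow> X \<in> carrier_mat s (t + r) \<Longrightarrow> h \<in> GL (t + r) \<Longrightarrow>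
      \<psi> (h * B * ginv h) (four_block_mat k X (0\<^sub>m (t + r) s) h * M * (four_block_mat k X (0\<^sub>m (t + r) s) h)\<^sup>T)
        = \<psi> B M"
    and f: "\<And>B a1 m d11 d12 d22. B \<in> carrier_mat (t + r) (t + r) \<Longrightarrow> a1 \<in> NSym e r \<Longrightarrow> Q B (zdiag t a1) \<Longrightarrow> s = t
      + m \<Longrightarrow>
       d11 \<in> Sym e t \<Longrightarrow> d12 \<in> carrier_mat t m \<Longrightarrow> d22 \<in> NSym e m \<Longrightarrow>
       \<psi> B (bordered e (four_block_mat d11 d12 (e \<cdot>\<^sub>m d12\<^sup>T) d22) (hcat (idblock (t + m) t) (0\<^sub>m (t + m) r))
         (zdiag t a1)) = f d22"
  shows "(\<Sum>c\<in>carrier_mat s (t + r). \<Sum>d\<in>Sym e s. \<psi> B0 (bordered e d c a)) =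
    card (full_col_rank s t :: 'a mat set) * CARD('a) ^ (s * r) *
     (card (Sym e t) * CARD('a) ^ (t * (s - t)) * (\<Sum>d\<in>NSym e (s - t). f d))"
proof -
  obtain h a1 where h: "h \<in> GL (t + r)" "a1 \<in> NSym e r" "h * a * h\<^sup>T = zdiag t a1"
    using SymN_normal_form[OF e a] .
  note aS = SymN_Sym[OF a]
  let ?B = "h * B0 * ginv h"
  have Bc: "?B \<in> carrier_mat (t + r) (t + r)" using B0(1) GL_carrier[OF h(1)] ginv[OF h(1)] by simp
  have QB: "Q ?B (zdiag t a1)" using Q[OF B0(1) aS h(1) B0(2)] h(3) by simp
  let ?g = "four_block_mat (1\<^sub>m s) (0\<^sub>m s (t + r)) (0\<^sub>m (t + r) s) h"
  have "(\<Sum>c\<in>carrier_mat s (t + r). \<Sum>d\<in>Sym e s. \<psi> B0 (bordered e d c a)) =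
     (\<Sum>c\<in>carrier_mat s (t + r). \<Sum>d\<in>Sym e s. \<psi> ?B (?g * bordered e d c a * ?g\<^sup>T))"
  proof (intro sum.cong refl)
    fix c d :: "'a mat" assume c: "c \<in> carrier_mat s (t + r)" and d: "d \<in> Sym e s"
    show "\<psi> B0 (bordered e d c a) = \<psi> ?B (?g * bordered e d c a * ?g\<^sup>T)"
      by (rule inv[symmetric, OF B0(1) bordered_Sym[OF e d c aS] GL_one _ h(1)]) simp
  qed
  also have "\<dots> = (\<Sum>c\<in>carrier_mat s (t + r). \<Sum>d\<in>Sym e s. \<psi> ?B (bordered e d c (zdiag t a1)))"
    using bordered_sum_transport[OF e aS h(1) refl, of "\<psi> ?B"] h(3) by simp
  also have "\<dots> = card (full_col_rank s t :: 'a mat set) * CARD('a) ^ (s * r) *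
      (\<Sum>d\<in>Sym e s. \<psi> ?B (bordered e d (hcat (idblock s t) (0\<^sub>m s r)) (zdiag t a1)))"
  proof (rule bordered_sum_normal[OF e h(2) refl])
    show "\<And>M. M \<notin> GL (s + (t + r)) \<Longrightarrow> \<psi> ?B M = 0" by (rule zero)
    fix d c k X :: "'a mat" assume *: "d \<in> Sym e s" "c \<in> carrier_mat s (t + r)" "k \<in> GL s"
      "X \<in> carrier_mat s (t + r)"
    have S: "bordered e d c (zdiag t a1) \<in> Sym e (s + (t + r))"
      by (rule bordered_Sym[OF e *(1,2) zdiag_Sym[OF e NSym_Sym[OF h(2)]]])
    have g1: "ginv (1\<^sub>m (t + r)) = (1\<^sub>m (t + r) :: 'a mat)" using ginv[OF GL_one, of "t + r", where 'a = 'a]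
      by simp
    have B1: "1\<^sub>m (t + r) * ?B * ginv (1\<^sub>m (t + r)) = ?B" unfolding g1 using Bc
      by (simp only: left_mult_one_mat[OF Bc] right_mult_one_mat[OF Bc])
    show "\<psi> ?B (four_block_mat k X (0\<^sub>m (t + r) s) (1\<^sub>m (t + r)) * bordered e d c (zdiag t a1) *
      (four_block_mat k X (0\<^sub>m (t + r) s) (1\<^sub>m (t + r)))\<^sup>T)
      = \<psi> ?B (bordered e d c (zdiag t a1))"
      using inv[OF Bc S *(3,4) GL_one] unfolding B1 .
  qed
  also have "\<dots> = card (full_col_rank s t :: 'a mat set) * CARD('a) ^ (s * r) *
     (card (Sym e t) * CARD('a) ^ (t * (s - t)) * (\<Sum>d\<in>NSym e (s - t). f d))"
  proof (cases "s < t")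
    case True
    then show ?thesis by (simp add: full_col_rank_empty)
  next
    case False
    then obtain m where m: "s = t + m" using le_Suc_ex not_less by metis
    have "(\<Sum>d\<in>Sym e (t + m). \<psi> ?B (bordered e d (hcat (idblock (t + m) t) (0\<^sub>m (t + m) r)) (zdiag t a1))) =
      card (Sym e t) * card (carrier_mat t m :: 'a mat set) * (\<Sum>d\<in>NSym e m. f d)"
      by (rule bordered_normal_sum[OF e h(2)]) (use zero f[OF Bc h(2) QB m] m in auto)
    then show ?thesis using m by (simp add: card_carrier_mat)
  qed
  finally show ?thesis .
qed

lemma bordered_count:
  fixes e :: "'a::{field,finite}"
  assumes e: "e * e = 1" and a: "a \<in> SymN e t r"
  shows "(\<Sum>c\<in>carrier_mat s (t + r). \<Sum>d\<in>Sym e s. if bordered e d c a \<in> GL (s + (t + r)) then 1 else 0 :: nat) =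
    card (full_col_rank s t :: 'a mat set) * CARD('a) ^ (s * r) *
     (card (Sym e t) * CARD('a) ^ (t * (s - t)) * card (NSym e (s - t)))"
proof -
  have "(\<Sum>c\<in>carrier_mat s (t + r). \<Sum>d\<in>Sym e s. (\<lambda>B M. if M \<in> GL (s + (t + r)) then 1 else 0 :: nat)
    (0\<^sub>m (t + r) (t + r)) (bordered e d c a)) =
    card (full_col_rank s t :: 'a mat set) * CARD('a) ^ (s * r) *
     (card (Sym e t) * CARD('a) ^ (t * (s - t)) * (\<Sum>d\<in>NSym e (s - t). 1))"
  proof (rule bordered_sum_general[OF e a, where Q = "\<lambda>_ _. True" and f = "\<lambda>_. 1"])
    fix M k X h :: "'a mat" assume *: "M \<in> Sym e (s + (t + r))" "k \<in> GL s" "X \<in> carrier_mat s (t + r)"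
      "h \<in> GL (t + r)"
    have "four_block_mat k X (0\<^sub>m (t + r) s) h \<in> GL (s + (t + r))"
      using GL_upper_block[OF GL_carrier[OF *(2)] *(3) GL_carrier[OF *(4)]] * by blast
    then show "(if four_block_mat k X (0\<^sub>m (t + r) s) h * M * (four_block_mat k X (0\<^sub>m (t + r) s) h)\<^sup>T \<in> GL (s
      + (t + r)) then 1 else 0 :: nat)
      = (if M \<in> GL (s + (t + r)) then 1 else 0)"
      using GL_congruence_iff[OF Sym_carrier[OF *(1)]] by simp
  next
    fix a1 d11 d12 d22 :: "'a mat" and m
    assume *: "a1 \<in> NSym e r" "s = t + m" "d11 \<in> Sym e t" "d12 \<in> carrier_mat t m" "d22 \<in> NSym e m"
    show "(if bordered e (four_block_mat d11 d12 (e \<cdot>\<^sub>m d12\<^sup>T) d22) (hcat (idblock (t + m) t) (0\<^sub>m (t + m) r))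
      (zdiag t a1) \<in> GL (s + (t + r)) then 1 else 0 :: nat) = 1"
      using bordered_normal_GL[OF e Sym_carrier[OF *(3)] *(4) GL_carrier[OF NSym_GL[OF *(5)]]
        NSym_GL[OF *(1)]] NSym_GL[OF *(5)]
      unfolding *(2) by simp
  qed auto
  then show ?thesis by simp
qed

section \<open>Completions of a nilpotent intertwiner\<close>

text \<open>For \<open>M = bordered e d c a\<close> these are the extensions \<open>B\<close> of \<open>B0\<close> that preserve the radical spanned by the
  first \<open>s\<close> basis vectors.\<close>

definition Bset :: "'a::field \<Rightarrow> nat \<Rightarrow> nat \<Rightarrow> 'a mat \<Rightarrow> 'a mat \<Rightarrow> 'a mat set" where
  "Bset e s r B0 M = {B \<in> carrier_mat (s + r) (s + r).
     (\<exists>D \<in> carrier_mat s s. \<exists>C \<in> carrier_mat s r. B = four_block_mat D C (0\<^sub>m r s) B0 \<and> nilpotent_mat D) \<and>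
     B * M \<in> Sym (- e) (s + r)}"

lemma finite_Bset [simp]: "finite (Bset e s r B0 (M :: 'a::{field,finite} mat))"
  by (rule finite_subset[OF _ finite_carrier_mat]) (auto simp: Bset_def)

text \<open>\<open>B\<close> and \<open>B'\<close> are one operator in two bases adapted to the same
  subspace. Its invariance carries over, and the diagonal blocks are conjugated by \<open>k\<close>
  and by \<open>h\<close>.\<close>

lemma block_triangular_intertwine:
  assumes k: "k \<in> GL s" and X: "X \<in> carrier_mat s r" and h: "h \<in> GL r" and B0: "B0 \<in> carrier_mat r r"
    and B: "B \<in> carrier_mat (s + r) (s + r)" and B': "B' \<in> carrier_mat (s + r) (s + r)"
    and eq: "four_block_mat k X (0\<^sub>m r s) h * B = B' * four_block_mat k X (0\<^sub>m r s) h"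
  shows "(\<exists>D \<in> carrier_mat s s. \<exists>C \<in> carrier_mat s r. B = four_block_mat D C (0\<^sub>m r s) B0 \<and> nilpotent_mat D) \<longleftrightarrow>
    (\<exists>D \<in> carrier_mat s s. \<exists>C \<in> carrier_mat s r. B' = four_block_mat D C (0\<^sub>m r s) (h * B0 * ginv h)
      \<and> nilpotent_mat D)"
proof -
  note kc = GL_carrier[OF k] and hc = GL_carrier[OF h] and hi = ginv[OF h]
  obtain D C R T where b: "D \<in> carrier_mat s s" "C \<in> carrier_mat s r" "R \<in> carrier_mat r s"
    "T \<in> carrier_mat r r"
    "B = four_block_mat D C R T" using four_block_cases[OF B] by metis
  obtain P Q S U where b': "P \<in> carrier_mat s s" "Q \<in> carrier_mat s r" "S \<in> carrier_mat r s"
    "U \<in> carrier_mat r r"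
    "B' = four_block_mat P Q S U" using four_block_cases[OF B'] by metis
  have l: "four_block_mat k X (0\<^sub>m r s) h * B
    = four_block_mat (k * D + X * R) (k * C + X * T) (0\<^sub>m r s * D + h * R) (0\<^sub>m r s * C + h * T)"
    unfolding b(5) by (rule mult_four_block_mat[OF kc X _ hc b(1-4)]) simp
  have r: "B' * four_block_mat k X (0\<^sub>m r s) h
    = four_block_mat (P * k + Q * 0\<^sub>m r s) (P * X + Q * h) (S * k + U * 0\<^sub>m r s) (S * X + U * h)"
    unfolding b'(5) by (rule mult_four_block_mat[OF b'(1-4) kc X _ hc]) simp
  have "k * D + X * R = P * k + Q * 0\<^sub>m r s \<and> k * C + X * T = P * X + Q * h \<and> 0\<^sub>m r s * D + h * R = S * k
    + U * 0\<^sub>m r s \<and>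
     0\<^sub>m r s * C + h * T = S * X + U * h"
    using eq unfolding l r
    by (rule four_block_cong_iff[of _ s s _ r _ r, THEN
      iffD1, rotated 8]) (use kc X hc b(1-4) b'(1-4) in \<open>auto intro!: carrier_matI\<close>)
  then have eqs: "k * D + X * R = P * k" "h * R = S * k" "h * T = S * X + U * h"
    using kc X hc b(1-4) b'(1-4) by auto
  have nil: "nilpotent_mat D \<longleftrightarrow> nilpotent_mat P" if "k * D = P * k"
    by (rule nil_intertwine[OF k b(1) b'(1) that])
  have hB0: "h * B0 * ginv h * h = h * B0"
  proof -
    have "h * B0 * ginv h * h = h * B0 * (ginv h * h)"
      by (rule assoc_mult_mat[of _ r r _ r _ r]) (use hc hi B0 in simp_all)
    then show ?thesis using hi hc B0 by simp
  qed
  have hBc: "h * B0 * ginv h \<in> carrier_mat r r" using hc hi B0 by simp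
  show ?thesis
  proof
    assume "\<exists>D \<in> carrier_mat s s. \<exists>C \<in> carrier_mat s r. B = four_block_mat D C (0\<^sub>m r s) B0 \<and> nilpotent_mat D"
    then obtain D1 C1 where 1: "D1 \<in> carrier_mat s s" "C1 \<in> carrier_mat s r" "B
      = four_block_mat D1 C1 (0\<^sub>m r s) B0" "nilpotent_mat D1" by blast
    have "D = D1 \<and> C = C1 \<and> R = 0\<^sub>m r s \<and> T = B0"
      using 1(3) unfolding b(5)
      by (rule four_block_cong_iff[of _ s s _ r _ r, THEN iffD1, rotated 8]) (use b(1-4) 1 B0 in simp_all)
    then have e1: "R = 0\<^sub>m r s" "T = B0" "nilpotent_mat D" using 1 by auto
    have "S * k = 0\<^sub>m r s" unfolding eqs(2)[symmetric] e1 using hc by simp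
    also have "\<dots> = 0\<^sub>m r s * k" using kc by simp
    finally have "S * k = 0\<^sub>m r s * k" .
    then have S: "S = 0\<^sub>m r s" by (rule GL_cancel_right[OF k b'(3) zero_carrier_mat])
    have "k * D = P * k" using eqs(1) X kc b unfolding e1 by simp
    then have P: "nilpotent_mat P" using nil e1 by blast
    have "U * h = h * B0" using eqs(3) X hc b' unfolding e1 S by simp
    then have "U * h = h * B0 * ginv h * h" unfolding hB0 .
    then have "U = h * B0 * ginv h" by (rule GL_cancel_right[OF h b'(4) hBc])
    then show "\<exists>D \<in> carrier_mat s s. \<exists>C \<in> carrier_mat s r. B' = four_block_mat D C (0\<^sub>m r s) (h * B0 * ginv h)
      \<and> nilpotent_mat D"
      using b' S P by blast
  next
    assume "\<exists>D \<in> carrier_mat s s. \<exists>C \<in> carrier_mat s r. B' = four_block_mat D C (0\<^sub>m r s) (h * B0 * ginv h)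
      \<and> nilpotent_mat D"
    then obtain D1 C1 where 1: "D1 \<in> carrier_mat s s" "C1 \<in> carrier_mat s r" "B'
      = four_block_mat D1 C1 (0\<^sub>m r s) (h * B0 * ginv h)" "nilpotent_mat D1" by blast
    have "P = D1 \<and> Q = C1 \<and> S = 0\<^sub>m r s \<and> U = h * B0 * ginv h"
      using 1(3) unfolding b'(5)
      by (rule four_block_cong_iff[of _ s s _ r _ r, THEN iffD1, rotated 8]) (use b'(1-4) 1 hBc in simp_all)
    then have e1: "S = 0\<^sub>m r s" "U = h * B0 * ginv h" "nilpotent_mat P" using 1 by auto
    have "h * R = h * 0\<^sub>m r s" using eqs(2) hc kc unfolding e1 by simp
    then have R: "R = 0\<^sub>m r s" by (rule GL_cancel_left[OF h b(3) zero_carrier_mat])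
    have "k * D = P * k" using eqs(1) X kc b unfolding R by simp
    then have D: "nilpotent_mat D" using nil e1 by blast
    have "h * T = h * B0" using eqs(3) X hc b' B0 unfolding e1 hB0 by (simp del: assoc_mult_mat)
    then have "T = B0" by (rule GL_cancel_left[OF h b(4) B0])
    then show "\<exists>D \<in> carrier_mat s s. \<exists>C \<in> carrier_mat s r. B = four_block_mat D C (0\<^sub>m r s) B0
      \<and> nilpotent_mat D"
      using b R D by blast
  qed
qed

lemma conj_congruence_Sym:
  assumes g: "g \<in> GL n" and B: "B \<in> carrier_mat n n" and M: "M \<in> carrier_mat n n"
  shows "g * B * ginv g * (g * M * g\<^sup>T) = g * (B * M) * g\<^sup>T"
    and "g * B * ginv g * (g * M * g\<^sup>T) \<in> Sym e n \<longleftrightarrow> B * M \<in> Sym e n"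
proof -
  note gc = GL_carrier[OF g] and gi = ginv[OF g]
  have "g * B * ginv g * (g * M * g\<^sup>T) = g * B * (ginv g * (g * M * g\<^sup>T))"
    by (rule assoc_mult_mat[of _ n n _ n _ n]) (use gc gi B M in simp_all)
  also have "ginv g * (g * M * g\<^sup>T) = ginv g * (g * (M * g\<^sup>T))"
    by (simp only: assoc_mult_mat[OF gc M transpose_carrier_mat[THEN iffD2, OF gc]])
  also have "\<dots> = ginv g * g * (M * g\<^sup>T)"
    by (rule assoc_mult_mat[of _ n n _ n _ n, symmetric]) (use gc gi B M in simp_all)
  also have "\<dots> = M * g\<^sup>T" unfolding gi(3) by (rule left_mult_one_mat[of _ n n]) (use gc M in simp)
  also have "g * B * (M * g\<^sup>T) = g * (B * (M * g\<^sup>T))"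
    by (rule assoc_mult_mat[of _ n n _ n _ n]) (use gc gi B M in simp_all)
  also have "B * (M * g\<^sup>T) = B * M * g\<^sup>T"
    by (rule assoc_mult_mat[of _ n n _ n _ n, symmetric]) (use gc gi B M in simp_all)
  also have "g * (B * M * g\<^sup>T) = g * (B * M) * g\<^sup>T"
    by (rule assoc_mult_mat[of _ n n _ n _ n, symmetric]) (use gc gi B M in simp_all)
  finally show *: "g * B * ginv g * (g * M * g\<^sup>T) = g * (B * M) * g\<^sup>T" .
  have BM: "B * M \<in> carrier_mat n n" using B M by simp
  show "g * B * ginv g * (g * M * g\<^sup>T) \<in> Sym e n \<longleftrightarrow> B * M \<in> Sym e n" unfolding *
  proof
    assume "g * (B * M) * g\<^sup>T \<in> Sym e n"
    then show "B * M \<in> Sym e n"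
      using Sym_congruence[of "g * (B * M) * g\<^sup>T" e n "ginv g" n] gi congruence_inverse(1)[OF BM g] by simp
  next
    assume "B * M \<in> Sym e n" then show "g * (B * M) * g\<^sup>T \<in> Sym e n" by (rule Sym_congruence[OF _ gc])
  qed
qed

lemma conj_inverse:
  assumes g: "g \<in> GL n" and B: "B \<in> carrier_mat n n"
  shows "ginv g * (g * B * ginv g) * g = B" "g * (ginv g * B * g) * ginv g = B" "g * B * ginv g * g = g * B"
proof -
  note gc = GL_carrier[OF g] and gi = ginv[OF g]
  have "g * B * ginv g * g = g * B * (ginv g * g)"
    by (rule assoc_mult_mat[of _ n n _ n _ n]) (use gc gi B in simp_all)
  then show 1: "g * B * ginv g * g = g * B" using gc gi B by simp
  have "ginv g * (g * B * ginv g) * g = ginv g * (g * B * ginv g * g)"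
    by (rule assoc_mult_mat[of _ n n _ n _ n]) (use gc gi B in simp_all)
  also have "\<dots> = ginv g * g * B" unfolding 1
    by (rule assoc_mult_mat[of _ n n _ n _ n, symmetric]) (use gc gi B in simp_all)
  finally show "ginv g * (g * B * ginv g) * g = B" using gi B by simp
  have "g * (ginv g * B * g) * ginv g = g * (ginv g * B * g * ginv g)"
    by (rule assoc_mult_mat[of _ n n _ n _ n]) (use gc gi B in simp_all)
  also have "ginv g * B * g * ginv g = ginv g * B * (g * ginv g)"
    by (rule assoc_mult_mat[of _ n n _ n _ n]) (use gc gi B in simp_all)
  also have "\<dots> = ginv g * B" using gi B by simp
  also have "g * (ginv g * B) = g * ginv g * B"
    by (rule assoc_mult_mat[of _ n n _ n _ n, symmetric]) (use gc gi B in simp_all)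
  finally show "g * (ginv g * B * g) * ginv g = B" using gi B by simp
qed

lemma Bset_transport:
  fixes e :: "'a::{field,finite}"
  assumes k: "k \<in> GL s" and X: "X \<in> carrier_mat s r" and h: "h \<in> GL r" and B0: "B0 \<in> carrier_mat r r"
    and M: "M \<in> carrier_mat (s + r) (s + r)" and g: "g = four_block_mat k X (0\<^sub>m r s) h"
  shows "card (Bset e s r (h * B0 * ginv h) (g * M * g\<^sup>T)) = card (Bset e s r B0 M)"
proof -
  have gG: "g \<in> GL (s + r)" unfolding g using GL_upper_block[OF GL_carrier[OF k] X GL_carrier[OF h]] k h
    by blast
  note gc = GL_carrier[OF gG] and gi = ginv[OF gG]
  have iff: "g * B * ginv g \<in> Bset e s r (h * B0 * ginv h) (g * M * g\<^sup>T) \<longleftrightarrow> B \<in> Bset e s r B0 M"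
    if B: "B \<in> carrier_mat (s + r) (s + r)" for B
  proof -
    have B': "g * B * ginv g \<in> carrier_mat (s + r) (s + r)" using gc gi B by simp
    have geq: "four_block_mat k X (0\<^sub>m r s) h * B = g * B * ginv g * four_block_mat k X (0\<^sub>m r s) h"
      unfolding g[symmetric] by (rule conj_inverse(3)[OF gG B, symmetric])
    show ?thesis
      unfolding Bset_def mem_Collect_eq conj_congruence_Sym(2)[OF gG B M]
        block_triangular_intertwine[OF k X h B0 B B' geq]
      using B B' by blast
  qed
  have "bij_betw (\<lambda>B. g * B * ginv g) (Bset e s r B0 M) (Bset e s r (h * B0 * ginv h) (g * M * g\<^sup>T))"
  proof (rule bij_betwI[where g = "\<lambda>B. ginv g * B * g"])
    have c: "B \<in> carrier_mat (s + r) (s + r)" if "B \<in> Bset e s r B0 M" for B B0 M using that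
      unfolding Bset_def by blast
    show "(\<lambda>B. g * B * ginv g) \<in> Bset e s r B0 M \<rightarrow> Bset e s r (h * B0 * ginv h) (g * M * g\<^sup>T)"
      using iff c by blast
    show "(\<lambda>B. ginv g * B * g) \<in> Bset e s r (h * B0 * ginv h) (g * M * g\<^sup>T) \<rightarrow> Bset e s r B0 M"
    proof
      fix B assume B: "B \<in> Bset e s r (h * B0 * ginv h) (g * M * g\<^sup>T)"
      have "ginv g * B * g \<in> carrier_mat (s + r) (s + r)" using gc gi c[OF B] by simp
      from iff[OF this] show "ginv g * B * g \<in> Bset e s r B0 M" using B
        unfolding conj_inverse(2)[OF gG c[OF B]] by blast
    qed
    show "ginv g * (g * B * ginv g) * g = B" if "B \<in> Bset e s r B0 M" for B
      by (rule conj_inverse[OF gG c[OF that]])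
    show "g * (ginv g * B * g) * ginv g = B" if "B \<in> Bset e s r (h * B0 * ginv h) (g * M * g\<^sup>T)" for B
      by (rule conj_inverse[OF gG c[OF that]])
  qed
  then show ?thesis by (rule bij_betw_same_card[symmetric])
qed

text \<open>Comparison of blocks in \<open>eq1\<close> shows that the first block column of
  \<open>D\<close> is \<open>- w\<^sup>T\<close> over zero, and the lower right block of
  \<open>eq2\<close> reads \<open>D22 * d22 = g22\<close>. Hence \<open>D\<close> is block
  triangular with diagonal blocks \<open>- w\<^sup>T\<close>, nilpotent along with \<open>w\<close>,
  and \<open>g22 * ginv d22\<close>.\<close>

lemma nil_D_normal:
  fixes e :: "'a::field"
  assumes e: "e * e = 1" and a1: "a1 \<in> GL r" and d22: "d22 \<in> GL m"
    and d: "d11 \<in> carrier_mat t t" "d12 \<in> carrier_mat t m" "d21 \<in> carrier_mat m t"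
    and w: "w \<in> carrier_mat t t" "y \<in> carrier_mat r t" "p \<in> carrier_mat r r" "nilpotent_mat w"
    and D: "D \<in> carrier_mat (t + m) (t + m)" and C: "C \<in> carrier_mat (t + m) (t + r)"
    and g: "g11 \<in> carrier_mat t t" "g12 \<in> carrier_mat t m" "g21 \<in> carrier_mat m t" "g22 \<in> carrier_mat m m"
    and eq1: "D * four_block_mat (1\<^sub>m t) (0\<^sub>m t r) (0\<^sub>m m t) (0\<^sub>m m r) + C * zdiag t a1 =
       - (four_block_mat (1\<^sub>m t) (0\<^sub>m t r) (0\<^sub>m m t) (0\<^sub>m m r) * (four_block_mat w (0\<^sub>m t r) y p)\<^sup>T)"
    and eq2: "D * four_block_mat d11 d12 d21 d22
      + C * four_block_mat (e \<cdot>\<^sub>m 1\<^sub>m t) (0\<^sub>m t m) (0\<^sub>m r t) (0\<^sub>m r m) =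
       four_block_mat g11 g12 g21 g22"
  shows "nilpotent_mat D \<longleftrightarrow> nilpotent_mat (g22 * ginv d22)"
proof -
  note a1c = GL_carrier[OF a1] and dc = GL_carrier[OF d22] and di = ginv[OF d22]
  obtain D11 D12 D21 D22 where D4: "D11 \<in> carrier_mat t t" "D12 \<in> carrier_mat t m" "D21 \<in> carrier_mat m t"
    "D22 \<in> carrier_mat m m"
    "D = four_block_mat D11 D12 D21 D22" using four_block_cases[OF D] by metis
  obtain C11 C12 C21 C22 where C4: "C11 \<in> carrier_mat t t" "C12 \<in> carrier_mat t r" "C21 \<in> carrier_mat m t"
    "C22 \<in> carrier_mat m r"
    "C = four_block_mat C11 C12 C21 C22" using four_block_cases[OF C] by metis
  have 1: "D * four_block_mat (1\<^sub>m t) (0\<^sub>m t r) (0\<^sub>m m t) (0\<^sub>m m r)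
    = four_block_mat D11 (0\<^sub>m t r) D21 (0\<^sub>m m r)"
    unfolding D4(5) by (subst mult_four_block_mat[OF D4(1-4), of _ t _ r]) (use D4(1-4) in simp_all)
  have 2: "C * zdiag t a1 = four_block_mat (0\<^sub>m t t) (C12 * a1) (0\<^sub>m m t) (C22 * a1)"
    unfolding C4(5) zdiag_eq[OF a1c] by (subst mult_four_block_mat[OF C4(1-4), of _ t _ r])
      (use C4(1-4) a1c in simp_all)
  have 3: "(four_block_mat w (0\<^sub>m t r) y p)\<^sup>T = four_block_mat w\<^sup>T y\<^sup>T (0\<^sub>m r t) p\<^sup>T"
    by (subst transpose_four_block_mat[of _ t t _ r _ r]) (use w in simp_all)
  have 4: "four_block_mat (1\<^sub>m t) (0\<^sub>m t r) (0\<^sub>m m t) (0\<^sub>m m r) * (four_block_mat w (0\<^sub>m t r) y p)\<^sup>T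
     = four_block_mat w\<^sup>T y\<^sup>T (0\<^sub>m m t) (0\<^sub>m m r)"
    unfolding 3 by (subst mult_four_block_mat[of _ t t _ r _ m _ _ t _ r]) (use w in simp_all)
  have 5: "- four_block_mat w\<^sup>T y\<^sup>T (0\<^sub>m m t) (0\<^sub>m m r) = four_block_mat (- w\<^sup>T) (- y\<^sup>T) (0\<^sub>m m t) (0\<^sub>m m r)"
    by (rule eq_matI) (use w in auto)
  have "four_block_mat (D11 + 0\<^sub>m t t) (0\<^sub>m t r + C12 * a1) (D21 + 0\<^sub>m m t) (0\<^sub>m m r + C22 * a1) =
     four_block_mat (- w\<^sup>T) (- y\<^sup>T) (0\<^sub>m m t) (0\<^sub>m m r)"
    using eq1 unfolding 1 2 4 5
    by (subst add_four_block_mat[of _ t t _ r _ m, symmetric]) (use D4(1-4) C4(1-4) a1c in simp_all)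
  then have "D11 + 0\<^sub>m t t = - w\<^sup>T \<and> 0\<^sub>m t r + C12 * a1 = - y\<^sup>T \<and> D21 + 0\<^sub>m m t = 0\<^sub>m m t \<and> 0\<^sub>m m r + C22 * a1
    = 0\<^sub>m m r"
    by (rule four_block_cong_iff[of _ t t _ r _ m, THEN
      iffD1, rotated 8]) (use D4(1-4) C4(1-4) a1c w in simp_all)
  then have D11: "D11 = - w\<^sup>T" and D21: "D21 = 0\<^sub>m m t" using D4(1,3) by simp_all
  have 6: "D * four_block_mat d11 d12 d21 d22
    = four_block_mat (D11 * d11 + D12 * d21) (D11 * d12 + D12 * d22) (D22 * d21) (D22 * d22)"
    unfolding D4(5) D21 by (subst mult_four_block_mat[of _ t t _ m _ m _ _ t _ m])
      (use D4(1-4) d dc in simp_all)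
  have 7: "C * four_block_mat (e \<cdot>\<^sub>m 1\<^sub>m t) (0\<^sub>m t m) (0\<^sub>m r t) (0\<^sub>m r m)
    = four_block_mat (C11 * (e \<cdot>\<^sub>m 1\<^sub>m t)) (0\<^sub>m t m) (C21 * (e \<cdot>\<^sub>m 1\<^sub>m t)) (0\<^sub>m m m)"
    unfolding C4(5) by (subst mult_four_block_mat[OF C4(1-4), of _ t _ m]) (use C4(1-4) in simp_all)
  have "four_block_mat (D11 * d11 + D12 * d21 + C11 * (e \<cdot>\<^sub>m 1\<^sub>m t)) (D11 * d12 + D12 * d22 + 0\<^sub>m t m)
     (D22 * d21 + C21 * (e \<cdot>\<^sub>m 1\<^sub>m t)) (D22 * d22 + 0\<^sub>m m m) = four_block_mat g11 g12 g21 g22"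
    using eq2 unfolding 6 7
    by (subst add_four_block_mat[of _ t t _ m _ m, symmetric])
      (use D4(1-4) C4(1-4) d dc in \<open>auto intro!: carrier_matI\<close>)
  then have "D11 * d11 + D12 * d21 + C11 * (e \<cdot>\<^sub>m 1\<^sub>m t) = g11 \<and> D11 * d12 + D12 * d22 + 0\<^sub>m t m = g12 \<and>
     D22 * d21 + C21 * (e \<cdot>\<^sub>m 1\<^sub>m t) = g21 \<and> D22 * d22 + 0\<^sub>m m m = g22"
    by (rule four_block_cong_iff[of _ t t _ m _ m, THEN
      iffD1, rotated 8]) (use D4(1-4) C4(1-4) d dc g in \<open>auto intro!: carrier_matI\<close>)
  then have g22: "g22 = D22 * d22" using D4(4) dc by simp
  have "g22 * ginv d22 = D22 * (d22 * ginv d22)" unfolding g22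
    by (rule assoc_mult_mat[of _ m m _ m _ m]) (use D4(4) dc di in simp_all)
  then have D22: "g22 * ginv d22 = D22" using di D4(4) by simp
  have "nilpotent_mat D11" unfolding D11 using nil_uminus[of "w\<^sup>T" t] nil_transpose[OF w(1)] w by simp
  then show ?thesis unfolding D22 D4(5) D21 using nil_upper_block[OF D4(1,2,4)] by blast
qed

lemma zdiag_mult_right:
  fixes a1 :: "'a::field mat"
  assumes "w \<in> carrier_mat t t" "x \<in> carrier_mat t r" "y \<in> carrier_mat r t" "p \<in> carrier_mat r r"
    "a1 \<in> carrier_mat r r"
  shows "four_block_mat w x y p * zdiag t a1 = four_block_mat (0\<^sub>m t t) (x * a1) (0\<^sub>m r t) (p * a1)"
  unfolding zdiag_eq[OF assms(5)] by (subst mult_four_block_mat[OF assms(1-4), of _ t _ r])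
    (use assms in simp_all)

text \<open>The first block column of \<open>B0 * zdiag t a1\<close> is zero; by the sign condition
  its first block row is zero as well, and \<open>a1\<close> cancels.\<close>

lemma skew_zdiag_block:
  fixes e :: "'a::field"
  assumes e: "e * e = 1" and a1: "a1 \<in> GL r" and B0: "B0 \<in> carrier_mat (t + r) (t + r)"
    and S: "B0 * zdiag t a1 \<in> Sym e (t + r)"
  obtains w y p where "w \<in> carrier_mat t t" "y \<in> carrier_mat r t" "p \<in> carrier_mat r r" "B0
    = four_block_mat w (0\<^sub>m t r) y p"
proof -
  note a1c = GL_carrier[OF a1]
  obtain w x y p where b: "w \<in> carrier_mat t t" "x \<in> carrier_mat t r" "y \<in> carrier_mat r t"
    "p \<in> carrier_mat r r"
    "B0 = four_block_mat w x y p" using four_block_cases[OF B0] by metis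
  have "0\<^sub>m r t = e \<cdot>\<^sub>m (x * a1)\<^sup>T"
    using S unfolding b(5) zdiag_mult_right[OF b(1-4) a1c]
    by (subst (asm) Sym_block[OF e]) (use b(1-4) a1c in auto)
  then have "e \<cdot>\<^sub>m 0\<^sub>m r t = e \<cdot>\<^sub>m (e \<cdot>\<^sub>m (x * a1)\<^sup>T)" by simp
  then have "(x * a1)\<^sup>T = 0\<^sub>m r t" unfolding smult_smult e by simp
  then have "x * a1 = 0\<^sub>m t r" by (metis transpose_transpose zero_transpose_mat)
  then have "x * a1 = 0\<^sub>m t r * a1" using a1c by simp
  then have "x = 0\<^sub>m t r" by (rule GL_cancel_right[OF a1 b(2) zero_carrier_mat])
  with b that show thesis by blast
qed

text \<open>An extension \<open>B\<close> is recovered from the form \<open>B * M\<close>. Of its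
  blocks only the upper left one, \<open>g\<close>, is free: the lower ones are \<open>B0\<close>
  times those of \<open>M\<close>, and the sign condition supplies the upper right one. Conversely
  every \<open>g\<close> of sign \<open>- e\<close> occurs, and nilpotency restricts just its lower
  right block of size \<open>m\<close>.\<close>

lemma card_Bset_normal:
  fixes e :: "'a::{field,finite}"
  assumes e: "e * e = 1" and a1: "a1 \<in> NSym e r" and B0: "B0 \<in> carrier_mat (t + r) (t + r)" "nilpotent_mat B0"
    and S: "B0 * zdiag t a1 \<in> Sym (- e) (t + r)"
    and d: "d11 \<in> Sym e t" "d12 \<in> carrier_mat t m" "d22 \<in> NSym e m"
    and M: "M = bordered e (four_block_mat d11 d12 (e \<cdot>\<^sub>m d12\<^sup>T) d22)
      (hcat (idblock (t + m) t) (0\<^sub>m (t + m) r)) (zdiag t a1)"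
  shows "card (Bset e (t + m) (t + r) B0 M) =
    card (Sym (- e) t) * card (carrier_mat t m :: 'a mat set)
      * card {h \<in> Sym (- e) m. nilpotent_mat (h * ginv d22)}"
proof -
  let ?s = "t + m" and ?r = "t + r"
  define d where "d = four_block_mat d11 d12 (e \<cdot>\<^sub>m d12\<^sup>T) d22"
  define c :: "'a mat" where "c = hcat (idblock (t + m) t) (0\<^sub>m (t + m) r)"
  define a where "a = zdiag t a1"
  define ec where "ec = e \<cdot>\<^sub>m c\<^sup>T"
  have Mb: "M = four_block_mat d c ec a" unfolding M bordered_def d_def c_def a_def ec_def ..
  have me: "(- e) * (- e) = 1" using e by simp
  have a1G: "a1 \<in> GL r" by (rule NSym_GL[OF a1])
  note a1c = GL_carrier[OF a1G]
  have MG: "M \<in> GL (?s + ?r)"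
    unfolding M using bordered_normal_GL[OF e Sym_carrier[OF d(1)] d(2) GL_carrier[OF NSym_GL[OF d(3)]] a1G]
      NSym_GL[OF d(3)] by blast
  note Mc = GL_carrier[OF MG] and Mi = ginv[OF MG]
  have dc: "d \<in> carrier_mat ?s ?s" unfolding d_def using Sym_carrier[OF d(1)] GL_carrier[OF NSym_GL[OF d(3)]]
    by simp
  have cc: "c \<in> carrier_mat ?s ?r" unfolding c_def by simp
  have ecc: "ec \<in> carrier_mat ?r ?s" unfolding ec_def using cc by simp
  have ac: "a \<in> carrier_mat ?r ?r" unfolding a_def using a1c by simp
  obtain w y p where w: "w \<in> carrier_mat t t" "y \<in> carrier_mat r t" "p \<in> carrier_mat r r" "B0
    = four_block_mat w (0\<^sub>m t r) y p"
    using skew_zdiag_block[OF me a1G B0(1) S] .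
  have nilw: "nilpotent_mat w" using B0(2) unfolding w(4) nil_lower_block[OF w(1-3)] by blast
  have B0T: "B0\<^sup>T \<in> carrier_mat ?r ?r" using B0(1) by simp
  \<comment> \<open>The upper right block that the sign condition imposes on \<open>B * M\<close>,
    whose lower left block is \<open>B0 * ec\<close>.\<close>
  define \<gamma> where "\<gamma> = - (c * B0\<^sup>T)"
  have \<gamma>c: "\<gamma> \<in> carrier_mat ?s ?r" unfolding \<gamma>_def using cc B0T by simp
  have B0ec: "B0 * ec = (- e) \<cdot>\<^sub>m \<gamma>\<^sup>T"
  proof -
    have "(c * B0\<^sup>T)\<^sup>T = (B0\<^sup>T)\<^sup>T * c\<^sup>T" by (rule transpose_mult[OF cc B0T])
    moreover have "B0 * (e \<cdot>\<^sub>m c\<^sup>T) = e \<cdot>\<^sub>m (B0 * c\<^sup>T)"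
      by (rule mult_smult_distrib[OF B0(1)]) (use cc in simp)
    ultimately show ?thesis unfolding ec_def \<gamma>_def transpose_uminus by (intro eq_matI) auto
  qed
  define \<Gamma> where "\<Gamma> g = bordered (- e) g \<gamma> (B0 * a)" for g
  have S': "B0 * a \<in> Sym (- e) ?r" using S unfolding a_def .
  have \<Gamma>S: "\<Gamma> g \<in> Sym (- e) (?s + ?r)" if "g \<in> Sym (- e) ?s" for g
    unfolding \<Gamma>_def by (rule bordered_Sym[OF me that \<gamma>c S'])
  have \<Gamma>b: "\<Gamma> g = four_block_mat g \<gamma> (B0 * ec) (B0 * a)" for g unfolding \<Gamma>_def bordered_def B0ec ..
  have BM: "four_block_mat D C (0\<^sub>m ?r ?s) B0 * M
    = four_block_mat (D * d + C * ec) (D * c + C * a) (B0 * ec) (B0 * a)"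
    if "D \<in> carrier_mat ?s ?s" "C \<in> carrier_mat ?s ?r" for D C
    unfolding Mb by (subst mult_four_block_mat[OF that _ B0(1) dc cc ecc ac])
      (use dc cc ecc ac B0(1) in simp_all)
  define F where "F g = \<Gamma> g * ginv M" for g
  have Fc: "F g \<in> carrier_mat (?s + ?r) (?s + ?r)" if "g \<in> Sym (- e) ?s" for g
    unfolding F_def using Sym_carrier[OF \<Gamma>S[OF that]] Mi(1) by simp
  have FM: "F g * M = \<Gamma> g" if "g \<in> Sym (- e) ?s" for g
  proof -
    have "\<Gamma> g * ginv M * M = \<Gamma> g * (ginv M * M)"
      by (rule assoc_mult_mat[OF Sym_carrier[OF \<Gamma>S[OF that]] Mi(1) Mc])
    then show ?thesis unfolding F_def Mi(3) using Sym_carrier[OF \<Gamma>S[OF that]] by simp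
  qed
  have cblock: "c = four_block_mat (1\<^sub>m t) (0\<^sub>m t r) (0\<^sub>m m t) (0\<^sub>m m r)" unfolding c_def
    by (rule hcat_idblock)
  have ecblock: "ec = four_block_mat (e \<cdot>\<^sub>m 1\<^sub>m t) (0\<^sub>m t m) (0\<^sub>m r t) (0\<^sub>m r m)"
    unfolding ec_def c_def by (rule smult_transpose_hcat_idblock)
  have Fiff: "F g \<in> Bset e ?s ?r B0 M \<longleftrightarrow> nilpotent_mat (h * ginv d22)"
    if x: "x \<in> Sym (- e) t" "z \<in> carrier_mat t m" "h \<in> Sym (- e) m"
      and g: "g = four_block_mat x z ((- e) \<cdot>\<^sub>m z\<^sup>T) h" for x z h g
  proof -
    have gS: "g \<in> Sym (- e) ?s" unfolding g by (rule Sym_block_I[OF me x])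
    obtain D C R T where b: "D \<in> carrier_mat ?s ?s" "C \<in> carrier_mat ?s ?r" "R \<in> carrier_mat ?r ?s"
      "T \<in> carrier_mat ?r ?r"
      "F g = four_block_mat D C R T" using four_block_cases[OF Fc[OF gS]] by metis
    have "four_block_mat (D * d + C * ec) (D * c + C * a) (R * d + T * ec) (R * c + T * a) = \<Gamma> g"
      unfolding FM[OF gS, symmetric] b(5) Mb by (rule mult_four_block_mat[OF b(1-4) dc cc ecc ac, symmetric])
    then have "D * d + C * ec = g \<and> D * c + C * a = \<gamma> \<and> R * d + T * ec = B0 * ec \<and> R * c + T * a = B0 * a"
      unfolding \<Gamma>b by (rule four_block_cong_iff[of _ ?s ?s _ ?r _ ?r, THEN iffD1, rotated 8])
        (use b(1-4) dc cc ecc ac B0(1) \<gamma>c Sym_carrier[OF gS] in \<open>auto intro!: carrier_matI\<close>)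
    then have eqs: "D * d + C * ec = g" "D * c + C * a = \<gamma>" by auto
    \<comment> \<open>The matrix with last block row \<open>0, B0\<close> has the same product with
      \<open>M\<close> as \<open>F g\<close>. Cancelling the nonsingular \<open>M\<close> shows that
      \<open>F g\<close> has this triangular shape.\<close>
    have BF: "four_block_mat D C (0\<^sub>m ?r ?s) B0 * M = F g * M" unfolding BM[OF b(1,2)] eqs FM[OF gS] \<Gamma>b ..
    have FB: "F g = four_block_mat D C (0\<^sub>m ?r ?s) B0"
      by (rule GL_cancel_right[OF MG Fc[OF gS] _ BF[symmetric]]) (use b B0(1) in simp)
    have nilD: "nilpotent_mat D \<longleftrightarrow> nilpotent_mat (h * ginv d22)"
      by (rule nil_D_normal[where ?d21.0 = "e \<cdot>\<^sub>m d12\<^sup>T"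
        and ?g21.0 = "(- e) \<cdot>\<^sub>m z\<^sup>T", OF e a1G NSym_GL[OF d(3)] Sym_carrier[OF d(1)] d(2) _ w(1-3) nilw b(1,2)
        Sym_carrier[OF x(1)] x(2) _ Sym_carrier[OF x(3)]])
        (use eqs x d in \<open>simp_all only: cblock[symmetric] ecblock[symmetric] d_def[symmetric] a_def[symmetric]
          w(4)[symmetric] \<gamma>_def[symmetric] g[symmetric]
           smult_carrier_mat transpose_carrier_mat\<close>)
    have uniq: "D' = D" if "D' \<in> carrier_mat ?s ?s" "C' \<in> carrier_mat ?s ?r" "F g
      = four_block_mat D' C' (0\<^sub>m ?r ?s) B0" for D' C'
    proof -
      have "D' = D \<and> C' = C \<and> 0\<^sub>m ?r ?s = (0\<^sub>m ?r ?s :: 'a mat) \<and> B0 = B0"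
        using that(3) unfolding FB
        by (intro four_block_cong_iff[of _ ?s ?s _ ?r _ ?r, THEN iffD1]) (use that b B0(1) in simp_all)
      then show ?thesis by blast
    qed
    have "(\<exists>D \<in> carrier_mat ?s ?s. \<exists>C \<in> carrier_mat ?s ?r. F g = four_block_mat D C (0\<^sub>m ?r ?s) B0
      \<and> nilpotent_mat D)
       \<longleftrightarrow> nilpotent_mat D" using FB b(1,2) uniq by blast
    then show ?thesis unfolding Bset_def mem_Collect_eq FM[OF gS] using Fc[OF gS] \<Gamma>S[OF gS] nilD by blast
  qed
  have Fsurj: "\<exists>g \<in> Sym (- e) ?s. B = F g" if "B \<in> Bset e ?s ?r B0 M" for B
  proof -
    from that obtain D C where b: "D \<in> carrier_mat ?s ?s" "C \<in> carrier_mat ?s ?r" "B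
      = four_block_mat D C (0\<^sub>m ?r ?s) B0"
      and BS: "B * M \<in> Sym (- e) (?s + ?r)" and Bc: "B \<in> carrier_mat (?s + ?r) (?s + ?r)" unfolding Bset_def
        by blast
    have t1: "D * d + C * ec \<in> carrier_mat ?s ?s" and t2: "D * c + C * a \<in> carrier_mat ?s ?r"
      and t3: "B0 * ec \<in> carrier_mat ?r ?s" and t4: "B0 * a \<in> carrier_mat ?r ?r"
      using b(1,2) dc cc ecc ac B0(1) by (auto intro!: carrier_matI)
    have *: "D * d + C * ec \<in> Sym (- e) ?s" "B0 * ec = (- e) \<cdot>\<^sub>m (D * c + C * a)\<^sup>T"
      using BS unfolding b(3) BM[OF b(1,2)] Sym_block[OF me t1 t2 t3 t4] by blast+
    have "(- e) \<cdot>\<^sub>m ((- e) \<cdot>\<^sub>m (D * c + C * a)\<^sup>T) = (- e) \<cdot>\<^sub>m ((- e) \<cdot>\<^sub>m \<gamma>\<^sup>T)" using *(2) unfolding B0ec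
      by simp
    then have "D * c + C * a = \<gamma>" unfolding smult_smult me by simp
    then have "B * M = F (D * d + C * ec) * M" unfolding FM[OF *(1)] \<Gamma>b unfolding b(3) BM[OF b(1,2)] by simp
    then have "B = F (D * d + C * ec)" by (rule GL_cancel_right[OF MG Bc Fc[OF *(1)]])
    then show ?thesis using *(1) by blast
  qed
  have Finj: "g = g'" if "g \<in> Sym (- e) ?s" "g' \<in> Sym (- e) ?s" "F g = F g'" for g g'
  proof -
    have "\<Gamma> g = \<Gamma> g'" using FM[OF that(1)] FM[OF that(2)] that(3) by simp
    then show ?thesis unfolding \<Gamma>_def
      using bordered_inj[OF Sym_carrier[OF that(1)] \<gamma>c Sym_carrier[OF S'] Sym_carrier[OF that(2)] \<gamma>c
        Sym_carrier[OF S']] by blast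
  qed
  let ?H = "{h \<in> Sym (- e) m. nilpotent_mat (h * ginv d22)}"
  let ?b = "\<lambda>(A, B, D). four_block_mat A B ((- e) \<cdot>\<^sub>m B\<^sup>T) D"
  let ?X = "Sym (- e) t \<times> carrier_mat t m \<times> Sym (- e) m"
  note bij = bij_betw_Sym_block[OF me, of t m]
  have "bij_betw (\<lambda>x. F (?b x)) (Sym (- e) t \<times> carrier_mat t m \<times> ?H) (Bset e ?s ?r B0 M)"
  proof (rule bij_betw_imageI)
    have sub: "Sym (- e) t \<times> carrier_mat t m \<times> ?H \<subseteq> ?X" by blast
    show "inj_on (\<lambda>x. F (?b x)) (Sym (- e) t \<times> carrier_mat t m \<times> ?H)"
    proof (rule inj_onI)
      fix x x' assume x: "x \<in> Sym (- e) t \<times> carrier_mat t m \<times> ?H" "x' \<in> Sym (- e) t \<times> carrier_mat t m \<times> ?H"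
        "F (?b x) = F (?b x')"
      have X: "x \<in> ?X" "x' \<in> ?X" using x(1,2) sub by blast+
      have "?b x = ?b x'" by (rule Finj[OF bij_betwE[OF bij, rule_format, OF X(1)]
        bij_betwE[OF bij, rule_format, OF X(2)] x(3)])
      then show "x = x'" using inj_onD[OF bij_betw_imp_inj_on[OF bij]] X by blast
    qed
    show "(\<lambda>x. F (?b x)) ` (Sym (- e) t \<times> carrier_mat t m \<times> ?H) = Bset e ?s ?r B0 M"
    proof (intro equalityI subsetI)
      fix B assume "B \<in> (\<lambda>x. F (?b x)) ` (Sym (- e) t \<times> carrier_mat t m \<times> ?H)"
      then obtain x z h where "x \<in> Sym (- e) t" "z \<in> carrier_mat t m" "h \<in> ?H" "B = F (?b (x, z, h))" by blast
      then show "B \<in> Bset e ?s ?r B0 M" using Fiff[OF _ _ _ refl, of x z h] by simp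
    next
      fix B assume B: "B \<in> Bset e ?s ?r B0 M"
      then obtain g where g: "g \<in> Sym (- e) ?s" "B = F g" using Fsurj by blast
      then have "g \<in> ?b ` ?X" using bij_betw_imp_surj_on[OF bij] by blast
      then obtain x z h where x: "x \<in> Sym (- e) t" "z \<in> carrier_mat t m" "h \<in> Sym (- e) m" "g = ?b (x, z, h)"
        by blast
      then have gb: "g = four_block_mat x z ((- e) \<cdot>\<^sub>m z\<^sup>T) h" by simp
      have "nilpotent_mat (h * ginv d22)" using B Fiff[OF x(1-3) gb] unfolding g(2) by blast
      then show "B \<in> (\<lambda>x. F (?b x)) ` (Sym (- e) t \<times> carrier_mat t m \<times> ?H)"
        using x g(2) by (intro image_eqI[where x = "(x, z, h)"]) auto
    qed
  qed
  from bij_betw_same_card[OF this] show ?thesis by (simp add: card_cartesian_product)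
qed

text \<open>The numerator of \<open>M(e, m)\<close> from the overview, before division by the order
  of \<open>GL m\<close>.\<close>

definition nM :: "'a::{field,finite} \<Rightarrow> nat \<Rightarrow> nat" where
  "nM e m = (\<Sum>d\<in>NSym e m. card {h \<in> Sym (- e) m. nilpotent_mat (h * ginv d)})"

lemma bordered_B_count:
  fixes e :: "'a::{field,finite}"
  assumes e: "e * e = 1" and a: "a \<in> SymN e t r" and B0: "B0 \<in> carrier_mat (t + r) (t + r)"
    and S: "B0 * a \<in> Sym (- e) (t + r)" and nil: "nilpotent_mat B0"
  shows "(\<Sum>c\<in>carrier_mat s (t + r). \<Sum>d\<in>Sym e s. if bordered e d c a \<in> GL (s
    + (t + r)) then card (Bset e s (t + r) B0 (bordered e d c a)) else 0) =
    card (full_col_rank s t :: 'a mat set) * CARD('a) ^ (s * r) *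
     (card (Sym e t) * CARD('a) ^ (t * (s - t)) *
       (card (Sym (- e) t) * CARD('a) ^ (t * (s - t)) * nM e (s - t)))"
proof -
  let ?f = "\<lambda>d. card (Sym (- e) t) * CARD('a) ^ (t * (s - t))
    * card {h \<in> Sym (- e) (s - t). nilpotent_mat (h * ginv d)}"
  have "(\<Sum>c\<in>carrier_mat s (t + r). \<Sum>d\<in>Sym e s.
    (\<lambda>B M. if M \<in> GL (s + (t + r)) then card (Bset e s (t + r) B M) else 0) B0 (bordered e d c a)) =
    card (full_col_rank s t :: 'a mat set) * CARD('a) ^ (s * r) *
     (card (Sym e t) * CARD('a) ^ (t * (s - t)) * (\<Sum>d\<in>NSym e (s - t). ?f d))"
  proof (rule bordered_sum_general[OF e a B0, where Q = "\<lambda>B a. B * a \<in> Sym (- e) (t + r) \<and> nilpotent_mat B"])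
    show "B0 * a \<in> Sym (- e) (t + r) \<and> nilpotent_mat B0" using S nil by blast
  next
    fix B a h :: "'a mat"
    assume *: "B \<in> carrier_mat (t + r) (t + r)" "a \<in> Sym e (t + r)" "h \<in> GL (t + r)"
      "B * a \<in> Sym (- e) (t + r) \<and> nilpotent_mat B"
    then show "h * B * ginv h * (h * a * h\<^sup>T) \<in> Sym (- e) (t + r) \<and> nilpotent_mat (h * B * ginv h)"
      using conj_congruence_Sym(2)[OF *(3,1) Sym_carrier[OF *(2)]] nil_similar[OF *(3,1)] by blast
  next
    fix B M k X h :: "'a mat"
    assume *: "B \<in> carrier_mat (t + r) (t + r)" "M \<in> Sym e (s + (t + r))" "k \<in> GL s"
      "X \<in> carrier_mat s (t + r)" "h \<in> GL (t + r)"
    have "four_block_mat k X (0\<^sub>m (t + r) s) h \<in> GL (s + (t + r))"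
      using GL_upper_block[OF GL_carrier[OF *(3)] *(4) GL_carrier[OF *(5)]] * by blast
    then show "(if four_block_mat k X (0\<^sub>m (t + r) s) h * M * (four_block_mat k X (0\<^sub>m (t + r) s) h)\<^sup>T \<in> GL (s
      + (t + r))
       then card (Bset e s (t + r) (h * B * ginv h)
         (four_block_mat k X (0\<^sub>m (t + r) s) h * M * (four_block_mat k X (0\<^sub>m (t + r) s) h)\<^sup>T)) else 0)
      = (if M \<in> GL (s + (t + r)) then card (Bset e s (t + r) B M) else 0)"
      using GL_congruence_iff[OF Sym_carrier[OF *(2)]] Bset_transport[OF *(3,4,5,1) Sym_carrier[OF *(2)] refl]
        by simp
  next
    fix B a1 d11 d12 d22 :: "'a mat" and m
    assume *: "B \<in> carrier_mat (t + r) (t + r)" "a1 \<in> NSym e r" "B * zdiag t a1 \<in> Sym (- e) (t + r)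
      \<and> nilpotent_mat B"
      "s = t + m" "d11 \<in> Sym e t" "d12 \<in> carrier_mat t m" "d22 \<in> NSym e m"
    have GL: "bordered e (four_block_mat d11 d12 (e \<cdot>\<^sub>m d12\<^sup>T) d22) (hcat (idblock (t + m) t) (0\<^sub>m (t + m) r))
      (zdiag t a1) \<in> GL (s + (t + r))"
      using bordered_normal_GL[OF e Sym_carrier[OF *(5)] *(6) GL_carrier[OF NSym_GL[OF *(7)]]
        NSym_GL[OF *(2)]] NSym_GL[OF *(7)]
      unfolding *(4) by simp
    have "card (Bset e (t + m) (t + r) B
      (bordered e (four_block_mat d11 d12 (e \<cdot>\<^sub>m d12\<^sup>T) d22) (hcat (idblock (t + m) t) (0\<^sub>m (t + m) r))
      (zdiag t a1))) =
      card (Sym (- e) t) * card (carrier_mat t m :: 'a mat set)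
        * card {h \<in> Sym (- e) m. nilpotent_mat (h * ginv d22)}"
      by (rule card_Bset_normal[OF e *(2,1) _ _ *(5,6,7) refl]) (use *(3) in blast)+
    then show "(if bordered e (four_block_mat d11 d12 (e \<cdot>\<^sub>m d12\<^sup>T) d22)
      (hcat (idblock (t + m) t) (0\<^sub>m (t + m) r)) (zdiag t a1) \<in> GL (s + (t + r))
      then card (Bset e s (t + r) B (bordered e (four_block_mat d11 d12 (e \<cdot>\<^sub>m d12\<^sup>T) d22)
        (hcat (idblock (t + m) t) (0\<^sub>m (t + m) r)) (zdiag t a1))) else 0)
      = ?f d22" using GL *(4) by (simp add: card_carrier_mat)
  qed auto
  then show ?thesis by (simp add: nM_def sum_distrib_left)
qed

section \<open>Recursions by nullity\<close>

lemma Sym_sum_bordered: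
  fixes e :: "'a::{field,finite}" and \<psi> :: "'a mat \<Rightarrow> nat"
  assumes e: "e * e = 1"
  shows "(\<Sum>M\<in>Sym e (s + r). \<psi> M) = (\<Sum>a\<in>Sym e r. \<Sum>c\<in>carrier_mat s r. \<Sum>d\<in>Sym e s. \<psi> (bordered e d c a))"
proof -
  have "(\<Sum>M\<in>Sym e (s + r). \<psi> M) = (\<Sum>x\<in>Sym e s \<times> carrier_mat s r \<times> Sym e r. \<psi>
    (case x of (A, B, D) \<Rightarrow> four_block_mat A B (e \<cdot>\<^sub>m B\<^sup>T) D))"
    by (rule sum.reindex_bij_betw[OF bij_betw_Sym_block[OF e], symmetric])
  also have "\<dots> = (\<Sum>d\<in>Sym e s. \<Sum>c\<in>carrier_mat s r. \<Sum>a\<in>Sym e r. \<psi> (bordered e d c a))"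
    by (simp add: sum.cartesian_product' bordered_def)
  also have "\<dots> = (\<Sum>d\<in>Sym e s. \<Sum>a\<in>Sym e r. \<Sum>c\<in>carrier_mat s r. \<psi> (bordered e d c a))"
    by (intro sum.cong refl sum.swap)
  also have "\<dots> = (\<Sum>a\<in>Sym e r. \<Sum>d\<in>Sym e s. \<Sum>c\<in>carrier_mat s r. \<psi> (bordered e d c a))"
    by (rule sum.swap)
  also have "\<dots> = (\<Sum>a\<in>Sym e r. \<Sum>c\<in>carrier_mat s r. \<Sum>d\<in>Sym e s. \<psi> (bordered e d c a))"
    by (intro sum.cong refl sum.swap)
  finally show ?thesis .
qed

lemma Sym_sum_SymN:
  fixes e :: "'a::{field,finite}" and f :: "'a mat \<Rightarrow> nat"
  assumes e: "e * e = 1"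
  shows "(\<Sum>a\<in>Sym e n. f a) = (\<Sum>t\<le>n. \<Sum>a\<in>SymN e t (n - t). f a)"
proof -
  have "Sym e n = (\<Union>t\<in>{..n}. SymN e t (n - t))"
  proof (intro equalityI subsetI)
    fix a assume "a \<in> Sym e n"
    from Sym_cases_SymN[OF e this] obtain t r where "n = t + r" "a \<in> SymN e t r" .
    then show "a \<in> (\<Union>t\<in>{..n}. SymN e t (n - t))" by (intro UN_I[of t]) auto
  next
    fix a assume "a \<in> (\<Union>t\<in>{..n}. SymN e t (n - t))"
    then obtain t where "t \<le> n" "a \<in> SymN e t (n - t)" by blast
    then show "a \<in> Sym e n" using SymN_Sym[of a e t "n - t"] by simp
  qed
  moreover have "SymN e t (n - t) \<inter> SymN e t' (n - t') = {}" if "t \<le> n" "t' \<le> n" "t \<noteq> t'" for t t'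
    using SymN_unique[of _ e t "n - t" t' "n - t'"] that by fastforce
  ultimately show ?thesis by (simp add: sum.UNION_disjoint)
qed

lemma SymN_rank_0: 
  assumes e: "e * e = 1"
  shows "SymN e t 0 = {0\<^sub>m t t}"
proof (intro equalityI subsetI)
  fix a assume a: "a \<in> SymN e t 0"
  obtain h a1 where h: "h \<in> GL (t + 0)" "a1 \<in> NSym e 0" "h * a * h\<^sup>T = zdiag t a1"
    using SymN_normal_form[OF e a] .
  have "a1 = 0\<^sub>m 0 0" using GL_carrier[OF NSym_GL[OF h(2)]] carrier_0(1) by blast
  then have "zdiag t a1 = 0\<^sub>m t t" by (intro eq_matI) (auto simp: zdiag_def)
  then have "a = ginv h * 0\<^sub>m t t * (ginv h)\<^sup>T"
    using congruence_inverse(1)[OF Sym_carrier[OF SymN_Sym[OF a]] h(1)] h(3) by simp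
  then show "a \<in> {0\<^sub>m t t}" using ginv(1)[OF h(1)] by simp
next
  fix a assume "a \<in> {0\<^sub>m t t :: 'a mat}"
  moreover have "0\<^sub>m 0 0 \<in> NSym e 0" by (auto simp: NSym_def Sym_def intro!: eq_matI)
  moreover have "zdiag t (0\<^sub>m 0 0) = (0\<^sub>m t t :: 'a mat)" by (intro eq_matI) (auto simp: zdiag_def)
  ultimately show "a \<in> SymN e t 0" using zdiag_SymN[OF e, of "0\<^sub>m 0 0" 0 t] by simp
qed

section \<open>Nonsingular forms by bordering, and pairs of forms\<close>

lemma NSym_sum:
  fixes e :: "'a::{field,finite}" and f :: "'a mat \<Rightarrow> nat"
  shows "(\<Sum>M\<in>NSym e n. f M) = (\<Sum>M\<in>Sym e n. if M \<in> GL n then f M else 0)"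
proof -
  have "NSym e n = {z \<in> Sym e n. z \<in> GL n}" by (auto simp: NSym_iff)
  then show ?thesis by (simp only: sum.inter_filter[OF finite_Sym])
qed

text \<open>Bordering with a corner \<open>a\<close> of size 1, which is either nonzero, hence
  nonsingular, or zero, hence all radical; the two terms belong to these cases. For
  \<open>s = 0\<close> the truncated \<open>s - 1\<close> is multiplied by
  \<open>CARD('a) ^ 0 - 1 = 0\<close>.\<close>

lemma card_NSym_Suc:
  fixes e :: "'a::{field,finite}"
  assumes e: "e * e = 1"
  shows "card (NSym e (Suc s)) = (card (Sym e 1) - 1) * (CARD('a) ^ s * card (NSym e s))
     + (CARD('a) ^ s - 1) * (card (Sym e 1) * CARD('a) ^ (s - 1) * card (NSym e (s - 1)))"
proof -
  let ?f = "\<lambda>t r. card (full_col_rank s t :: 'a mat set) * CARD('a) ^ (s * r) *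
     (card (Sym e t) * CARD('a) ^ (t * (s - t)) * card (NSym e (s - t)))"
  have "card (NSym e (s + 1)) = (\<Sum>M\<in>NSym e (s + 1). 1)" by simp
  also have "\<dots> = (\<Sum>a\<in>Sym e 1. \<Sum>c\<in>carrier_mat s 1. \<Sum>d\<in>Sym e s. if bordered e d c a \<in> GL (s + 1) then 1 else 0)"
    unfolding NSym_sum by (rule Sym_sum_bordered[OF e])
  also have "\<dots> = (\<Sum>t\<le>1. \<Sum>a\<in>SymN e t (1 - t). \<Sum>c\<in>carrier_mat s 1. \<Sum>d\<in>Sym e s. if bordered e d c a \<in> GL (s
    + 1) then 1 else 0)"
    by (rule Sym_sum_SymN[OF e])
  also have "\<dots> = (\<Sum>t\<le>1. \<Sum>a\<in>SymN e t (1 - t). ?f t (1 - t))"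
  proof (intro sum.cong refl)
    fix t a assume "t \<in> {..1::nat}" and a: "a \<in> SymN e t (1 - t)"
    then have "t + (1 - t) = 1" by simp
    then show "(\<Sum>c\<in>carrier_mat s 1. \<Sum>d\<in>Sym e s. if bordered e d c a \<in> GL (s + 1) then 1 else 0)
      = ?f t (1 - t)"
      using bordered_count[OF e a, of s] by simp
  qed
  also have "\<dots> = card (SymN e 0 1) * ?f 0 1 + card (SymN e 1 0) * ?f 1 0" by simp
  finally have main: "card (NSym e (s + 1)) = card (SymN e 0 1) * ?f 0 1 + card (SymN e 1 0) * ?f 1 0" .
  have "card (Sym e 1) = (\<Sum>a\<in>Sym e 1. 1)" by simp
  also have "\<dots> = card (SymN e 0 1) + card (SymN e 1 0)" unfolding Sym_sum_SymN[OF e] by simp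
  finally have "card (Sym e 1) = card (SymN e 0 1) + 1" by (simp add: SymN_rank_0[OF e])
  moreover have "card (full_col_rank s 0 :: 'a mat set) = 1"
  proof -
    have "full_col_rank s 0 = {0\<^sub>m s 0 :: 'a mat}" unfolding full_col_rank_def carrier_0 by auto
    then show ?thesis by simp
  qed
  moreover have "card (Sym e 0) = 1"
  proof -
    have "Sym e 0 = {0\<^sub>m 0 0}" by (auto simp: Sym_def carrier_0 intro!: eq_matI)
    then show ?thesis by simp
  qed
  ultimately show ?thesis using main card_full_col_rank_1[of s, where 'a = 'a] SymN_rank_0[OF e, of 1] by simp
qed

text \<open>The flag \<open>z\<close> switches the nilpotency condition on, so that both counts obey the same recursion.\<close>

definition Wx :: "bool \<Rightarrow> 'a::{field,finite} \<Rightarrow> nat \<Rightarrow> 'a mat \<Rightarrow> nat" where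
  "Wx z e n \<beta> = card {\<Omega> \<in> NSym e n. z \<longrightarrow> nilpotent_mat (\<Omega> * \<beta>)}"

definition cX :: "bool \<Rightarrow> 'a::{field,finite} \<Rightarrow> nat \<Rightarrow> nat \<Rightarrow> nat" where
  "cX z e s r = (\<Sum>\<beta>\<in>SymN (- e) s r. Wx z e (s + r) \<beta>)"

lemma assoc_mult_mat_dims:
  fixes A :: "'a::semiring_0 mat"
  shows "dim_col A = dim_row B \<Longrightarrow> dim_col B = dim_row C \<Longrightarrow> A * B * C = A * (B * C)"
  by (rule assoc_mult_mat[of _ "dim_row A" "dim_row B" _ "dim_row C" _ "dim_col C"]) auto

lemma ginv_cancel:
  assumes g: "g \<in> GL n" and X: "dim_row X = n"
  shows "ginv g * (g * X) = X" "g * (ginv g * X) = X"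
    "g\<^sup>T * ((ginv g)\<^sup>T * X) = X" "(ginv g)\<^sup>T * (g\<^sup>T * X) = X"
proof -
  note gc = GL_carrier[OF g] and gi = ginv[OF g]
  have Xc: "X \<in> carrier_mat n (dim_col X)" using X by (intro carrier_matI) auto
  have "ginv g * (g * X) = ginv g * g * X"
    by (rule assoc_mult_mat[symmetric, of _ n n _ n]) (use gc gi Xc in simp_all)
  then show "ginv g * (g * X) = X" unfolding gi using Xc by simp
  have "g * (ginv g * X) = g * ginv g * X"
    by (rule assoc_mult_mat[symmetric, of _ n n _ n]) (use gc gi Xc in simp_all)
  then show "g * (ginv g * X) = X" unfolding gi using Xc by simp
  have 1: "g\<^sup>T * (ginv g)\<^sup>T = 1\<^sub>m n" using transpose_mult[OF gi(1) gc] gi(3) by simp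
  have 2: "(ginv g)\<^sup>T * g\<^sup>T = 1\<^sub>m n" using transpose_mult[OF gc gi(1)] gi(2) by simp
  have "g\<^sup>T * ((ginv g)\<^sup>T * X) = g\<^sup>T * (ginv g)\<^sup>T * X"
    by (rule assoc_mult_mat[symmetric, of _ n n _ n]) (use gc gi Xc in simp_all)
  then show "g\<^sup>T * ((ginv g)\<^sup>T * X) = X" unfolding 1 using Xc by simp
  have "(ginv g)\<^sup>T * (g\<^sup>T * X) = (ginv g)\<^sup>T * g\<^sup>T * X"
    by (rule assoc_mult_mat[symmetric, of _ n n _ n]) (use gc gi Xc in simp_all)
  then show "(ginv g)\<^sup>T * (g\<^sup>T * X) = X" unfolding 2 using Xc by simp
qed

text \<open>\<open>\<Omega>\<close> and \<open>\<beta>\<close> are forms on dual spaces. When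
  \<open>\<beta>\<close> is transformed by \<open>g\<close>, \<open>\<Omega>\<close> has to be
  transformed by the inverse transpose, and then the product changes by conjugation with
  \<open>g\<^sup>T\<close>.\<close>

lemma dual_congruence:
  assumes g: "g \<in> GL n" and \<Omega>: "\<Omega> \<in> carrier_mat n n" and \<beta>: "\<beta> \<in> carrier_mat n n"
  shows "nilpotent_mat ((ginv g)\<^sup>T * \<Omega> * ((ginv g)\<^sup>T)\<^sup>T * (g * \<beta> * g\<^sup>T)) \<longleftrightarrow> nilpotent_mat (\<Omega> * \<beta>)"
proof -
  note gc = GL_carrier[OF g] and gi = ginv[OF g]
  let ?A = "(ginv g)\<^sup>T * \<Omega> * ((ginv g)\<^sup>T)\<^sup>T * (g * \<beta> * g\<^sup>T)"
  have dims: "dim_row g = n" "dim_col g = n" "dim_row (ginv g) = n" "dim_col (ginv g) = n" "dim_row \<Omega>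
    = n" "dim_col \<Omega> = n" "dim_row \<beta> = n" "dim_col \<beta> = n"
    using gc gi \<Omega> \<beta> by auto
  have "g\<^sup>T * ?A = \<Omega> * \<beta> * g\<^sup>T" by (simp add: assoc_mult_mat_dims dims ginv_cancel[OF g] del: assoc_mult_mat)
  moreover have "?A \<in> carrier_mat n n" "\<Omega> * \<beta> \<in> carrier_mat n n"
    by (rule carrier_matI; simp only: index_mult_mat index_transpose_mat dims)+
  ultimately show ?thesis using nil_intertwine[OF GL_transpose[OF g]] by blast
qed

text \<open>One inequality suffices: the reverse one is the same statement for
  \<open>ginv g\<close>. The injection is the transformation of \<open>\<Omega>\<close> by the
  inverse transpose.\<close>

lemma Wx_le:
  assumes g: "g \<in> GL n" and \<beta>: "\<beta> \<in> carrier_mat n n"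
  shows "Wx z e n \<beta> \<le> Wx z e n (g * \<beta> * g\<^sup>T)"
  unfolding Wx_def
proof (rule card_inj_on_le)
  let ?f = "\<lambda>\<Omega>. (ginv g)\<^sup>T * \<Omega> * ((ginv g)\<^sup>T)\<^sup>T"
  note uG = GL_transpose[OF GL_ginv[OF g]]
  have c: "\<Omega> \<in> carrier_mat n n" if "\<Omega> \<in> NSym e n" for \<Omega> using GL_carrier[OF NSym_GL[OF that]] .
  show "inj_on ?f {\<Omega> \<in> NSym e n. z \<longrightarrow> nilpotent_mat (\<Omega> * \<beta>)}"
    by (rule inj_on_inverseI[where g = "\<lambda>X. ginv ((ginv g)\<^sup>T) * X * (ginv ((ginv g)\<^sup>T))\<^sup>T"])
      (rule congruence_inverse(1)[OF c uG], blast)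
  show "?f ` {\<Omega> \<in> NSym e n. z \<longrightarrow> nilpotent_mat (\<Omega> * \<beta>)}
    \<subseteq> {\<Omega> \<in> NSym e n. z \<longrightarrow> nilpotent_mat (\<Omega> * (g * \<beta> * g\<^sup>T))}"
    using NSym_congruence[OF _ uG] dual_congruence[OF g c \<beta>] by blast
  show "finite {\<Omega> \<in> NSym e n. z \<longrightarrow> nilpotent_mat (\<Omega> * (g * \<beta> * g\<^sup>T))}" by simp
qed

lemma Wx_congruence:
  assumes g: "g \<in> GL n" and \<beta>: "\<beta> \<in> carrier_mat n n"
  shows "Wx z e n (g * \<beta> * g\<^sup>T) = Wx z e n \<beta>"
proof (rule antisym[OF _ Wx_le[OF g \<beta>]])
  have "g * \<beta> * g\<^sup>T \<in> carrier_mat n n" using GL_carrier[OF g] \<beta> by simp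
  from Wx_le[OF GL_ginv[OF g] this, of z e] show "Wx z e n (g * \<beta> * g\<^sup>T) \<le> Wx z e n \<beta>"
    unfolding congruence_inverse(1)[OF \<beta> g] .
qed

lemma nil_zero: "nilpotent_mat (0\<^sub>m n n :: 'a::semiring_1 mat)"
proof -
  have "(0\<^sub>m n n :: 'a mat) ^\<^sub>m 1 = 0\<^sub>m n n" by simp
  then show ?thesis by (auto simp: nilpotent_mat_def simp del: One_nat_def intro!: exI[of _ 1])
qed

lemma bordered_mult_zdiag:
  fixes b :: "'a::field mat"
  assumes d: "d \<in> carrier_mat s s" and c: "c \<in> carrier_mat s r" and a: "a \<in> carrier_mat r r"
    and b: "b \<in> carrier_mat r r"
  shows "nilpotent_mat (bordered e d c a * zdiag s b) \<longleftrightarrow> nilpotent_mat (a * b)"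
proof -
  have "bordered e d c a * zdiag s b = four_block_mat (0\<^sub>m s s) (c * b) (0\<^sub>m r s) (a * b)"
    unfolding bordered_def by (rule zdiag_mult_right) (use assms in auto)
  then show ?thesis using nil_upper_block[of "0\<^sub>m s s" s "c * b" r "a * b"] assms by (simp add: nil_zero)
qed

lemma nil_mult_commute:
  assumes "b \<in> GL n" "a \<in> carrier_mat n n"
  shows "nilpotent_mat (a * b) \<longleftrightarrow> nilpotent_mat (b * a)"
  by (rule nil_intertwine[OF assms(1)])
    (use assms GL_carrier[OF assms(1)] in \<open>simp_all add: assoc_mult_mat_dims del: assoc_mult_mat\<close>)

lemma sum_sum_if:
  fixes f :: "'c \<Rightarrow> 'd \<Rightarrow> nat"
  shows "(\<Sum>x\<in>A. \<Sum>y\<in>B. if Q then f x y else 0) = (if Q then \<Sum>x\<in>A. \<Sum>y\<in>B. f x y else 0)"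
  by (cases Q) simp_all

text \<open>For \<open>\<beta> = zdiag s b\<close> the product \<open>\<Omega> * \<beta>\<close> is
  block triangular with diagonal blocks \<open>0\<close> and \<open>a * b\<close>. Nilpotency is
  thus a condition on the smaller pair alone, and the number of nonsingular \<open>\<Omega>\<close>
  around a given \<open>a\<close> is \<open>bordered_count\<close>.\<close>

lemma cX_rec:
  fixes e :: "'a::{field,finite}"
  assumes e: "e * e = 1"
  shows "cX z e s r * (CARD('a) ^ (r * s) * card (GL s :: 'a mat set) * card (GL r :: 'a mat set)) =
    card (GL (s + r) :: 'a mat set) * (\<Sum>t\<le>r. cX z (- e) t (r - t) *
      (card (full_col_rank s t :: 'a mat set) * CARD('a) ^ (s * (r - t)) *
       (card (Sym e t) * CARD('a) ^ (t * (s - t)) * card (NSym e (s - t)))))"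
proof -
  have me: "(- e) * (- e) = 1" using e by simp
  let ?E = "\<lambda>t. card (full_col_rank s t :: 'a mat set) * CARD('a) ^ (s * (r - t)) *
       (card (Sym e t) * CARD('a) ^ (t * (s - t)) * card (NSym e (s - t)))"
  have W: "Wx z e (s + r) (zdiag s b) = (\<Sum>t\<le>r. card {a \<in> SymN e t (r - t). z \<longrightarrow> nilpotent_mat (b * a)} * ?E t)"
    if b: "b \<in> NSym (- e) r" for b
  proof -
    note bc = GL_carrier[OF NSym_GL[OF b]]
    have "Wx z e (s + r) (zdiag s b) = (\<Sum>M | M \<in> NSym e (s + r) \<and> (z \<longrightarrow> nilpotent_mat (M * zdiag s b)). 1)"
      by (simp add: Wx_def)
    also have "\<dots> = (\<Sum>M\<in>NSym e (s + r). if z \<longrightarrow> nilpotent_mat (M * zdiag s b) then 1 else 0)"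
      by (rule sum.inter_filter) simp
    also have "\<dots> = (\<Sum>a\<in>Sym e r. \<Sum>c\<in>carrier_mat s r. \<Sum>d\<in>Sym e s.
        if bordered e d c a \<in> GL (s + r) then
          if z \<longrightarrow> nilpotent_mat (bordered e d c a * zdiag s b) then 1 else 0 else 0)"
      unfolding NSym_sum by (rule Sym_sum_bordered[OF e])
    also have "\<dots> = (\<Sum>a\<in>Sym e r. if z \<longrightarrow> nilpotent_mat (b * a)
       then \<Sum>c\<in>carrier_mat s r. \<Sum>d\<in>Sym e s. if bordered e d c a \<in> GL (s + r) then 1 else 0 else 0)"
    proof (rule sum.cong[OF refl])
      fix a assume a: "a \<in> Sym e r"
      note ac = Sym_carrier[OF a]
      have "(if bordered e d c a \<in> GL (s + r) then if z
        \<longrightarrow> nilpotent_mat (bordered e d c a * zdiag s b) then 1 else 0 else 0 :: nat) =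
         (if z \<longrightarrow> nilpotent_mat (b * a) then if bordered e d c a \<in> GL (s + r) then 1 else 0 else 0)"
        if "c \<in> carrier_mat s r" "d \<in> Sym e s" for c d
        using bordered_mult_zdiag[OF Sym_carrier[OF that(2)] that(1) ac bc, of e]
          nil_mult_commute[OF NSym_GL[OF b] ac] by simp
      then have "(\<Sum>c\<in>carrier_mat s r. \<Sum>d\<in>Sym e s.
        if bordered e d c a \<in> GL (s + r) then
          if z \<longrightarrow> nilpotent_mat (bordered e d c a * zdiag s b) then 1 else 0 else 0 :: nat) =
        (\<Sum>c\<in>carrier_mat s r. \<Sum>d\<in>Sym e s. if z \<longrightarrow> nilpotent_mat (b * a) then
          if bordered e d c a \<in> GL (s + r) then 1 else 0 else 0)"
        by (intro sum.cong refl) blast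
      also have "\<dots> =
        (if z \<longrightarrow> nilpotent_mat (b * a)
         then \<Sum>c\<in>carrier_mat s r. \<Sum>d\<in>Sym e s. if bordered e d c a \<in> GL (s + r) then 1 else 0 else 0)"
        by (rule sum_sum_if)
      finally show "(\<Sum>c\<in>carrier_mat s r. \<Sum>d\<in>Sym e s.
        if bordered e d c a \<in> GL (s + r) then
          if z \<longrightarrow> nilpotent_mat (bordered e d c a * zdiag s b) then 1 else 0 else 0 :: nat) =
        (if z \<longrightarrow> nilpotent_mat (b * a)
         then \<Sum>c\<in>carrier_mat s r. \<Sum>d\<in>Sym e s. if bordered e d c a \<in> GL (s + r) then 1 else 0 else 0)" .
    qed
    also have "\<dots> = (\<Sum>t\<le>r. \<Sum>a\<in>SymN e t (r - t). if z \<longrightarrow> nilpotent_mat (b * a)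
       then \<Sum>c\<in>carrier_mat s r. \<Sum>d\<in>Sym e s. if bordered e d c a \<in> GL (s + r) then 1 else 0 else 0)"
      by (rule Sym_sum_SymN[OF e])
    also have "\<dots> = (\<Sum>t\<le>r. \<Sum>a\<in>SymN e t (r - t). if z \<longrightarrow> nilpotent_mat (b * a) then ?E t else 0)"
    proof (intro sum.cong refl if_cong)
      fix t a assume "t \<in> {..r}" and a: "a \<in> SymN e t (r - t)"
      then have "t + (r - t) = r" by simp
      then show "(\<Sum>c\<in>carrier_mat s r. \<Sum>d\<in>Sym e s. if bordered e d c a \<in> GL (s + r) then 1 else 0) = ?E t"
        using bordered_count[OF e a, of s] by simp
    qed
    also have "\<dots> = (\<Sum>t\<le>r. card {a \<in> SymN e t (r - t). z \<longrightarrow> nilpotent_mat (b * a)} * ?E t)"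
    proof (rule sum.cong[OF refl])
      fix t
      have "(\<Sum>a\<in>SymN e t (r - t). if z \<longrightarrow> nilpotent_mat (b * a) then ?E t else 0) =
         (\<Sum>a\<in>{a \<in> SymN e t (r - t). z \<longrightarrow> nilpotent_mat (b * a)}. ?E t)"
        by (rule sum.inter_filter[symmetric]) simp
      then show "(\<Sum>a\<in>SymN e t (r - t). if z \<longrightarrow> nilpotent_mat (b * a) then ?E t else 0) =
        card {a \<in> SymN e t (r - t). z \<longrightarrow> nilpotent_mat (b * a)} * ?E t" by simp
    qed
    finally show ?thesis .
  qed
  have "cX z e s r * (CARD('a) ^ (r * s) * card (GL s :: 'a mat set) * card (GL r :: 'a mat set)) =
    card (GL (s + r) :: 'a mat set) * (\<Sum>b\<in>NSym (- e) r. Wx z e (s + r) (zdiag s b))"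
    unfolding cX_def by (rule orbit_sum[OF me]) (use Wx_congruence Sym_carrier in blast)
  also have "(\<Sum>b\<in>NSym (- e) r. Wx z e (s + r) (zdiag s b)) =
     (\<Sum>b\<in>NSym (- e) r. \<Sum>t\<le>r. card {a \<in> SymN e t (r - t). z \<longrightarrow> nilpotent_mat (b * a)} * ?E t)"
    by (rule sum.cong[OF refl]) (rule W)
  also have "\<dots> = (\<Sum>t\<le>r. (\<Sum>b\<in>NSym (- e) r. card {a \<in> SymN e t (r - t). z \<longrightarrow> nilpotent_mat (b * a)}) * ?E t)"
    unfolding sum_distrib_right by (rule sum.swap)
  also have "\<dots> = (\<Sum>t\<le>r. cX z (- e) t (r - t) * ?E t)"
  proof (rule sum.cong[OF refl])
    fix t assume t: "t \<in> {..r}"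
    \<comment> \<open>After the exchange of the two sums, the possibly singular \<open>a\<close>
      takes the place of \<open>\<beta>\<close> and the nonsingular \<open>b\<close> that of
      \<open>\<Omega>\<close>. This is the weight for the sign \<open>- e\<close>.\<close>
    have "(\<Sum>b\<in>NSym (- e) r. card {a \<in> SymN e t (r - t). z \<longrightarrow> nilpotent_mat (b * a)}) =
       (\<Sum>b\<in>NSym (- e) r. \<Sum>a | a \<in> SymN e t (r - t) \<and> (z \<longrightarrow> nilpotent_mat (b * a)). 1)" by simp
    also have "\<dots> = (\<Sum>a\<in>SymN e t (r - t). \<Sum>b | b \<in> NSym (- e) r \<and> (z \<longrightarrow> nilpotent_mat (b * a)). 1)"
      by (rule sum.swap_restrict) auto
    also have "\<dots> = cX z (- e) t (r - t)" using t by (simp add: cX_def Wx_def)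
    finally show "(\<Sum>b\<in>NSym (- e) r. card {a \<in> SymN e t (r - t). z \<longrightarrow> nilpotent_mat (b * a)}) * ?E t
      = cX z (- e) t (r - t) * ?E t"
      by simp
  qed
  finally show ?thesis .
qed

section \<open>Triples of two forms and an operator\<close>

definition Bs :: "'a::field \<Rightarrow> nat \<Rightarrow> 'a mat \<Rightarrow> 'a mat \<Rightarrow> 'a mat set" where
  "Bs e n \<beta> \<Omega> = {B \<in> carrier_mat n n. B * \<Omega> \<in> Sym (- e) n \<and> \<beta> * B \<in> Sym e n \<and>
     nilpotent_mat (\<Omega> * \<beta>) \<and> nilpotent_mat B}"

text \<open>\<open>Bs\<close> is empty unless \<open>\<Omega> * \<beta>\<close> is nilpotent, so
  this sum counts the admissible triples with given \<open>\<beta>\<close>.\<close>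

definition Wt :: "'a::{field,finite} \<Rightarrow> nat \<Rightarrow> 'a mat \<Rightarrow> nat" where
  "Wt e n \<beta> = (\<Sum>\<Omega>\<in>NSym e n. card (Bs e n \<beta> \<Omega>))"

definition cT :: "'a::{field,finite} \<Rightarrow> nat \<Rightarrow> nat \<Rightarrow> nat" where
  "cT e s r = (\<Sum>\<beta>\<in>SymN (- e) s r. Wt e (s + r) \<beta>)"

lemma finite_Bs [simp]: "finite (Bs e n \<beta> (\<Omega> :: 'a::{field,finite} mat))"
  by (rule finite_subset[OF _ finite_carrier_mat]) (auto simp: Bs_def)

lemma ginv_dual:
  assumes g: "g \<in> GL n"
  shows "ginv ((ginv g)\<^sup>T) = g\<^sup>T"
proof -
  note uG = GL_transpose[OF GL_ginv[OF g]]
  have "(ginv g)\<^sup>T * g\<^sup>T = 1\<^sub>m n" using transpose_mult[OF GL_carrier[OF g] ginv(1)[OF g]] ginv(2)[OF g]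
    by simp
  then have "(ginv g)\<^sup>T * ginv ((ginv g)\<^sup>T) = (ginv g)\<^sup>T * g\<^sup>T" using ginv(2)[OF uG] by simp
  then show ?thesis by (rule GL_cancel_left[OF uG ginv(1)[OF uG], rotated]) (use GL_carrier[OF g] in simp)
qed

text \<open>\<open>B\<close> is conjugated by the inverse transpose of \<open>g\<close>, in step
  with \<open>\<Omega>\<close>. Then \<open>B * \<Omega>\<close> changes by congruence with the
  inverse transpose and \<open>\<beta> * B\<close> by congruence with \<open>g\<close>, so both sign
  conditions persist.\<close>

lemma Wt_le:
  assumes g: "g \<in> GL n" and \<beta>: "\<beta> \<in> carrier_mat n n"
  shows "Wt e n \<beta> \<le> Wt e n (g * \<beta> * g\<^sup>T)"
proof -
  let ?u = "(ginv g)\<^sup>T"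
  note gc = GL_carrier[OF g] and gi = ginv[OF g]
  have uG: "?u \<in> GL n" by (rule GL_transpose[OF GL_ginv[OF g]])
  note uc = GL_carrier[OF uG]
  have c: "\<Omega> \<in> carrier_mat n n" if "\<Omega> \<in> NSym e n" for \<Omega> using GL_carrier[OF NSym_GL[OF that]] .
  have cB: "B \<in> carrier_mat n n" if "B \<in> Bs e n \<beta> \<Omega>" for B \<Omega> using that unfolding Bs_def by blast
  let ?f = "\<lambda>(\<Omega>, B). (?u * \<Omega> * ?u\<^sup>T, ?u * B * ginv ?u)"
  have "card (Sigma (NSym e n) (Bs e n \<beta>)) \<le> card (Sigma (NSym e n) (Bs e n (g * \<beta> * g\<^sup>T)))"
  proof (rule card_inj_on_le[of ?f])
    show "inj_on ?f (Sigma (NSym e n) (Bs e n \<beta>))"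
    proof (rule inj_on_inverseI[where g = "\<lambda>(X, B). (ginv ?u * X * (ginv ?u)\<^sup>T, ginv ?u * B * ?u)"])
      fix x assume "x \<in> Sigma (NSym e n) (Bs e n \<beta>)"
      then obtain \<Omega> B where x: "x = (\<Omega>, B)" "\<Omega> \<in> NSym e n" "B \<in> Bs e n \<beta> \<Omega>" by blast
      show "(\<lambda>(X, B). (ginv ?u * X * (ginv ?u)\<^sup>T, ginv ?u * B * ?u)) (?f x) = x"
        unfolding x(1) prod.case congruence_inverse(1)[OF c[OF x(2)] uG] conj_inverse(1)[OF uG cB[OF x(3)]] ..
    qed
    show "?f ` Sigma (NSym e n) (Bs e n \<beta>) \<subseteq> Sigma (NSym e n) (Bs e n (g * \<beta> * g\<^sup>T))"
    proof
      fix y assume "y \<in> ?f ` Sigma (NSym e n) (Bs e n \<beta>)"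
      then obtain x where x: "y = ?f x" "x \<in> Sigma (NSym e n) (Bs e n \<beta>)" by blast
      from x(2) obtain \<Omega> B where p: "x = (\<Omega>, B)" "\<Omega> \<in> NSym e n" "B \<in> Bs e n \<beta> \<Omega>" by blast
      have "y = (?u * \<Omega> * ?u\<^sup>T, ?u * B * ginv ?u)" unfolding x(1) p(1) prod.case ..
      note y = this p(2,3)
      note \<Omega>c = c[OF y(2)] and Bc = cB[OF y(3)]
      have B: "B * \<Omega> \<in> Sym (- e) n" "\<beta> * B \<in> Sym e n" "nilpotent_mat (\<Omega> * \<beta>)" "nilpotent_mat B"
        using y(3) unfolding Bs_def by blast+
      have dims: "dim_row g = n" "dim_col g = n" "dim_row (ginv g) = n" "dim_col (ginv g) = n" "dim_row B
        = n" "dim_col B = n" "dim_row \<beta> = n" "dim_col \<beta> = n"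
        using gc gi Bc \<beta> by auto
      have "g * \<beta> * g\<^sup>T * (?u * B * ginv ?u) = g * (\<beta> * B) * g\<^sup>T"
        unfolding ginv_dual[OF g] by (simp add: assoc_mult_mat_dims dims ginv_cancel[OF g] del:
          assoc_mult_mat)
      then have 1: "g * \<beta> * g\<^sup>T * (?u * B * ginv ?u) \<in> Sym e n" using Sym_congruence[OF B(2) gc] by simp
      have 2: "?u * B * ginv ?u * (?u * \<Omega> * ?u\<^sup>T) \<in> Sym (- e) n"
        using conj_congruence_Sym(2)[OF uG Bc \<Omega>c] B(1) by blast
      have 3: "nilpotent_mat (?u * \<Omega> * ?u\<^sup>T * (g * \<beta> * g\<^sup>T))" using dual_congruence[OF g \<Omega>c \<beta>] B(3) by blast
      have 4: "nilpotent_mat (?u * B * ginv ?u)" using nil_similar[OF uG Bc] B(4) by blast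
      have 5: "?u * B * ginv ?u \<in> carrier_mat n n"
        by (rule mult_carrier_mat[OF mult_carrier_mat[OF uc Bc] ginv(1)[OF uG]])
      show "y \<in> Sigma (NSym e n) (Bs e n (g * \<beta> * g\<^sup>T))"
        unfolding y(1) Bs_def using 1 2 3 4 5 NSym_congruence[OF y(2) uG] by blast
    qed
  qed auto
  then show ?thesis unfolding Wt_def by (simp add: card_SigmaI)
qed

lemma Wt_congruence:
  assumes g: "g \<in> GL n" and \<beta>: "\<beta> \<in> carrier_mat n n"
  shows "Wt e n (g * \<beta> * g\<^sup>T) = Wt e n \<beta>"
proof (rule antisym[OF _ Wt_le[OF g \<beta>]])
  have "g * \<beta> * g\<^sup>T \<in> carrier_mat n n" using GL_carrier[OF g] \<beta> by simp
  from Wt_le[OF GL_ginv[OF g] this, of e] show "Wt e n (g * \<beta> * g\<^sup>T) \<le> Wt e n \<beta>"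
    unfolding congruence_inverse(1)[OF \<beta> g] .
qed

lemma Sym_transpose_iff:
  assumes e: "e * e = 1" and X: "X \<in> carrier_mat n n"
  shows "X\<^sup>T \<in> Sym e n \<longleftrightarrow> X \<in> Sym e n"
proof -
  have "X = e \<cdot>\<^sub>m X\<^sup>T \<longleftrightarrow> X\<^sup>T = e \<cdot>\<^sub>m X"
  proof
    assume "X = e \<cdot>\<^sub>m X\<^sup>T"
    then have "e \<cdot>\<^sub>m X = e \<cdot>\<^sub>m (e \<cdot>\<^sub>m X\<^sup>T)" by simp
    then show "X\<^sup>T = e \<cdot>\<^sub>m X" unfolding smult_smult e by simp
  next
    assume "X\<^sup>T = e \<cdot>\<^sub>m X"
    then have "e \<cdot>\<^sub>m X\<^sup>T = e \<cdot>\<^sub>m (e \<cdot>\<^sub>m X)" by simp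
    then show "X = e \<cdot>\<^sub>m X\<^sup>T" unfolding smult_smult e by simp
  qed
  then show ?thesis using X by (simp add: Sym_def)
qed

lemma Sym_smult_iff:
  fixes u :: "'a::field"
  assumes u: "u * u = 1" and X: "X \<in> carrier_mat n n"
  shows "u \<cdot>\<^sub>m X \<in> Sym e n \<longleftrightarrow> X \<in> Sym e n"
proof -
  have imp: "u \<cdot>\<^sub>m Y \<in> Sym e n" if "Y \<in> Sym e n" for Y
    using that by (auto simp: Sym_def transpose_smult smult_smult mult.commute)
  show ?thesis using imp[of X] imp[of "u \<cdot>\<^sub>m X"] u by (auto simp: smult_smult)
qed

text \<open>Up to sign, \<open>(b * B)\<^sup>T\<close> is \<open>B\<^sup>T * b\<close> and
  \<open>(B * a)\<^sup>T\<close> is \<open>a * B\<^sup>T\<close>. Transposition therefore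
  interchanges the two sign conditions, which are exactly those of the triple with \<open>a\<close>
  and \<open>b\<close> exchanged.\<close>

lemma card_Bs_swap:
  fixes e :: "'a::{field,finite}"
  assumes e: "e * e = 1" and a: "a \<in> Sym e n" and b: "b \<in> NSym (- e) n"
  shows "card (Bs e n b a) = card (Bs (- e) n a b)"
proof -
  have me: "(- e) * (- e) = 1" using e by simp
  note ac = Sym_carrier[OF a] and bc = GL_carrier[OF NSym_GL[OF b]]
  have aT: "a\<^sup>T = e \<cdot>\<^sub>m a" and bT: "b\<^sup>T = (- e) \<cdot>\<^sub>m b" using a b by (auto simp: Sym_def NSym_def)
  have iff: "B\<^sup>T \<in> Bs (- e) n a b \<longleftrightarrow> B \<in> Bs e n b a" if B: "B \<in> carrier_mat n n" for B
  proof -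
    have BTc: "B\<^sup>T \<in> carrier_mat n n" using B by simp
    have "(b * B)\<^sup>T = B\<^sup>T * b\<^sup>T" by (rule transpose_mult[OF bc B])
    also have "\<dots> = (- e) \<cdot>\<^sub>m (B\<^sup>T * b)" unfolding bT by (rule mult_smult_distrib[OF BTc bc])
    finally have 1: "B\<^sup>T * b \<in> Sym e n \<longleftrightarrow> b * B \<in> Sym e n"
      using Sym_transpose_iff[OF e mult_carrier_mat[OF bc B]] Sym_smult_iff[OF me mult_carrier_mat[OF BTc bc]]
        by simp
    have "(B * a)\<^sup>T = a\<^sup>T * B\<^sup>T" by (rule transpose_mult[OF B ac])
    also have "\<dots> = e \<cdot>\<^sub>m (a * B\<^sup>T)" unfolding aT by (rule mult_smult_assoc_mat[OF ac BTc])
    finally have 2: "a * B\<^sup>T \<in> Sym (- e) n \<longleftrightarrow> B * a \<in> Sym (- e) n"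
      using Sym_transpose_iff[OF me mult_carrier_mat[OF B ac]] Sym_smult_iff[OF e mult_carrier_mat[OF ac BTc]]
        by simp
    show ?thesis unfolding Bs_def mem_Collect_eq minus_minus 1 2
      using nil_mult_commute[OF NSym_GL[OF b] ac] nil_transpose[OF B] B BTc by blast
  qed
  have "bij_betw transpose_mat (Bs e n b a) (Bs (- e) n a b)"
  proof (rule bij_betwI[where g = transpose_mat])
    show "transpose_mat \<in> Bs e n b a \<rightarrow> Bs (- e) n a b" using iff unfolding Bs_def by blast
    show "transpose_mat \<in> Bs (- e) n a b \<rightarrow> Bs e n b a"
    proof
      fix B assume B: "B \<in> Bs (- e) n a b"
      then have "B\<^sup>T \<in> carrier_mat n n" unfolding Bs_def by simp
      from iff[OF this] B show "B\<^sup>T \<in> Bs e n b a" by simp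
    qed
  qed auto
  then show ?thesis by (rule bij_betw_same_card)
qed

text \<open>The sign condition on \<open>zdiag s b * B\<close> contains \<open>b * R = 0\<close> for
  the lower left block \<open>R\<close> of \<open>B\<close>, so \<open>B\<close> is block
  triangular. Its lower right block \<open>B0\<close> inherits every condition on the smaller pair,
  and different \<open>B0\<close> give disjoint sets of \<open>B\<close>.\<close>

lemma card_Bs_bordered:
  fixes e :: "'a::{field,finite}"
  assumes e: "e * e = 1" and d: "d \<in> carrier_mat s s" and c: "c \<in> carrier_mat s r"
    and a: "a \<in> carrier_mat r r" and b: "b \<in> GL r"
  shows "card (Bs e (s + r) (zdiag s b) (bordered e d c a))
    = (\<Sum>B0\<in>Bs e r b a. card (Bset e s r B0 (bordered e d c a)))"
proof -
  let ?M = "bordered e d c a"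
  have me: "(- e) * (- e) = 1" using e by simp
  note bc = GL_carrier[OF b]
  have zb: "zdiag s b * four_block_mat D C R S = four_block_mat (0\<^sub>m s s) (0\<^sub>m s r) (b * R) (b * S)"
    if "D \<in> carrier_mat s s" "C \<in> carrier_mat s r" "R \<in> carrier_mat r s" "S \<in> carrier_mat r r" for D C R S
    unfolding zdiag_eq[OF bc] by (subst mult_four_block_mat[of _ s s _ r _ r _ _ s _ r])
      (use that bc in simp_all)
  have z0: "0\<^sub>m s s \<in> Sym e s" "e \<cdot>\<^sub>m (0\<^sub>m s r)\<^sup>T = 0\<^sub>m r s" by (simp_all add: Sym_def)
  have zS: "four_block_mat (0\<^sub>m s s) (0\<^sub>m s r) (b * R) (b * S) \<in> Sym e (s + r) \<longleftrightarrow> b * R = 0\<^sub>m r s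
    \<and> b * S \<in> Sym e r"
    if "R \<in> carrier_mat r s" "S \<in> carrier_mat r r" for R S
    using Sym_block[OF e zero_carrier_mat zero_carrier_mat mult_carrier_mat[OF bc that(1)]
      mult_carrier_mat[OF bc that(2)]] z0 by simp
  have eq: "Bs e (s + r) (zdiag s b) ?M = (\<Union>B0\<in>Bs e r b a. Bset e s r B0 ?M)"
  proof (intro equalityI subsetI)
    fix B assume "B \<in> Bs e (s + r) (zdiag s b) ?M"
    then have B: "B \<in> carrier_mat (s + r) (s + r)" "B * ?M \<in> Sym (- e) (s + r)"
      "zdiag s b * B \<in> Sym e (s + r)"
      "nilpotent_mat (?M * zdiag s b)" "nilpotent_mat B" unfolding Bs_def by blast+
    obtain D C R S where bl: "D \<in> carrier_mat s s" "C \<in> carrier_mat s r" "R \<in> carrier_mat r s"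
      "S \<in> carrier_mat r r"
      "B = four_block_mat D C R S" using four_block_cases[OF B(1)] by metis
    have bR: "b * R = 0\<^sub>m r s" "b * S \<in> Sym e r" using B(3) unfolding bl(5) zb[OF bl(1-4)] zS[OF bl(3,4)]
      by blast+
    have "b * R = b * 0\<^sub>m r s" using bR(1) bc by simp
    then have R: "R = 0\<^sub>m r s" by (rule GL_cancel_left[OF b bl(3) zero_carrier_mat])
    have nil: "nilpotent_mat D" "nilpotent_mat S" using B(5) unfolding bl(5) R nil_upper_block[OF bl(1,2,4)]
      by blast+
    have "B * ?M = four_block_mat (D * d + C * (e \<cdot>\<^sub>m c\<^sup>T)) (D * c + C * a) (0\<^sub>m r s * d
      + S * (e \<cdot>\<^sub>m c\<^sup>T)) (0\<^sub>m r s * c + S * a)"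
      unfolding bl(5) R bordered_def by (rule mult_four_block_mat[OF bl(1,2) _ bl(4) d c _ a])
        (use c in simp_all)
    then have "0\<^sub>m r s * c + S * a \<in> Sym (- e) r"
      using B(2) by (simp only:) (subst (asm) Sym_block[OF me], use bl d c a in \<open>auto intro!: carrier_matI\<close>)
    then have "S * a \<in> Sym (- e) r" using c bl(4) a by simp
    then have "S \<in> Bs e r b a" unfolding Bs_def using bl(4) bR nil B(4) bordered_mult_zdiag[OF d c a bc]
      by blast
    moreover have "B \<in> Bset e s r S ?M" unfolding Bset_def using bl R nil B(1,2) by blast
    ultimately show "B \<in> (\<Union>B0\<in>Bs e r b a. Bset e s r B0 ?M)" by blast
  next
    fix B assume "B \<in> (\<Union>B0\<in>Bs e r b a. Bset e s r B0 ?M)"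
    then obtain B0 where B0: "B0 \<in> Bs e r b a" "B \<in> Bset e s r B0 ?M" by blast
    have B0': "B0 \<in> carrier_mat r r" "b * B0 \<in> Sym e r" "nilpotent_mat (a * b)" "nilpotent_mat B0" using B0(1)
      unfolding Bs_def by blast+
    from B0(2) obtain D C where B: "D \<in> carrier_mat s s" "C \<in> carrier_mat s r" "B
      = four_block_mat D C (0\<^sub>m r s) B0" "nilpotent_mat D"
      and B': "B \<in> carrier_mat (s + r) (s + r)" "B * ?M \<in> Sym (- e) (s + r)" unfolding Bset_def by blast
    have "b * 0\<^sub>m r s = 0\<^sub>m r s" using bc by simp
    then have "zdiag s b * B \<in> Sym e (s + r)"
      unfolding B(3) zb[OF B(1,2) zero_carrier_mat B0'(1)] zS[OF zero_carrier_mat B0'(1)] using B0'(2)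
        by blast
    moreover have "nilpotent_mat B" unfolding B(3) nil_upper_block[OF B(1,2) B0'(1)] using B(4) B0'(4)
      by blast
    ultimately show "B \<in> Bs e (s + r) (zdiag s b) ?M" unfolding Bs_def
      using B' B0'(3) bordered_mult_zdiag[OF d c a bc] by blast
  qed
  have "Bset e s r B0 ?M \<inter> Bset e s r B0' ?M = {}" if "B0 \<in> Bs e r b a" "B0' \<in> Bs e r b a" "B0 \<noteq> B0'"
    for B0 B0'
  proof (rule ccontr)
    assume "Bset e s r B0 ?M \<inter> Bset e s r B0' ?M \<noteq> {}"
    then obtain D C D' C' where x: "D \<in> carrier_mat s s" "C \<in> carrier_mat s r" "D' \<in> carrier_mat s s"
      "C' \<in> carrier_mat s r"
      "four_block_mat D C (0\<^sub>m r s) B0 = four_block_mat D' C' (0\<^sub>m r s) B0'" unfolding Bset_def by fastforce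
    have "B0 \<in> carrier_mat r r" "B0' \<in> carrier_mat r r" using that(1,2) unfolding Bs_def by blast+
    with x have "D = D' \<and> C = C' \<and> 0\<^sub>m r s = (0\<^sub>m r s :: 'a mat) \<and> B0 = B0'"
      by (intro four_block_cong_iff[of _ s s _ r _ r, THEN iffD1]) simp_all
    with that(3) show False by blast
  qed
  then show ?thesis unfolding eq by (intro card_UN_disjoint) auto
qed

text \<open>The scheme of \<open>cX_rec\<close> with one more layer. For each \<open>B0\<close> the
  number of completions is given by \<open>bordered_B_count\<close> and does not depend on
  \<open>B0\<close>; the number of the \<open>B0\<close> themselves is turned by
  \<open>card_Bs_swap\<close> into the weight for the sign \<open>- e\<close>.\<close>

lemma cT_rec:
  fixes e :: "'a::{field,finite}"
  assumes e: "e * e = 1"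
  shows "cT e s r * (CARD('a) ^ (r * s) * card (GL s :: 'a mat set) * card (GL r :: 'a mat set)) =
    card (GL (s + r) :: 'a mat set) * (\<Sum>t\<le>r. cT (- e) t (r - t) *
      (card (full_col_rank s t :: 'a mat set) * CARD('a) ^ (s * (r - t)) *
       (card (Sym e t) * CARD('a) ^ (t * (s - t)) *
         (card (Sym (- e) t) * CARD('a) ^ (t * (s - t)) * nM e (s - t)))))"
proof -
  have me: "(- e) * (- e) = 1" using e by simp
  let ?E = "\<lambda>t. card (full_col_rank s t :: 'a mat set) * CARD('a) ^ (s * (r - t)) *
       (card (Sym e t) * CARD('a) ^ (t * (s - t)) *
         (card (Sym (- e) t) * CARD('a) ^ (t * (s - t)) * nM e (s - t)))"
  have W: "Wt e (s + r) (zdiag s b) = (\<Sum>t\<le>r. \<Sum>a\<in>SymN e t (r - t). card (Bs (- e) r a b) * ?E t)"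
    if b: "b \<in> NSym (- e) r" for b
  proof -
    note bG = NSym_GL[OF b]
    have "Wt e (s + r) (zdiag s b) = (\<Sum>a\<in>Sym e r. \<Sum>c\<in>carrier_mat s r. \<Sum>d\<in>Sym e s.
        if bordered e d c a \<in> GL (s + r) then card (Bs e (s + r) (zdiag s b) (bordered e d c a)) else 0)"
      unfolding NSym_sum Wt_def by (rule Sym_sum_bordered[OF e])
    also have "\<dots> = (\<Sum>a\<in>Sym e r. \<Sum>B0\<in>Bs e r b a. \<Sum>c\<in>carrier_mat s r. \<Sum>d\<in>Sym e s.
        if bordered e d c a \<in> GL (s + r) then card (Bset e s r B0 (bordered e d c a)) else 0)"
    proof (rule sum.cong[OF refl])
      fix a assume a: "a \<in> Sym e r"
      have "(if bordered e d c a \<in> GL (s + r) then card (Bs e (s + r) (zdiag s b) (bordered e d c a)) else 0)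
        =
        (\<Sum>B0\<in>Bs e r b a. if bordered e d c a \<in> GL (s
          + r) then card (Bset e s r B0 (bordered e d c a)) else 0)"
        if "c \<in> carrier_mat s r" "d \<in> Sym e s" for c d
        using card_Bs_bordered[OF e Sym_carrier[OF that(2)] that(1) Sym_carrier[OF a] bG] by simp
      then have "(\<Sum>c\<in>carrier_mat s r. \<Sum>d\<in>Sym e s.
        if bordered e d c a \<in> GL (s + r) then card (Bs e (s + r) (zdiag s b) (bordered e d c a)) else 0) =
        (\<Sum>c\<in>carrier_mat s r. \<Sum>d\<in>Sym e s. \<Sum>B0\<in>Bs e r b a.
          if bordered e d c a \<in> GL (s + r) then card (Bset e s r B0 (bordered e d c a)) else 0)"
        by (intro sum.cong refl) blast
      also have "\<dots> = (\<Sum>c\<in>carrier_mat s r. \<Sum>B0\<in>Bs e r b a. \<Sum>d\<in>Sym e s. if bordered e d c a \<in> GL (s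
        + r) then card (Bset e s r B0 (bordered e d c a)) else 0)"
        by (intro sum.cong refl sum.swap)
      also have "\<dots> = (\<Sum>B0\<in>Bs e r b a. \<Sum>c\<in>carrier_mat s r. \<Sum>d\<in>Sym e s. if bordered e d c a \<in> GL (s
        + r) then card (Bset e s r B0 (bordered e d c a)) else 0)"
        by (rule sum.swap)
      finally show "(\<Sum>c\<in>carrier_mat s r. \<Sum>d\<in>Sym e s.
        if bordered e d c a \<in> GL (s + r) then card (Bs e (s + r) (zdiag s b) (bordered e d c a)) else 0)
          = \<dots>" .
    qed
    also have "\<dots> = (\<Sum>t\<le>r. \<Sum>a\<in>SymN e t (r - t). \<Sum>B0\<in>Bs e r b a. \<Sum>c\<in>carrier_mat s r. \<Sum>d\<in>Sym e s.
        if bordered e d c a \<in> GL (s + r) then card (Bset e s r B0 (bordered e d c a)) else 0)"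
      by (rule Sym_sum_SymN[OF e])
    also have "\<dots> = (\<Sum>t\<le>r. \<Sum>a\<in>SymN e t (r - t). card (Bs (- e) r a b) * ?E t)"
    proof (intro sum.cong refl)
      fix t a assume "t \<in> {..r}" and a: "a \<in> SymN e t (r - t)"
      then have tr: "t + (r - t) = r" by simp
      have "(\<Sum>c\<in>carrier_mat s r. \<Sum>d\<in>Sym e s. if bordered e d c a \<in> GL (s
        + r) then card (Bset e s r B0 (bordered e d c a)) else 0) = ?E t"
        if "B0 \<in> Bs e r b a" for B0
        using bordered_B_count[OF e a, of B0 s] that unfolding tr Bs_def by blast
      then have "(\<Sum>B0\<in>Bs e r b a. \<Sum>c\<in>carrier_mat s r. \<Sum>d\<in>Sym e s. if bordered e d c a \<in> GL (s
        + r) then card (Bset e s r B0 (bordered e d c a)) else 0)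
        = (\<Sum>B0\<in>Bs e r b a. ?E t)" by (intro sum.cong refl) blast
      also have "\<dots> = card (Bs (- e) r a b) * ?E t"
        using card_Bs_swap[OF e _ b, of a] SymN_Sym[OF a] tr by simp
      finally show "(\<Sum>B0\<in>Bs e r b a. \<Sum>c\<in>carrier_mat s r. \<Sum>d\<in>Sym e s. if bordered e d c a \<in> GL (s
        + r) then card (Bset e s r B0 (bordered e d c a)) else 0)
        = card (Bs (- e) r a b) * ?E t" .
    qed
    finally show ?thesis .
  qed
  have "cT e s r * (CARD('a) ^ (r * s) * card (GL s :: 'a mat set) * card (GL r :: 'a mat set)) =
    card (GL (s + r) :: 'a mat set) * (\<Sum>b\<in>NSym (- e) r. Wt e (s + r) (zdiag s b))"
    unfolding cT_def by (rule orbit_sum[OF me]) (use Wt_congruence Sym_carrier in blast)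
  also have "(\<Sum>b\<in>NSym (- e) r. Wt e (s + r) (zdiag s b)) =
     (\<Sum>b\<in>NSym (- e) r. \<Sum>t\<le>r. \<Sum>a\<in>SymN e t (r - t). card (Bs (- e) r a b) * ?E t)"
    by (rule sum.cong[OF refl]) (rule W)
  also have "\<dots> = (\<Sum>t\<le>r. \<Sum>b\<in>NSym (- e) r. \<Sum>a\<in>SymN e t (r - t). card (Bs (- e) r a b) * ?E t)"
    by (rule sum.swap)
  also have "\<dots> = (\<Sum>t\<le>r. \<Sum>a\<in>SymN e t (r - t). \<Sum>b\<in>NSym (- e) r. card (Bs (- e) r a b) * ?E t)"
    by (intro sum.cong refl sum.swap)
  also have "\<dots> = (\<Sum>t\<le>r. cT (- e) t (r - t) * ?E t)"
    unfolding cT_def Wt_def minus_minus sum_distrib_right by (intro sum.cong refl) auto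
  finally show ?thesis .
qed

lemma NSym_0: "NSym e 0 = {0\<^sub>m 0 0}"
  by (auto simp: NSym_def Sym_def carrier_0 intro!: eq_matI)

lemma sum_cX_False:
  fixes e :: "'a::{field,finite}"
  assumes e: "e * e = 1"
  shows "(\<Sum>s\<le>n. cX False e s (n - s)) = card (NSym e n) * card (Sym (- e) n)"
proof -
  have me: "(- e) * (- e) = 1" using e by simp
  have "(\<Sum>s\<le>n. cX False e s (n - s)) = (\<Sum>s\<le>n. \<Sum>\<beta>\<in>SymN (- e) s (n - s). Wx False e n \<beta>)"
    unfolding cX_def by (intro sum.cong refl) auto
  also have "\<dots> = (\<Sum>\<beta>\<in>Sym (- e) n. Wx False e n \<beta>)" by (rule Sym_sum_SymN[OF me, symmetric])
  finally show ?thesis by (simp add: Wx_def)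
qed

lemma nil_smult_unit:
  fixes X :: "'a::field mat"
  assumes u: "u * u = 1" and X: "X \<in> carrier_mat n n"
  shows "nilpotent_mat (u \<cdot>\<^sub>m X) \<longleftrightarrow> nilpotent_mat X"
proof -
  have "u = 1 \<or> u = -1" using u square_eq_1_iff by blast
  moreover have "(- 1) \<cdot>\<^sub>m X = - X" by (rule eq_matI) auto
  ultimately show ?thesis using nil_uminus[OF X] by auto
qed

text \<open>\<open>\<Omega> * \<beta> * \<Omega>\<^sup>T * ginv \<Omega>\<close> is \<open>e\<close>
  times \<open>\<Omega> * \<beta>\<close>. So
  \<open>\<beta> \<mapsto> \<Omega> * \<beta> * \<Omega>\<^sup>T\<close> matches the two
  descriptions of a nilpotent pair, by \<open>\<Omega> * \<beta>\<close> here and by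
  \<open>h * ginv d\<close> in \<open>nM\<close>.\<close>

lemma sum_cX_True:
  fixes e :: "'a::{field,finite}"
  assumes e: "e * e = 1"
  shows "(\<Sum>s\<le>n. cX True e s (n - s)) = nM e n"
proof -
  have me: "(- e) * (- e) = 1" using e by simp
  have "(\<Sum>s\<le>n. cX True e s (n - s)) = (\<Sum>s\<le>n. \<Sum>\<beta>\<in>SymN (- e) s (n - s). Wx True e n \<beta>)"
    unfolding cX_def by (intro sum.cong refl) auto
  also have "\<dots> = (\<Sum>\<beta>\<in>Sym (- e) n. Wx True e n \<beta>)" by (rule Sym_sum_SymN[OF me, symmetric])
  also have "\<dots> = (\<Sum>\<beta>\<in>Sym (- e) n. \<Sum>\<Omega> | \<Omega> \<in> NSym e n \<and> nilpotent_mat (\<Omega> * \<beta>). 1)" by (simp add: Wx_def)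
  also have "\<dots> = (\<Sum>\<Omega>\<in>NSym e n. \<Sum>\<beta> | \<beta> \<in> Sym (- e) n \<and> nilpotent_mat (\<Omega> * \<beta>). 1)"
    by (rule sum.swap_restrict) auto
  also have "\<dots> = (\<Sum>\<Omega>\<in>NSym e n. card {h \<in> Sym (- e) n. nilpotent_mat (h * ginv \<Omega>)})"
  proof (rule sum.cong[OF refl])
    fix \<Omega> assume \<Omega>: "\<Omega> \<in> NSym e n"
    have \<Omega>G: "\<Omega> \<in> GL n" by (rule NSym_GL[OF \<Omega>])
    note \<Omega>c = GL_carrier[OF \<Omega>G] and \<Omega>i = ginv[OF \<Omega>G]
    have \<Omega>T: "\<Omega>\<^sup>T = e \<cdot>\<^sub>m \<Omega>" using \<Omega> by (simp add: NSym_def Sym_def)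
    have nil: "nilpotent_mat (\<Omega> * \<beta> * \<Omega>\<^sup>T * ginv \<Omega>) \<longleftrightarrow> nilpotent_mat (\<Omega> * \<beta>)" if \<beta>: "\<beta> \<in> carrier_mat n n" for \<beta>
    proof -
      have ob: "\<Omega> * \<beta> \<in> carrier_mat n n" by (rule mult_carrier_mat[OF \<Omega>c \<beta>])
      have "\<Omega> * \<beta> * \<Omega>\<^sup>T * ginv \<Omega> = (e \<cdot>\<^sub>m (\<Omega> * \<beta> * \<Omega>)) * ginv \<Omega>"
        unfolding \<Omega>T mult_smult_distrib[OF ob \<Omega>c] ..
      also have "\<dots> = e \<cdot>\<^sub>m (\<Omega> * \<beta> * \<Omega> * ginv \<Omega>)"
        by (rule mult_smult_assoc_mat[OF mult_carrier_mat[OF ob \<Omega>c] \<Omega>i(1)])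
      also have "\<Omega> * \<beta> * \<Omega> * ginv \<Omega> = \<Omega> * \<beta> * (\<Omega> * ginv \<Omega>)" by (rule assoc_mult_mat[OF ob \<Omega>c \<Omega>i(1)])
      also have "\<dots> = \<Omega> * \<beta>" unfolding \<Omega>i by (rule right_mult_one_mat[OF ob])
      finally show ?thesis using nil_smult_unit[OF e ob] by simp
    qed
    have "bij_betw (\<lambda>\<beta>. \<Omega> * \<beta> * \<Omega>\<^sup>T) {\<beta>. \<beta> \<in> Sym (- e) n
      \<and> nilpotent_mat (\<Omega> * \<beta>)} {h \<in> Sym (- e) n. nilpotent_mat (h * ginv \<Omega>)}"
    proof (rule bij_betwI[where g = "\<lambda>\<beta>. ginv \<Omega> * \<beta> * (ginv \<Omega>)\<^sup>T"])
      show "(\<lambda>\<beta>. \<Omega> * \<beta> * \<Omega>\<^sup>T) \<in> {\<beta>. \<beta> \<in> Sym (- e) n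
        \<and> nilpotent_mat (\<Omega> * \<beta>)} \<rightarrow> {h \<in> Sym (- e) n. nilpotent_mat (h * ginv \<Omega>)}"
        using nil Sym_congruence[OF _ \<Omega>c] Sym_carrier by blast
      show "(\<lambda>\<beta>. ginv \<Omega> * \<beta> * (ginv \<Omega>)\<^sup>T) \<in> {h \<in> Sym (- e) n. nilpotent_mat (h * ginv \<Omega>)} \<rightarrow>
        {\<beta>. \<beta> \<in> Sym (- e) n \<and> nilpotent_mat (\<Omega> * \<beta>)}"
      proof
        fix h assume "h \<in> {h \<in> Sym (- e) n. nilpotent_mat (h * ginv \<Omega>)}"
        then have h: "h \<in> Sym (- e) n" "nilpotent_mat (h * ginv \<Omega>)" by blast+
        have S: "ginv \<Omega> * h * (ginv \<Omega>)\<^sup>T \<in> Sym (- e) n" by (rule Sym_congruence[OF h(1) \<Omega>i(1)])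
        show "ginv \<Omega> * h * (ginv \<Omega>)\<^sup>T \<in> {\<beta>. \<beta> \<in> Sym (- e) n \<and> nilpotent_mat (\<Omega> * \<beta>)}"
          using S nil[OF Sym_carrier[OF S]] h(2) unfolding congruence_inverse(2)[OF Sym_carrier[OF h(1)] \<Omega>G]
            by blast
      qed
      show "ginv \<Omega> * (\<Omega> * \<beta> * \<Omega>\<^sup>T) * (ginv \<Omega>)\<^sup>T = \<beta>" if "\<beta> \<in> {\<beta>. \<beta> \<in> Sym (- e) n \<and> nilpotent_mat (\<Omega> * \<beta>)}"
        for \<beta>
        by (rule congruence_inverse[OF _ \<Omega>G]) (use that Sym_carrier in blast)
      show "\<Omega> * (ginv \<Omega> * \<beta> * (ginv \<Omega>)\<^sup>T) * \<Omega>\<^sup>T = \<beta>" if "\<beta> \<in> {h \<in> Sym (- e) n. nilpotent_mat (h * ginv \<Omega>)}"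
        for \<beta>
        by (rule congruence_inverse[OF _ \<Omega>G]) (use that Sym_carrier in blast)
    qed
    from bij_betw_same_card[OF this]
    show "(\<Sum>\<beta> | \<beta> \<in> Sym (- e) n \<and> nilpotent_mat (\<Omega> * \<beta>). 1)
      = card {h \<in> Sym (- e) n. nilpotent_mat (h * ginv \<Omega>)}" by simp
  qed
  finally show ?thesis by (simp add: nM_def)
qed

lemma cX_False_0:
  fixes e :: "'a::{field,finite}"
  assumes e: "e * e = 1"
  shows "cX False e 0 r = card (NSym (- e) r) * card (NSym e r)"
proof -
  have "(- e) * (- e) = 1" using e by simp
  then show ?thesis by (simp add: cX_def Wx_def SymN_0)
qed

text \<open>This provides the start of the recursions: for \<open>\<beta>\<close> of nullity zero,
  nilpotency leaves only the empty matrices.\<close>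

lemma NSym_nil_mult:
  assumes "\<Omega> \<in> NSym e r" "\<beta> \<in> NSym e' r" "nilpotent_mat (\<Omega> * \<beta>)"
  shows "r = 0"
  using nil_GL[OF GL_mult[OF NSym_GL[OF assms(1)] NSym_GL[OF assms(2)]] assms(3)] .

lemma cX_True_0:
  fixes e :: "'a::{field,finite}"
  assumes e: "e * e = 1"
  shows "cX True e 0 r = (if r = 0 then 1 else 0)"
proof -
  have me: "(- e) * (- e) = 1" using e by simp
  show ?thesis
  proof (cases "r = 0")
    case True
    have "{\<Omega> \<in> NSym e 0. nilpotent_mat (\<Omega> * 0\<^sub>m 0 0)} = {0\<^sub>m 0 0}" using nil_zero[of 0] by (auto simp: NSym_0)
    then show ?thesis using True by (simp add: cX_def Wx_def SymN_0[OF me] NSym_0)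
  next
    case False
    then have "Wx True e r \<beta> = 0" if "\<beta> \<in> NSym (- e) r" for \<beta>
      using NSym_nil_mult[OF _ that] by (auto simp: Wx_def)
    then show ?thesis using False by (simp add: cX_def SymN_0[OF me])
  qed
qed

lemma cT_0:
  fixes e :: "'a::{field,finite}"
  assumes e: "e * e = 1"
  shows "cT e 0 r = (if r = 0 then 1 else 0)"
proof -
  have me: "(- e) * (- e) = 1" using e by simp
  show ?thesis
  proof (cases "r = 0")
    case True
    have z: "0\<^sub>m 0 0 \<in> Sym u 0" for u :: 'a by (auto simp: Sym_def intro!: eq_matI)
    have "Bs e 0 (0\<^sub>m 0 0) (0\<^sub>m 0 0) = {0\<^sub>m 0 0}"
    proof (intro equalityI subsetI)
      fix B assume "B \<in> Bs e 0 (0\<^sub>m 0 0) (0\<^sub>m 0 0)"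
      then have "B \<in> carrier_mat 0 0" unfolding Bs_def by blast
      then show "B \<in> {0\<^sub>m 0 0}" by (simp only: carrier_0)
    next
      fix B assume "B \<in> {0\<^sub>m 0 0 :: 'a mat}"
      then show "B \<in> Bs e 0 (0\<^sub>m 0 0) (0\<^sub>m 0 0)" using z nil_zero[of 0] by (simp add: Bs_def)
    qed
    then show ?thesis using True by (simp add: cT_def Wt_def SymN_0[OF me] NSym_0)
  next
    case False
    have "Bs e r \<beta> \<Omega> = {}" if "\<beta> \<in> NSym (- e) r" "\<Omega> \<in> NSym e r" for \<beta> \<Omega>
      using NSym_nil_mult[OF that(2,1)] False by (auto simp: Bs_def)
    then have "Wt e r \<beta> = 0" if "\<beta> \<in> NSym (- e) r" for \<beta> using that by (simp add: Wt_def)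
    then show ?thesis using False by (simp add: cT_def SymN_0[OF me])
  qed
qed

section \<open>Skew forms and the symplectic group\<close>

definition hyperbolic_form :: "'a::field mat" where
  "hyperbolic_form = mat 2 2 (\<lambda>(i, j). if i = 0 \<and> j = 1 then 1 else if i = 1 \<and> j = 0 then -1 else 0)"

lemma hyperbolic_form_carrier [simp]: "hyperbolic_form \<in> carrier_mat 2 2"
  by (simp add: hyperbolic_form_def)

lemma hyperbolic_form_dims [simp]: "dim_row hyperbolic_form = 2" "dim_col hyperbolic_form = 2"
  by (simp_all add: hyperbolic_form_def)

lemma hyperbolic_form_GL: "hyperbolic_form \<in> GL 2"
proof (rule GL_I)
  show "hyperbolic_form * (- hyperbolic_form) = (1\<^sub>m 2 :: 'a mat)"
  proof (rule eq_matI)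
    fix i j assume "i < dim_row (1\<^sub>m 2 :: 'a mat)" "j < dim_col (1\<^sub>m 2 :: 'a mat)"
    then have "i = 0 \<or> i = 1" "j = 0 \<or> j = 1" by auto
    then show "(hyperbolic_form * (- hyperbolic_form)) $$ (i, j) = (1\<^sub>m 2 :: 'a mat) $$ (i, j)"
      by (auto simp: hyperbolic_form_def scalar_prod_def numeral_2_eq_2)
  qed (simp_all add: hyperbolic_form_def)
qed simp_all

lemma skew_zero_diag:
  fixes M :: "'a::field mat"
  assumes two: "(2::'a) \<noteq> 0" and M: "M \<in> Sym (- 1) n" and i: "i < n"
  shows "M $$ (i, i) = 0"
proof -
  have "M\<^sup>T = (- 1) \<cdot>\<^sub>m M" and Mc: "M \<in> carrier_mat n n" using M by (auto simp: Sym_def)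
  then have "M\<^sup>T $$ (i, i) = ((- 1) \<cdot>\<^sub>m M) $$ (i, i)" by simp
  then have "M $$ (i, i) = - M $$ (i, i)" using i Mc by simp
  then have "2 * M $$ (i, i) = 0" by (simp add: eq_neg_iff_add_eq_0)
  then show ?thesis using two by simp
qed

text \<open>A unit vector that pairs nontrivially with the first one spans a hyperbolic plane
  together with it. The two are completed to a basis, and one elimination step splits the plane off
  orthogonally.\<close>

lemma skew_split:
  fixes M :: "'a::field mat"
  assumes two: "(2::'a) \<noteq> 0" and M: "M \<in> NSym (- 1) n" and n: "n > 0"
  shows "\<exists>m. n = 2 + m \<and> (\<exists>g \<in> GL n. \<exists>D \<in> NSym (- 1) m.
    g * M * g\<^sup>T = four_block_mat hyperbolic_form (0\<^sub>m 2 m) (0\<^sub>m m 2) D)"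
proof -
  note MS = NSym_Sym[OF M] and MG = NSym_GL[OF M]
  note Mc = Sym_carrier[OF MS]
  have MT: "M $$ (j, i) = - M $$ (i, j)" if "i < n" "j < n" for i j
  proof -
    have "M\<^sup>T = (- 1) \<cdot>\<^sub>m M" using MS by (simp add: Sym_def)
    then have "M\<^sup>T $$ (i, j) = ((- 1) \<cdot>\<^sub>m M) $$ (i, j)" by simp
    then show ?thesis using that Mc by simp
  qed
  have "\<exists>i < n. M $$ (i, 0) \<noteq> 0"
  proof (rule ccontr)
    assume "\<not> (\<exists>i < n. M $$ (i, 0) \<noteq> 0)"
    then have "col M 0 = 0\<^sub>v n" using Mc n by (intro eq_vecI) auto
    then have "M *\<^sub>v unit_vec n 0 = 0\<^sub>v n" using Mc n by (intro eq_vecI) (auto simp: vec_eq_iff)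
    then have "unit_vec n 0 = (0\<^sub>v n :: 'a vec)" using GL_mult_vec_eq_0[OF MG] by simp
    then show False using n by (metis unit_vec_nonzero)
  qed
  then obtain i where i: "i < n" "M $$ (i, 0) \<noteq> 0" by blast
  define \<mu> where "\<mu> = inverse (M $$ (i, 0))"
  have i0: "i \<noteq> 0" using i skew_zero_diag[OF two MS n] by metis
  \<comment> \<open>The columns are \<open>\<mu>\<close> times the unit vector at \<open>i\<close>
    and the unit vector at \<open>0\<close>; the scalar makes their pairing equal to one.\<close>
  define c where "c = mat n 2 (\<lambda>(k, j). if j = 0 then (if k = i then \<mu> else 0) else (if k = 0 then 1 else 0))"
  have cc: "c \<in> carrier_mat n 2" by (simp add: c_def)
  have cFC: "c \<in> full_col_rank n 2" unfolding full_col_rank_def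
  proof (intro CollectI conjI ballI impI cc)
    fix v assume v: "v \<in> carrier_vec 2" "c *\<^sub>v v = 0\<^sub>v n"
    have cv: "(c *\<^sub>v v) $ k = c $$ (k, 0) * v $ 0 + c $$ (k, 1) * v $ 1" if "k < n" for k
      using that v(1) by (simp add: c_def scalar_prod_def numeral_2_eq_2)
    have "c $$ (i, 0) * v $ 0 + c $$ (i, 1) * v $ 1 = 0" unfolding cv[OF i(1), symmetric] v(2) using i by simp
    then have "\<mu> * v $ 0 = 0" using i i0 by (simp add: c_def)
    then have "v $ 0 = 0" using i(2) by (simp add: \<mu>_def)
    moreover have "c $$ (0, 0) * v $ 0 + c $$ (0, 1) * v $ 1 = 0" unfolding cv[OF n, symmetric] v(2) using n
      by simp
    then have "v $ 1 = 0" using i0 n by (simp add: c_def)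
    ultimately show "v = 0\<^sub>v 2" using v(1) by (intro eq_vecI) (auto simp: less_2_cases_iff)
  qed
  obtain m Y where m: "n = 2 + m" and Y: "Y \<in> GL n" "c = Y * idblock n 2"
    using full_col_rank_normal_form[OF cFC] by blast
  note Yc = GL_carrier[OF Y(1)]
  let ?Z = "Y\<^sup>T * M * (Y\<^sup>T)\<^sup>T"
  have ZN: "?Z \<in> NSym (- 1) n" by (rule NSym_congruence[OF M GL_transpose[OF Y(1)]])
  have Yij: "Y $$ (k, j) = c $$ (k, j)" if "k < n" "j < 2" for k j
    using mult_idblock_col[of Y n 2 m k j] that Yc m Y(2) by simp
  have MY: "(M * Y) $$ (k, j) = (if j = 0 then M $$ (k, i) * \<mu> else M $$ (k, 0))" if "k < n" "j < 2" for k j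
  proof -
    have "(M * Y) $$ (k, j) = (\<Sum>l\<in>{0..<n}. M $$ (k, l) * c $$ (l, j))"
      using that Mc Yc m Yij by (simp add: scalar_prod_def)
    also have "\<dots> = (\<Sum>l\<in>{0..<n}. if l = (if j = 0 then i else 0) then M $$ (k, l) * (if j
      = 0 then \<mu> else 1) else 0)"
      by (rule sum.cong) (use that in \<open>auto simp: c_def\<close>)
    also have "\<dots> = (if j = 0 then M $$ (k, i) * \<mu> else M $$ (k, 0))" using i n by (simp add: sum.delta)
    finally show ?thesis .
  qed
  have Z: "?Z $$ (j', j) = (if j' = 0 then \<mu> * (M * Y) $$ (i, j) else (M * Y) $$ (0, j))" if "j' < 2" "j < 2"
    for j' j
  proof -
    have "?Z = Y\<^sup>T * (M * Y)" using Mc Yc by (simp add: assoc_mult_mat[of _ n n _ n _ n])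
    then have "?Z $$ (j', j) = (\<Sum>l\<in>{0..<n}. Y $$ (l, j') * (M * Y) $$ (l, j))"
      using that Mc Yc m by (simp only:) (subst index_mult_mat(1), simp_all add: scalar_prod_def)
    also have "\<dots> = (\<Sum>l\<in>{0..<n}. if l = (if j' = 0 then i else 0) then (if j' = 0 then \<mu> else 1) * (M * Y) $$
      (l, j) else 0)"
      by (rule sum.cong[OF refl]) (use that Yij in \<open>auto simp: c_def\<close>)
    also have "\<dots> = (if j' = 0 then \<mu> * (M * Y) $$ (i, j) else (M * Y) $$ (0, j))" using i n
      by (simp add: sum.delta)
    finally show ?thesis .
  qed
  obtain A B C D where bl: "A \<in> carrier_mat 2 2" "B \<in> carrier_mat 2 m" "C \<in> carrier_mat m 2"
    "D \<in> carrier_mat m m"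
    "?Z = four_block_mat A B C D" using four_block_cases[of ?Z 2 m 2 m] GL_carrier[OF NSym_GL[OF ZN]] m
      by metis
  have A: "A = hyperbolic_form"
  proof (rule eq_matI)
    fix j' j assume "j' < dim_row (hyperbolic_form :: 'a mat)" "j < dim_col (hyperbolic_form :: 'a mat)"
    then have j: "j' < 2" "j < 2" by (simp_all add: hyperbolic_form_def)
    have "A $$ (j', j) = ?Z $$ (j', j)" unfolding bl(5) using bl(1,4) j by simp
    also have "\<dots> = (if j' = 0 then \<mu> * (if j = 0 then M $$ (i, i) * \<mu> else M $$ (i, 0)) else (if j
      = 0 then M $$ (0, i) * \<mu> else M $$ (0, 0)))"
      using Z[OF j] MY[OF i(1) j(2)] MY[OF n j(2)] by simp
    also have "\<dots> = hyperbolic_form $$ (j', j)"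
      using j skew_zero_diag[OF two MS i(1)] skew_zero_diag[OF two MS n] MT[OF i(1) n] i(2)
      by (auto simp: hyperbolic_form_def \<mu>_def less_2_cases_iff)
    finally show "A $$ (j', j) = hyperbolic_form $$ (j', j)" .
  qed (use bl in \<open>simp_all add: hyperbolic_form_def\<close>)
  have me: "(- 1) * (- 1) = (1 :: 'a)" by simp
  have ZS: "four_block_mat A B C D \<in> Sym (- 1) (2 + m)" using NSym_Sym[OF ZN] bl(5) m by simp
  note hG = hyperbolic_form_GL[where 'a = 'a] and hi = ginv[OF hyperbolic_form_GL[where 'a = 'a]]
  \<comment> \<open>Clears the lower left block, since \<open>?X * hyperbolic_form = - C\<close>.
    The upper right block then vanishes by skew symmetry, without further computation.\<close>
  let ?X = "- (C * ginv hyperbolic_form)"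
  have Xc: "?X \<in> carrier_mat m 2" using bl(3) hi(1) by simp
  let ?g = "four_block_mat (1\<^sub>m 2) (0\<^sub>m 2 m) ?X (1\<^sub>m m)"
  have gG: "?g \<in> GL (2 + m)" using GL_lower_block[OF one_carrier_mat Xc one_carrier_mat] by simp
  have "C * ginv hyperbolic_form * hyperbolic_form = C * (ginv hyperbolic_form * hyperbolic_form)"
    by (rule assoc_mult_mat[OF bl(3) hi(1) hyperbolic_form_carrier])
  then have "C * ginv hyperbolic_form * hyperbolic_form = C" unfolding hi(3) using bl(3) by simp
  moreover have "?X * hyperbolic_form = - (C * ginv hyperbolic_form * hyperbolic_form)"
    by (rule uminus_mult_left_mat) (use hi in \<open>simp add: carrier_matD[OF hyperbolic_form_carrier]\<close>)
  ultimately have "?X * hyperbolic_form = - C" by simp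
  then have XA: "?X * A + C = 0\<^sub>m m 2" unfolding A using bl(3) by (intro eq_matI) auto
  have "?g * four_block_mat A B C D = four_block_mat (1\<^sub>m 2 * A + 0\<^sub>m 2 m * C) (1\<^sub>m 2 * B
    + 0\<^sub>m 2 m * D) (?X * A + 1\<^sub>m m * C) (?X * B + 1\<^sub>m m * D)"
    by (rule mult_four_block_mat[OF one_carrier_mat zero_carrier_mat Xc one_carrier_mat bl(1-4)])
  also have "\<dots> = four_block_mat A B (0\<^sub>m m 2) (?X * B + D)" using bl(1-4) XA by simp
  finally have gZ: "?g * four_block_mat A B C D = four_block_mat A B (0\<^sub>m m 2) (?X * B + D)" .
  have XBc: "?X * B + D \<in> carrier_mat m m" by (rule add_carrier_mat[OF bl(4)])
  have gT: "?g\<^sup>T = four_block_mat (1\<^sub>m 2) (?X\<^sup>T) (0\<^sub>m m 2) (1\<^sub>m m)"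
    by (subst transpose_four_block_mat[OF one_carrier_mat zero_carrier_mat Xc one_carrier_mat]) simp
  have XTc: "?X\<^sup>T \<in> carrier_mat 2 m" using Xc by simp
  have "?g * four_block_mat A B C D * ?g\<^sup>T = four_block_mat (A * 1\<^sub>m 2 + B * 0\<^sub>m m 2) (A * ?X\<^sup>T + B * 1\<^sub>m m)
     (0\<^sub>m m 2 * 1\<^sub>m 2 + (?X * B + D) * 0\<^sub>m m 2) (0\<^sub>m m 2 * ?X\<^sup>T + (?X * B + D) * 1\<^sub>m m)"
    unfolding gZ gT by (rule mult_four_block_mat[OF bl(1,2) zero_carrier_mat XBc one_carrier_mat XTc
      zero_carrier_mat one_carrier_mat])
  also have "\<dots> = four_block_mat hyperbolic_form (A * ?X\<^sup>T + B) (0\<^sub>m m 2) (?X * B + D)"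
  proof (rule cong_four_block_mat)
    show "A * 1\<^sub>m 2 + B * 0\<^sub>m m 2 = hyperbolic_form"
      using bl(2) unfolding A by (simp add: right_mult_one_mat[OF hyperbolic_form_carrier])
    show "A * ?X\<^sup>T + B * 1\<^sub>m m = A * ?X\<^sup>T + B" using bl(2) by simp
    show "0\<^sub>m m 2 * 1\<^sub>m 2 + (?X * B + D) * 0\<^sub>m m 2 = 0\<^sub>m m 2" unfolding right_mult_zero_mat[OF XBc] by simp
    show "0\<^sub>m m 2 * ?X\<^sup>T + (?X * B + D) * 1\<^sub>m m = ?X * B + D"
      using right_mult_one_mat[OF XBc] left_add_zero_mat[OF XBc] left_mult_zero_mat[OF XTc, of m] by simp
  qed
  finally have eq: "?g * four_block_mat A B C D * ?g\<^sup>T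
    = four_block_mat hyperbolic_form (A * ?X\<^sup>T + B) (0\<^sub>m m 2) (?X * B + D)" .
  have Qc: "A * ?X\<^sup>T + B \<in> carrier_mat 2 m" by (rule add_carrier_mat[OF bl(2)])
  have S: "four_block_mat hyperbolic_form (A * ?X\<^sup>T + B) (0\<^sub>m m 2) (?X * B + D) \<in> Sym (- 1) (2 + m)"
    using Sym_congruence[OF ZS GL_carrier[OF gG]] unfolding eq .
  have b: "0\<^sub>m m 2 = (- 1) \<cdot>\<^sub>m (A * ?X\<^sup>T + B)\<^sup>T" "?X * B + D \<in> Sym (- 1) m"
    using S unfolding Sym_block[OF me hyperbolic_form_carrier Qc zero_carrier_mat XBc] by blast+
  have "(- 1) \<cdot>\<^sub>m 0\<^sub>m m 2 = (- 1) \<cdot>\<^sub>m ((- 1) \<cdot>\<^sub>m (A * ?X\<^sup>T + B)\<^sup>T)" using b(1) by simp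
  then have "(A * ?X\<^sup>T + B)\<^sup>T = 0\<^sub>m m 2" unfolding smult_smult me by simp
  then have Q: "A * ?X\<^sup>T + B = 0\<^sub>m 2 m" by (metis transpose_transpose zero_transpose_mat)
  have ZG: "four_block_mat A B C D \<in> GL (2 + m)" using NSym_GL[OF ZN] bl(5) m by simp
  have "four_block_mat hyperbolic_form (0\<^sub>m 2 m) (0\<^sub>m m 2) (?X * B + D) \<in> GL (2 + m)"
    using GL_congruence_iff[OF GL_carrier[OF ZG] gG] ZG unfolding eq Q by blast
  then have "?X * B + D \<in> GL m" using GL_upper_block[OF hyperbolic_form_carrier zero_carrier_mat XBc] by blast
  then have DN: "?X * B + D \<in> NSym (- 1) m" using b(2) by (simp add: NSym_iff)
  have YTc: "Y\<^sup>T \<in> carrier_mat n n" using Yc by simp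
  have gn: "?g \<in> GL n" using gG m by simp
  have "?g * Y\<^sup>T * M * (?g * Y\<^sup>T)\<^sup>T = ?g * ?Z * ?g\<^sup>T"
    by (rule congruence_comp[OF Mc YTc GL_carrier[OF gn], symmetric])
  also have "\<dots> = four_block_mat hyperbolic_form (0\<^sub>m 2 m) (0\<^sub>m m 2) (?X * B + D)" unfolding bl(5) eq Q ..
  finally show ?thesis using m DN GL_mult[OF gn GL_transpose[OF Y(1)]] by blast
qed

lemma skew_congruent:
  fixes M :: "'a::field mat"
  assumes two: "(2::'a) \<noteq> 0"
  shows "M \<in> NSym (- 1) n \<Longrightarrow> M' \<in> NSym (- 1) n \<Longrightarrow> \<exists>g \<in> GL n. g * M * g\<^sup>T = M'"
proof (induction n arbitrary: M M' rule: less_induct)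
  case (less n)
  note Mc = GL_carrier[OF NSym_GL[OF less.prems(1)]] and Mc' = GL_carrier[OF NSym_GL[OF less.prems(2)]]
  show ?case
  proof (cases "n = 0")
    case True
    then have "1\<^sub>m n * M * (1\<^sub>m n)\<^sup>T = M'" using less.prems Mc by (simp add: NSym_0)
    then show ?thesis using GL_one by blast
  next
    case False
    then have n: "n > 0" by simp
    obtain m g D where 1: "n = 2 + m" "g \<in> GL n" "D \<in> NSym (- 1) m" "g * M * g\<^sup>T
      = four_block_mat hyperbolic_form (0\<^sub>m 2 m) (0\<^sub>m m 2) D"
      using skew_split[OF two less.prems(1) n] by blast
    obtain m' g' D' where 2: "n = 2 + m'" "g' \<in> GL n" "D' \<in> NSym (- 1) m'" "g' * M' * g'\<^sup>T
      = four_block_mat hyperbolic_form (0\<^sub>m 2 m') (0\<^sub>m m' 2) D'"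
      using skew_split[OF two less.prems(2) n] by blast
    have mm: "m' = m" "m < n" using 1(1) 2(1) by auto
    obtain h where h: "h \<in> GL m" "h * D * h\<^sup>T = D'" using less.IH[OF mm(2) 1(3), of D'] 2(3) mm(1) by blast
    note hc = GL_carrier[OF h(1)] and Dc = GL_carrier[OF NSym_GL[OF 1(3)]]
    let ?h = "four_block_mat (1\<^sub>m 2) (0\<^sub>m 2 m) (0\<^sub>m m 2) h"
    have hG: "?h \<in> GL n" unfolding 1(1) using GL_upper_block[OF one_carrier_mat zero_carrier_mat hc] h(1)
      GL_one by blast
    have hT: "?h\<^sup>T = four_block_mat (1\<^sub>m 2) (0\<^sub>m 2 m) (0\<^sub>m m 2) (h\<^sup>T)"
      by (subst transpose_four_block_mat[OF one_carrier_mat zero_carrier_mat zero_carrier_mat hc]) simp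
    have "?h * four_block_mat hyperbolic_form (0\<^sub>m 2 m) (0\<^sub>m m 2) D
      = four_block_mat hyperbolic_form (0\<^sub>m 2 m) (0\<^sub>m m 2) (h * D)"
      by (subst mult_four_block_mat[OF one_carrier_mat zero_carrier_mat zero_carrier_mat hc
        hyperbolic_form_carrier zero_carrier_mat zero_carrier_mat Dc])
        (use hc Dc left_mult_one_mat[OF hyperbolic_form_carrier] in \<open>simp add:
          carrier_matD[OF hyperbolic_form_carrier]\<close>)
    then have "?h * (g * M * g\<^sup>T) * ?h\<^sup>T = four_block_mat hyperbolic_form (0\<^sub>m 2 m) (0\<^sub>m m 2) (h * D) * ?h\<^sup>T"
      unfolding 1(4) by simp
    also have "\<dots> = four_block_mat hyperbolic_form (0\<^sub>m 2 m) (0\<^sub>m m 2) (h * D * h\<^sup>T)" unfolding hT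
      by (subst mult_four_block_mat[OF hyperbolic_form_carrier zero_carrier_mat zero_carrier_mat
        mult_carrier_mat[OF hc Dc] one_carrier_mat zero_carrier_mat zero_carrier_mat, of _ m])
        (use hc Dc right_mult_one_mat[OF hyperbolic_form_carrier] in \<open>simp_all add:
          carrier_matD[OF hyperbolic_form_carrier] del: assoc_mult_mat\<close>)
    also have "\<dots> = g' * M' * g'\<^sup>T" using 2(4) h(2) mm(1) by simp
    finally have *: "?h * (g * M * g\<^sup>T) * ?h\<^sup>T = g' * M' * g'\<^sup>T" .
    have gi': "ginv g' \<in> GL n" by (rule GL_ginv[OF 2(2)])
    have k1: "?h * (g * M * g\<^sup>T) * ?h\<^sup>T = (?h * g) * M * (?h * g)\<^sup>T"
      by (rule congruence_comp[OF Mc GL_carrier[OF 1(2)] GL_carrier[OF hG]])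
    have hg: "?h * g \<in> GL n" by (rule GL_mult[OF hG 1(2)])
    have "(ginv g' * (?h * g)) * M * (ginv g' * (?h * g))\<^sup>T
      = ginv g' * ((?h * g) * M * (?h * g)\<^sup>T) * (ginv g')\<^sup>T"
      by (rule congruence_comp[OF Mc GL_carrier[OF hg] GL_carrier[OF gi'], symmetric])
    also have "\<dots> = M'" unfolding k1[symmetric] * by (rule congruence_inverse(1)[OF Mc' 2(2)])
    finally show ?thesis using GL_mult[OF gi' hg] by blast
  qed
qed

section \<open>The order of the symplectic group and the commuting pairs\<close>

lemma Sp_group_GL:
  assumes J: "J \<in> NSym e (2 * n)" and g: "g \<in> Sp_group n J"
  shows "g \<in> GL (2 * n)"
proof -
  have gc: "g \<in> carrier_mat (2 * n) (2 * n)" and eq: "g * J * g\<^sup>T = J" using g by (auto simp: Sp_group_def)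
  note Jc = GL_carrier[OF NSym_GL[OF J]]
  have "det (g * J * g\<^sup>T) = det g * det J * det g"
    using gc Jc by (simp add: det_mult[of _ "2 * n"] det_transpose del: assoc_mult_mat)
  then show ?thesis using NSym_GL[OF J] gc unfolding eq by (auto simp: GL_def)
qed

text \<open>Orbit and stabiliser: by \<open>skew_congruent\<close> the map
  \<open>g \<mapsto> g * J * g\<^sup>T\<close> is onto the nonsingular skew forms, and each of its
  fibres is a coset of \<open>Sp_group n J\<close>.\<close>

lemma card_GL_Sp:
  fixes J :: "'a::{field,finite} mat"
  assumes two: "(2::'a) \<noteq> 0" and J: "J \<in> NSym (- 1) (2 * n)"
  shows "card (GL (2 * n) :: 'a mat set) = card (NSym (- 1 :: 'a) (2 * n)) * card (Sp_group n J)"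
proof (rule card_fibres[of _ _ "\<lambda>g. g * J * g\<^sup>T"])
  note Jc = GL_carrier[OF NSym_GL[OF J]]
  show "(\<lambda>g. g * J * g\<^sup>T) ` GL (2 * n) \<subseteq> NSym (- 1) (2 * n)" using NSym_congruence[OF J] by blast
  fix M :: "'a mat" assume "M \<in> NSym (- 1) (2 * n)"
  then obtain g0 where g0: "g0 \<in> GL (2 * n)" "g0 * J * g0\<^sup>T = M" using skew_congruent[OF two J] by blast
  note g0c = GL_carrier[OF g0(1)] and g0i = ginv[OF g0(1)]
  have conj: "(k * h) * J * (k * h)\<^sup>T = k * (h * J * h\<^sup>T) * k\<^sup>T" if "k \<in> GL (2 * n)" "h \<in> GL (2 * n)" for k h
    by (rule congruence_comp[OF Jc GL_carrier[OF that(2)] GL_carrier[OF that(1)], symmetric])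
  have c1: "ginv g0 * (g0 * k) = k" "g0 * (ginv g0 * k) = k" if "k \<in> GL (2 * n)" for k
    using ginv_cancel(1,2)[OF g0(1)] GL_carrier[OF that] by auto
  have "bij_betw (\<lambda>k. g0 * k) (Sp_group n J) {g \<in> GL (2 * n). g * J * g\<^sup>T = M}"
  proof (rule bij_betwI[where g = "\<lambda>k. ginv g0 * k"])
    show "(\<lambda>k. g0 * k) \<in> Sp_group n J \<rightarrow> {g \<in> GL (2 * n). g * J * g\<^sup>T = M}"
    proof
      fix k assume k: "k \<in> Sp_group n J"
      have kG: "k \<in> GL (2 * n)" by (rule Sp_group_GL[OF J k])
      have "k * J * k\<^sup>T = J" using k by (simp add: Sp_group_def)
      then show "g0 * k \<in> {g \<in> GL (2 * n). g * J * g\<^sup>T = M}"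
        using conj[OF g0(1) kG] g0(2) GL_mult[OF g0(1) kG] by simp
    qed
    show "(\<lambda>k. ginv g0 * k) \<in> {g \<in> GL (2 * n). g * J * g\<^sup>T = M} \<rightarrow> Sp_group n J"
    proof
      fix g assume "g \<in> {g \<in> GL (2 * n). g * J * g\<^sup>T = M}"
      then have g: "g \<in> GL (2 * n)" "g * J * g\<^sup>T = M" by blast+
      have "(ginv g0 * g) * J * (ginv g0 * g)\<^sup>T = ginv g0 * M * (ginv g0)\<^sup>T"
        using conj[OF GL_ginv[OF g0(1)] g(1)] g(2) by simp
      also have "\<dots> = J" unfolding g0(2)[symmetric] by (rule congruence_inverse(1)[OF Jc g0(1)])
      finally show "ginv g0 * g \<in> Sp_group n J"
        using GL_carrier[OF GL_mult[OF GL_ginv[OF g0(1)] g(1)]] by (simp only: Sp_group_def mem_Collect_eq)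
    qed
    show "ginv g0 * (g0 * k) = k" if "k \<in> Sp_group n J" for k by (rule c1[OF Sp_group_GL[OF J that]])
    show "g0 * (ginv g0 * k) = k" if "k \<in> {g \<in> GL (2 * n). g * J * g\<^sup>T = M}" for k using c1 that by blast
  qed
  then show "card {g \<in> GL (2 * n). g * J * g\<^sup>T = M} = card (Sp_group n J)"
    by (rule bij_betw_same_card[symmetric])
qed auto

lemma sp_lie_iff: "A \<in> carrier_mat (2 * n) (2 * n) \<Longrightarrow> J \<in> carrier_mat (2 * n) (2 * n) \<Longrightarrow> A \<in> sp_lie n J
  \<longleftrightarrow> A * J \<in> Sym 1 (2 * n)"
  by (auto simp: sp_lie_def Sym_def)

lemma NS_le:
  fixes J :: "'a::{field,finite} mat"
  assumes g: "g \<in> GL (2 * n)" and J: "J \<in> carrier_mat (2 * n) (2 * n)"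
  shows "NS n J \<le> NS n (g * J * g\<^sup>T)"
  unfolding NS_def
proof (rule card_inj_on_le[of "\<lambda>(A, B). (g * A * ginv g, g * B * ginv g)"])
  note gc = GL_carrier[OF g] and gi = ginv[OF g]
  have J': "g * J * g\<^sup>T \<in> carrier_mat (2 * n) (2 * n)" using gc J by simp
  have cj: "g * A * ginv g \<in> carrier_mat (2 * n) (2 * n)" if "A \<in> carrier_mat (2 * n) (2 * n)" for A
    using gc gi that by simp
  have mult: "g * A * ginv g * (g * B * ginv g) = g * (A * B) * ginv g"
    if "A \<in> carrier_mat (2 * n) (2 * n)" "B \<in> carrier_mat (2 * n) (2 * n)" for A B
  proof -
    have dims: "dim_row g = 2 * n" "dim_col g = 2 * n" "dim_row (ginv g) = 2 * n" "dim_col (ginv g) = 2 * n"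
      "dim_row A = 2 * n" "dim_col A = 2 * n" "dim_row B = 2 * n" "dim_col B = 2 * n" using gc gi that by auto
    show ?thesis by (simp add: assoc_mult_mat_dims dims ginv_cancel[OF g] del: assoc_mult_mat)
  qed
  have pc: "A \<in> carrier_mat (2 * n) (2 * n)" "B \<in> carrier_mat (2 * n) (2 * n)"
    if "(A, B) \<in> commuting_nilpotent_pairs n J" for A B
    using that by (auto simp: commuting_nilpotent_pairs_def sp_lie_def)
  show "inj_on (\<lambda>(A, B). (g * A * ginv g, g * B * ginv g)) (commuting_nilpotent_pairs n J)"
  proof (rule inj_on_inverseI[where g = "\<lambda>(A, B). (ginv g * A * g, ginv g * B * g)"])
    fix x assume x: "x \<in> commuting_nilpotent_pairs n J"
    obtain A B where AB: "x = (A, B)" by (cases x)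
    show "(\<lambda>(A, B). (ginv g * A * g, ginv g * B * g)) ((\<lambda>(A, B). (g * A * ginv g, g * B * ginv g)) x) = x"
      unfolding AB prod.case using conj_inverse(1)[OF g] pc[OF x[unfolded AB]] by simp
  qed
  show "(\<lambda>(A, B). (g * A * ginv g, g * B * ginv g)) ` commuting_nilpotent_pairs n J
    \<subseteq> commuting_nilpotent_pairs n (g * J * g\<^sup>T)"
  proof (intro image_subsetI)
    fix x assume x: "x \<in> commuting_nilpotent_pairs n J"
    obtain A B where AB: "x = (A, B)" by (cases x)
    note c = pc[OF x[unfolded AB]]
    have p: "A * J \<in> Sym 1 (2 * n)" "B * J \<in> Sym 1 (2 * n)" "nilpotent_mat A" "nilpotent_mat B" "A * B
      = B * A"
      using x[unfolded AB] sp_lie_iff[OF c(1) J] sp_lie_iff[OF c(2) J]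
        by (auto simp: commuting_nilpotent_pairs_def)
    have "g * A * ginv g \<in> sp_lie n (g * J * g\<^sup>T)" "g * B * ginv g \<in> sp_lie n (g * J * g\<^sup>T)"
      using sp_lie_iff[OF cj[OF c(1)] J'] sp_lie_iff[OF cj[OF c(2)] J'] conj_congruence_Sym(2)[OF g c(1) J]
        conj_congruence_Sym(2)[OF g c(2) J] p
      by blast+
    moreover have "nilpotent_mat (g * A * ginv g)" "nilpotent_mat (g * B * ginv g)"
      using nil_similar[OF g c(1)] nil_similar[OF g c(2)] p by blast+
    moreover have "g * A * ginv g * (g * B * ginv g) = g * B * ginv g * (g * A * ginv g)"
      unfolding mult[OF c] mult[OF c(2,1)] p(5) ..
    ultimately show "(\<lambda>(A, B). (g * A * ginv g, g * B * ginv g)) x \<in> commuting_nilpotent_pairs n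
      (g * J * g\<^sup>T)"
      unfolding AB commuting_nilpotent_pairs_def by simp
  qed
qed (rule finite_commuting_nilpotent_pairs)

lemma NS_eq:
  fixes J M :: "'a::{field,finite} mat"
  assumes two: "(2::'a) \<noteq> 0" and J: "J \<in> NSym (- 1) (2 * n)" and M: "M \<in> NSym (- 1) (2 * n)"
  shows "NS n M = NS n J"
proof (rule antisym)
  note Jc = GL_carrier[OF NSym_GL[OF J]] and Mc = GL_carrier[OF NSym_GL[OF M]]
  show "NS n M \<le> NS n J" using skew_congruent[OF two M J] NS_le[OF _ Mc] by metis
  show "NS n J \<le> NS n M" using skew_congruent[OF two J M] NS_le[OF _ Jc] by metis
qed

text \<open>The pair \<open>(\<beta>, B)\<close> corresponds to \<open>(A, B) = (\<Omega> \<beta>, B)\<close>.\<close>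

lemma NS_eq_sum:
  fixes \<Omega> :: "'a::{field,finite} mat"
  assumes \<Omega>: "\<Omega> \<in> NSym (- 1) (2 * n)"
  shows "NS n \<Omega> = (\<Sum>\<beta>\<in>Sym 1 (2 * n). card (Bs (- 1) (2 * n) \<beta> \<Omega>))"
proof -
  let ?N = "2 * n"
  have \<Omega>G: "\<Omega> \<in> GL ?N" by (rule NSym_GL[OF \<Omega>])
  note \<Omega>c = GL_carrier[OF \<Omega>G] and \<Omega>i = ginv[OF \<Omega>G]
  have \<Omega>T: "\<Omega>\<^sup>T = - \<Omega>"
  proof -
    have "\<Omega>\<^sup>T = (- 1) \<cdot>\<^sub>m \<Omega>" using \<Omega> by (simp add: NSym_def Sym_def)
    also have "\<dots> = - \<Omega>" by (rule eq_matI) auto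
    finally show ?thesis .
  qed
  have cong: "\<Omega> * \<beta> * \<Omega> \<in> Sym 1 ?N \<longleftrightarrow> \<beta> \<in> Sym 1 ?N" if \<beta>: "\<beta> \<in> carrier_mat ?N ?N" for \<beta>
  proof -
    have ob: "\<Omega> * \<beta> \<in> carrier_mat ?N ?N" by (rule mult_carrier_mat[OF \<Omega>c \<beta>])
    have eq: "\<Omega> * \<beta> * \<Omega>\<^sup>T = (- 1) \<cdot>\<^sub>m (\<Omega> * \<beta> * \<Omega>)"
    proof -
      have "\<Omega>\<^sup>T = (- 1) \<cdot>\<^sub>m \<Omega>" using \<Omega> by (simp add: NSym_def Sym_def)
      then show ?thesis using mult_smult_distrib[OF ob \<Omega>c, of "- 1"] by simp
    qed
    have "\<Omega> * \<beta> * \<Omega> \<in> Sym 1 ?N \<longleftrightarrow> \<Omega> * \<beta> * \<Omega>\<^sup>T \<in> Sym 1 ?N"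
      unfolding eq by (rule Sym_smult_iff[OF _ mult_carrier_mat[OF ob \<Omega>c], symmetric]) simp
    also have "\<dots> \<longleftrightarrow> \<beta> \<in> Sym 1 ?N"
      using Sym_congruence[of \<beta> 1 ?N \<Omega> ?N] Sym_congruence[of "\<Omega> * \<beta> * \<Omega>\<^sup>T" 1 ?N "ginv \<Omega>" ?N]
        congruence_inverse(1)[OF \<beta> \<Omega>G] \<Omega>c \<Omega>i(1) by auto
    finally show ?thesis .
  qed
  \<comment> \<open>With \<open>B * \<Omega>\<close> symmetric and \<open>\<Omega>\<close> skew,
    \<open>B * \<Omega>\<close> is minus \<open>\<Omega> * B\<^sup>T\<close>. Cancelling
    \<open>\<Omega>\<close> on the left turns commutation into
    \<open>\<beta> * B = - (B\<^sup>T * \<beta>)\<close>.\<close>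
  have comm: "\<Omega> * \<beta> * B = B * (\<Omega> * \<beta>) \<longleftrightarrow> \<beta> * B \<in> Sym (- 1) ?N"
    if \<beta>: "\<beta> \<in> Sym 1 ?N" and B: "B \<in> carrier_mat ?N ?N" "B * \<Omega> \<in> Sym 1 ?N" for \<beta> B
  proof -
    note \<beta>c = Sym_carrier[OF \<beta>]
    have BTc: "B\<^sup>T \<in> carrier_mat ?N ?N" using B by simp
    have "(B * \<Omega>)\<^sup>T = \<Omega>\<^sup>T * B\<^sup>T" by (rule transpose_mult[OF B(1) \<Omega>c])
    then have "B * \<Omega> = - \<Omega> * B\<^sup>T" using B(2) unfolding \<Omega>T by (simp add: Sym_def)
    then have BO: "B * \<Omega> = - (\<Omega> * B\<^sup>T)" using \<Omega>c BTc by simp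
    have "B * (\<Omega> * \<beta>) = B * \<Omega> * \<beta>" by (rule assoc_mult_mat[OF B(1) \<Omega>c \<beta>c, symmetric])
    also have "\<dots> = - (\<Omega> * B\<^sup>T * \<beta>)" unfolding BO using \<Omega>c BTc \<beta>c by (simp del: assoc_mult_mat)
    also have "\<Omega> * B\<^sup>T * \<beta> = \<Omega> * (B\<^sup>T * \<beta>)" by (rule assoc_mult_mat[OF \<Omega>c BTc \<beta>c])
    also have "- (\<Omega> * (B\<^sup>T * \<beta>)) = \<Omega> * (- (B\<^sup>T * \<beta>))" using \<Omega>c BTc \<beta>c by simp
    finally have r: "B * (\<Omega> * \<beta>) = \<Omega> * (- (B\<^sup>T * \<beta>))" .
    have l: "\<Omega> * \<beta> * B = \<Omega> * (\<beta> * B)" by (rule assoc_mult_mat[OF \<Omega>c \<beta>c B(1)])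
    have c1: "\<beta> * B \<in> carrier_mat ?N ?N" "- (B\<^sup>T * \<beta>) \<in> carrier_mat ?N ?N" using \<beta>c B BTc by auto
    have "\<Omega> * \<beta> * B = B * (\<Omega> * \<beta>) \<longleftrightarrow> \<beta> * B = - (B\<^sup>T * \<beta>)"
      unfolding r l using GL_cancel_left[OF \<Omega>G c1] by auto
    also have "B\<^sup>T * \<beta> = (\<beta> * B)\<^sup>T"
    proof -
      have "(\<beta> * B)\<^sup>T = B\<^sup>T * \<beta>\<^sup>T" by (rule transpose_mult[OF \<beta>c B(1)])
      then show ?thesis using \<beta> by (simp add: Sym_def)
    qed
    also have "\<beta> * B = - (\<beta> * B)\<^sup>T \<longleftrightarrow> \<beta> * B \<in> Sym (- 1) ?N"
    proof -
      have "(- 1) \<cdot>\<^sub>m X = - X" for X :: "'a mat" by (rule eq_matI) auto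
      moreover have "\<beta> * B = - (\<beta> * B)\<^sup>T \<longleftrightarrow> (\<beta> * B)\<^sup>T = - (\<beta> * B)" by (metis uminus_uminus_mat)
      ultimately show ?thesis using c1(1) by (simp add: Sym_def)
    qed
    finally show ?thesis .
  qed
  have iff: "(\<Omega> * \<beta>, B) \<in> commuting_nilpotent_pairs n \<Omega> \<longleftrightarrow> \<beta> \<in> Sym 1 ?N \<and> B \<in> Bs (- 1) ?N \<beta> \<Omega>"
    if \<beta>: "\<beta> \<in> carrier_mat ?N ?N" for \<beta> B
  proof -
    have ob: "\<Omega> * \<beta> \<in> carrier_mat ?N ?N" by (rule mult_carrier_mat[OF \<Omega>c \<beta>])
    have 1: "\<Omega> * \<beta> \<in> sp_lie n \<Omega> \<longleftrightarrow> \<beta> \<in> Sym 1 ?N" using sp_lie_iff[OF ob \<Omega>c] cong[OF \<beta>] by simp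
    have 2: "B \<in> sp_lie n \<Omega> \<longleftrightarrow> B \<in> carrier_mat ?N ?N \<and> B * \<Omega> \<in> Sym 1 ?N"
      using sp_lie_iff[OF _ \<Omega>c, of B] by (auto simp: sp_lie_def)
    have "(\<Omega> * \<beta>, B) \<in> commuting_nilpotent_pairs n \<Omega> \<longleftrightarrow> \<beta> \<in> Sym 1 ?N
      \<and> (B \<in> carrier_mat ?N ?N \<and> B * \<Omega> \<in> Sym 1 ?N) \<and>
      nilpotent_mat (\<Omega> * \<beta>) \<and> nilpotent_mat B \<and> \<Omega> * \<beta> * B = B * (\<Omega> * \<beta>)"
      unfolding commuting_nilpotent_pairs_def mem_Collect_eq prod.case 1 2 ..
    also have "\<dots> \<longleftrightarrow> \<beta> \<in> Sym 1 ?N \<and> B \<in> Bs (- 1) ?N \<beta> \<Omega>"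
      unfolding Bs_def mem_Collect_eq minus_minus using comm by blast
    finally show ?thesis .
  qed
  have "bij_betw (\<lambda>(\<beta>, B). (\<Omega> * \<beta>, B)) (Sigma (Sym 1 ?N) (\<lambda>\<beta>. Bs (- 1) ?N \<beta> \<Omega>))
    (commuting_nilpotent_pairs n \<Omega>)"
  proof (rule bij_betwI[where g = "\<lambda>(A, B). (ginv \<Omega> * A, B)"])
    show "(\<lambda>(\<beta>, B). (\<Omega> * \<beta>, B)) \<in> Sigma (Sym 1 ?N) (\<lambda>\<beta>. Bs (- 1) ?N \<beta> \<Omega>) \<rightarrow> commuting_nilpotent_pairs n \<Omega>"
    proof
      fix x assume "x \<in> Sigma (Sym 1 ?N) (\<lambda>\<beta>. Bs (- 1) ?N \<beta> \<Omega>)"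
      then obtain \<beta> B where x: "x = (\<beta>, B)" "\<beta> \<in> Sym 1 ?N" "B \<in> Bs (- 1) ?N \<beta> \<Omega>" by blast
      show "(\<lambda>(\<beta>, B). (\<Omega> * \<beta>, B)) x \<in> commuting_nilpotent_pairs n \<Omega>"
        unfolding x(1) prod.case using iff[OF Sym_carrier[OF x(2)]] x by blast
    qed
    have AB: "\<exists>\<beta>. \<beta> = ginv \<Omega> * A \<and> A = \<Omega> * \<beta> \<and> \<beta> \<in> carrier_mat ?N ?N"
      if "(A, B) \<in> commuting_nilpotent_pairs n \<Omega>" for A B
    proof -
      have "A \<in> carrier_mat ?N ?N" using that by (simp add: commuting_nilpotent_pairs_def sp_lie_def)
      then have "\<Omega> * (ginv \<Omega> * A) = A" "ginv \<Omega> * A \<in> carrier_mat ?N ?N" using ginv_cancel(2)[OF \<Omega>G] \<Omega>i(1)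
        by auto
      then show ?thesis by metis
    qed
    show "(\<lambda>(A, B). (ginv \<Omega> * A, B)) \<in> commuting_nilpotent_pairs n \<Omega> \<rightarrow> Sigma (Sym 1 ?N) (\<lambda>\<beta>. Bs (- 1) ?N \<beta> \<Omega>)"
    proof
      fix x assume x: "x \<in> commuting_nilpotent_pairs n \<Omega>"
      obtain A B where xAB: "x = (A, B)" by (cases x)
      obtain \<beta> where \<beta>: "\<beta> = ginv \<Omega> * A" "A = \<Omega> * \<beta>" "\<beta> \<in> carrier_mat ?N ?N" using AB[OF x[unfolded xAB]]
        by blast
      show "(\<lambda>(A, B). (ginv \<Omega> * A, B)) x \<in> Sigma (Sym 1 ?N) (\<lambda>\<beta>. Bs (- 1) ?N \<beta> \<Omega>)"
        unfolding xAB prod.case \<beta>(1)[symmetric] using iff[OF \<beta>(3)] x unfolding xAB \<beta>(2)[symmetric] by blast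
    qed
    show "(\<lambda>(A, B). (ginv \<Omega> * A, B)) ((\<lambda>(\<beta>, B). (\<Omega> * \<beta>, B)) x) = x"
      if "x \<in> Sigma (Sym 1 ?N) (\<lambda>\<beta>. Bs (- 1) ?N \<beta> \<Omega>)" for x
      using that ginv_cancel(1)[OF \<Omega>G] Sym_carrier by fastforce
    show "(\<lambda>(\<beta>, B). (\<Omega> * \<beta>, B)) ((\<lambda>(A, B). (ginv \<Omega> * A, B)) x) = x" if x: "x \<in> commuting_nilpotent_pairs n \<Omega>"
      for x
    proof -
      obtain A B where xAB: "x = (A, B)" by (cases x)
      obtain \<beta> where \<beta>: "\<beta> = ginv \<Omega> * A" "A = \<Omega> * \<beta>" using AB[OF x[unfolded xAB]] by blast
      show ?thesis unfolding xAB prod.case \<beta>(1)[symmetric] \<beta>(2)[symmetric] ..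
    qed
  qed
  from bij_betw_same_card[OF this] show ?thesis by (simp add: NS_def card_SigmaI)
qed

lemma sum_cT:
  fixes J :: "'a::{field,finite} mat"
  assumes two: "(2::'a) \<noteq> 0" and J: "J \<in> NSym (- 1) (2 * n)"
  shows "(\<Sum>s\<le>2 * n. cT (- 1 :: 'a) s (2 * n - s)) = card (NSym (- 1 :: 'a) (2 * n)) * NS n J"
proof -
  have "(\<Sum>s\<le>2 * n. cT (- 1 :: 'a) s (2 * n - s))
    = (\<Sum>s\<le>2 * n. \<Sum>\<beta>\<in>SymN (1 :: 'a) s (2 * n - s). Wt (- 1) (2 * n) \<beta>)"
    unfolding cT_def minus_minus by (intro sum.cong refl) auto
  also have "\<dots> = (\<Sum>\<beta>\<in>Sym (1 :: 'a) (2 * n). Wt (- 1) (2 * n) \<beta>)" by (rule Sym_sum_SymN[symmetric]) simp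
  also have "\<dots> = (\<Sum>\<Omega>\<in>NSym (- 1 :: 'a) (2 * n). \<Sum>\<beta>\<in>Sym 1 (2 * n). card (Bs (- 1) (2 * n) \<beta> \<Omega>))"
    unfolding Wt_def by (rule sum.swap)
  also have "\<dots> = (\<Sum>\<Omega>\<in>NSym (- 1 :: 'a) (2 * n). NS n J)"
  proof (rule sum.cong[OF refl])
    fix \<Omega> :: "'a mat" assume \<Omega>: "\<Omega> \<in> NSym (- 1) (2 * n)"
    show "(\<Sum>\<beta>\<in>Sym 1 (2 * n). card (Bs (- 1) (2 * n) \<beta> \<Omega>)) = NS n J"
      using NS_eq_sum[OF \<Omega>] NS_eq[OF two J \<Omega>] by simp
  qed
  finally show ?thesis by simp
qed

section \<open>Masses\<close>

definition gl :: "'a::{field,finite} itself \<Rightarrow> nat \<Rightarrow> real" where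
  "gl _ n = real (card (GL n :: 'a mat set))"

definition qr :: "'a::{field,finite} itself \<Rightarrow> real" where
  "qr _ = real CARD('a)"

definition Em :: "'a::{field,finite} \<Rightarrow> nat \<Rightarrow> real" where
  "Em e n = real (card (NSym e n)) / gl TYPE('a) n"

definition Mm :: "'a::{field,finite} \<Rightarrow> nat \<Rightarrow> real" where
  "Mm e n = real (nM e n) / gl TYPE('a) n"

definition pm :: "'a::{field,finite} \<Rightarrow> nat \<Rightarrow> nat \<Rightarrow> real" where
  "pm e s r = real (cT e s r) / gl TYPE('a) (s + r)"

definition xm :: "bool \<Rightarrow> 'a::{field,finite} \<Rightarrow> nat \<Rightarrow> nat \<Rightarrow> real" where
  "xm z e s r = real (cX z e s r) / gl TYPE('a) (s + r)"

text \<open>The coefficient in the recursion for pairs. Without the operator \<open>B\<close> the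
  powers of \<open>q\<close> cancel only in part; the denominator is what is left.\<close>

definition Km :: "'a::{field,finite} \<Rightarrow> nat \<Rightarrow> nat \<Rightarrow> real" where
  "Km e t m = Em e m / qr TYPE('a) ^ (symdim (- e) t + t * m)"

text \<open>The mass of the pairs of nonsingular forms of opposite signs. The sign \<open>1\<close>
  is a mere choice: exchanging the two forms gives the same mass for \<open>- 1\<close>.\<close>

definition Iq :: "'a::{field,finite} itself \<Rightarrow> nat \<Rightarrow> real" where
  "Iq _ k = xm False (1 :: 'a) 0 k"

text \<open>The mass of all pairs \<open>(\<Omega>, \<beta>)\<close>, the power of \<open>q\<close>
  being the number of forms \<open>\<beta>\<close> over a field of odd order.\<close>

definition Lm :: "'a::{field,finite} \<Rightarrow> nat \<Rightarrow> real" where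
  "Lm e n = Em e n * qr TYPE('a) ^ symdim (- e) n"

lemma gl_pos: "gl TYPE('a::{field,finite}) n > 0"
  by (simp add: gl_def card_GL_pos)

lemma gl_0: "gl TYPE('a::{field,finite}) 0 = 1"
  by (simp add: gl_def GL_0)

lemma qr_gt_1: "qr TYPE('a::{field,finite}) > 1"
  using card_field_gt_1[where 'a = 'a] by (simp add: qr_def)

lemma gl_Suc: "gl TYPE('a::{field,finite}) (Suc n)
  = (qr TYPE('a) ^ Suc n - 1) * qr TYPE('a) ^ n * gl TYPE('a) n"
proof -
  have "1 \<le> CARD('a) ^ Suc n" using card_field_gt_1[where 'a = 'a] by simp
  then have "real (CARD('a) ^ Suc n - 1) = qr TYPE('a) ^ Suc n - 1" by (simp add: of_nat_diff qr_def)
  then show ?thesis unfolding gl_def card_GL_Suc[of n] of_nat_mult by (simp add: qr_def)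
qed

text \<open>The passage to masses, common to both recursions. For \<open>t \<le> s\<close> the
  number of injective matrices is a quotient of orders of general linear groups, which replaces the
  order for \<open>s\<close> by the one for \<open>s - t\<close> and leaves the stated power of
  \<open>q\<close>. For \<open>t > s\<close> that number is zero, whence the conditional.\<close>

lemma normalised_recursion:
  fixes c :: nat and c' w :: "nat \<Rightarrow> nat"
  assumes "c * (CARD('a::{field,finite}) ^ (r * s) * card (GL s :: 'a mat set) * card (GL r :: 'a mat set)) =
    card (GL (s + r) :: 'a mat set) * (\<Sum>t\<le>r. c' t *
      (card (full_col_rank s t :: 'a mat set) * CARD('a) ^ (s * (r - t)) * w t))"
  shows "real c / gl TYPE('a) (s + r) = (\<Sum>t\<le>r. if t \<le> s then
    (real (w t) / gl TYPE('a) (s - t) / qr TYPE('a) ^ (t * (s - t) + s * t)) *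
    (real (c' t) / gl TYPE('a) r) else 0)"
proof -
  let ?q = "qr TYPE('a)" and ?g = "gl TYPE('a)"
  have q0: "?q > 0" using qr_gt_1[where 'a = 'a] by simp
  have g0: "?g n > 0" for n by (rule gl_pos)
  have "real c * (?q ^ (r * s) * ?g s * ?g r) = ?g (s + r) *
    (\<Sum>t\<le>r. real (c' t) * (real (card (full_col_rank s t :: 'a mat set)) * ?q ^ (s * (r - t)) * real (w t)))"
    using arg_cong[OF assms, of real] unfolding gl_def qr_def
      by (simp only: of_nat_mult of_nat_sum of_nat_power)
  then have "real c / ?g (s + r) = (\<Sum>t\<le>r. real (c' t) *
    (real (card (full_col_rank s t :: 'a mat set)) * ?q ^ (s * (r - t)) * real (w t))) /
    (?q ^ (r * s) * ?g s * ?g r)"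
    using q0 g0[of s] g0[of r] g0[of "s + r"] by (simp add: field_simps)
  also have "\<dots> = (\<Sum>t\<le>r. if t \<le> s then (real (w t) / ?g (s - t) / ?q ^ (t * (s - t) + s * t)) *
    (real (c' t) / ?g r) else 0)"
    unfolding sum_divide_distrib
  proof (rule sum.cong[OF refl])
    fix t assume t: "t \<in> {..r}"
    show "real (c' t) * (real (card (full_col_rank s t :: 'a mat set)) * ?q ^ (s * (r - t)) * real (w t)) /
      (?q ^ (r * s) * ?g s * ?g r) =
      (if t \<le> s then (real (w t) / ?g (s - t) / ?q ^ (t * (s - t) + s * t)) * (real (c' t) / ?g r) else 0)"
    proof (cases "t \<le> s")
      case True
      then obtain m where m: "s = t + m" using le_Suc_ex by blast
      have "real (card (full_col_rank (t + m) t :: 'a mat set)) * (?q ^ (t * m) * ?g m) = ?g (t + m)"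
        using arg_cong[OF card_full_col_rank[of t m, where 'a = 'a], of real] unfolding gl_def qr_def
          by (simp only: of_nat_mult of_nat_power)
      then have F: "real (card (full_col_rank s t :: 'a mat set)) = ?g s / (?q ^ (t * m) * ?g m)"
        using q0 g0[of m] m by (simp add: field_simps)
      have "r * s = s * (r - t) + s * t" using t
        by (metis add_mult_distrib2 atMost_iff le_add_diff_inverse2 mult.commute)
      then have Q: "?q ^ (r * s) = ?q ^ (s * (r - t)) * ?q ^ (s * t)" by (simp add: power_add)
      have "real (c' t) * (real (card (full_col_rank s t :: 'a mat set)) * ?q ^ (s * (r - t)) * real (w t)) /
        (?q ^ (r * s) * ?g s * ?g r) =
        (real (w t) / ?g m / (?q ^ (t * m) * ?q ^ (s * t))) * (real (c' t) / ?g r)"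
        unfolding F Q using q0 g0[of m] g0[of s] g0[of r] by (simp add: field_simps)
      then show ?thesis using True m by (simp add: power_add)
    next
      case False
      then show ?thesis by (simp add: full_col_rank_empty)
    qed
  qed
  finally show ?thesis .
qed

context
  assumes odd: "odd CARD('a::{field,finite})"
begin

lemma unit_cases: "(e :: 'a) * e = 1 \<Longrightarrow> e = 1 \<or> e = - 1"
  using square_eq_1_iff by blast

lemma card_Sym_real: "(e :: 'a) * e = 1 \<Longrightarrow> real (card (Sym e n)) = qr TYPE('a) ^ symdim e n"
  using card_Sym[OF unit_cases odd, of e n] by (simp add: qr_def)

lemma symdim_sum: "(e :: 'a) * e = 1 \<Longrightarrow> symdim e n + symdim (- e) n = n * n"
  using symdim_plus_minus[OF odd_card_two_neq_0[OF odd] unit_cases] by blast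

text \<open>The forms of both signs on the \<open>t\<close> dimensions and the two rectangular
  blocks contribute the exponent \<open>t * t + 2 * t * (s - t)\<close>. This equals
  \<open>t * (s - t) + s * t\<close>, the exponent in the denominator, so no power of
  \<open>q\<close> survives.\<close>

lemma pm_rec:
  assumes e: "(e :: 'a) * e = 1"
  shows "pm e s r = (\<Sum>t\<le>r. if t \<le> s then Mm e (s - t) * pm (- e) t (r - t) else 0)"
proof -
  let ?q = "qr TYPE('a)"
  have me: "(- e) * (- e) = 1" using e by simp
  have q0: "?q > 0" using qr_gt_1[where 'a = 'a] by simp
  have "pm e s r = (\<Sum>t\<le>r. if t \<le> s then (real
    (card (Sym e t) * CARD('a) ^ (t * (s - t)) *
    (card (Sym (- e) t) * CARD('a) ^ (t * (s - t)) * nM e (s - t)))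
     / gl TYPE('a) (s - t) / ?q ^ (t * (s - t) + s * t)) *
       (real (cT (- e) t (r - t)) / gl TYPE('a) r) else 0)"
    unfolding pm_def by (rule normalised_recursion[OF cT_rec[OF e]])
  also have "\<dots> = (\<Sum>t\<le>r. if t \<le> s then Mm e (s - t) * pm (- e) t (r - t) else 0)"
  proof (intro sum.cong refl if_cong)
    fix t assume t: "t \<in> {..r}" and ts: "t \<le> s"
    obtain m where m: "s = t + m" using ts le_Suc_ex by blast
    have "real (card (Sym e t) * CARD('a) ^ (t * (s - t)) *
      (card (Sym (- e) t) * CARD('a) ^ (t * (s - t)) * nM e (s - t)))
      = ?q ^ symdim e t * ?q ^ (t * m) * (?q ^ symdim (- e) t * ?q ^ (t * m) * real (nM e m))"
      using card_Sym_real[OF e, of t] card_Sym_real[OF me, of t] m by (simp add: qr_def)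
    also have "\<dots> = ?q ^ (symdim e t + symdim (- e) t + t * m + t * m) * real (nM e m)"
      by (simp add: power_add)
    also have "symdim e t + symdim (- e) t + t * m + t * m = t * m + s * t" unfolding symdim_sum[OF e] m
      by (simp add: algebra_simps)
    finally have W: "real (card (Sym e t) * CARD('a) ^ (t * (s - t)) *
      (card (Sym (- e) t) * CARD('a) ^ (t * (s - t)) * nM e (s - t)))
      = ?q ^ (t * m + s * t) * real (nM e m)" .
    have sm: "s - t = m" using m by simp
    have "real (card (Sym e t) * CARD('a) ^ (t * (s - t)) *
      (card (Sym (- e) t) * CARD('a) ^ (t * (s - t)) * nM e (s - t)))
      / gl TYPE('a) (s - t) / ?q ^ (t * (s - t) + s * t)
        = Mm e (s - t)" unfolding W unfolding sm Mm_def using q0 by simp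
    then show "(real (card (Sym e t) * CARD('a) ^ (t * (s - t)) *
      (card (Sym (- e) t) * CARD('a) ^ (t * (s - t)) * nM e (s - t)))
     / gl TYPE('a) (s - t) / ?q ^ (t * (s - t) + s * t)) * (real (cT (- e) t (r - t)) / gl TYPE('a) r)
       = Mm e (s - t) * pm (- e) t (r - t)"
      using t by (simp add: pm_def)
  qed
  finally show ?thesis .
qed

lemma xm_rec:
  assumes e: "(e :: 'a) * e = 1"
  shows "xm z e s r = (\<Sum>t\<le>r. if t \<le> s then Km e t (s - t) * xm z (- e) t (r - t) else 0)"
proof -
  let ?q = "qr TYPE('a)"
  have q0: "?q > 0" using qr_gt_1[where 'a = 'a] by simp
  have "xm z e s r = (\<Sum>t\<le>r. if t \<le> s then
    (real (card (Sym e t) * CARD('a) ^ (t * (s - t)) * card (NSym e (s - t)))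
     / gl TYPE('a) (s - t) / ?q ^ (t * (s - t) + s * t)) *
       (real (cX z (- e) t (r - t)) / gl TYPE('a) r) else 0)"
    unfolding xm_def by (rule normalised_recursion[OF cX_rec[OF e]])
  also have "\<dots> = (\<Sum>t\<le>r. if t \<le> s then Km e t (s - t) * xm z (- e) t (r - t) else 0)"
  proof (intro sum.cong refl if_cong)
    fix t assume t: "t \<in> {..r}" and ts: "t \<le> s"
    obtain m where m: "s = t + m" using ts le_Suc_ex by blast
    have "real (card (Sym e t) * CARD('a) ^ (t * (s - t)) * card (NSym e (s - t)))
      = ?q ^ (symdim e t + t * m) * real (card (NSym e m))"
      using card_Sym_real[OF e, of t] m by (simp add: qr_def power_add)
    moreover have "t * (s - t) + s * t = (symdim e t + t * m) + (symdim (- e) t + t * m)"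
      using symdim_sum[OF e, of t] m by (simp add: algebra_simps)
    ultimately have "real (card (Sym e t) * CARD('a) ^ (t * (s - t)) * card (NSym e (s - t)))
      / gl TYPE('a) (s - t) / ?q ^ (t * (s - t) + s * t) = Km e t (s - t)"
      using q0 m by (simp only: power_add Km_def Em_def) (simp add: field_simps)
    then show "(real (card (Sym e t) * CARD('a) ^ (t * (s - t)) * card (NSym e (s - t)))
     / gl TYPE('a) (s - t) / ?q ^ (t * (s - t) + s * t)) * (real (cX z (- e) t (r - t)) / gl TYPE('a) r)
       = Km e t (s - t) * xm z (- e) t (r - t)"
      using t by (simp add: xm_def)
  qed
  finally show ?thesis .
qed

lemma sum_triangle_swap:
  fixes f :: "nat \<Rightarrow> nat \<Rightarrow> real"
  shows "(\<Sum>t\<le>r. \<Sum>k\<le>r - t. f t k) = (\<Sum>k\<le>r. \<Sum>t\<le>r - k. f t k)"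
proof -
  have "(\<Sum>t\<le>r. \<Sum>k\<le>r - t. f t k) = (\<Sum>t\<le>r. \<Sum>k | k \<in> {..r} \<and> t + k \<le> r. f t k)"
    by (intro sum.cong refl) auto
  also have "\<dots> = (\<Sum>k\<le>r. \<Sum>t | t \<in> {..r} \<and> t + k \<le> r. f t k)" by (rule sum.swap_restrict) auto
  also have "\<dots> = (\<Sum>k\<le>r. \<Sum>t\<le>r - k. f t k)" by (intro sum.cong refl) auto
  finally show ?thesis .
qed

lemma Iq_eq:
  assumes e: "(e :: 'a) * e = 1"
  shows "xm False e 0 k = Iq TYPE('a) k"
proof -
  have "cX False e 0 k = cX False (1 :: 'a) 0 k" using unit_cases[OF e] by (auto simp: cX_False_0)
  then show ?thesis by (simp add: Iq_def xm_def)
qed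

text \<open>The coefficients \<^const>\<open>Km\<close> of the recursion depend on \<open>t\<close> and \<open>s - t\<close> only, so that it is
  invariant under translation in \<open>r\<close>. This plays the role of the Fitting decomposition: the
  invertible part of \<open>\<Omega> \<beta>\<close> is split off without any linear algebra.\<close>

lemma xm_convolution:
  "(e :: 'a) * e = 1 \<Longrightarrow> xm False e s r = (\<Sum>k\<le>r. Iq TYPE('a) k * xm True e s (r - k))"
proof (induction "s + r" arbitrary: e s r rule: less_induct)
  case less
  note e = less.prems
  have me: "(- e) * (- e) = 1" using e by simp
  show ?case
  proof (cases "s = 0")
    case True
    \<comment> \<open>With \<open>\<beta>\<close> nonsingular, \<open>\<Omega> * \<beta>\<close> is
      nilpotent only in size 0.\<close>
    have "xm True e 0 m = (if m = 0 then 1 else 0)" for m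
      using e by (simp add: xm_def cX_True_0 gl_0)
    then have "(\<Sum>k\<le>r. Iq TYPE('a) k * xm True e 0 (r - k)) = (\<Sum>k\<le>r. if k = r then Iq TYPE('a) k else 0)"
      by (intro sum.cong refl) auto
    then show ?thesis using True Iq_eq[OF e] by (simp add: sum.delta)
  next
    case False
    have "xm False e s r = (\<Sum>t\<le>r. if t \<le> s then Km e t (s - t) * xm False (- e) t (r - t) else 0)"
      by (rule xm_rec[OF e])
    also have "\<dots> = (\<Sum>t\<le>r. \<Sum>k\<le>r - t. if t \<le> s then Km e t (s - t) *
      (Iq TYPE('a) k * xm True (- e) t (r - t - k)) else 0)"
    proof (rule sum.cong[OF refl])
      fix t assume t: "t \<in> {..r}"
      \<comment> \<open>The total size drops from \<open>s + r\<close> to \<open>r\<close>, a strict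
        decrease because \<open>s\<close> is positive here.\<close>
      have "xm False (- e) t (r - t) = (\<Sum>k\<le>r - t. Iq TYPE('a) k * xm True (- e) t (r - t - k))"
        by (rule less.hyps) (use t False me in auto)
      then show "(if t \<le> s then Km e t (s - t) * xm False (- e) t (r - t) else 0) =
        (\<Sum>k\<le>r - t. if t \<le> s then Km e t (s - t) * (Iq TYPE('a) k * xm True (- e) t (r - t - k)) else 0)"
        by (simp add: sum_distrib_left)
    qed
    also have "\<dots> = (\<Sum>k\<le>r. \<Sum>t\<le>r - k. if t \<le> s then Km e t (s - t) *
      (Iq TYPE('a) k * xm True (- e) t (r - t - k)) else 0)"
      by (rule sum_triangle_swap)
    also have "\<dots> = (\<Sum>k\<le>r. Iq TYPE('a) k * xm True e s (r - k))"
    proof (rule sum.cong[OF refl])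
      fix k
      have "r - t - k = r - k - t" for t by simp
      then show "(\<Sum>t\<le>r - k. if t \<le> s then Km e t (s - t) *
        (Iq TYPE('a) k * xm True (- e) t (r - t - k)) else 0) = Iq TYPE('a) k * xm True e s (r - k)"
        unfolding xm_rec[OF e, of True s "r - k"] sum_distrib_left by (intro sum.cong refl) auto
    qed
    finally show ?thesis .
  qed
qed

text \<open>The preceding convolution summed over the nullity: all pairs on one side, nilpotent
  pairs times nonsingular ones on the other. It determines \<open>Mm\<close> from the numbers of
  nonsingular forms.\<close>

lemma Mm_convolution:
  assumes e: "(e :: 'a) * e = 1"
  shows "(\<Sum>k\<le>n. Iq TYPE('a) k * Mm e (n - k)) = Lm e n"
proof -
  have me: "(- e) * (- e) = 1" using e by simp
  have M: "Mm e m = (\<Sum>s\<le>m. xm True e s (m - s))" for m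
    unfolding Mm_def sum_cX_True[OF e, symmetric] of_nat_sum sum_divide_distrib xm_def
      by (intro sum.cong refl) auto
  have "Lm e n = (\<Sum>s\<le>n. xm False e s (n - s))"
  proof -
    have "(\<Sum>s\<le>n. xm False e s (n - s)) = real (\<Sum>s\<le>n. cX False e s (n - s)) / gl TYPE('a) n"
      unfolding of_nat_sum sum_divide_distrib xm_def by (intro sum.cong refl) auto
    also have "\<dots> = Lm e n" unfolding sum_cX_False[OF e] Lm_def Em_def by (simp add: card_Sym_real[OF me])
    finally show ?thesis by simp
  qed
  also have "\<dots> = (\<Sum>s\<le>n. \<Sum>k\<le>n - s. Iq TYPE('a) k * xm True e s (n - s - k))"
    by (intro sum.cong refl xm_convolution e)
  also have "\<dots> = (\<Sum>k\<le>n. \<Sum>s\<le>n - k. Iq TYPE('a) k * xm True e s (n - s - k))" by (rule sum_triangle_swap)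
  also have "\<dots> = (\<Sum>k\<le>n. Iq TYPE('a) k * Mm e (n - k))"
    unfolding M sum_distrib_left by (intro sum.cong refl) (simp add: add.commute)
  finally show ?thesis by simp
qed

section \<open>Numbers of nonsingular forms and the resulting coefficient recursions\<close>

lemma minus_one_neq_one: "(- 1 :: 'a) \<noteq> 1"
proof
  assume "(- 1 :: 'a) = 1"
  then have "(2 :: 'a) = 0" by (metis add.right_inverse one_add_one)
  then show False using odd_card_two_neq_0[OF odd] by simp
qed

lemma card_Sym_1: "card (Sym (1 :: 'a) 1) = CARD('a)" "card (Sym (- 1 :: 'a) 1) = 1"
  using card_Sym[OF _ odd, of 1 1] card_Sym[OF _ odd, of "- 1" 1] minus_one_neq_one
    by (simp_all add: symdim_def)

text \<open>A skew form of size 1 is zero, so only the second term of \<open>card_NSym_Suc\<close>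
  remains. It links sizes of equal parity, and for \<open>n = 0\<close> it vanishes.\<close>

lemma NSym_skew_Suc:
  "real (card (NSym (- 1 :: 'a) (Suc n)))
    = (qr TYPE('a) ^ n - 1) * qr TYPE('a) ^ (n - 1) * real (card (NSym (- 1 :: 'a) (n - 1)))"
proof -
  have "1 \<le> CARD('a) ^ n" by simp
  then have "real (CARD('a) ^ n - 1) = qr TYPE('a) ^ n - 1" by (simp add: of_nat_diff qr_def)
  then show ?thesis using card_NSym_Suc[of "- 1 :: 'a" n] unfolding card_Sym_1 by (simp add: qr_def)
qed

lemma NSym_sym_Suc:
  "real (card (NSym (1 :: 'a) (Suc n))) = (qr TYPE('a) - 1) * qr TYPE('a) ^ n * real (card (NSym (1 :: 'a) n))
     + (qr TYPE('a) ^ n - 1) * qr TYPE('a) ^ n * real (card (NSym (1 :: 'a) (n - 1)))"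
proof -
  have 1: "real (CARD('a) ^ n - 1) = qr TYPE('a) ^ n - 1" by (simp add: of_nat_diff qr_def)
  have 2: "real (CARD('a) - 1) = qr TYPE('a) - 1" by (simp add: of_nat_diff qr_def Suc_leI)
  \<comment> \<open>At \<open>n = 0\<close> the truncated exponent spoils
    \<open>q * q ^ (n - 1) = q ^ n\<close>, but there the factor \<open>q ^ n - 1\<close> is
    zero.\<close>
  have 3: "(qr TYPE('a) ^ n - 1) * (qr TYPE('a) * qr TYPE('a) ^ (n - 1))
    = (qr TYPE('a) ^ n - 1) * qr TYPE('a) ^ n"
    by (cases n) auto
  have "real (card (NSym (1 :: 'a) (Suc n)))
    = real (CARD('a) - 1) * (qr TYPE('a) ^ n * real (card (NSym (1 :: 'a) n)))
     + real (CARD('a) ^ n - 1) * (qr TYPE('a) * qr TYPE('a) ^ (n - 1) * real (card (NSym (1 :: 'a) (n - 1))))"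
    using card_NSym_Suc[of "1 :: 'a" n] unfolding card_Sym_1 by (simp add: qr_def)
  then show ?thesis unfolding 1 2 using 3 by (simp add: mult.assoc[symmetric])
qed

text \<open>The three-term recursion collapses: the ratio of consecutive numbers is
  \<open>q ^ n - 1\<close> for odd \<open>n\<close> and \<open>q ^ n\<close> for even
  \<open>n\<close>, and either ratio, inserted into the recursion, produces the next one.\<close>

lemma NSym_sym_parity:
  "real (card (NSym (1 :: 'a) (Suc (2 * k))))
    = (qr TYPE('a) ^ Suc (2 * k) - 1) * real (card (NSym (1 :: 'a) (2 * k)))"
  "real (card (NSym (1 :: 'a) (Suc (Suc (2 * k)))))
    = qr TYPE('a) ^ Suc (Suc (2 * k)) * real (card (NSym (1 :: 'a) (Suc (2 * k))))"
proof -
  let ?q = "qr TYPE('a)" and ?s = "\<lambda>n. real (card (NSym (1 :: 'a) n))"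
  have step: "?s (Suc (Suc n)) = ?q ^ Suc (Suc n) * ?s (Suc n)" if "?s (Suc n) = (?q ^ Suc n - 1) * ?s n"
    for n
  proof -
    have "?s (Suc (Suc n)) = (?q - 1) * ?q ^ Suc n * ?s (Suc n) + ?q ^ Suc n * ((?q ^ Suc n - 1) * ?s n)"
      using NSym_sym_Suc[of "Suc n"] by simp
    then show ?thesis unfolding that[symmetric] by (simp add: algebra_simps)
  qed
  have 1: "?s (Suc (2 * k)) = (?q ^ Suc (2 * k) - 1) * ?s (2 * k)" for k
  proof (induction k)
    case 0
    show ?case using NSym_sym_Suc[of 0] by simp
  next
    case (Suc k)
    have "?s (Suc (Suc (Suc (2 * k)))) = (?q - 1) * ?q ^ Suc (Suc (2 * k)) * ?s (Suc (Suc (2 * k)))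
        + (?q ^ Suc (Suc (2 * k)) - 1) * (?q ^ Suc (Suc (2 * k)) * ?s (Suc (2 * k)))"
      using NSym_sym_Suc[of "Suc (Suc (2 * k))"] by simp
    then have "?s (Suc (Suc (Suc (2 * k)))) = (?q ^ Suc (Suc (Suc (2 * k))) - 1) * ?s (Suc (Suc (2 * k)))"
      unfolding step[OF Suc, symmetric] by (simp add: algebra_simps)
    then show ?case by simp
  qed
  show "?s (Suc (2 * k)) = (?q ^ Suc (2 * k) - 1) * ?s (2 * k)" by (rule 1)
  show "?s (Suc (Suc (2 * k))) = ?q ^ Suc (Suc (2 * k)) * ?s (Suc (2 * k))" by (rule step[OF 1])
qed

lemma NSym_skew_odd: "card (NSym (- 1 :: 'a) (Suc (2 * k))) = 0"
proof -
  have "real (card (NSym (- 1 :: 'a) (Suc (2 * k)))) = 0"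
    by (induction k) (use NSym_skew_Suc in auto)
  then show ?thesis by simp
qed

lemma Lm_0: "Lm (1 :: 'a) 0 = 1" "Lm (- 1 :: 'a) 0 = 1" "Iq TYPE('a) 0 = 1"
  by (simp_all add: Lm_def Em_def NSym_0 gl_0 Iq_def xm_def cX_False_0)

lemma Lm_skew_odd: "Lm (- 1 :: 'a) (Suc (2 * k)) = 0"
  by (simp add: Lm_def Em_def NSym_skew_odd)

lemma Iq_odd: "Iq TYPE('a) (Suc (2 * k)) = 0"
  by (simp add: Iq_def xm_def cX_False_0 NSym_skew_odd)

lemma Iq_Em: "Iq TYPE('a) n = Em (1 :: 'a) n * real (card (NSym (- 1 :: 'a) n))"
  by (simp add: Iq_def xm_def cX_False_0 Em_def)

lemma q_power_neq_1: "qr TYPE('a) ^ Suc n - 1 \<noteq> 0"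
proof -
  have "1 < qr TYPE('a) ^ Suc n" by (rule one_less_power[OF qr_gt_1]) simp
  then show ?thesis by simp
qed

lemma Em_sym_Suc:
  "Em (1 :: 'a) (Suc (2 * k)) = Em (1 :: 'a) (2 * k) / qr TYPE('a) ^ (2 * k)"
  "Em (1 :: 'a) (Suc (Suc (2 * k))) = Em (1 :: 'a) (Suc (2 * k)) * qr TYPE('a) /
    (qr TYPE('a) ^ Suc (Suc (2 * k)) - 1)"
  using gl_pos[of "2 * k", where 'a = 'a] gl_pos[of "Suc (2 * k)",
    where 'a = 'a] qr_gt_1[where 'a = 'a] q_power_neq_1[of "2 * k"] q_power_neq_1[of "Suc (2 * k)"]
  unfolding Em_def gl_Suc[of "2 * k"] gl_Suc[of "Suc (2 * k)"] NSym_sym_parity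
  by (simp_all add: divide_simps del: power_Suc) (simp_all add: algebra_simps)

lemma Em_skew_Suc:
  "Em (- 1 :: 'a) (Suc (Suc (2 * k))) = Em (- 1 :: 'a) (2 * k) /
    ((qr TYPE('a) ^ Suc (Suc (2 * k)) - 1) * qr TYPE('a) ^ Suc (2 * k))"
  using gl_pos[of "2 * k", where 'a = 'a] qr_gt_1[where 'a
    = 'a] q_power_neq_1[of "2 * k"] q_power_neq_1[of "Suc (2 * k)"]
  unfolding Em_def gl_Suc[of "2 * k"] gl_Suc[of "Suc (2 * k)"] NSym_skew_Suc[of "Suc (2 * k)"]
  by (simp add: divide_simps del: power_Suc)

lemma symdim_Suc_sym: "symdim (1 :: 'a) (Suc n) = symdim (1 :: 'a) n + Suc n"
  by (simp add: symdim_def)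

lemma symdim_Suc_skew: "symdim (- 1 :: 'a) (Suc n) = symdim (- 1 :: 'a) n + n"
  using minus_one_neq_one by (simp add: symdim_def)

lemma Lm_sym_odd: "Lm (1 :: 'a) (Suc (2 * k)) = Lm (1 :: 'a) (2 * k)"
  using qr_gt_1[where 'a = 'a] by (simp add: Lm_def Em_sym_Suc symdim_Suc_skew power_add)

text \<open>Together with \<open>Lm e 0 = 1\<close> this makes the even coefficients
  \<open>1 / ((1 - q^(-2)) * \<dots> * (1 - q^(-2 k)))\<close> for both signs. They are the
  coefficients in the expansion of Euler's product \<open>1 / (\<Prod>l. 1 - z / q^(2 l))\<close> in
  powers of \<open>z\<close>.\<close>

lemma Lm_even_Suc:
  assumes "(e :: 'a) = 1 \<or> e = - 1"
  shows "Lm e (Suc (Suc (2 * k))) * (1 - 1 / qr TYPE('a) ^ Suc (Suc (2 * k))) = Lm e (2 * k)"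
proof -
  define q where "q = qr TYPE('a)"
  define A where "A = q ^ (2 * k)"
  define d where "d = q * (q * A) - 1"
  have A0: "A \<noteq> 0" "q \<noteq> 0" using qr_gt_1[where 'a = 'a] by (simp_all add: A_def q_def)
  have d0: "d \<noteq> 0" using q_power_neq_1[of "Suc (2 * k)"] by (simp add: d_def A_def q_def)
  have pow: "qr TYPE('a) ^ (2 * k) = A" "qr TYPE('a) ^ Suc (2 * k) = q * A" "qr TYPE('a) ^ Suc (Suc (2 * k))
    = q * (q * A)"
    by (simp_all add: A_def q_def)
  have "Lm e (Suc (Suc (2 * k))) = Lm e (2 * k) * (q * (q * A) / d)"
    using assms
  proof
    assume e: "e = 1"
    have "Lm e (Suc (Suc (2 * k))) = Em e (2 * k) / A * q / d *
      (q ^ symdim (- 1 :: 'a) (2 * k) * A * (q * A))"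
      unfolding Lm_def e Em_sym_Suc symdim_Suc_skew power_add pow by (simp add: d_def q_def)
    also have "\<dots> = Em e (2 * k) * q ^ symdim (- 1 :: 'a) (2 * k) * (q * (q * A) / d)"
      using A0 d0 by (simp add: field_simps)
    finally show ?thesis by (simp add: Lm_def e q_def)
  next
    assume e: "e = - 1"
    have "Lm e (Suc (Suc (2 * k))) = Em e (2 * k) / (d * (q * A)) *
      (q ^ symdim (1 :: 'a) (2 * k) * (q * A) * (q * (q * A)))"
      unfolding Lm_def e minus_minus Em_skew_Suc symdim_Suc_sym power_add pow by (simp add: d_def q_def)
    also have "\<dots> = Em e (2 * k) * q ^ symdim (1 :: 'a) (2 * k) * (q * (q * A) / d)"
      using A0 d0 by (simp add: field_simps)
    finally show ?thesis by (simp add: Lm_def e q_def)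
  qed
  note 1 = this
  have 2: "q * (q * A) / d * (1 - 1 / (q * (q * A))) = 1"
  proof -
    have "1 - 1 / (q * (q * A)) = d / (q * (q * A))" using A0 by (simp add: d_def diff_divide_distrib)
    then show ?thesis using A0 d0 by simp
  qed
  show ?thesis unfolding pow 1 by (simp only: mult.assoc 2 mult_1_right)
qed

text \<open>The recursion of the q-binomial series with base \<open>q^(-2)\<close> and parameter
  \<open>1 / q\<close>, whose sum is
  \<open>\<Prod>l. (1 - z / q^(2 l + 1)) / (1 - z / q^(2 l))\<close>.\<close>

lemma Iq_even_Suc:
  "Iq TYPE('a) (Suc (Suc (2 * k))) * (1 - 1 / qr TYPE('a) ^ Suc (Suc (2 * k)))
    = Iq TYPE('a) (2 * k) * (1 - 1 / qr TYPE('a) ^ Suc (2 * k))"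
proof -
  define q where "q = qr TYPE('a)"
  define A where "A = q ^ (2 * k)"
  define d where "d = q * (q * A) - 1"
  define f where "f = q * A - 1"
  have A0: "A \<noteq> 0" "q \<noteq> 0" using qr_gt_1[where 'a = 'a] by (simp_all add: A_def q_def)
  have d0: "d \<noteq> 0" using q_power_neq_1[of "Suc (2 * k)"] by (simp add: d_def A_def q_def)
  have pow: "qr TYPE('a) ^ (2 * k) = A" "qr TYPE('a) ^ Suc (2 * k) = q * A" "qr TYPE('a) ^ Suc (Suc (2 * k))
    = q * (q * A)"
    by (simp_all add: A_def q_def)
  have "Iq TYPE('a) (Suc (Suc (2 * k))) = Em (1 :: 'a) (2 * k) / A * q / d *
    (f * A * real (card (NSym (- 1 :: 'a) (2 * k))))"
    unfolding Iq_Em Em_sym_Suc NSym_skew_Suc[of "Suc (2 * k)"] pow diff_Suc_1 by (simp add: d_def f_def q_def)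
  also have "\<dots> = Iq TYPE('a) (2 * k) * (q * f / d)" unfolding Iq_Em using A0 d0 by (simp add: field_simps)
  finally have 1: "Iq TYPE('a) (Suc (Suc (2 * k))) = Iq TYPE('a) (2 * k) * (q * f / d)" .
  have "1 - 1 / (q * (q * A)) = d / (q * (q * A))" using A0 by (simp add: d_def diff_divide_distrib)
  moreover have "1 - 1 / (q * A) = f / (q * A)" using A0 by (simp add: f_def diff_divide_distrib)
  ultimately show ?thesis unfolding pow 1 using A0 d0 by simp
qed

lemma pm_0: "(e :: 'a) * e = 1 \<Longrightarrow> pm e 0 r = (if r = 0 then 1 else 0)"
  by (simp add: pm_def cT_0 gl_0)

lemma pm_skew_odd: "s + r = Suc (2 * k) \<Longrightarrow> pm (- 1 :: 'a) s r = 0"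
  using NSym_skew_odd[of k] by (simp add: pm_def cT_def Wt_def)

text \<open>\<open>card_GL_Sp\<close> factors the order of \<open>GL (2 * n)\<close>; the number of
  skew forms cancels against the one in \<open>sum_cT\<close>.\<close>

lemma sum_pm:
  fixes J :: "'a mat"
  assumes J: "J \<in> NSym (- 1) (2 * n)"
  shows "(\<Sum>s\<le>2 * n. pm (- 1 :: 'a) s (2 * n - s)) = real (NS n J) / real (card (Sp_group n J))"
proof -
  note two = odd_card_two_neq_0[OF odd]
  have "(\<Sum>s\<le>2 * n. pm (- 1 :: 'a) s (2 * n - s))
    = real (\<Sum>s\<le>2 * n. cT (- 1 :: 'a) s (2 * n - s)) / gl TYPE('a) (2 * n)"
    unfolding of_nat_sum sum_divide_distrib pm_def by (intro sum.cong refl) auto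
  also have "\<dots> = real (card (NSym (- 1 :: 'a) (2 * n))) * real (NS n J) /
    (real (card (NSym (- 1 :: 'a) (2 * n))) * real (card (Sp_group n J)))"
    unfolding sum_cT[OF two J] gl_def card_GL_Sp[OF two J] of_nat_mult ..
  also have "\<dots> = real (NS n J) / real (card (Sp_group n J))"
    using J by (simp add: card_gt_0_iff) (auto simp: card_eq_0_iff)
  finally show ?thesis .
qed

end

section \<open>Power series\<close>

text \<open>Multiplication by \<open>f N\<close> changes only coefficients beyond index
  \<open>N\<close>, so each coefficient is eventually constant.\<close>

lemma prod_one_plus_X_power_stable:
  fixes f :: "nat \<Rightarrow> 'b::comm_ring_1 fps"
  assumes f: "\<And>i. f i = 1 + fps_X ^ Suc i * g i"
  shows "k \<le> N \<Longrightarrow> fps_nth (\<Prod>i<N. f i) k = fps_nth (\<Prod>i<k. f i) k"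
proof (induction N)
  case (Suc N)
  show ?case
  proof (cases "k = Suc N")
    case False
    then have kN: "k \<le> N" using Suc.prems by simp
    have "(\<Prod>i<Suc N. f i) = (\<Prod>i<N. f i) + fps_X ^ Suc N * (g N * (\<Prod>i<N. f i))"
      by (simp add: f algebra_simps del: power_Suc)
    then have "fps_nth (\<Prod>i<Suc N. f i) k = fps_nth (\<Prod>i<N. f i) k"
      using kN by (simp add: fps_X_power_mult_nth del: power_Suc)
    then show ?thesis using Suc.IH[OF kN] by simp
  qed simp
qed simp

lemma fps_prodinf_one_plus_X_power:
  assumes f: "\<And>i. f i = 1 + fps_X ^ Suc i * g i"
  shows "fps_convergent_prod f" "k \<le> N \<Longrightarrow> fps_nth (fps_prodinf f) k = fps_nth (\<Prod>i<N. f i) k"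
proof -
  have lim: "(\<lambda>N. fps_nth (\<Prod>i<N. f i) k) \<longlonglongrightarrow> fps_nth (\<Prod>i<k. f i) k" for k
    by (intro tendsto_eventually eventually_sequentiallyI[of k]) (rule prod_one_plus_X_power_stable[OF f])
  then show "fps_convergent_prod f" by (auto simp: fps_convergent_prod_def convergent_def)
  show "fps_nth (fps_prodinf f) k = fps_nth (\<Prod>i<N. f i) k" if "k \<le> N"
    using limI[OF lim[of k]] prod_one_plus_X_power_stable[OF f that] by (simp add: fps_prodinf_def)
qed

lemma fps_nth_compose_X_power:
  fixes F :: "'b::comm_ring_1 fps"
  assumes n: "0 < n"
  shows "fps_nth (F oo fps_X ^ n) i = (if n dvd i then fps_nth F (i div n) else 0)"
proof -
  have "fps_nth (F oo fps_X ^ n) i = (\<Sum>k=0..i. if k * n = i then fps_nth F k else 0)"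
    unfolding fps_compose_nth power_mult[symmetric]
    by (intro sum.cong refl) (auto simp: fps_X_power_nth mult.commute)
  also have "\<dots> = (if n dvd i then fps_nth F (i div n) else 0)"
  proof (cases "n dvd i")
    case True
    have "(\<Sum>k=0..i. if k * n = i then fps_nth F k else 0) = (\<Sum>k=0..i. if k = i div n then fps_nth F k else 0)"
      using n True by (intro sum.cong refl) auto
    then show ?thesis using True by (simp add: sum.delta)
  next
    case False
    then have "k * n \<noteq> i" for k by auto
    then show ?thesis using False by simp
  qed
  finally show ?thesis .
qed

lemma fps_compose_X_power_1: "0 < j \<Longrightarrow> (1 :: 'b::comm_ring_1 fps) oo fps_X ^ j = 1"
  by (rule fps_ext) (auto simp: fps_nth_compose_X_power)

lemma linear_compose:
  "(1 - fps_const a * fps_X) oo (fps_const p * fps_X) = 1 - fps_const (p * a :: real) * fps_X"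
proof (rule fps_ext)
  fix n
  show "fps_nth ((1 - fps_const a * fps_X) oo (fps_const p * fps_X)) n
    = fps_nth (1 - fps_const (p * a) * fps_X) n"
    by (cases "n = 1") (auto simp: fps_compose_linear)
qed

section \<open>The product over \<open>l\<close> as a power series, and its difference
  equation\<close>

context
  fixes q :: real
  assumes q: "q > 1"
begin

definition Pq :: "nat \<Rightarrow> real fps" where
  "Pq N = (\<Prod>l<N. 1 - fps_const (1 / q ^ (2 * l + 1)) * fps_X)"

text \<open>The series \<open>D(z)\<close> of the overview, with \<open>z\<close> as the variable.
  Its coefficients are genuine limits of real sequences; substituting \<open>fps_X ^ Suc i\<close>
  yields the inner product for the index \<open>i\<close>.\<close>

definition Dq :: "real fps" where
  "Dq = Abs_fps (\<lambda>k. lim (\<lambda>N. fps_nth (Pq N) k))"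

lemma Pq_nth_0: "fps_nth (Pq N) 0 = 1"
  unfolding Pq_def by (induction N) auto

lemma Pq_Suc_nth: "fps_nth (Pq (Suc N)) (Suc k)
  = fps_nth (Pq N) (Suc k) - 1 / q ^ (2 * N + 1) * fps_nth (Pq N) k"
proof -
  have "Pq (Suc N) = Pq N - fps_const (1 / q ^ (2 * N + 1)) * (fps_X * Pq N)"
    unfolding Pq_def by (simp add: algebra_simps)
  then show ?thesis by simp
qed

text \<open>Induction on the index of the coefficient: the increments of coefficient
  \<open>Suc k\<close> are those of a bounded sequence, coefficient \<open>k\<close>, times a
  geometric one, hence summable.\<close>

lemma Pq_convergent: "convergent (\<lambda>N. fps_nth (Pq N) k)"
proof (induction k)
  case 0
  then show ?case by (simp add: Pq_nth_0 convergent_const)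
next
  case (Suc k)
  then obtain B where B: "\<And>N. \<bar>fps_nth (Pq N) k\<bar> \<le> B"
    using convergent_imp_Bseq[THEN BseqD] by (metis real_norm_def)
  have "summable (\<lambda>N. fps_nth (Pq (Suc N)) (Suc k) - fps_nth (Pq N) (Suc k))"
  proof (rule summable_comparison_test')
    show "summable (\<lambda>N. B * (1 / q) ^ N)"
      using q by (intro summable_mult summable_geometric) simp
    fix N :: nat
    have "(1 / q) ^ (2 * N + 1) \<le> (1 / q) ^ N" using q by (intro power_decreasing) auto
    then have "\<bar>1 / q ^ (2 * N + 1)\<bar> \<le> (1 / q) ^ N" using q by (simp add: power_one_over)
    then have "\<bar>1 / q ^ (2 * N + 1)\<bar> * \<bar>fps_nth (Pq N) k\<bar> \<le> (1 / q) ^ N * B"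
      using B[of N] q by (intro mult_mono) auto
    then show "norm (fps_nth (Pq (Suc N)) (Suc k) - fps_nth (Pq N) (Suc k)) \<le> B * (1 / q) ^ N"
      unfolding Pq_Suc_nth by (simp add: abs_mult mult.commute)
  qed
  then have "convergent (\<lambda>n. \<Sum>N<n. fps_nth (Pq (Suc N)) (Suc k) - fps_nth (Pq N) (Suc k))"
    by (simp only: summable_iff_convergent)
  then have "convergent (\<lambda>n. fps_nth (Pq n) (Suc k) - fps_nth (Pq 0) (Suc k))"
    unfolding sum_lessThan_telescope[of "\<lambda>n. fps_nth (Pq n) (Suc k)"] .
  from convergent_add[OF this convergent_const[of "fps_nth (Pq 0) (Suc k)"]] show ?case by simp
qed

lemma Pq_lim: "(\<lambda>N. fps_nth (Pq N) k) \<longlonglongrightarrow> fps_nth Dq k"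
  using Pq_convergent[of k] by (simp add: Dq_def convergent_LIMSEQ_iff)

lemma Dq_0: "fps_nth Dq 0 = 1"
  using LIMSEQ_unique[OF Pq_lim[of 0]] by (simp add: Pq_nth_0 LIMSEQ_const_iff)

text \<open>Replacing \<open>z\<close> by \<open>z / q^2\<close> raises \<open>l\<close> by one in
  every factor; the factor for \<open>l = 0\<close> is supplied separately.\<close>

lemma Pq_functional: "Pq (Suc N) = (1 - fps_const (1 / q) * fps_X) * (Pq N oo (fps_const (1 / q\<^sup>2) * fps_X))"
proof -
  have c: "(1 - fps_const (1 / q ^ (2 * l + 1)) * fps_X) oo (fps_const (1 / q\<^sup>2) * fps_X)
    = 1 - fps_const (1 / q ^ (2 * Suc l + 1)) * fps_X" for l
    unfolding linear_compose by (simp add: power2_eq_square)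
  have "Pq N oo (fps_const (1 / q\<^sup>2) * fps_X) = (\<Prod>l<N. 1 - fps_const (1 / q ^ (2 * Suc l + 1)) * fps_X)"
    unfolding Pq_def by (subst fps_compose_prod_distrib) (simp_all only: c fps_mult_nth_0 fps_X_nth, simp_all)
  then show ?thesis unfolding Pq_def by (subst prod.lessThan_Suc_shift) simp
qed

text \<open>The limit of \<open>Pq_functional\<close>. Each coefficient of the right-hand side
  involves at most two coefficients of the series, so the limit may be taken
  coefficientwise.\<close>

lemma Dq_functional: "Dq = (1 - fps_const (1 / q) * fps_X) * (Dq oo (fps_const (1 / q\<^sup>2) * fps_X))"
proof (rule fps_ext)
  fix k
  have nth: "fps_nth ((1 - fps_const (1 / q) * fps_X) * (F oo (fps_const (1 / q\<^sup>2) * fps_X))) k =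
     (1 / q\<^sup>2) ^ k * fps_nth F k - (if k
       = 0 then 0 else 1 / q * ((1 / q\<^sup>2) ^ (k - 1) * fps_nth F (k - 1)))" for F
    using q by (simp add: fps_compose_linear left_diff_distrib mult.assoc)
  have "(\<lambda>N. fps_nth (Pq (Suc N)) k) \<longlonglongrightarrow>
     (1 / q\<^sup>2) ^ k * fps_nth Dq k - (if k = 0 then 0 else 1 / q * ((1 / q\<^sup>2) ^ (k - 1) * fps_nth Dq (k - 1)))"
    unfolding Pq_functional nth using q by (cases "k = 0") (auto intro!: tendsto_intros Pq_lim)
  moreover have "(\<lambda>N. fps_nth (Pq (Suc N)) k) \<longlonglongrightarrow> fps_nth Dq k" by (rule LIMSEQ_Suc[OF Pq_lim])
  ultimately show "fps_nth Dq k = fps_nth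
    ((1 - fps_const (1 / q) * fps_X) * (Dq oo (fps_const (1 / q\<^sup>2) * fps_X))) k"
    unfolding nth by (rule LIMSEQ_unique[rotated])
qed

text \<open>Comparison of coefficients gives a first-order recursion whose leading factor
  \<open>1 - (1 / q\<^sup>2) ^ Suc k\<close> is nonzero for \<open>q > 1\<close>. The constant term
  therefore determines the solution.\<close>

lemma functional_unique:
  fixes F G :: "real fps"
  assumes F: "F * (1 - fps_X) = (1 - fps_const (1 / q) * fps_X) * (F oo (fps_const (1 / q\<^sup>2) * fps_X))"
    and G: "G * (1 - fps_X) = (1 - fps_const (1 / q) * fps_X) * (G oo (fps_const (1 / q\<^sup>2) * fps_X))"
    and 0: "fps_nth F 0 = fps_nth G 0"
  shows "F = G"
proof -
  have rec: "fps_nth H (Suc k) * (1 - (1 / q\<^sup>2) ^ Suc k) = fps_nth H k * (1 - 1 / q * (1 / q\<^sup>2) ^ k)"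
    if "H * (1 - fps_X) = (1 - fps_const (1 / q) * fps_X) * (H oo (fps_const (1 / q\<^sup>2) * fps_X))"
      for H :: "real fps" and k
  proof -
    have "fps_nth (H * (1 - fps_X)) (Suc k) = fps_nth H (Suc k) - fps_nth H k"
      by (simp add: right_diff_distrib)
    moreover have "fps_nth ((1 - fps_const (1 / q) * fps_X) * (H oo (fps_const (1 / q\<^sup>2) * fps_X))) (Suc k) =
      (1 / q\<^sup>2) ^ Suc k * fps_nth H (Suc k) - 1 / q * ((1 / q\<^sup>2) ^ k * fps_nth H k)"
      by (simp add: fps_compose_linear left_diff_distrib mult.assoc del: power_Suc)
    ultimately have "fps_nth H (Suc k) - fps_nth H k
      = (1 / q\<^sup>2) ^ Suc k * fps_nth H (Suc k) - 1 / q * ((1 / q\<^sup>2) ^ k * fps_nth H k)"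
      using that by simp
    then show ?thesis by (simp add: algebra_simps del: power_Suc)
  qed
  have "fps_nth F k = fps_nth G k" for k
  proof (induction k)
    case (Suc k)
    have "(1 / q\<^sup>2) ^ Suc k < 1" using q by (intro power_Suc_less_one) auto
    then have "1 - (1 / q\<^sup>2) ^ Suc k \<noteq> 0" by (simp del: power_Suc)
    then show ?case using rec[OF F, of k] rec[OF G, of k] Suc by (metis mult_right_cancel)
  qed (rule 0)
  then show ?thesis by (rule fps_ext)
qed

end

lemma den_factor_prod:
  assumes "real m > 1"
  shows "(\<Prod>l<N. den_factor m i l) = Pq (real m) N oo fps_X ^ Suc i"
proof -
  have "Pq (real m) N oo fps_X ^ Suc i =
    (\<Prod>l<N. (1 - fps_const (1 / real m ^ (2 * l + 1)) * fps_X) oo fps_X ^ Suc i)"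
    unfolding Pq_def[OF assms] by (rule fps_compose_prod_distrib) simp
  also have "\<dots> = (\<Prod>l<N. den_factor m i l)"
    by (intro prod.cong refl) (simp add: den_factor_def fps_compose_sub_distrib fps_compose_mult_distrib
      fps_compose_X_power_1 del: power_Suc)
  finally show ?thesis by simp
qed

lemma den_factor_prodinf:
  assumes m: "real m > 1"
  shows "fps_convergent_prod (den_factor m i)" "fps_prodinf (den_factor m i) = Dq (real m) oo fps_X ^ Suc i"
proof -
  have lim: "(\<lambda>N. fps_nth (\<Prod>l<N. den_factor m i l) k) \<longlonglongrightarrow> fps_nth (Dq (real m) oo fps_X ^ Suc i) k" for k
    unfolding den_factor_prod[OF m] by (cases "Suc i dvd k")
      (auto simp: fps_nth_compose_X_power Pq_lim[OF m] simp del: power_Suc)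
  then show "fps_convergent_prod (den_factor m i)" by (auto simp: fps_convergent_prod_def convergent_def)
  show "fps_prodinf (den_factor m i) = Dq (real m) oo fps_X ^ Suc i"
    by (rule fps_ext) (simp add: fps_prodinf_def limI[OF lim] del: power_Suc)
qed

lemma fps_one_plus_X: "fps_nth F 0 = 1 \<Longrightarrow> F = 1 + fps_X * fps_shift 1 (F :: 'b::comm_ring_1 fps)"
  by (rule fps_ext) (simp add: fps_X_mult_nth)

text \<open>Gives the factors of the outer product the shape for which coefficients
  stabilise.\<close>

lemma compose_X_power_one_plus:
  assumes "fps_nth F 0 = (1 :: real)"
  shows "F oo fps_X ^ Suc i = 1 + fps_X ^ Suc i * (fps_shift 1 F oo fps_X ^ Suc i)"
proof -
  have "F oo fps_X ^ Suc i = (1 + fps_X * fps_shift 1 F) oo fps_X ^ Suc i" using fps_one_plus_X[OF assms]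
    by simp
  also have "\<dots> = 1 + fps_X ^ Suc i * (fps_shift 1 F oo fps_X ^ Suc i)"
    by (simp add: fps_compose_add_distrib fps_compose_mult_distrib fps_compose_X_power_1 del: power_Suc)
  finally show ?thesis .
qed

section \<open>Generating functions of the masses and the product formula\<close>

definition Hf :: "'a::{field,finite} \<Rightarrow> nat \<Rightarrow> real fps" where
  "Hf e i = Abs_fps (\<lambda>n. \<Sum>(s, r) | i * s + r = n. pm e s r)"

definition Mf :: "'a::{field,finite} \<Rightarrow> real fps" where
  "Mf e = Abs_fps (Mm e)"

definition Lam :: "'a::{field,finite} itself \<Rightarrow> real fps" where
  "Lam _ = Abs_fps (\<lambda>k. Lm (- 1 :: 'a) (2 * k))"

definition Iot :: "'a::{field,finite} itself \<Rightarrow> real fps" where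
  "Iot _ = Abs_fps (\<lambda>k. Iq TYPE('a) (2 * k))"

lemma finite_weight: "0 < i \<Longrightarrow> finite {(s, r). i * s + r = (n :: nat)}"
proof (rule finite_subset[of _ "{..n} \<times> {..n}"])
  assume i: "0 < i"
  show "{(s, r). i * s + r = n} \<subseteq> {..n} \<times> {..n}"
  proof clarify
    fix s r show "s \<in> {..i * s + r} \<and> r \<in> {..i * s + r}" using i by (cases i) auto
  qed
qed simp

lemma compose_mult_nth:
  fixes F G :: "real fps"
  assumes i: "0 < i"
  shows "fps_nth ((F oo fps_X ^ i) * G) n = (\<Sum>(m, k) | i * m + k = n. fps_nth F m * fps_nth G k)"
proof -
  have "fps_nth ((F oo fps_X ^ i) * G) n
    = (\<Sum>j=0..n. if i dvd j then fps_nth F (j div i) * fps_nth G (n - j) else 0)"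
    unfolding fps_mult_nth using i by (intro sum.cong refl) (simp add: fps_nth_compose_X_power)
  also have "\<dots> = (\<Sum>j\<in>{j \<in> {0..n}. i dvd j}. fps_nth F (j div i) * fps_nth G (n - j))"
    by (rule sum.inter_filter[symmetric]) simp
  also have "\<dots> = (\<Sum>(m, k) | i * m + k = n. fps_nth F m * fps_nth G k)"
    by (rule sum.reindex_bij_witness[of _ "\<lambda>(m, k). i * m" "\<lambda>j. (j div i, n - j)"]) (use i in auto)
  finally show ?thesis .
qed

context
  assumes odd: "odd CARD('a::{field,finite})"
begin

text \<open>With \<open>m = s - t\<close> in the recursion for \<open>pm\<close>, the weight
  \<open>i * s + r\<close> becomes \<open>i * m + (Suc i * t + (r - t))\<close>. The old nullity is
  counted \<open>i\<close> times, and its part \<open>t\<close> passes on into the new nullity with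
  one more unit taken from \<open>r\<close>.\<close>

lemma Hf_rec:
  assumes e: "(e :: 'a) * e = 1" and i: "0 < i"
  shows "Hf e i = (Mf e oo fps_X ^ i) * Hf (- e) (Suc i)"
proof (rule fps_ext)
  fix n
  have fin: "finite {(s, r). i * s + r = n}" by (rule finite_weight[OF i])
  have fin': "finite {(s, r). Suc i * s + r = k}" for k by (rule finite_weight) simp
  have "fps_nth (Hf e i) n = (\<Sum>(s, r) | i * s + r = n. \<Sum>t | t \<le> r \<and> t \<le> s. Mm e (s - t) * pm (- e) t (r - t))"
  proof -
    have "pm e s r = (\<Sum>t | t \<le> r \<and> t \<le> s. Mm e (s - t) * pm (- e) t (r - t))" for s r
    proof -
      have "{t. t \<le> r \<and> t \<le> s} = {t \<in> {..r}. t \<le> s}" by auto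
      then show ?thesis unfolding pm_rec[OF odd e, of s r] by (simp only: sum.inter_filter[OF finite_atMost])
    qed
    then show ?thesis unfolding Hf_def fps_nth_Abs_fps by (intro sum.cong refl) (simp add: case_prod_beta)
  qed
  also have "\<dots> = (\<Sum>(x, t)\<in>Sigma {(s, r). i * s + r = n} (\<lambda>(s, r). {t. t \<le> r \<and> t \<le> s}).
    (case x of (s, r) \<Rightarrow> Mm e (s - t) * pm (- e) t (r - t)))"
    by (subst sum.Sigma[symmetric, OF fin]) (auto intro!: sum.cong)
  also have "\<dots> = (\<Sum>(x, y)\<in>Sigma {(m, k). i * m + k = n} (\<lambda>(m, k). {(t, r). Suc i * t + r = k}). Mm e (fst x)
    * pm (- e) (fst y) (snd y))"
    by (rule sum.reindex_bij_witness[of _ "\<lambda>((m, k), (t, r)). ((m + t, r + t), t)"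
      "\<lambda>((s, r), t). ((s - t, Suc i * t + (r - t)), (t, r - t))"])
      (auto simp: algebra_simps)
  also have "\<dots> = (\<Sum>(m, k) | i * m + k = n. \<Sum>(t, r) | Suc i * t + r = k. Mm e m * pm (- e) t r)"
    by (subst sum.Sigma[symmetric, OF finite_weight[OF i]])
      (use fin' in \<open>auto intro!: sum.cong simp: case_prod_beta\<close>)
  also have "\<dots> = (\<Sum>(m, k) | i * m + k = n. fps_nth (Mf e) m * fps_nth (Hf (- e) (Suc i)) k)"
    by (intro sum.cong refl) (auto simp: Mf_def Hf_def sum_distrib_left case_prod_beta)
  also have "\<dots> = fps_nth ((Mf e oo fps_X ^ i) * Hf (- e) (Suc i)) n"
    by (rule compose_mult_nth[OF i, symmetric])
  finally show "fps_nth (Hf e i) n = fps_nth ((Mf e oo fps_X ^ i) * Hf (- e) (Suc i)) n" .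
qed

text \<open>A positive nullity already has weight at least \<open>i\<close>, and nullity zero leaves
  only the empty triple. So the series tends to 1 as \<open>i\<close> grows, and iterating
  \<open>Hf_rec\<close> loses nothing in the limit.\<close>

lemma Hf_low:
  assumes e: "(e :: 'a) * e = 1" and n: "n < i"
  shows "fps_nth (Hf e i) n = (if n = 0 then 1 else 0)"
proof -
  have "{(s, r). i * s + r = n} = {(0, n)}"
  proof (intro equalityI subsetI)
    fix x assume "x \<in> {(s, r). i * s + r = n}"
    then obtain s r where x: "x = (s, r)" "i * s + r = n" by blast
    have "s = 0"
    proof (rule ccontr)
      assume "s \<noteq> 0" then have "i \<le> i * s" by simp
      with x(2) n show False by linarith
    qed
    then show "x \<in> {(0, n)}" using x by simp
  qed auto
  then show ?thesis using pm_0[OF odd e, of n] by (simp add: Hf_def)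
qed

lemma Hf_prod:
  "Hf (- 1 :: 'a) 1 = (\<Prod>j<K. Mf ((- 1 :: 'a) ^ Suc j) oo fps_X ^ Suc j) * Hf ((- 1 :: 'a) ^ Suc K) (Suc K)"
proof (induction K)
  case (Suc K)
  have "(- 1 :: 'a) ^ Suc K * (- 1) ^ Suc K = 1" by (simp flip: power_mult_distrib)
  from Hf_rec[OF this, of "Suc K"] Suc show ?case by (simp add: mult.assoc)
qed simp

lemma one_minus_inverse_power: "1 - 1 / qr TYPE('a) ^ Suc n \<noteq> 0"
  using q_power_neq_1[OF odd, of n] by (auto simp: field_simps)

lemma Lm_sym_even: "Lm (1 :: 'a) (2 * k) = Lm (- 1 :: 'a) (2 * k)"
proof (induction k)
  case 0
  then show ?case using Lm_0[OF odd] by simp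
next
  case (Suc k)
  have "Lm (1 :: 'a) (Suc (Suc (2 * k))) = Lm (- 1 :: 'a) (Suc (Suc (2 * k)))"
    using Lm_even_Suc[OF odd, of 1 k] Lm_even_Suc[OF odd, of "- 1" k] Suc one_minus_inverse_power[of
      "Suc (2 * k)"]
    by (metis mult_right_cancel)
  then show ?case by simp
qed

lemma nth_compose_X2:
  "fps_nth (F oo fps_X ^ 2) (2 * k) = fps_nth (F :: real fps) k" "fps_nth (F oo fps_X ^ 2) (Suc (2 * k)) = 0"
  by (auto simp: fps_nth_compose_X_power)

lemma fps_eq_parity:
  fixes F G :: "real fps"
  assumes "\<And>k. fps_nth F (2 * k) = fps_nth G (2 * k)" "\<And>k. fps_nth F (Suc (2 * k)) = fps_nth G (Suc (2 * k))"
  shows "F = G"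
proof (rule fps_ext)
  fix n
  show "fps_nth F n = fps_nth G n"
    by (cases "even n") (use assms in \<open>auto elim!: evenE oddE\<close>)
qed

text \<open>For the sign \<open>- 1\<close> only even sizes occur. For the sign \<open>1\<close>
  each odd coefficient equals the even one before it, which produces the factor
  \<open>1 + fps_X\<close>; the numerator of the final identity stems from this factor.\<close>

lemma Lm_fps:
  "Abs_fps (Lm (- 1 :: 'a)) = (Lam TYPE('a)) oo fps_X ^ 2"
  "Abs_fps (Lm (1 :: 'a)) = (1 + fps_X) * (Lam TYPE('a) oo fps_X ^ 2)"
  "Abs_fps (Iq TYPE('a)) = (Iot TYPE('a)) oo fps_X ^ 2"
proof -
  show "Abs_fps (Lm (- 1 :: 'a)) = (Lam TYPE('a)) oo fps_X ^ 2"
    by (rule fps_eq_parity; simp only: nth_compose_X2) (simp_all add: Lam_def Lm_skew_odd[OF odd])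
  show "Abs_fps (Iq TYPE('a)) = (Iot TYPE('a)) oo fps_X ^ 2"
    by (rule fps_eq_parity; simp only: nth_compose_X2) (simp_all add: Iot_def Iq_odd[OF odd])
  have mult: "fps_nth ((1 + fps_X) * G) n = fps_nth G n + (if n = 0 then 0 else fps_nth G (n - 1))"
    for G :: "real fps" and n
    by (simp add: distrib_right)
  show "Abs_fps (Lm (1 :: 'a)) = (1 + fps_X) * (Lam TYPE('a) oo fps_X ^ 2)"
  proof (rule fps_eq_parity)
    fix k
    show "fps_nth (Abs_fps (Lm (1 :: 'a))) (Suc (2 * k))
      = fps_nth ((1 + fps_X) * (Lam TYPE('a) oo fps_X ^ 2)) (Suc (2 * k))"
      unfolding mult nth_compose_X2 by (simp add: nth_compose_X2 Lam_def Lm_sym_odd[OF odd] Lm_sym_even)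
    show "fps_nth (Abs_fps (Lm (1 :: 'a))) (2 * k)
      = fps_nth ((1 + fps_X) * (Lam TYPE('a) oo fps_X ^ 2)) (2 * k)"
    proof (cases k)
      case 0
      then show ?thesis unfolding mult nth_compose_X2 by (simp add: Lam_def Lm_0[OF odd])
    next
      case (Suc l)
      have "2 * k - 1 = Suc (2 * l)" using Suc by simp
      then show ?thesis unfolding mult nth_compose_X2
        by (simp only: nth_compose_X2) (simp add: Lam_def Lm_sym_even)
    qed
  qed
qed

lemma inverse_square_power: "(1 / (qr TYPE('a))\<^sup>2) ^ k = 1 / qr TYPE('a) ^ (2 * k)"
  by (simp add: power_one_over power_mult)

lemma Lam_functional: "(Lam TYPE('a)) * (1 - fps_X)
  = (Lam TYPE('a)) oo (fps_const (1 / (qr TYPE('a))\<^sup>2) * fps_X)"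
proof (rule fps_ext)
  fix n
  show "fps_nth (Lam TYPE('a) * (1 - fps_X)) n
    = fps_nth (Lam TYPE('a) oo (fps_const (1 / (qr TYPE('a))\<^sup>2) * fps_X)) n"
  proof (cases n)
    case 0
    then show ?thesis by (simp add: fps_compose_linear)
  next
    case (Suc k)
    have "Lm (- 1 :: 'a) (2 * Suc k) * (1 - 1 / qr TYPE('a) ^ (2 * Suc k)) = Lm (- 1 :: 'a) (2 * k)"
      using Lm_even_Suc[OF odd, of "- 1" k] by simp
    then have "fps_nth (Lam TYPE('a)) (Suc k) - fps_nth (Lam TYPE('a)) k
      = 1 / qr TYPE('a) ^ (2 * Suc k) * fps_nth (Lam TYPE('a)) (Suc k)"
      unfolding Lam_def fps_nth_Abs_fps by (simp only: right_diff_distrib)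
        (simp add: mult.commute del: power_Suc mult_Suc_right)
    then show ?thesis unfolding Suc fps_compose_linear fps_nth_Abs_fps inverse_square_power
      by (simp add: right_diff_distrib del: power_Suc mult_Suc_right)
  qed
qed

lemma Iot_functional:
  "(Iot TYPE('a)) * (1 - fps_X) = (1 - fps_const (1 / qr TYPE('a)) * fps_X) *
    (Iot TYPE('a) oo (fps_const (1 / (qr TYPE('a))\<^sup>2) * fps_X))"
proof (rule fps_ext)
  fix n
  let ?q = "qr TYPE('a)"
  show "fps_nth (Iot TYPE('a) * (1 - fps_X)) n
    = fps_nth ((1 - fps_const (1 / ?q) * fps_X) * (Iot TYPE('a) oo (fps_const (1 / ?q\<^sup>2) * fps_X))) n"
  proof (cases n)
    case 0
    then show ?thesis by (simp add: fps_compose_linear)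
  next
    case (Suc k)
    have r: "fps_nth ((1 - fps_const (1 / ?q) * fps_X) * (Iot TYPE('a) oo (fps_const (1 / ?q\<^sup>2) * fps_X)))
      (Suc k) =
       (1 / ?q\<^sup>2) ^ Suc k * fps_nth (Iot TYPE('a)) (Suc k) - 1 / ?q *
         ((1 / ?q\<^sup>2) ^ k * fps_nth (Iot TYPE('a)) k)"
      by (simp add: fps_compose_linear left_diff_distrib mult.assoc del: power_Suc)
    have "fps_nth (Iot TYPE('a)) (Suc k) * (1 - 1 / ?q ^ (2 * Suc k))
      = fps_nth (Iot TYPE('a)) k * (1 - 1 / (?q * ?q ^ (2 * k)))"
      using Iq_even_Suc[OF odd, of k] by (simp add: Iot_def)
    moreover have "1 / ?q * (1 / ?q ^ (2 * k) * x) = x * (1 / (?q * ?q ^ (2 * k)))" for x by simp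
    ultimately show ?thesis unfolding Suc r inverse_square_power
      by (simp add: right_diff_distrib del: power_Suc mult_Suc_right)
  qed
qed

text \<open>An instance of the q-binomial theorem with base \<open>q^(-2)\<close>. Multiplying the
  difference equations of \<open>Lam\<close> and \<open>Dq\<close> gives the equation of
  \<open>Iot\<close>, and the constant terms agree.\<close>

lemma Lam_Dq: "(Lam TYPE('a)) * Dq (qr TYPE('a)) = (Iot TYPE('a))"
proof (rule functional_unique[OF qr_gt_1 _ Iot_functional])
  let ?q = "qr TYPE('a)"
  let ?c = "fps_const (1 / ?q\<^sup>2) * fps_X"
  have "(Lam TYPE('a)) * Dq ?q * (1 - fps_X) = (Lam TYPE('a) * (1 - fps_X)) * Dq ?q" by (simp add: mult_ac)
  also have "\<dots> = (Lam TYPE('a) oo ?c) * ((1 - fps_const (1 / ?q) * fps_X) * (Dq ?q oo ?c))"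
    unfolding Lam_functional using Dq_functional[OF qr_gt_1[where 'a = 'a]] by simp
  also have "\<dots> = (1 - fps_const (1 / ?q) * fps_X) * ((Lam TYPE('a) * Dq ?q) oo ?c)"
    by (simp add: fps_compose_mult_distrib mult_ac)
  finally show "(Lam TYPE('a)) * Dq ?q * (1 - fps_X)
    = (1 - fps_const (1 / ?q) * fps_X) * (Lam TYPE('a) * Dq ?q oo ?c)" .
  show "fps_nth (Lam TYPE('a) * Dq ?q) 0 = fps_nth (Iot TYPE('a)) 0"
    by (simp add: Lam_def Iot_def Dq_0[OF qr_gt_1] Lm_0[OF odd])
qed

lemma Iq_Mf:
  assumes e: "(e :: 'a) * e = 1"
  shows "Abs_fps (Iq TYPE('a)) * Mf e = Abs_fps (Lm e)"
  by (rule fps_ext) (simp add: fps_mult_nth Mf_def Mm_convolution[OF odd e, symmetric] atLeast0AtMost)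

text \<open>By the convolution, \<open>Mf\<close> is the series of \<open>Lm\<close> divided by that
  of \<open>Iq\<close>. Both contain the series \<open>Lam\<close> in the squared variable; it has
  constant term 1 and cancels.\<close>

lemma Mf_Dq:
  "(Dq (qr TYPE('a)) oo fps_X ^ 2) * Mf (- 1 :: 'a) = 1"
  "(Dq (qr TYPE('a)) oo fps_X ^ 2) * Mf (1 :: 'a) = 1 + fps_X"
proof -
  let ?D = "Dq (qr TYPE('a)) oo fps_X ^ 2" and ?L = "(Lam TYPE('a)) oo fps_X ^ 2"
  have "fps_nth ?L 0 = 1" using nth_compose_X2(1)[of "(Lam TYPE('a))" 0] Lm_0[OF odd] by (simp add: Lam_def)
  then have L0: "?L \<noteq> 0" by (metis fps_zero_nth zero_neq_one)
  have I: "Abs_fps (Iq TYPE('a)) = ?L * ?D"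
    unfolding Lm_fps Lam_Dq[symmetric] by (rule fps_compose_mult_distrib) simp
  have "?L * (?D * Mf (- 1 :: 'a)) = ?L * 1"
    using Iq_Mf[of "- 1"] unfolding I Lm_fps by (simp add: mult.assoc)
  then show "?D * Mf (- 1 :: 'a) = 1" using L0 by (metis mult_left_cancel)
  have "?L * (?D * Mf (1 :: 'a)) = ?L * (1 + fps_X)"
    using Iq_Mf[of 1] unfolding I Lm_fps by (simp add: mult_ac)
  then show "?D * Mf (1 :: 'a) = 1 + fps_X" using L0 by (metis mult_left_cancel)
qed

lemma X_power_compose: "fps_X ^ m oo fps_X ^ Suc n = (fps_X ^ (Suc n * m) :: real fps)"
  by (subst fps_compose_power[symmetric]) (simp_all add: power_mult del: power_Suc mult_Suc)

lemma compose_X2_swap: "(F oo fps_X ^ 2) oo fps_X ^ Suc j = (F oo fps_X ^ Suc j) oo (fps_X ^ 2 :: real fps)"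
proof -
  have "(F oo fps_X ^ 2) oo fps_X ^ Suc j = F oo (fps_X ^ 2 oo fps_X ^ Suc j)"
    by (rule fps_compose_assoc[symmetric]) simp_all
  also have "(fps_X ^ 2 oo fps_X ^ Suc j :: real fps) = fps_X ^ Suc j oo fps_X ^ 2"
    using X_power_compose[of 2 j] X_power_compose[of "Suc j" 1]
      by (simp add: numeral_2_eq_2 mult.commute del: power_Suc)
  also have "F oo (fps_X ^ Suc j oo fps_X ^ 2) = (F oo fps_X ^ Suc j) oo fps_X ^ 2"
    by (rule fps_compose_assoc) simp_all
  finally show ?thesis .
qed

text \<open>The sign \<open>(- 1) ^ Suc j\<close> is \<open>1\<close> exactly for odd
  \<open>j\<close>. These factors contribute \<open>1 + fps_X ^ Suc j\<close>, with even exponent,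
  and the others contribute 1; so \<open>2 * L\<close> factors yield \<open>L\<close> factors of the
  numerator in the squared variable.\<close>

lemma prod_Mf_Dq:
  "(\<Prod>j<2 * L. Mf ((- 1 :: 'a) ^ Suc j) oo fps_X ^ Suc j) *
    ((\<Prod>j<2 * L. Dq (qr TYPE('a)) oo fps_X ^ Suc j) oo fps_X ^ 2)
    = (\<Prod>i<L. num_factor i) oo fps_X ^ 2"
proof -
  let ?D = "Dq (qr TYPE('a))"
  have "(\<Prod>j<2 * L. Mf ((- 1 :: 'a) ^ Suc j) oo fps_X ^ Suc j) * ((\<Prod>j<2 * L. ?D oo fps_X ^ Suc j) oo fps_X ^ 2)
    = (\<Prod>j<2 * L. (Mf ((- 1 :: 'a) ^ Suc j) oo fps_X ^ Suc j) * ((?D oo fps_X ^ 2) oo fps_X ^ Suc j))"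
    unfolding compose_X2_swap by (subst fps_compose_prod_distrib) (simp_all add: prod.distrib del: power_Suc)
  also have "\<dots> = (\<Prod>j<2 * L. if odd j then 1 + fps_X ^ Suc j else 1)"
  proof (rule prod.cong[OF refl])
    fix j
    have "(Mf ((- 1 :: 'a) ^ Suc j) oo fps_X ^ Suc j) * ((?D oo fps_X ^ 2) oo fps_X ^ Suc j) =
      ((?D oo fps_X ^ 2) * Mf ((- 1 :: 'a) ^ Suc j)) oo fps_X ^ Suc j"
      by (subst fps_compose_mult_distrib) (simp_all add: mult.commute del: power_Suc)
    also have "\<dots> = (if odd j then 1 + fps_X ^ Suc j else 1)"
    proof (cases "odd j")
      case True
      then have "(- 1 :: 'a) ^ Suc j = 1" by simp
      then show ?thesis using True
        by (simp add: Mf_Dq fps_compose_add_distrib fps_compose_X_power_1 del: power_Suc)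
    next
      case False
      then have "(- 1 :: 'a) ^ Suc j = - 1" by simp
      then show ?thesis using False by (simp add: Mf_Dq fps_compose_X_power_1 del: power_Suc)
    qed
    finally show "(Mf ((- 1 :: 'a) ^ Suc j) oo fps_X ^ Suc j) * ((?D oo fps_X ^ 2) oo fps_X ^ Suc j) =
       (if odd j then 1 + fps_X ^ Suc j else 1)" .
  qed
  also have "\<dots> = (\<Prod>i<L. 1 + fps_X ^ (2 * Suc i))"
    by (induction L) (simp_all add: mult.commute del: power_Suc)
  also have "\<dots> = (\<Prod>i<L. num_factor i oo fps_X ^ 2)"
  proof (intro prod.cong refl)
    fix i
    have "(1 + fps_X ^ Suc i :: real fps) oo fps_X ^ Suc 1 = 1 + fps_X ^ (Suc 1 * Suc i)"
      unfolding fps_compose_add_distrib X_power_compose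
        by (simp add: fps_compose_X_power_1 del: power_Suc mult_Suc)
    then show "1 + fps_X ^ (2 * Suc i) = num_factor i oo fps_X ^ 2"
      by (simp add: num_factor_def numeral_2_eq_2 del: power_Suc)
  qed
  also have "\<dots> = (\<Prod>i<L. num_factor i) oo fps_X ^ 2" by (rule fps_compose_prod_distrib[symmetric]) simp
  finally show ?thesis .
qed

text \<open>With weight \<open>i = 1\<close> the masses are collected by total size
  \<open>s + r\<close>. There is no nonsingular skew form of odd size, so only even powers
  occur.\<close>

lemma Hf_skew:
  fixes J :: "nat \<Rightarrow> 'a mat"
  assumes J: "\<And>n. J n \<in> NSym (- 1) (2 * n)"
  shows "Hf (- 1 :: 'a) 1 = Abs_fps (\<lambda>n. real (NS n (J n)) / real (card (Sp_group n (J n)))) oo fps_X ^ 2"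
proof -
  have H: "fps_nth (Hf (- 1 :: 'a) 1) n = (\<Sum>s\<le>n. pm (- 1 :: 'a) s (n - s))" for n
    unfolding Hf_def fps_nth_Abs_fps
    by (rule sum.reindex_bij_witness[of _ "\<lambda>s. (s, n - s)" fst]) auto
  show ?thesis
  proof (rule fps_eq_parity)
    fix k
    show "fps_nth (Hf (- 1 :: 'a) 1) (2 * k) =
      fps_nth (Abs_fps (\<lambda>n. real (NS n (J n)) / real (card (Sp_group n (J n)))) oo fps_X ^ 2) (2 * k)"
      unfolding H nth_compose_X2 sum_pm[OF odd J] by simp
    show "fps_nth (Hf (- 1 :: 'a) 1) (Suc (2 * k)) =
      fps_nth (Abs_fps (\<lambda>n. real (NS n (J n)) / real (card (Sp_group n (J n)))) oo fps_X ^ 2) (Suc (2 * k))"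
      unfolding H nth_compose_X2 by (intro sum.neutral ballI pm_skew_odd[OF odd]) simp
  qed
qed

text \<open>In the squared variable the coefficient in question has index \<open>2 * n\<close>.
  After \<open>2 * n\<close> steps of the recursion the remaining factor \<open>?H\<close> agrees
  with 1 up to that index, so finite products give the coefficient exactly.\<close>

lemma truncated_identity:
  fixes J :: "nat \<Rightarrow> 'a mat"
  assumes J: "\<And>n. J n \<in> NSym (- 1) (2 * n)"
  shows "fps_nth (Abs_fps (\<lambda>n. real (NS n (J n)) / real (card (Sp_group n (J n)))) *
    (\<Prod>j<2 * n. Dq (qr TYPE('a)) oo fps_X ^ Suc j)) n
    = fps_nth (\<Prod>i<n. num_factor i) n"
proof -
  let ?A = "Abs_fps (\<lambda>n. real (NS n (J n)) / real (card (Sp_group n (J n))))"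
  let ?P = "\<Prod>j<2 * n. Dq (qr TYPE('a)) oo fps_X ^ Suc j" and ?N = "\<Prod>i<n. num_factor i"
  let ?H = "Hf ((- 1 :: 'a) ^ Suc (2 * n)) (Suc (2 * n))"
  let ?Q = "\<Prod>j<2 * n. Mf ((- 1 :: 'a) ^ Suc j) oo fps_X ^ Suc j"
  have e: "(- 1 :: 'a) ^ Suc (2 * n) * (- 1) ^ Suc (2 * n) = 1" by simp
  have "(?A * ?P) oo fps_X ^ 2 = (?A oo fps_X ^ 2) * (?P oo fps_X ^ 2)"
    by (rule fps_compose_mult_distrib) simp
  also have "?A oo fps_X ^ 2 = ?Q * ?H" unfolding Hf_skew[OF J, symmetric] by (rule Hf_prod)
  also have "?Q * ?H * (?P oo fps_X ^ 2) = (?Q * (?P oo fps_X ^ 2)) * ?H" by (simp only: mult_ac)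
  also have "\<dots> = (?N oo fps_X ^ 2) * ?H" unfolding prod_Mf_Dq ..
  finally have "fps_nth (?A * ?P) n = fps_nth ((?N oo fps_X ^ 2) * ?H) (2 * n)"
    using nth_compose_X2(1)[of "?A * ?P" n] by simp
  also have "\<dots> = (\<Sum>i=0..2 * n. fps_nth (?N oo fps_X ^ 2) i * fps_nth ?H (2 * n - i))" by (rule fps_mult_nth)
  also have "\<dots> = (\<Sum>i=0..2 * n. if i = 2 * n then fps_nth (?N oo fps_X ^ 2) i else 0)"
  proof (rule sum.cong[OF refl])
    fix i assume "i \<in> {0..2 * n}"
    then have "2 * n - i < Suc (2 * n)" "2 * n - i = 0 \<longleftrightarrow> i = 2 * n" by auto
    then show "fps_nth (?N oo fps_X ^ 2) i * fps_nth ?H (2 * n - i)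
      = (if i = 2 * n then fps_nth (?N oo fps_X ^ 2) i else 0)"
      using Hf_low[OF e] by simp
  qed
  also have "\<dots> = fps_nth ?N n" by (simp add: sum.delta nth_compose_X2 del: mult_2)
  finally show ?thesis .
qed

end

theorem theorem4p10:
  fixes J :: "nat \<Rightarrow> 'a::{field,finite} mat" and q :: nat
  assumes q: "q = CARD('a)" "odd q"
    and J: "\<And>n. J n \<in> carrier_mat (2 * n) (2 * n)"
           "\<And>n. invertible_mat (J n)"
           "\<And>n. skew_symmetric_mat (J n)"
  shows "fps_convergent_prod num_factor
       \<and> (\<forall>i. fps_convergent_prod (den_factor q i))
       \<and> fps_convergent_prod (\<lambda>i. fps_prodinf (den_factor q i))
       \<and> Abs_fps (\<lambda>n. real (NS n (J n)) / real (card (Sp_group n (J n))))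
           = fps_prodinf num_factor / fps_prodinf (\<lambda>i. fps_prodinf (den_factor q i))"
proof -
  let ?A = "Abs_fps (\<lambda>n. real (NS n (J n)) / real (card (Sp_group n (J n))))"
  let ?D = "fps_prodinf (\<lambda>i. fps_prodinf (den_factor q i))"
  have odd: "odd CARD('a)" using q by simp
  have qr: "real q = qr TYPE('a)" by (simp add: q qr_def)
  have q1: "real q > 1" unfolding qr by (rule qr_gt_1)
  have JN: "J n \<in> NSym (- 1) (2 * n)" for n
  proof -
    obtain B where B: "inverts_mat (J n) B" "inverts_mat B (J n)" using J(2)[of n]
      by (auto simp: invertible_mat_def)
    \<comment> \<open>\<open>inverts_mat\<close> leaves the size of \<open>B\<close> open; the
      numbers of columns of the two products fix it.\<close>
    have "dim_col (J n * B) = 2 * n" "dim_col (B * J n) = dim_row B" using B J(1)[of n]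
      by (auto simp: inverts_mat_def)
    then have "B \<in> carrier_mat (2 * n) (2 * n)" using J(1)[of n] by auto
    then have "J n \<in> GL (2 * n)" using GL_I[OF J(1)] B(1) J(1)[of n] by (auto simp: inverts_mat_def)
    moreover have "- J n = (- 1) \<cdot>\<^sub>m J n" by (rule eq_matI) auto
    then have "J n \<in> Sym (- 1) (2 * n)" using J(1,3)[of n] by (simp add: Sym_def skew_symmetric_mat_def)
    ultimately show ?thesis by (simp add: NSym_iff)
  qed
  have num: "num_factor i = 1 + fps_X ^ Suc i * 1" for i by (simp add: num_factor_def)
  have den: "fps_prodinf (den_factor q i) = 1 + fps_X ^ Suc i * (fps_shift 1 (Dq (real q)) oo fps_X ^ Suc i)"
    for i
    unfolding den_factor_prodinf(2)[OF q1] by (rule compose_X_power_one_plus[OF Dq_0[OF q1]])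
  have "?A * ?D = fps_prodinf num_factor"
  proof (rule fps_ext)
    fix n
    have "fps_nth (?A * ?D) n = (\<Sum>i=0..n. fps_nth ?A i * fps_nth ?D (n - i))" by (rule fps_mult_nth)
    \<comment> \<open>Any number of factors that is at least \<open>n\<close> gives the same
      coefficients up to \<open>n\<close>; \<open>2 * n\<close> is the number for which
      \<open>truncated_identity\<close> is stated.\<close>
    also have "\<dots> = (\<Sum>i=0..n. fps_nth ?A i * fps_nth (\<Prod>j<2 * n. fps_prodinf (den_factor q j)) (n - i))"
      by (intro sum.cong refl arg_cong2[of _ _ _ _ "(*)"] fps_prodinf_one_plus_X_power(2)[OF den]) simp
    also have "\<dots> = fps_nth (?A * (\<Prod>j<2 * n. Dq (qr TYPE('a)) oo fps_X ^ Suc j)) n"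
      unfolding den_factor_prodinf(2)[OF q1] qr by (rule fps_mult_nth[symmetric])
    also have "\<dots> = fps_nth (\<Prod>i<n. num_factor i) n" by (rule truncated_identity[OF odd JN])
    also have "\<dots> = fps_nth (fps_prodinf num_factor) n"
      by (rule fps_prodinf_one_plus_X_power(2)[OF num, symmetric]) simp
    finally show "fps_nth (?A * ?D) n = fps_nth (fps_prodinf num_factor) n" .
  qed
  moreover have "fps_nth ?D 0 = 1" using fps_prodinf_one_plus_X_power(2)[OF den, of 0 0] by simp
  then have "?D \<noteq> 0" by auto
  ultimately have "?A = fps_prodinf num_factor / ?D" by (metis nonzero_mult_div_cancel_right)
  then show ?thesis
    using fps_prodinf_one_plus_X_power(1)[OF num] fps_prodinf_one_plus_X_power(1)[OF den]
      den_factor_prodinf(1)[OF q1] by blast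
qed

end
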